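(* Let $M$ be a smooth manifold, $n\ge1$, and let $\pi\in\mathfrak{X}^{n+1}(M)$ be a Nambu-Poisson structure of order $n$ on $M$. (1) The graph $\mathfrak{G}_\pi\subset\mathcal{T}^n=TM\oplus\wedge^nT^*M$ of $\pi^\sharp$ is a sub-Leibniz algebroid of the Leibniz algebroid $(\mathcal{T}^n,\{\cdot,\cdot\},\rho)$. (2) There is an induced bracket operation $[\cdot,\cdot]_\pi$ on $\Omega^n(M)$, given by $$[\alpha,\beta]_\pi=L_{\pi^\sharp(\alpha)}\beta-L_{\pi^\sharp(\beta)}\alpha+d\,i_{\pi^\sharp(\beta)}\alpha,\qquad \alpha,\beta\in\Omega^n(M)$$ (induced in the sense that $\{\pi^\sharp(\alpha)+\alpha,\pi^\sharp(\beta)+\beta\}=\pi^\sharp([\alpha,\beta]_\pi)+[\alpha,\beta]_\pi$), and $(\wedge^nT^*M,[\cdot,\cdot]_\pi,\pi^\sharp)$ is a Leibniz algebroid.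
   Context: The bundle map $\pi^\sharp:\wedge^nT^*M\to TM$ is $\pi^\sharp(\xi)=i_\xi\pi$, so that $\pi^\sharp(\xi_1\wedge\cdots\wedge\xi_n)=\pi(\xi_1,\dots,\xi_n,\cdot)$ for 1-forms $\xi_i$. Its graph is $\mathfrak{G}_\pi=\{\pi^\sharp(\alpha)+\alpha:\alpha\in\wedge^nT^*M\}$. The higher-order Dorfman bracket on $\Gamma(\mathcal{T}^n)$ is $$\{X+\alpha,Y+\beta\}=[X,Y]+L_X\beta-L_Y\alpha+d\,i_Y\alpha$$ for vector fields $X,Y$ and $\alpha,\beta\in\Omega^n(M)$, and $\rho(X+\alpha)=X$. A Leibniz algebroid structure on a vector bundle $E\to M$ is a pair consisting of an $\mathbb{R}$-bilinear bracket $\{\cdot,\cdot\}$ on $\Gamma(E)$ making it a Leibniz algebra, i.e. $\{a,\{b,c\}\}=\{\{a,b\},c\}+\{b,\{a,c\}\}$, and a vector bundle morphism $\rho:E\to TM$ (the anchor) such that $\rho\{a,b\}=[\rho(a),\rho(b)]$ and $\{a,fb\}=f\{a,b\}+\rho(a)(f)\,b$ for all $a,b,c\in\Gamma(E)$, $f\in C^\infty(M)$. A sub-Leibniz algebroid is a subbundle whose space of sections is closed under the bracket, with the restricted bracket and anchor. A Nambu-Poisson structure of order $n$ is an $(n+1)$-vector field $\pi$ such that the bracket $\{f_1,\dots,f_{n+1}\}=\pi(df_1,\dots,df_{n+1})$ on $C^\infty(M)$ satisfies $$\{f_1,\dots,f_n,\{g_1,\dots,g_{n+1}\}\}=\sum_{i=1}^{n+1}\{g_1,\dots,\{f_1,\dots,f_n,g_i\},\dots,g_{n+1}\};$$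 equivalently, $L_{\pi^\sharp(df_1\wedge\cdots\wedge df_n)}\pi=0$ for all $f_1,\dots,f_n\in C^\infty(M)$. (For $n=1$ the formula for $[\cdot,\cdot]_\pi$ is the usual bracket on 1-forms of a Poisson manifold, which $[\cdot,\cdot]_\pi$ generalizes.) *)

theory Defs
  imports "HOL-Analysis.Analysis" "HOL-Library.Function_Algebras"
begin

subsection \<open>Function spaces as real vector spaces\<close>

text \<open>Tangent vectors and alternating forms are functions into the reals, so fibres of
  bundles are subspaces of function types, with pointwise operations.\<close>

instantiation "fun" :: (type, real_vector) real_vector
begin

definition scaleR_fun :: "real \<Rightarrow> ('a \<Rightarrow> 'b) \<Rightarrow> 'a \<Rightarrow> 'b"
  where "scaleR_fun c f = (\<lambda>x. c *\<^sub>R f x)"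

instance
  by standard (auto simp: scaleR_fun_def fun_eq_iff algebra_simps)

end

subsection \<open>Smooth manifolds and smooth functions\<close>

text \<open>\<open>S\<close> is meant to be open.  In finite dimensions, \<open>f\<close> is of class
  \<open>C\<^sup>k\<^sup>+\<^sup>1\<close> iff it is differentiable and all its directional derivatives are of class
  \<open>C\<^sup>k\<close>.\<close>

primrec Ck_on :: "nat \<Rightarrow> 'e::real_normed_vector set \<Rightarrow> ('e \<Rightarrow> 'f::real_normed_vector) \<Rightarrow> bool"
  where
    "Ck_on 0 S f \<longleftrightarrow> continuous_on S f"
  | "Ck_on (Suc k) S f \<longleftrightarrow>
       (\<forall>x\<in>S. f differentiable (at x)) \<and>
       (\<forall>v. Ck_on k S (\<lambda>x. frechet_derivative f (at x) v))"

definition smooth_on :: "'e::real_normed_vector set \<Rightarrow> ('e \<Rightarrow> 'f::real_normed_vector) \<Rightarrow> bool"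
  where "smooth_on S f \<longleftrightarrow> (\<forall>k. Ck_on k S f)"

text \<open>A smooth manifold is the whole (Hausdorff, second countable) type \<open>'a\<close> with an atlas of
  charts \<open>(U, \<phi>)\<close>.  The model space \<open>'e\<close> is a finite-dimensional inner product space instead of
  a \<open>euclidean_space\<close>, since the latter class excludes dimension 0.  The atlas need not be
  maximal: compatible atlases yield the same smooth functions, hence the same notions below.\<close>

type_synonym ('a, 'e) atlas = "('a set \<times> ('a \<Rightarrow> 'e)) set"

definition smooth_manifold ::
    "('a::{t2_space, second_countable_topology}, 'e::real_inner) atlas \<Rightarrow> bool"
  where "smooth_manifold A \<longleftrightarrow>
    (\<exists>B::'e set. finite B \<and> span B = UNIV) \<and>
    (\<Union>(U, \<phi>)\<in>A. U) = UNIV \<and>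
    (\<forall>(U, \<phi>)\<in>A. open U \<and> open (\<phi> ` U) \<and> inj_on \<phi> U \<and>
       homeomorphism U (\<phi> ` U) \<phi> (inv_into U \<phi>)) \<and>
    (\<forall>(U, \<phi>)\<in>A. \<forall>(V, \<psi>)\<in>A. smooth_on (\<phi> ` (U \<inter> V)) (\<lambda>x. \<psi> (inv_into U \<phi> x)))"

text \<open>Functions are total on \<open>'a\<close>; those in \<open>smooth_funs A W\<close> are smooth on the open set \<open>W\<close>
  and arbitrary elsewhere.\<close>

definition smooth_funs ::
    "('a::topological_space, 'e::real_inner) atlas \<Rightarrow> 'a set \<Rightarrow> ('a \<Rightarrow> real) set"
  where "smooth_funs A W =
    {f. \<forall>(U, \<phi>)\<in>A. smooth_on (\<phi> ` (U \<inter> W)) (\<lambda>x. f (inv_into U \<phi> x))}"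

subsection \<open>Smooth vector bundles\<close>

text \<open>A bundle is given by its fibres and, for every open \<open>W\<close>, its smooth sections over \<open>W\<close>
  (again total functions, constrained only on \<open>W\<close>).  A local frame is the same as a local
  trivialization.\<close>

record ('a, 'v) vbundle =
  fibre :: "'a \<Rightarrow> 'v set"
  sections :: "'a set \<Rightarrow> ('a \<Rightarrow> 'v) set"

definition local_frame ::
    "('a::topological_space, 'e::real_inner) atlas \<Rightarrow> ('a, 'v::real_vector) vbundle
      \<Rightarrow> 'a set \<Rightarrow> ('a \<Rightarrow> 'v) list \<Rightarrow> bool"
  where "local_frame A E U es \<longleftrightarrow> open U \<and>
    (\<forall>p\<in>U. distinct (map (\<lambda>e. e p) es) \<and> independent (set (map (\<lambda>e. e p) es)) \<and>
       span (set (map (\<lambda>e. e p) es)) = fibre E p) \<and>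
    (\<forall>W s. open W \<longrightarrow> W \<subseteq> U \<longrightarrow>
       (s \<in> sections E W \<longleftrightarrow>
         (\<exists>c. (\<forall>i<length es. c i \<in> smooth_funs A W) \<and>
              (\<forall>p\<in>W. s p = (\<Sum>i<length es. c i p *\<^sub>R (es ! i) p)))))"

definition vector_bundle ::
    "('a::topological_space, 'e::real_inner) atlas \<Rightarrow> ('a, 'v::real_vector) vbundle \<Rightarrow> bool"
  where "vector_bundle A E \<longleftrightarrow>
    (\<forall>p. subspace (fibre E p)) \<and>
    (\<exists>r. \<forall>p. \<exists>U es. p \<in> U \<and> length es = r \<and> local_frame A E U es) \<and>
    (\<forall>W W' s. open W \<longrightarrow> open W' \<longrightarrow> W' \<subseteq> W \<longrightarrow> s \<in> sections E W \<longrightarrow> s \<in> sections E W') \<and>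
    (\<forall>W s. open W \<longrightarrow>
       (\<forall>p\<in>W. \<exists>W'. open W' \<and> p \<in> W' \<and> W' \<subseteq> W \<and> s \<in> sections E W') \<longrightarrow> s \<in> sections E W)"

abbreviation global_sections :: "('a, 'v) vbundle \<Rightarrow> ('a \<Rightarrow> 'v) set"
  where "global_sections E \<equiv> sections E UNIV"

definition restrict_bundle :: "('a, 'v) vbundle \<Rightarrow> ('a \<Rightarrow> 'v set) \<Rightarrow> ('a, 'v) vbundle"
  where "restrict_bundle E F =
    \<lparr>fibre = F, sections = (\<lambda>W. {s \<in> sections E W. \<forall>p\<in>W. s p \<in> F p})\<rparr>"

definition subbundle ::
    "('a::topological_space, 'e::real_inner) atlas \<Rightarrow> ('a, 'v::real_vector) vbundle
      \<Rightarrow> ('a \<Rightarrow> 'v set) \<Rightarrow> bool"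
  where "subbundle A E F \<longleftrightarrow>
    vector_bundle A E \<and> (\<forall>p. F p \<subseteq> fibre E p) \<and> vector_bundle A (restrict_bundle E F)"

definition bundle_morphism ::
    "('a, 'v::real_vector) vbundle \<Rightarrow> ('a::topological_space, 'w::real_vector) vbundle
      \<Rightarrow> ('a \<Rightarrow> 'v \<Rightarrow> 'w) \<Rightarrow> bool"
  where "bundle_morphism E F h \<longleftrightarrow>
    (\<forall>p. \<forall>u\<in>fibre E p. h p u \<in> fibre F p \<and>
       (\<forall>w\<in>fibre E p. h p (u + w) = h p u + h p w) \<and>
       (\<forall>c. h p (c *\<^sub>R u) = c *\<^sub>R h p u)) \<and>
    (\<forall>W s. open W \<longrightarrow> s \<in> sections E W \<longrightarrow> (\<lambda>p. h p (s p)) \<in> sections F W)"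

subsection \<open>The tangent bundle\<close>

text \<open>Tangent vectors at \<open>p\<close> are derivations at \<open>p\<close> of the algebra of smooth functions,
  with value 0 on non-smooth functions so that they are determined by their action.\<close>

type_synonym 'a tvec = "('a \<Rightarrow> real) \<Rightarrow> real"

definition tangent_space ::
    "('a::topological_space, 'e::real_inner) atlas \<Rightarrow> 'a \<Rightarrow> 'a tvec set"
  where "tangent_space A p = {v.
    (\<forall>f\<in>smooth_funs A UNIV. \<forall>g\<in>smooth_funs A UNIV.
       v (\<lambda>x. f x + g x) = v f + v g \<and> v (\<lambda>x. f x * g x) = f p * v g + g p * v f) \<and>
    (\<forall>f\<in>smooth_funs A UNIV. \<forall>c. v (\<lambda>x. c * f x) = c * v f) \<and>
    (\<forall>f. f \<notin> smooth_funs A UNIV \<longrightarrow> v f = 0)}"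

definition tangent_bundle ::
    "('a::topological_space, 'e::real_inner) atlas \<Rightarrow> ('a, 'a tvec) vbundle"
  where "tangent_bundle A =
    \<lparr>fibre = tangent_space A,
     sections = (\<lambda>W. {X. (\<forall>p\<in>W. X p \<in> tangent_space A p) \<and>
       (\<forall>f\<in>smooth_funs A UNIV. (\<lambda>p. X p f) \<in> smooth_funs A W)})\<rparr>"

abbreviation vector_fields ::
    "('a::topological_space, 'e::real_inner) atlas \<Rightarrow> ('a \<Rightarrow> 'a tvec) set"
  where "vector_fields A \<equiv> global_sections (tangent_bundle A)"

definition lie_bracket :: "('a \<Rightarrow> 'a tvec) \<Rightarrow> ('a \<Rightarrow> 'a tvec) \<Rightarrow> 'a \<Rightarrow> 'a tvec"
  where "lie_bracket X Y = (\<lambda>p f. X p (\<lambda>q. Y q f) - Y p (\<lambda>q. X q f))"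

subsection \<open>Differential forms and multivector fields\<close>

text \<open>Alternating \<open>k\<close>-linear real functions on a subspace \<open>V\<close>; the arguments form a list, and the
  value is 0 on lists that are not \<open>k\<close>-tuples of elements of \<open>V\<close>.\<close>

definition alt_maps :: "nat \<Rightarrow> 'v::real_vector set \<Rightarrow> ('v list \<Rightarrow> real) set"
  where "alt_maps k V = {\<omega>.
    (\<forall>vs i. length vs = k \<longrightarrow> set vs \<subseteq> V \<longrightarrow> i < k \<longrightarrow>
       (\<forall>u\<in>V. \<forall>w\<in>V. \<omega> (vs[i := u + w]) = \<omega> (vs[i := u]) + \<omega> (vs[i := w])) \<and>
       (\<forall>u\<in>V. \<forall>c. \<omega> (vs[i := c *\<^sub>R u]) = c * \<omega> (vs[i := u])) \<and>
       (\<forall>j<i. vs ! i = vs ! j \<longrightarrow> \<omega> vs = 0)) \<and>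
    (\<forall>vs. \<not> (length vs = k \<and> set vs \<subseteq> V) \<longrightarrow> \<omega> vs = 0)}"

type_synonym 'a form = "'a tvec list \<Rightarrow> real"

text \<open>Smoothness of a form over \<open>W\<close> is tested on global vector fields, which suffices because
  every local vector field agrees near a given point with a global one.\<close>

definition form_bundle ::
    "('a::topological_space, 'e::real_inner) atlas \<Rightarrow> nat \<Rightarrow> ('a, 'a form) vbundle"
  where "form_bundle A k =
    \<lparr>fibre = (\<lambda>p. alt_maps k (tangent_space A p)),
     sections = (\<lambda>W. {\<alpha>. (\<forall>p\<in>W. \<alpha> p \<in> alt_maps k (tangent_space A p)) \<and>
       (\<forall>Xs. length Xs = k \<longrightarrow> set Xs \<subseteq> vector_fields A \<longrightarrow>
         (\<lambda>p. \<alpha> p (map (\<lambda>X. X p) Xs)) \<in> smooth_funs A W)})\<rparr>"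

abbreviation forms ::
    "('a::topological_space, 'e::real_inner) atlas \<Rightarrow> nat \<Rightarrow> ('a \<Rightarrow> 'a form) set"
  where "forms A k \<equiv> global_sections (form_bundle A k)"

text \<open>Covectors are forms of degree 1, i.e. functions of one-element lists.\<close>

abbreviation cotangent_space ::
    "('a::topological_space, 'e::real_inner) atlas \<Rightarrow> 'a \<Rightarrow> 'a form set"
  where "cotangent_space A p \<equiv> fibre (form_bundle A 1) p"

definition multivector_fields ::
    "('a::topological_space, 'e::real_inner) atlas \<Rightarrow> nat \<Rightarrow> ('a \<Rightarrow> 'a form list \<Rightarrow> real) set"
  where "multivector_fields A k = {\<pi>.
    (\<forall>p. \<pi> p \<in> alt_maps k (cotangent_space A p)) \<and>
    (\<forall>\<xi>s. length \<xi>s = k \<longrightarrow> set \<xi>s \<subseteq> forms A 1 \<longrightarrow>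
       (\<lambda>p. \<pi> p (map (\<lambda>\<xi>. \<xi> p) \<xi>s)) \<in> smooth_funs A UNIV)}"

definition differential ::
    "('a::topological_space, 'e::real_inner) atlas \<Rightarrow> ('a \<Rightarrow> real) \<Rightarrow> 'a \<Rightarrow> 'a form"
  where "differential A f =
    (\<lambda>p vs. if length vs = 1 \<and> set vs \<subseteq> tangent_space A p then hd vs f else 0)"

text \<open>The exterior product of covectors, normalized by
  \<open>(\<xi>\<^sub>1 \<and> \<dots> \<and> \<xi>\<^sub>n)(v\<^sub>1, \<dots>, v\<^sub>n) = det (\<xi>\<^sub>i(v\<^sub>j))\<close>.\<close>

definition wedge ::
    "('a::topological_space, 'e::real_inner) atlas \<Rightarrow> 'a \<Rightarrow> 'a form list \<Rightarrow> 'a form"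
  where "wedge A p \<xi>s =
    (\<lambda>vs. if length vs = length \<xi>s \<and> set vs \<subseteq> tangent_space A p
       then \<Sum>\<sigma> | \<sigma> permutes {..<length \<xi>s}.
         of_int (sign \<sigma>) * (\<Prod>i<length \<xi>s. (\<xi>s ! i) [vs ! \<sigma> i])
       else 0)"

definition interior_product :: "('a \<Rightarrow> 'a tvec) \<Rightarrow> ('a \<Rightarrow> 'a form) \<Rightarrow> 'a \<Rightarrow> 'a form"
  where "interior_product X \<alpha> = (\<lambda>p vs. \<alpha> p (X p # vs))"

text \<open>The \<open>k\<close>-form determined by a \<open>C\<^sup>\<infinity>\<close>-multilinear operator \<open>Q\<close> on vector fields: its value
  on tangent vectors at \<open>p\<close> is the value of \<open>Q\<close> at \<open>p\<close> on any vector fields extending them.\<close>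

definition form_of_operator ::
    "('a::topological_space, 'e::real_inner) atlas \<Rightarrow> nat
      \<Rightarrow> (('a \<Rightarrow> 'a tvec) list \<Rightarrow> 'a \<Rightarrow> real) \<Rightarrow> 'a \<Rightarrow> 'a form"
  where "form_of_operator A k Q =
    (\<lambda>p vs. if length vs = k \<and> set vs \<subseteq> tangent_space A p
       then Q (SOME Xs. length Xs = k \<and> set Xs \<subseteq> vector_fields A \<and> map (\<lambda>X. X p) Xs = vs) p
       else 0)"

definition lie_derivative ::
    "('a::topological_space, 'e::real_inner) atlas \<Rightarrow> nat \<Rightarrow> ('a \<Rightarrow> 'a tvec)
      \<Rightarrow> ('a \<Rightarrow> 'a form) \<Rightarrow> 'a \<Rightarrow> 'a form"
  where "lie_derivative A k X \<alpha> = form_of_operator A k (\<lambda>Ys p.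
    X p (\<lambda>q. \<alpha> q (map (\<lambda>Y. Y q) Ys)) -
    (\<Sum>i<k. \<alpha> p (map (\<lambda>Y. Y p) (Ys[i := lie_bracket X (Ys ! i)]))))"

definition delete_nth :: "nat \<Rightarrow> 'b list \<Rightarrow> 'b list"
  where "delete_nth i xs = take i xs @ drop (Suc i) xs"

text \<open>The exterior derivative of \<open>k\<close>-forms, by the invariant formula; indices start at 0.\<close>

definition ext_derivative ::
    "('a::topological_space, 'e::real_inner) atlas \<Rightarrow> nat \<Rightarrow> ('a \<Rightarrow> 'a form) \<Rightarrow> 'a \<Rightarrow> 'a form"
  where "ext_derivative A k \<alpha> = form_of_operator A (Suc k) (\<lambda>Xs p.
    (\<Sum>i\<le>k. (-1) ^ i * (Xs ! i) p (\<lambda>q. \<alpha> q (map (\<lambda>X. X q) (delete_nth i Xs)))) +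
    (\<Sum>j\<le>k. \<Sum>i<j. (-1) ^ (i + j) *
       \<alpha> p (map (\<lambda>X. X p)
         (lie_bracket (Xs ! i) (Xs ! j) # delete_nth i (delete_nth j Xs)))))"

subsection \<open>Leibniz algebroids\<close>

text \<open>The last clause is \<open>{a, f b} = f {a, b} + \<rho>(a)(f) b\<close>.\<close>

definition leibniz_algebroid ::
    "('a::topological_space, 'e::real_inner) atlas \<Rightarrow> ('a, 'v::real_vector) vbundle
      \<Rightarrow> (('a \<Rightarrow> 'v) \<Rightarrow> ('a \<Rightarrow> 'v) \<Rightarrow> 'a \<Rightarrow> 'v) \<Rightarrow> ('a \<Rightarrow> 'v \<Rightarrow> 'a tvec) \<Rightarrow> bool"
  where "leibniz_algebroid A E br \<rho> \<longleftrightarrow>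
    vector_bundle A E \<and>
    bundle_morphism E (tangent_bundle A) \<rho> \<and>
    (\<forall>a\<in>global_sections E. \<forall>b\<in>global_sections E. br a b \<in> global_sections E) \<and>
    (\<forall>a\<in>global_sections E. \<forall>b\<in>global_sections E. \<forall>c\<in>global_sections E.
       br (a + b) c = br a c + br b c \<and> br a (b + c) = br a b + br a c) \<and>
    (\<forall>a\<in>global_sections E. \<forall>b\<in>global_sections E. \<forall>t::real.
       br (t *\<^sub>R a) b = t *\<^sub>R br a b \<and> br a (t *\<^sub>R b) = t *\<^sub>R br a b) \<and>
    (\<forall>a\<in>global_sections E. \<forall>b\<in>global_sections E. \<forall>c\<in>global_sections E.
       br a (br b c) = br (br a b) c + br b (br a c)) \<and>
    (\<forall>a\<in>global_sections E. \<forall>b\<in>global_sections E.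
       (\<lambda>p. \<rho> p (br a b p)) = lie_bracket (\<lambda>p. \<rho> p (a p)) (\<lambda>p. \<rho> p (b p))) \<and>
    (\<forall>a\<in>global_sections E. \<forall>b\<in>global_sections E. \<forall>f\<in>smooth_funs A UNIV.
       br a (\<lambda>p. f p *\<^sub>R b p) = (\<lambda>p. f p *\<^sub>R br a b p + \<rho> p (a p) f *\<^sub>R b p))"

definition sub_leibniz_algebroid ::
    "('a::topological_space, 'e::real_inner) atlas \<Rightarrow> ('a, 'v::real_vector) vbundle
      \<Rightarrow> (('a \<Rightarrow> 'v) \<Rightarrow> ('a \<Rightarrow> 'v) \<Rightarrow> 'a \<Rightarrow> 'v) \<Rightarrow> ('a \<Rightarrow> 'v \<Rightarrow> 'a tvec)
      \<Rightarrow> ('a \<Rightarrow> 'v set) \<Rightarrow> bool"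
  where "sub_leibniz_algebroid A E br \<rho> F \<longleftrightarrow>
    leibniz_algebroid A E br \<rho> \<and>
    subbundle A E F \<and>
    (\<forall>a\<in>global_sections (restrict_bundle E F). \<forall>b\<in>global_sections (restrict_bundle E F).
       br a b \<in> global_sections (restrict_bundle E F))"

subsection \<open>The Leibniz algebroid \<open>TM \<oplus> \<Lambda>\<^sup>n T\<^sup>*M\<close>\<close>

text \<open>\<open>X + \<alpha>\<close> is represented by the pair \<open>(X, \<alpha>)\<close>.\<close>

definition direct_sum :: "('a, 'v) vbundle \<Rightarrow> ('a, 'w) vbundle \<Rightarrow> ('a, 'v \<times> 'w) vbundle"
  where "direct_sum E F =
    \<lparr>fibre = (\<lambda>p. fibre E p \<times> fibre F p),
     sections = (\<lambda>W. {s. (\<lambda>p. fst (s p)) \<in> sections E W \<and> (\<lambda>p. snd (s p)) \<in> sections F W})\<rparr>"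

definition generalized_tangent_bundle ::
    "('a::topological_space, 'e::real_inner) atlas \<Rightarrow> nat \<Rightarrow> ('a, 'a tvec \<times> 'a form) vbundle"
  where "generalized_tangent_bundle A n = direct_sum (tangent_bundle A) (form_bundle A n)"

definition dorfman ::
    "('a::topological_space, 'e::real_inner) atlas \<Rightarrow> nat \<Rightarrow> ('a \<Rightarrow> 'a tvec \<times> 'a form)
      \<Rightarrow> ('a \<Rightarrow> 'a tvec \<times> 'a form) \<Rightarrow> 'a \<Rightarrow> 'a tvec \<times> 'a form"
  where "dorfman A n s t =
    (let X = (\<lambda>p. fst (s p)); \<alpha> = (\<lambda>p. snd (s p));
         Y = (\<lambda>p. fst (t p)); \<beta> = (\<lambda>p. snd (t p))
     in (\<lambda>p. (lie_bracket X Y p,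
          (lie_derivative A n X \<beta> - lie_derivative A n Y \<alpha>
             + ext_derivative A (n - 1) (interior_product Y \<alpha>)) p)))"

definition dorfman_anchor :: "'a \<Rightarrow> 'a tvec \<times> 'a form \<Rightarrow> 'a tvec"
  where "dorfman_anchor p u = fst u"

subsection \<open>Nambu-Poisson structures\<close>

definition nambu_function_bracket ::
    "('a::topological_space, 'e::real_inner) atlas \<Rightarrow> ('a \<Rightarrow> 'a form list \<Rightarrow> real)
      \<Rightarrow> ('a \<Rightarrow> real) list \<Rightarrow> 'a \<Rightarrow> real"
  where "nambu_function_bracket A \<pi> fs = (\<lambda>p. \<pi> p (map (\<lambda>f. differential A f p) fs))"

definition nambu_poisson ::
    "('a::topological_space, 'e::real_inner) atlas \<Rightarrow> nat \<Rightarrow> ('a \<Rightarrow> 'a form list \<Rightarrow> real) \<Rightarrow> bool"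
  where "nambu_poisson A n \<pi> \<longleftrightarrow>
    \<pi> \<in> multivector_fields A (n + 1) \<and>
    (\<forall>fs gs. length fs = n \<longrightarrow> set fs \<subseteq> smooth_funs A UNIV \<longrightarrow>
       length gs = n + 1 \<longrightarrow> set gs \<subseteq> smooth_funs A UNIV \<longrightarrow>
       nambu_function_bracket A \<pi> (fs @ [nambu_function_bracket A \<pi> gs]) =
       (\<lambda>p. \<Sum>i<n + 1. nambu_function_bracket A \<pi>
          (gs[i := nambu_function_bracket A \<pi> (fs @ [gs ! i])]) p))"

text \<open>\<open>\<pi>\<^sup>\<sharp>\<close> at \<open>p\<close> is the unique linear map on \<open>\<Lambda>\<^sup>n T\<^sub>p\<^sup>*M\<close> with
  \<open>\<pi>\<^sup>\<sharp>(\<xi>\<^sub>1 \<and> \<dots> \<and> \<xi>\<^sub>n) = \<pi>(\<xi>\<^sub>1, \<dots>, \<xi>\<^sub>n, \<cdot>)\<close>.  The right-hand side, a linear functional of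
  covectors, stands for the tangent vector \<open>f \<mapsto> \<pi>(\<xi>\<^sub>1, \<dots>, \<xi>\<^sub>n, df)\<close>.\<close>

definition sharp ::
    "('a::topological_space, 'e::real_inner) atlas \<Rightarrow> nat \<Rightarrow> ('a \<Rightarrow> 'a form list \<Rightarrow> real)
      \<Rightarrow> 'a \<Rightarrow> 'a form \<Rightarrow> 'a tvec"
  where "sharp A n \<pi> p = (THE L.
    (\<forall>\<xi>\<in>fibre (form_bundle A n) p. \<forall>\<eta>\<in>fibre (form_bundle A n) p. L (\<xi> + \<eta>) = L \<xi> + L \<eta>) \<and>
    (\<forall>\<xi>\<in>fibre (form_bundle A n) p. \<forall>c. L (c *\<^sub>R \<xi>) = c *\<^sub>R L \<xi>) \<and>
    (\<forall>\<xi>s. length \<xi>s = n \<longrightarrow> set \<xi>s \<subseteq> cotangent_space A p \<longrightarrow>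
       L (wedge A p \<xi>s) =
         (\<lambda>f. if f \<in> smooth_funs A UNIV then \<pi> p (\<xi>s @ [differential A f p]) else 0)) \<and>
    (\<forall>\<xi>. \<xi> \<notin> fibre (form_bundle A n) p \<longrightarrow> L \<xi> = 0))"

definition sharp_field ::
    "('a::topological_space, 'e::real_inner) atlas \<Rightarrow> nat \<Rightarrow> ('a \<Rightarrow> 'a form list \<Rightarrow> real)
      \<Rightarrow> ('a \<Rightarrow> 'a form) \<Rightarrow> 'a \<Rightarrow> 'a tvec"
  where "sharp_field A n \<pi> \<alpha> = (\<lambda>p. sharp A n \<pi> p (\<alpha> p))"

definition sharp_graph ::
    "('a::topological_space, 'e::real_inner) atlas \<Rightarrow> nat \<Rightarrow> ('a \<Rightarrow> 'a form list \<Rightarrow> real)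
      \<Rightarrow> 'a \<Rightarrow> ('a tvec \<times> 'a form) set"
  where "sharp_graph A n \<pi> p = {(sharp A n \<pi> p \<xi>, \<xi>) |\<xi>. \<xi> \<in> fibre (form_bundle A n) p}"

definition graph_section ::
    "('a::topological_space, 'e::real_inner) atlas \<Rightarrow> nat \<Rightarrow> ('a \<Rightarrow> 'a form list \<Rightarrow> real)
      \<Rightarrow> ('a \<Rightarrow> 'a form) \<Rightarrow> 'a \<Rightarrow> 'a tvec \<times> 'a form"
  where "graph_section A n \<pi> \<alpha> = (\<lambda>p. (sharp_field A n \<pi> \<alpha> p, \<alpha> p))"

definition nambu_form_bracket ::
    "('a::topological_space, 'e::real_inner) atlas \<Rightarrow> nat \<Rightarrow> ('a \<Rightarrow> 'a form list \<Rightarrow> real)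
      \<Rightarrow> ('a \<Rightarrow> 'a form) \<Rightarrow> ('a \<Rightarrow> 'a form) \<Rightarrow> 'a \<Rightarrow> 'a form"
  where "nambu_form_bracket A n \<pi> \<alpha> \<beta> =
    lie_derivative A n (sharp_field A n \<pi> \<alpha>) \<beta> - lie_derivative A n (sharp_field A n \<pi> \<beta>) \<alpha>
      + ext_derivative A (n - 1) (interior_product (sharp_field A n \<pi> \<beta>) \<alpha>)"

end

theory Submission
  imports Defs "Jordan_Normal_Form.Determinant"
begin

text \<open>Forms are handled as tensorial multilinear operators on vector fields.  Cartan's formula
  then makes the generalized tangent bundle with the Dorfman bracket a Leibniz algebroid.  The graph of \<open>\<pi>\<^sup>\<sharp>\<close>
  is closed under the bracket iff the deviation \<open>[\<pi>\<^sup>\<sharp>\<alpha>, \<pi>\<^sup>\<sharp>\<beta>] - \<pi>\<^sup>\<sharp>[\<alpha>, \<beta>]\<^sub>\<pi>\<close> vanishes.  On wedges of exact forms this is the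
  fundamental identity, so the point is that the deviation is tensorial, that is,
  \<open>\<pi>\<^sup>\<sharp>(df \<and> (i\<^bsub>\<pi>\<^sup>\<sharp>\<alpha>\<^esub> \<beta> + i\<^bsub>\<pi>\<^sup>\<sharp>\<beta>\<^esub> \<alpha>)) = 0\<close>.  This is a pointwise quadratic identity for \<open>\<pi>\<close>, a consequence of the
  fundamental identity for products of functions.  Since a section of the graph is determined by its form
  part, the Leibniz algebroid on forms is inherited from the graph.\<close>

text \<open>In the second argument tensoriality is the Leibniz rule; in the first, replacing
  \<alpha> by f \<alpha> leaves the term displayed above. For n = 1 its two contractions cancel by
  skew-symmetry of \<pi>. For n \<ge> 2 their sum may be nonzero and dies only after multiplication
  by df and application of the sharp map. Decomposability of \<pi>, the usual explanation, fails for
  n = 1. One argument for all n comes from putting a product uw in the first slot of the fundamental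
  identity: the terms undifferentiated in u or w cancel, and the cross terms say that an exchange
  sum of two (n+1)-tuples of covectors does not depend on the exchanged slot.

  A second obstacle is that tangent vectors are derivations of global functions and forms are tested
  on global fields. Local computations therefore use coordinates and coordinate fields that are cut
  off to global ones, and a bump function equal to 1 at the point transfers the result. Hadamard's
  lemma shows that these fields span the tangent spaces.\<close>

subsection \<open>Orthonormal bases\<close>

text \<open>\<open>Basis\<close> belongs to \<open>euclidean_space\<close>, while the model type is
  only \<open>real_inner\<close>; a finite orthonormal set that reproduces every vector gives the
  same coordinate calculus.\<close>

definition orthonormal_basis :: "'e::real_inner set \<Rightarrow> bool"
  where "orthonormal_basis B \<longleftrightarrow> finite B \<and>
    (\<forall>b\<in>B. \<forall>c\<in>B. inner b c = (if b = c then 1 else 0)) \<and>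
    (\<forall>x. x = (\<Sum>b\<in>B. inner x b *\<^sub>R b))"

lemma gram_schmidt:
  assumes "finite S"
  shows "\<exists>B::'e::real_inner set. finite B \<and>
    (\<forall>b\<in>B. \<forall>c\<in>B. inner b c = (if b = c then 1 else 0)) \<and>
    (\<forall>x\<in>span S. x = (\<Sum>b\<in>B. inner x b *\<^sub>R b))"
  using assms
proof (induction S)
  case empty
  show ?case by (rule exI[of _ "{}"]) auto
next
  case (insert v S)
  then obtain B :: "'e set" where B: "finite B"
    "\<And>b c. b \<in> B \<Longrightarrow> c \<in> B \<Longrightarrow> inner b c = (if b = c then 1 else 0)"
    "\<And>x. x \<in> span S \<Longrightarrow> x = (\<Sum>b\<in>B. inner x b *\<^sub>R b)"
    by auto
  \<comment> \<open>The residual of the projection onto the span of \<open>B\<close>. It kills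
    \<open>span S\<close>, so on \<open>span (insert v S)\<close> it takes only multiples of
    \<open>P v\<close>; normalizing \<open>P v\<close>, if it is nonzero, gives the one vector to be
    added.\<close>
  define P where "P y = y - (\<Sum>b\<in>B. inner y b *\<^sub>R b)" for y
  have P_diff: "P (y - k *\<^sub>R z) = P y - k *\<^sub>R P z" for y z k
    by (simp add: P_def inner_diff_left algebra_simps sum_subtractf scaleR_sum_right)
  have P_span: "\<exists>k. P x = k *\<^sub>R P v" if x: "x \<in> span (insert v S)" for x
  proof -
    from x obtain k where "x - k *\<^sub>R v \<in> span S"
      using span_breakdown_eq by blast
    then have "P (x - k *\<^sub>R v) = 0" using B(3) by (simp add: P_def)
    then show ?thesis using P_diff by auto
  qed
  have P_orth: "inner (P y) c = 0" if "c \<in> B" for y c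
  proof -
    have "(\<Sum>b\<in>B. inner y b * inner b c) = (\<Sum>b\<in>B. if b = c then inner y c else 0)"
      using that B(2) by (intro sum.cong) auto
    then show ?thesis
      using that B(1) by (simp add: P_def inner_diff_left inner_sum_left)
  qed
  show ?case
  proof (cases "P v = 0")
    case True
    then have "\<forall>x\<in>span (insert v S). x = (\<Sum>b\<in>B. inner x b *\<^sub>R b)"
      using P_span by (fastforce simp: P_def)
    then show ?thesis using B by blast
  next
    case False
    define e where "e = (1 / norm (P v)) *\<^sub>R P v"
    have ee: "inner e e = 1"
      using False by (simp add: e_def power2_norm_eq_inner[symmetric] power2_eq_square)
    have eB: "inner e c = 0" "inner c e = 0" if "c \<in> B" for c
      using P_orth[OF that] by (simp_all add: e_def inner_commute)
    have eN: "e \<notin> B" using eB ee by fastforce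
    have "x = (\<Sum>b\<in>insert e B. inner x b *\<^sub>R b)" if x: "x \<in> span (insert v S)" for x
    proof -
      obtain k where k: "P x = k *\<^sub>R P v" using P_span[OF x] by blast
      have xd: "x = (\<Sum>b\<in>B. inner x b *\<^sub>R b) + (k * norm (P v)) *\<^sub>R e"
        using k False by (simp add: P_def e_def) (metis diff_add_cancel add.commute)
      have "inner x e = k * norm (P v)"
        by (subst xd) (simp add: inner_add_left inner_sum_left eB ee)
      then show ?thesis using xd B(1) eN by (simp add: add.commute)
    qed
    moreover have "\<forall>b\<in>insert e B. \<forall>c\<in>insert e B. inner b c = (if b = c then 1 else 0)"
      using B(2) eB ee eN by auto
    ultimately show ?thesis using B(1) by (intro exI[of _ "insert e B"]) auto
  qed
qed

lemma orthonormal_basis_exists: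
  assumes "finite S" "span S = (UNIV :: 'e::real_inner set)"
  shows "\<exists>B::'e set. orthonormal_basis B"
  using gram_schmidt[OF assms(1)] assms(2) unfolding orthonormal_basis_def by auto

lemma orthonormal_basis_expand: "orthonormal_basis B \<Longrightarrow> (\<Sum>b\<in>B. inner x b *\<^sub>R b) = x"
  unfolding orthonormal_basis_def by metis

lemma orthonormal_basis_linear:
  assumes "orthonormal_basis B" "linear L"
  shows "L x = (\<Sum>b\<in>B. inner x b *\<^sub>R L b)"
  by (subst orthonormal_basis_expand[OF assms(1), symmetric])
     (simp add: linear_sum[OF assms(2)] linear_scale[OF assms(2)])

lemma orthonormal_basis_real: "orthonormal_basis {1::real}"
  by (simp add: orthonormal_basis_def)

text \<open>A closed ball has bounded coordinates, hence is a closed subset of a coordinate box, and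
  boxes are compact by induction on the number of basis vectors. In \<open>extend_by_bump\<close>
  this makes the set that carries a cut-off function closed in the manifold.\<close>

lemma compact_cball_orthonormal_basis:
  fixes a :: "'e::real_inner"
  assumes "orthonormal_basis (B :: 'e set)"
  shows "compact (cball a r)"
proof -
  have fin: "finite B" using assms by (simp add: orthonormal_basis_def)
  have K: "compact {\<Sum>b\<in>F. c b *\<^sub>R b | c. \<forall>b\<in>F. \<bar>c b\<bar> \<le> s}" if "finite F" for F :: "'e set" and s :: real
    using that
  proof (induction F)
    case empty
    then show ?case by simp
  next
    case (insert v F)
    let ?K = "{\<Sum>b\<in>F. c b *\<^sub>R b | c. \<forall>b\<in>F. \<bar>c b\<bar> \<le> s}"
    have "{\<Sum>b\<in>insert v F. c b *\<^sub>R b | c. \<forall>b\<in>insert v F. \<bar>c b\<bar> \<le> s}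
      = (\<lambda>(t, x). t *\<^sub>R v + x) ` ({-s..s} \<times> ?K)" (is "?L = ?R")
    proof
      show "?L \<subseteq> ?R"
      proof
        fix y assume "y \<in> ?L"
        then obtain c where c: "y = (\<Sum>b\<in>insert v F. c b *\<^sub>R b)" "\<forall>b\<in>insert v F. \<bar>c b\<bar> \<le> s" by auto
        then have "y = c v *\<^sub>R v + (\<Sum>b\<in>F. c b *\<^sub>R b)" using insert by simp
        moreover have "c v \<in> {-s..s}" using c(2) by (auto simp: abs_le_iff)
        ultimately show "y \<in> ?R" using c(2)
          by (intro image_eqI[of _ _ "(c v, \<Sum>b\<in>F. c b *\<^sub>R b)"]) auto
      qed
      show "?R \<subseteq> ?L"
      proof
        fix y assume "y \<in> ?R"
        then obtain t c where t: "t \<in> {-s..s}" and c: "\<forall>b\<in>F. \<bar>c b\<bar> \<le> s"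
          and y: "y = t *\<^sub>R v + (\<Sum>b\<in>F. c b *\<^sub>R b)" by auto
        have "(\<Sum>b\<in>F. c b *\<^sub>R b) = (\<Sum>b\<in>F. (c(v := t)) b *\<^sub>R b)"
          using insert by (intro sum.cong) auto
        then have "y = (\<Sum>b\<in>insert v F. (c(v := t)) b *\<^sub>R b)"
          using insert y by simp
        moreover have "\<forall>b\<in>insert v F. \<bar>(c(v := t)) b\<bar> \<le> s" using t c by auto
        ultimately show "y \<in> ?L" by blast
      qed
    qed
    moreover have "compact ..."
      using insert by (intro compact_continuous_image compact_Times)
        (auto simp: case_prod_unfold intro!: continuous_intros)
    ultimately show ?case by simp
  qed
  \<comment> \<open>Bounds the norm of every point of the ball and so, by Cauchy-Schwarz, each of
    its coordinates.\<close>
  define s where "s = norm a + \<bar>r\<bar>"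
  have "cball a r = cball a r \<inter> {\<Sum>b\<in>B. c b *\<^sub>R b | c. \<forall>b\<in>B. \<bar>c b\<bar> \<le> s}"
  proof -
    have "x \<in> {\<Sum>b\<in>B. c b *\<^sub>R b | c. \<forall>b\<in>B. \<bar>c b\<bar> \<le> s}" if "x \<in> cball a r" for x
    proof -
      have nx: "norm x \<le> s"
        using that norm_triangle_ineq2[of x a] unfolding s_def
        by (auto simp: dist_norm norm_minus_commute)
      have "\<bar>inner x b\<bar> \<le> s" if "b \<in> B" for b
      proof -
        have "norm b = 1" using assms that by (simp add: orthonormal_basis_def norm_eq_sqrt_inner)
        then show ?thesis using Cauchy_Schwarz_ineq2[of x b] nx by simp
      qed
      then show ?thesis using orthonormal_basis_expand[OF assms, of x, symmetric]
        by (intro CollectI exI[of _ "inner x"]) simp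
    qed
    then show ?thesis by blast
  qed
  moreover have "compact ..." by (intro closed_Int_compact K fin) auto
  ultimately show ?thesis by simp
qed

subsection \<open>Functions of class \<open>C\<^sup>k\<close>\<close>

lemma frechet_derivative_eqI: "(f has_derivative D) (at x) \<Longrightarrow> frechet_derivative f (at x) = D"
  using frechet_derivative_at by metis

lemma has_derivative_cong_open:
  assumes "open S" "x \<in> S" "\<And>y. y \<in> S \<Longrightarrow> f y = g y"
  shows "(f has_derivative D) (at x) \<longleftrightarrow> (g has_derivative D) (at x)"
  using has_derivative_transform_within_open[OF _ assms(1,2)] assms(3) by metis

lemma frechet_derivative_cong_open:
  assumes "open S" "x \<in> S" "\<And>y. y \<in> S \<Longrightarrow> f y = g y"
  shows "frechet_derivative f (at x) = frechet_derivative g (at x)"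
  unfolding frechet_derivative_def using has_derivative_cong_open[OF assms] by simp

lemma Ck_on_cong:
  assumes "open S" "\<And>x. x \<in> S \<Longrightarrow> f x = g x"
  shows "Ck_on k S f \<longleftrightarrow> Ck_on k S g"
  using assms(2)
proof (induction k arbitrary: f g)
  case 0
  then show ?case by (auto intro: continuous_on_cong)
next
  case (Suc k)
  have "f differentiable (at x) \<longleftrightarrow> g differentiable (at x)" if "x \<in> S" for x
    unfolding differentiable_def using has_derivative_cong_open[OF assms(1) that, of f g] Suc.prems by blast
  moreover have "Ck_on k S (\<lambda>x. frechet_derivative f (at x) v) \<longleftrightarrow> Ck_on k S (\<lambda>x. frechet_derivative g (at x) v)" for v
    using frechet_derivative_cong_open[OF assms(1), of _ f g] Suc.prems by (intro Suc.IH) auto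
  ultimately show ?case by simp
qed

lemma Ck_on_subset: "Ck_on k S f \<Longrightarrow> T \<subseteq> S \<Longrightarrow> Ck_on k T f"
  by (induction k arbitrary: f) (auto intro: continuous_on_subset)

text \<open>\<open>Ck_on\<close> refers to \<open>frechet_derivative\<close>, a choice of
  derivative; by uniqueness of derivatives any exhibited \<open>D\<close> may take its
  place.\<close>

lemma Ck_on_SucI:
  assumes "open S" "\<And>x. x \<in> S \<Longrightarrow> (f has_derivative D x) (at x)"
    and "\<And>v. Ck_on k S (\<lambda>x. D x v)"
  shows "Ck_on (Suc k) S f"
proof -
  have "Ck_on k S (\<lambda>x. frechet_derivative f (at x) v) \<longleftrightarrow> Ck_on k S (\<lambda>x. D x v)" for v
    using frechet_derivative_eqI[OF assms(2)] assms(1) by (intro Ck_on_cong) auto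
  then show ?thesis using assms unfolding Ck_on.simps differentiable_def by blast
qed

lemma Ck_on_Suc_has_derivative:
  "Ck_on (Suc k) S f \<Longrightarrow> x \<in> S \<Longrightarrow> (f has_derivative frechet_derivative f (at x)) (at x)"
  by (simp add: frechet_derivative_works)

lemma Ck_on_SucD: "Ck_on (Suc k) S f \<Longrightarrow> Ck_on k S f"
proof (induction k arbitrary: f)
  case 0
  then show ?case
    by (auto intro!: continuous_at_imp_continuous_on differentiable_imp_continuous_within)
next
  case (Suc k)
  then show ?case using Ck_on.simps(2) by blast
qed

lemma Ck_on_local:
  assumes "\<And>x. x \<in> S \<Longrightarrow> \<exists>T. open T \<and> x \<in> T \<and> Ck_on k T f"
  shows "Ck_on k S f"
  using assms
proof (induction k arbitrary: f)
  case 0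
  then show ?case
    by (metis Ck_on.simps(1) continuous_at_imp_continuous_on continuous_on_eq_continuous_at)
next
  case (Suc k)
  then show ?case unfolding Ck_on.simps by meson
qed

lemma Ck_on_const [simp]: "Ck_on k S (\<lambda>x. c)"
  by (induction k arbitrary: c) (auto simp: frechet_derivative_const)

lemma Ck_on_linear:
  assumes "bounded_linear L" "open S" "Ck_on k S f"
  shows "Ck_on k S (\<lambda>x. L (f x))"
  using assms(3)
proof (induction k arbitrary: f)
  case 0
  then show ?case using linear_continuous_on[OF assms(1)]
    by (auto intro: continuous_on_compose2[of UNIV L])
next
  case (Suc k)
  show ?case
  proof (rule Ck_on_SucI[OF assms(2)])
    show "((\<lambda>x. L (f x)) has_derivative (\<lambda>v. L (frechet_derivative f (at x) v))) (at x)" if "x \<in> S" for x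
      using bounded_linear.has_derivative[OF assms(1)] Ck_on_Suc_has_derivative[OF Suc.prems that] by blast
    show "Ck_on k S (\<lambda>x. L (frechet_derivative f (at x) v))" for v
      using Suc.prems by (intro Suc.IH) simp
  qed
qed

lemma Ck_on_ident: "open S \<Longrightarrow> Ck_on k S (\<lambda>x. x)"
  by (cases k) (auto intro!: Ck_on_SucI[where D = "\<lambda>_ v. v"] simp: continuous_on_id)

lemma Ck_on_bounded_linear: "bounded_linear L \<Longrightarrow> open S \<Longrightarrow> Ck_on k S L"
  using Ck_on_linear[of L S k "\<lambda>x. x"] Ck_on_ident by blast

lemma Ck_on_add:
  assumes "open S" "Ck_on k S f" "Ck_on k S g"
  shows "Ck_on k S (\<lambda>x. f x + g x)"
  using assms(2,3)
proof (induction k arbitrary: f g)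
  case 0
  then show ?case by (auto intro: continuous_intros)
next
  case (Suc k)
  show ?case
    using Suc.prems
    by (intro Ck_on_SucI[OF assms(1), where D = "\<lambda>x v. frechet_derivative f (at x) v + frechet_derivative g (at x) v"]
        has_derivative_add Suc.IH) (auto intro: Ck_on_Suc_has_derivative)
qed

lemma Ck_on_sum:
  assumes "open S" "\<And>i. i \<in> I \<Longrightarrow> Ck_on k S (f i)"
  shows "Ck_on k S (\<lambda>x. \<Sum>i\<in>I. f i x)"
  using assms(2)
  by (induction I rule: infinite_finite_induct) (auto intro: Ck_on_add[OF assms(1)])

lemma Ck_on_mult:
  fixes f g :: "'e::real_normed_vector \<Rightarrow> real"
  assumes "open S" "Ck_on k S f" "Ck_on k S g"
  shows "Ck_on k S (\<lambda>x. f x * g x)"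
  using assms(2,3)
proof (induction k arbitrary: f g)
  case 0
  then show ?case by (auto intro: continuous_intros)
next
  case (Suc k)
  show ?case
    using Suc.prems
    by (intro Ck_on_SucI[OF assms(1), where D = "\<lambda>x v. f x * frechet_derivative g (at x) v + frechet_derivative f (at x) v * g x"]
        has_derivative_mult Suc.IH Ck_on_add[OF assms(1)])
      (auto intro: Ck_on_Suc_has_derivative Ck_on_SucD simp del: Ck_on.simps dest: Ck_on.simps(2)[THEN iffD1])
qed

text \<open>Expanding the inner derivative in the orthonormal basis turns the chain rule into a
  finite sum of products of real functions: the partial derivatives of \<open>g\<close> along
  \<open>h\<close>, covered by the induction hypothesis, and the coordinates of the derivative of
  \<open>h\<close>.\<close>

lemma Ck_on_compose:
  fixes g :: "'e::real_inner \<Rightarrow> real" and h :: "'x::real_normed_vector \<Rightarrow> 'e"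
  assumes "orthonormal_basis (B :: 'e set)" "open S" "h ` S \<subseteq> T"
    and "Ck_on k T g" "Ck_on k S h"
  shows "Ck_on k S (\<lambda>x. g (h x))"
  using assms(4,5)
proof (induction k arbitrary: g)
  case 0
  then show ?case using assms(3) by (auto intro: continuous_on_compose2)
next
  case (Suc k)
  have Dg: "(g has_derivative frechet_derivative g (at (h x))) (at (h x))" if "x \<in> S" for x
    using Suc.prems assms(3) that by (intro Ck_on_Suc_has_derivative) auto
  have Dh: "(h has_derivative frechet_derivative h (at x)) (at x)" if "x \<in> S" for x
    using Suc.prems that by (intro Ck_on_Suc_has_derivative)
  show ?case
  proof (rule Ck_on_SucI[OF assms(2)])
    fix x assume x: "x \<in> S"
    have "((\<lambda>x. g (h x)) has_derivative (\<lambda>v. frechet_derivative g (at (h x)) (frechet_derivative h (at x) v))) (at x)"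
      using has_derivative_compose[OF Dh Dg] x by blast
    also have "(\<lambda>v. frechet_derivative g (at (h x)) (frechet_derivative h (at x) v)) =
        (\<lambda>v. \<Sum>b\<in>B. inner (frechet_derivative h (at x) v) b * frechet_derivative g (at (h x)) b)"
      by (rule ext) (rule orthonormal_basis_linear[OF assms(1) has_derivative_linear[OF Dg[OF x]], unfolded real_scaleR_def])
    finally show "((\<lambda>x. g (h x)) has_derivative (\<lambda>v. \<Sum>b\<in>B. inner (frechet_derivative h (at x) v) b * frechet_derivative g (at (h x)) b)) (at x)" .
  next
    show "Ck_on k S (\<lambda>x. \<Sum>b\<in>B. inner (frechet_derivative h (at x) v) b * frechet_derivative g (at (h x)) b)" for v
    proof (intro Ck_on_sum[OF assms(2)] Ck_on_mult[OF assms(2)])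
      show "Ck_on k S (\<lambda>x. inner (frechet_derivative h (at x) v) b)" for b
        using Suc.prems(2) by (intro Ck_on_linear[OF bounded_linear_inner_left assms(2)]) simp
      show "Ck_on k S (\<lambda>x. frechet_derivative g (at (h x)) b)" for b
        using Suc.IH[of "\<lambda>y. frechet_derivative g (at y) b"] Suc.prems Ck_on_SucD[OF Suc.prems(2)] by simp
    qed
  qed
qed

lemma smooth_onD: "smooth_on S f \<Longrightarrow> Ck_on k S f"
  by (simp add: smooth_on_def)

lemma smooth_on_cong: "open S \<Longrightarrow> (\<And>x. x \<in> S \<Longrightarrow> f x = g x) \<Longrightarrow> smooth_on S f \<longleftrightarrow> smooth_on S g"
  unfolding smooth_on_def using Ck_on_cong by blast

lemma smooth_on_subset: "smooth_on S f \<Longrightarrow> T \<subseteq> S \<Longrightarrow> smooth_on T f"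
  unfolding smooth_on_def using Ck_on_subset by blast

lemma smooth_on_local:
  assumes "\<And>x. x \<in> S \<Longrightarrow> \<exists>T. open T \<and> x \<in> T \<and> smooth_on T f"
  shows "smooth_on S f"
  unfolding smooth_on_def using assms[unfolded smooth_on_def] by (intro allI Ck_on_local) blast

lemma smooth_on_const [simp]: "smooth_on S (\<lambda>x. c)"
  by (simp add: smooth_on_def)

lemma smooth_on_add: "open S \<Longrightarrow> smooth_on S f \<Longrightarrow> smooth_on S g \<Longrightarrow> smooth_on S (\<lambda>x. f x + g x)"
  by (simp add: smooth_on_def Ck_on_add)

lemma smooth_on_sum: "open S \<Longrightarrow> (\<And>i. i \<in> I \<Longrightarrow> smooth_on S (f i)) \<Longrightarrow> smooth_on S (\<lambda>x. \<Sum>i\<in>I. f i x)"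
  by (simp add: smooth_on_def Ck_on_sum)

lemma smooth_on_mult:
  fixes f g :: "'e::real_normed_vector \<Rightarrow> real"
  shows "open S \<Longrightarrow> smooth_on S f \<Longrightarrow> smooth_on S g \<Longrightarrow> smooth_on S (\<lambda>x. f x * g x)"
  by (simp add: smooth_on_def Ck_on_mult)

lemma smooth_on_bounded_linear: "bounded_linear L \<Longrightarrow> open S \<Longrightarrow> smooth_on S L"
  by (simp add: smooth_on_def Ck_on_bounded_linear)

lemma smooth_on_compose:
  fixes g :: "'e::real_inner \<Rightarrow> real" and h :: "'x::real_normed_vector \<Rightarrow> 'e"
  assumes "orthonormal_basis (B :: 'e set)" "open S" "h ` S \<subseteq> T" "smooth_on T g" "smooth_on S h"
  shows "smooth_on S (\<lambda>x. g (h x))"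
  using assms(4,5) Ck_on_compose[OF assms(1-3)] by (auto simp: smooth_on_def)

lemma smooth_on_has_derivative:
  "smooth_on S f \<Longrightarrow> x \<in> S \<Longrightarrow> (f has_derivative frechet_derivative f (at x)) (at x)"
  using Ck_on_Suc_has_derivative smooth_onD by blast

lemma smooth_on_frechet_derivative: "smooth_on S f \<Longrightarrow> smooth_on S (\<lambda>x. frechet_derivative f (at x) v)"
  unfolding smooth_on_def using Ck_on.simps(2) by blast

lemma smooth_on_continuous: "smooth_on S f \<Longrightarrow> continuous_on S f"
  using smooth_onD[of S f 0] by simp

subsection \<open>Bump functions\<close>

text \<open>The powers of 1/t make the family closed under differentiation: the derivative of
  \<open>flat m\<close> is a combination of \<open>flat (m + 1)\<close> and
  \<open>flat (m + 2)\<close>, so smoothness of all members follows by one induction.\<close>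

definition flat :: "nat \<Rightarrow> real \<Rightarrow> real"
  where "flat m t = (if t > 0 then (1 / t) ^ m * exp (- (1 / t)) else 0)"

lemma flat_tendsto_0: "(flat m \<longlongrightarrow> 0) (at 0)"
proof -
  have "((\<lambda>t::real. (1 / t) ^ m * exp (- (1 / t))) \<longlongrightarrow> 0) (at_right 0)"
  proof -
    have "((\<lambda>s::real. s ^ m / exp s) \<longlongrightarrow> 0) at_top" by (rule tendsto_power_div_exp_0)
    moreover have "filterlim (\<lambda>t::real. 1 / t) at_top (at_right 0)"
      using filterlim_inverse_at_top_right by (simp add: inverse_eq_divide)
    ultimately have "((\<lambda>t::real. (1 / t) ^ m / exp (1 / t)) \<longlongrightarrow> 0) (at_right 0)"
      by (rule filterlim_compose)
    then show ?thesis by (simp add: exp_minus field_simps)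
  qed
  then have "(flat m \<longlongrightarrow> 0) (at_right 0)"
    by (rule Lim_transform_eventually) (auto simp: flat_def eventually_at_filter)
  moreover have "(flat m \<longlongrightarrow> 0) (at_left 0)"
    by (rule Lim_transform_eventually[OF tendsto_const])
       (auto simp: flat_def eventually_at_filter)
  ultimately show ?thesis by (simp add: filterlim_at_split)
qed

lemma has_real_derivative_imp_has_derivative:
  assumes "(f has_real_derivative c) (at x)"
  shows "(f has_derivative (\<lambda>v. v * c)) (at x)"
  using assms unfolding has_field_derivative_def
  by (rule has_derivative_eq_rhs) (simp add: fun_eq_iff)

lemma inverse_power_has_real_derivative:
  fixes x :: real
  assumes "x \<noteq> 0"
  shows "((\<lambda>x. (1 / x) ^ m) has_real_derivative (- real m * (1 / x) ^ (m + 1))) (at x)"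
proof -
  have "((\<lambda>x. 1 / x) has_real_derivative (- (1 / x)\<^sup>2)) (at x)"
    using assms by (auto intro!: derivative_eq_intros simp: power2_eq_square)
  from DERIV_power[OF this, of m] show ?thesis
    by (rule DERIV_cong) (cases m; simp add: power2_eq_square field_simps assms)
qed

lemma flat_has_derivative:
  "(flat m has_derivative (\<lambda>v. v * (- real m * flat (m + 1) t + flat (m + 2) t))) (at t)"
proof -
  consider "t > 0" | "t < 0" | "t = 0" by linarith
  then show ?thesis
  proof cases
    case 1
    have "((\<lambda>t. (1 / t) ^ m * exp (- (1 / t))) has_real_derivative
        (- real m * ((1 / t) ^ (m + 1) * exp (- (1 / t))) + (1 / t) ^ (m + 2) * exp (- (1 / t)))) (at t)"
    proof -
      have "((\<lambda>t. exp (- (1 / t))) has_real_derivative exp (- (1 / t)) * (1 / t) ^ 2) (at t)"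
        using 1 by (auto intro!: derivative_eq_intros simp: power2_eq_square)
      from DERIV_mult[OF inverse_power_has_real_derivative[of t m] this] 1 show ?thesis
        by (simp add: power2_eq_square algebra_simps)
    qed
    then have "((\<lambda>t. (1 / t) ^ m * exp (- (1 / t))) has_derivative
        (\<lambda>v. v * (- real m * flat (m + 1) t + flat (m + 2) t))) (at t)"
      using 1 by (intro has_real_derivative_imp_has_derivative) (simp add: flat_def)
    then show ?thesis
      by (rule has_derivative_transform_within_open[where s = "{0<..}"]) (use 1 in \<open>auto simp: flat_def\<close>)
  next
    case 2
    have "((\<lambda>t. 0) has_derivative (\<lambda>v. v * (- real m * flat (m + 1) t + flat (m + 2) t))) (at t)"
      using 2 by (simp add: flat_def)
    then show ?thesis
      by (rule has_derivative_transform_within_open[where s = "{..<0}"]) (use 2 in \<open>auto simp: flat_def\<close>)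
  next
    case 3
    \<comment> \<open>The difference quotient of \<open>flat m\<close> at 0 is
      \<open>flat (m + 1)\<close> itself, on both sides of 0.\<close>
    have "(flat m has_real_derivative 0) (at 0)"
      unfolding has_field_derivative_iff
    proof (rule Lim_transform_eventually[OF flat_tendsto_0])
      show "\<forall>\<^sub>F x in at 0. flat (m + 1) x = (flat m x - flat m 0) / (x - 0)"
        by (auto simp: flat_def eventually_at_filter)
    qed
    from has_real_derivative_imp_has_derivative[OF this] show ?thesis
      using 3 by (simp add: flat_def)
  qed
qed

lemma smooth_on_flat: "smooth_on UNIV (flat m)"
proof -
  have "Ck_on k UNIV (flat m)" for k
  proof (induction k arbitrary: m)
    case 0
    have "isCont (flat m) t" for t
      using flat_has_derivative by (blast intro: has_derivative_continuous)
    then show ?case by (simp add: continuous_at_imp_continuous_on)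
  next
    case (Suc k)
    show ?case
      by (rule Ck_on_SucI[OF _ flat_has_derivative]) (intro Ck_on_mult Ck_on_add Ck_on_const Suc.IH open_UNIV)+
  qed
  then show ?thesis by (simp add: smooth_on_def)
qed

lemma smooth_on_inverse_power: "smooth_on {0<..} (\<lambda>x::real. (1 / x) ^ m)"
proof -
  have "Ck_on k {0<..} (\<lambda>x::real. (1 / x) ^ m)" for k
  proof (induction k arbitrary: m)
    case 0
    show ?case by (auto intro!: continuous_intros)
  next
    case (Suc k)
    have "((\<lambda>x. (1 / x) ^ m) has_derivative (\<lambda>v. v * (- real m * (1 / x) ^ (m + 1)))) (at x)" if "x > 0" for x :: real
      using that by (intro has_real_derivative_imp_has_derivative inverse_power_has_real_derivative) simp
    then show ?case
      by (intro Ck_on_SucI[where D = "\<lambda>x v. v * (- real m * (1 / x) ^ (m + 1))"] Ck_on_mult Ck_on_const Suc.IH) auto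
  qed
  then show ?thesis by (simp add: smooth_on_def)
qed

text \<open>The denominator is positive because t and 1 - t are never both nonpositive. The exponent
  1 gives the reciprocal the form handled by \<open>smooth_on_inverse_power\<close>.\<close>

definition smooth_step :: "real \<Rightarrow> real"
  where "smooth_step t = flat 0 t * (1 / (flat 0 t + flat 0 (1 - t))) ^ 1"

lemma smooth_step_0: "t \<le> 0 \<Longrightarrow> smooth_step t = 0"
  and smooth_step_1: "t \<ge> 1 \<Longrightarrow> smooth_step t = 1"
  by (auto simp: smooth_step_def flat_def)

lemma smooth_on_smooth_step: "smooth_on UNIV smooth_step"
proof -
  have sh: "smooth_on UNIV (\<lambda>t. flat 0 (1 - t))"
  proof (rule smooth_on_compose[OF orthonormal_basis_real _ _ smooth_on_flat])
    show "smooth_on UNIV (\<lambda>t::real. 1 - t)"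
      using smooth_on_add[of UNIV "\<lambda>_. 1" "\<lambda>t::real. - t"] smooth_on_bounded_linear[of "\<lambda>t::real. - t" UNIV]
      by (simp add: bounded_linear_minus bounded_linear_ident)
  qed auto
  have pos: "flat 0 t + flat 0 (1 - t) > 0" for t
    by (cases "t > 0") (auto simp: flat_def intro: add_pos_pos)
  have "smooth_on UNIV (\<lambda>t. (1 / (flat 0 t + flat 0 (1 - t))) ^ 1)"
    by (rule smooth_on_compose[OF orthonormal_basis_real _ _ smooth_on_inverse_power])
       (auto intro!: smooth_on_add smooth_on_flat sh simp: pos)
  then show ?thesis
    unfolding smooth_step_def[abs_def] by (intro smooth_on_mult smooth_on_flat) auto
qed

lemma smooth_on_inner_diff:
  fixes a :: "'e::real_inner"
  assumes "orthonormal_basis (B :: 'e set)"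
  shows "smooth_on UNIV (\<lambda>x. inner (x - a) (x - a))"
proof -
  have "inner (x - a) (x - a) = (\<Sum>b\<in>B. (inner x b - inner a b) * (inner x b - inner a b))" for x
  proof -
    have "inner (x - a) (x - a) = (\<Sum>b\<in>B. inner (x - a) b *\<^sub>R inner b (x - a))"
      by (rule orthonormal_basis_linear[OF assms, of "\<lambda>y. inner y (x - a)"])
         (simp add: linear_iff inner_add_left)
    moreover have "inner b (x - a) = inner x b - inner a b" for b
      by (simp add: inner_diff_right inner_commute)
    ultimately show ?thesis by (simp add: inner_diff_left)
  qed
  moreover have "smooth_on UNIV (\<lambda>x. inner x b - inner a b)" for b
    using smooth_on_add[of UNIV "\<lambda>x. inner x b" "\<lambda>_. - inner a b"]
    by (simp add: smooth_on_bounded_linear bounded_linear_inner_left)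
  ultimately show ?thesis by (auto intro!: smooth_on_sum smooth_on_mult)
qed

lemma bump_function:
  fixes a :: "'e::real_inner"
  assumes B: "orthonormal_basis (B :: 'e set)" and r: "0 < r" "r < s"
  shows "\<exists>h::'e \<Rightarrow> real. smooth_on UNIV h \<and> (\<forall>x. norm (x - a) \<le> r \<longrightarrow> h x = 1) \<and>
    (\<forall>x. norm (x - a) \<ge> s \<longrightarrow> h x = 0)"
proof -
  \<comment> \<open>The affine function with value 1 at the square of r and 0 at the square of s. It
    is applied to the squared distance, which is smooth also at the centre.\<close>
  define g where "g t = (s\<^sup>2 - t) * (1 / (s\<^sup>2 - r\<^sup>2))" for t :: real
  have d: "s\<^sup>2 - r\<^sup>2 > 0" using r by (simp add: power_strict_mono)
  have "smooth_on UNIV (\<lambda>t::real. s\<^sup>2 + - t)"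
    by (intro smooth_on_add smooth_on_const smooth_on_bounded_linear) (auto simp: bounded_linear_minus bounded_linear_ident)
  then have g: "smooth_on UNIV g"
    unfolding g_def by (intro smooth_on_mult) auto
  have sg: "smooth_on UNIV (\<lambda>t. smooth_step (g t))"
    by (rule smooth_on_compose[OF orthonormal_basis_real _ _ smooth_on_smooth_step g]) auto
  have "smooth_on UNIV (\<lambda>x. smooth_step (g (inner (x - a) (x - a))))"
    by (rule smooth_on_compose[OF orthonormal_basis_real _ _ sg smooth_on_inner_diff[OF B]]) auto
  moreover have "smooth_step (g (inner (x - a) (x - a))) = 1" if "norm (x - a) \<le> r" for x
  proof (rule smooth_step_1)
    have "(norm (x - a))\<^sup>2 \<le> r\<^sup>2" using that by (intro power_mono) auto
    then show "1 \<le> g (inner (x - a) (x - a))"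
      using d by (simp add: g_def power2_norm_eq_inner field_simps)
  qed
  moreover have "smooth_step (g (inner (x - a) (x - a))) = 0" if "norm (x - a) \<ge> s" for x
  proof (rule smooth_step_0)
    have "(norm (x - a))\<^sup>2 \<ge> s\<^sup>2" using that r by (intro power_mono) auto
    then show "g (inner (x - a) (x - a)) \<le> 0"
      using d by (simp add: g_def power2_norm_eq_inner field_simps)
  qed
  ultimately show ?thesis by blast
qed

subsection \<open>Hadamard's lemma\<close>

lemma segment_in_ball:
  fixes a :: "'e::real_normed_vector"
  assumes "x \<in> ball a r" "0 \<le> t" "t \<le> (1::real)"
  shows "a + t *\<^sub>R (x - a) \<in> ball a r"
proof -
  have "t * norm (x - a) \<le> 1 * norm (x - a)" using assms by (intro mult_right_mono) auto
  then show ?thesis using assms by (simp add: dist_norm norm_minus_commute)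
qed

lemma star_integrable:
  fixes F :: "'e::real_inner \<Rightarrow> real"
  assumes "continuous_on (ball a r) F" "x \<in> ball a r"
  shows "(\<lambda>t. t ^ m * F (a + t *\<^sub>R (x - a))) integrable_on {0..1}"
proof (rule integrable_continuous_real)
  have "continuous_on {0..1} (\<lambda>t. F (a + t *\<^sub>R (x - a)))"
    using segment_in_ball[OF assms(2)]
    by (intro continuous_on_compose2[OF assms(1)] continuous_intros) (auto simp del: mem_ball)
  then show "continuous_on {0..1} (\<lambda>t. t ^ m * F (a + t *\<^sub>R (x - a)))"
    by (auto intro!: continuous_intros)
qed

text \<open>Differentiation under the integral sign along the rays from \<open>a\<close>. The weight
  \<open>t ^ m\<close> is carried along because each differentiation produces one more factor t;
  with m arbitrary, the derivative is again an integral of the same kind and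
  \<open>star_integral_smooth\<close> is an induction.\<close>

lemma star_integral_has_derivative:
  fixes F :: "'e::real_inner \<Rightarrow> real"
  assumes B: "orthonormal_basis (B :: 'e set)" and F: "smooth_on (ball a r) F" and x: "x \<in> ball a r"
  shows "((\<lambda>x. integral {0..1} (\<lambda>t. t ^ m * F (a + t *\<^sub>R (x - a)))) has_derivative
    (\<lambda>v. integral {0..1} (\<lambda>t. t ^ Suc m * frechet_derivative F (at (a + t *\<^sub>R (x - a))) v))) (at x)"
proof -
  define D where "D b y = frechet_derivative F (at y) b" for b y
  define G where "G t y = a + t *\<^sub>R (y - a)" for t y
  have fin: "finite B" using B by (simp add: orthonormal_basis_def)
  have nB: "norm b = 1" if "b \<in> B" for b
    using B that by (simp add: orthonormal_basis_def norm_eq_sqrt_inner)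
  have hd: "(F has_derivative (\<lambda>v. \<Sum>b\<in>B. inner v b * D b y)) (at y)" if "y \<in> ball a r" for y
  proof -
    note d = smooth_on_has_derivative[OF F that]
    have "frechet_derivative F (at y) = (\<lambda>v. \<Sum>b\<in>B. inner v b * D b y)"
      unfolding D_def
      by (rule ext) (rule orthonormal_basis_linear[OF B has_derivative_linear[OF d], unfolded real_scaleR_def])
    then show ?thesis using d by simp
  qed
  have Deq: "frechet_derivative F (at y) v = (\<Sum>b\<in>B. inner v b * D b y)" if "y \<in> ball a r" for y v
    using frechet_derivative_eqI[OF hd[OF that]] by simp
  have Gball: "G t y \<in> ball a r" if "y \<in> ball a r" "t \<in> {0..1}" for t y
    using that segment_in_ball by (auto simp: G_def simp del: mem_ball)
  have Dcont: "continuous_on (ball a r) (D b)" for b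
    unfolding D_def by (intro smooth_on_continuous smooth_on_frechet_derivative F)
  have Fcont: "continuous_on (ball a r) F" by (intro smooth_on_continuous F)
  have Fint: "(\<lambda>t. t ^ m * F (G t y)) integrable_on {0..1}" if "y \<in> ball a r" for y
    using star_integrable[OF Fcont that] by (simp add: G_def)
  have Dint: "(\<lambda>t. t ^ Suc m * D b (G t y)) integrable_on {0..1}" if "y \<in> ball a r" for y b
    using star_integrable[OF Dcont that, of "Suc m"] by (simp add: G_def)
  define L where "L v = (\<Sum>b\<in>B. inner v b * integral {0..1} (\<lambda>t. t ^ Suc m * D b (G t x)))" for v
  have L_int: "((\<lambda>t. t ^ Suc m * (\<Sum>b\<in>B. inner v b * D b (G t x))) has_integral L v) {0..1}" for v
  proof -
    have "((\<lambda>t. \<Sum>b\<in>B. inner v b * (t ^ Suc m * D b (G t x))) has_integral L v) {0..1}"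
      unfolding L_def
      by (intro has_integral_sum fin has_integral_mult_right integrable_integral Dint x)
    then show ?thesis by (simp add: sum_distrib_left mult_ac)
  qed
  have L_eq: "integral {0..1} (\<lambda>t. t ^ Suc m * frechet_derivative F (at (a + t *\<^sub>R (x - a))) v) = L v" for v
  proof -
    have "integral {0..1} (\<lambda>t. t ^ Suc m * frechet_derivative F (at (a + t *\<^sub>R (x - a))) v)
      = integral {0..1} (\<lambda>t. t ^ Suc m * (\<Sum>b\<in>B. inner v b * D b (G t x)))"
      using Deq Gball[OF x] by (intro integral_cong) (auto simp: G_def simp del: mem_ball)
    then show ?thesis using L_int integral_unique by metis
  qed
  have bl: "bounded_linear L"
    unfolding L_def by (intro bounded_linear_sum bounded_linear_mult_left[THEN bounded_linear_compose] bounded_linear_inner_left)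
  have est: "\<exists>d>0. \<forall>y. norm (y - x) < d \<longrightarrow>
      norm (integral {0..1} (\<lambda>t. t ^ m * F (G t y)) - integral {0..1} (\<lambda>t. t ^ m * F (G t x)) - L (y - x))
        \<le> e * norm (y - x)" if e: "e > 0" for e
  proof -
    \<comment> \<open>Each of the \<open>card B\<close> partial derivatives may vary by
      \<open>e'\<close>; the added 1 keeps the denominator positive when \<open>B\<close> is
      empty.\<close>
    define e' where "e' = e / (real (card B) + 1)"
    have e': "e' > 0" "real (card B) * e' \<le> e" using e by (auto simp: e'_def field_simps)
    \<comment> \<open>Compactness of the interval gives a neighbourhood of \<open>x\<close> that
      works for all t at once.\<close>
    have "\<forall>b\<in>B. \<exists>X. x \<in> X \<and> open X \<and> (\<forall>y\<in>X \<inter> ball a r. \<forall>t\<in>{0..1}. dist (D b (G t y)) (D b (G t x)) \<le> e')"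
    proof
      fix b assume "b \<in> B"
      have "continuous_on (ball a r \<times> {0..1}) (\<lambda>x. G (snd x) (fst x))"
        unfolding G_def by (intro continuous_intros)
      then have c: "continuous_on (ball a r \<times> {0..1}) (\<lambda>(y, t). D b (G t y))"
        unfolding case_prod_unfold
        by (rule continuous_on_compose2[OF Dcont])
           (use Gball in \<open>auto simp del: mem_ball\<close>)
      show "\<exists>X. x \<in> X \<and> open X \<and> (\<forall>y\<in>X \<inter> ball a r. \<forall>t\<in>{0..1}. dist (D b (G t y)) (D b (G t x)) \<le> e')"
        by (rule continuous_on_prod_compactE[OF c compact_Icc x e'(1)]) (metis case_prod_conv)
    qed
    then obtain X where X0: "\<forall>b\<in>B. x \<in> X b \<and> open (X b) \<and>
        (\<forall>y\<in>X b \<inter> ball a r. \<forall>t\<in>{0..1}. dist (D b (G t y)) (D b (G t x)) \<le> e')"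
      unfolding bchoice_iff by (elim exE)
    have X: "\<And>b. b \<in> B \<Longrightarrow> x \<in> X b" "\<And>b. b \<in> B \<Longrightarrow> open (X b)"
      "\<And>b y t. b \<in> B \<Longrightarrow> y \<in> X b \<Longrightarrow> y \<in> ball a r \<Longrightarrow> t \<in> {0..1} \<Longrightarrow> dist (D b (G t y)) (D b (G t x)) \<le> e'"
      using X0 by blast+
    have "open (ball a r \<inter> (\<Inter>b\<in>B. X b))" using X(2) fin by (intro open_Int open_INT) auto
    moreover have "x \<in> ball a r \<inter> (\<Inter>b\<in>B. X b)" using X(1) x by blast
    ultimately obtain d where d: "d > 0" "ball x d \<subseteq> ball a r \<inter> (\<Inter>b\<in>B. X b)"
      by (rule openE)
    have "norm (integral {0..1} (\<lambda>t. t ^ m * F (G t y)) - integral {0..1} (\<lambda>t. t ^ m * F (G t x)) - L (y - x))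
        \<le> e * norm (y - x)" if y: "norm (y - x) < d" for y
    proof -
      have seg: "x + s *\<^sub>R (y - x) \<in> ball x d" if "s \<in> {0..1}" for s
        using segment_in_ball[of y x d s] that y by (simp add: dist_norm norm_minus_commute)
      have yball: "y \<in> ball a r" using seg[of 1] d(2) by auto
      have ptw: "norm (t ^ m * F (G t y) - t ^ m * F (G t x) - t ^ Suc m * (\<Sum>b\<in>B. inner (y - x) b * D b (G t x)))
          \<le> e * norm (y - x)" if t: "t \<in> {0..1}" for t
      proof -
        \<comment> \<open>Mean value theorem on the segment from x to y after contraction towards a
          by t; the contraction contributes the factor t that raises the weight to
          \<open>Suc m\<close>.\<close>
        have "\<exists>s\<in>{0<..<1}. F (G t (x + 1 *\<^sub>R (y - x))) - F (G t (x + 0 *\<^sub>R (y - x))) =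
            (\<lambda>h. \<Sum>b\<in>B. inner (t *\<^sub>R (h *\<^sub>R (y - x))) b * D b (G t (x + s *\<^sub>R (y - x)))) (1 - 0)"
        proof (rule mvt_simple)
          fix s :: real assume s: "0 \<le> s" "s \<le> 1"
          have i: "G t (x + s *\<^sub>R (y - x)) \<in> ball a r" using seg[of s] s d(2) t by (intro Gball) auto
          have "((\<lambda>s. G t (x + s *\<^sub>R (y - x))) has_derivative (\<lambda>h. t *\<^sub>R (h *\<^sub>R (y - x)))) (at s within {0..1})"
            unfolding G_def by (auto intro!: derivative_eq_intros)
          from has_derivative_compose[OF this hd[OF i]]
          show "((\<lambda>s. F (G t (x + s *\<^sub>R (y - x)))) has_derivative
            (\<lambda>h. \<Sum>b\<in>B. inner (t *\<^sub>R (h *\<^sub>R (y - x))) b * D b (G t (x + s *\<^sub>R (y - x))))) (at s within {0..1})" .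
        qed simp
        then obtain s where s: "s \<in> {0<..<1}" and
          mv: "F (G t y) - F (G t x) = t * (\<Sum>b\<in>B. inner (y - x) b * D b (G t (x + s *\<^sub>R (y - x))))"
          by (auto simp: sum_distrib_left mult_ac)
        let ?z = "x + s *\<^sub>R (y - x)"
        have z: "?z \<in> ball a r" "\<And>b. b \<in> B \<Longrightarrow> ?z \<in> X b" using seg[of s] s d(2) by auto
        have "t ^ m * F (G t y) - t ^ m * F (G t x) - t ^ Suc m * (\<Sum>b\<in>B. inner (y - x) b * D b (G t x))
          = t ^ m * (F (G t y) - F (G t x)) - t ^ Suc m * (\<Sum>b\<in>B. inner (y - x) b * D b (G t x))"
          by (simp add: right_diff_distrib)
        also have "... = t ^ Suc m * (\<Sum>b\<in>B. inner (y - x) b * (D b (G t ?z) - D b (G t x)))"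
          unfolding mv by (simp add: right_diff_distrib sum_subtractf mult_ac)
        finally have "norm (t ^ m * F (G t y) - t ^ m * F (G t x) - t ^ Suc m * (\<Sum>b\<in>B. inner (y - x) b * D b (G t x)))
          = t ^ Suc m * \<bar>\<Sum>b\<in>B. inner (y - x) b * (D b (G t ?z) - D b (G t x))\<bar>"
          using t by (simp add: abs_mult power_abs)
        also have "... \<le> 1 * \<bar>\<Sum>b\<in>B. inner (y - x) b * (D b (G t ?z) - D b (G t x))\<bar>"
          using t by (intro mult_right_mono power_le_one) auto
        also have "... \<le> (\<Sum>b\<in>B. \<bar>inner (y - x) b * (D b (G t ?z) - D b (G t x))\<bar>)"
          by (simp add: sum_abs)
        also have "... \<le> (\<Sum>b\<in>B. norm (y - x) * e')"
        proof (rule sum_mono)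
          fix b assume b: "b \<in> B"
          have "\<bar>inner (y - x) b\<bar> \<le> norm (y - x)" using Cauchy_Schwarz_ineq2[of "y - x" b] nB[OF b] by simp
          moreover have "\<bar>D b (G t ?z) - D b (G t x)\<bar> \<le> e'" using X(3)[OF b z(2)[OF b] z(1) t] by (simp add: dist_real_def)
          ultimately show "\<bar>inner (y - x) b * (D b (G t ?z) - D b (G t x))\<bar> \<le> norm (y - x) * e'"
            unfolding abs_mult by (intro mult_mono) auto
        qed
        also have "... = (real (card B) * e') * norm (y - x)" by simp
        also have "... \<le> e * norm (y - x)" using e'(2) by (intro mult_right_mono) auto
        finally show ?thesis .
      qed
      have "((\<lambda>t. t ^ m * F (G t y) - t ^ m * F (G t x) - t ^ Suc m * (\<Sum>b\<in>B. inner (y - x) b * D b (G t x))) has_integral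
        (integral {0..1} (\<lambda>t. t ^ m * F (G t y)) - integral {0..1} (\<lambda>t. t ^ m * F (G t x)) - L (y - x))) {0..1}"
        by (intro has_integral_diff integrable_integral Fint yball x L_int)
      then have "norm (integral {0..1} (\<lambda>t. t ^ m * F (G t y)) - integral {0..1} (\<lambda>t. t ^ m * F (G t x)) - L (y - x))
          \<le> e * norm (y - x) * measure lborel {0..1::real}"
        using e ptw by (intro has_integral_bound_real[of _ "{}"]) auto
      then show ?thesis by simp
    qed
    then show ?thesis using d(1) by blast
  qed
  have "((\<lambda>x. integral {0..1} (\<lambda>t. t ^ m * F (G t x))) has_derivative L) (at x)"
    unfolding has_derivative_at_alt using bl est by blast
  then show ?thesis unfolding L_eq by (simp add: G_def)
qed

lemma star_integral_smooth:
  fixes F :: "'e::real_inner \<Rightarrow> real"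
  assumes B: "orthonormal_basis (B :: 'e set)" and F: "smooth_on (ball a r) F"
  shows "smooth_on (ball a r) (\<lambda>x. integral {0..1} (\<lambda>t. t ^ m * F (a + t *\<^sub>R (x - a))))"
proof -
  have "Ck_on k (ball a r) (\<lambda>x. integral {0..1} (\<lambda>t. t ^ m * F (a + t *\<^sub>R (x - a))))" for k
    using F
  proof (induction k arbitrary: m F)
    case 0
    then show ?case
      using star_integral_has_derivative[OF B 0]
      by (auto intro!: continuous_at_imp_continuous_on has_derivative_continuous)
  next
    case (Suc k)
    show ?case
      by (rule Ck_on_SucI[OF _ star_integral_has_derivative[OF B Suc.prems]])
         (auto intro!: Suc.IH smooth_on_frechet_derivative Suc.prems simp del: power_Suc)
  qed
  then show ?thesis by (simp add: smooth_on_def)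
qed

text \<open>The coefficients average the partial derivatives over the segment from \<open>a\<close>
  to the point, and the expansion is the fundamental theorem of calculus on that segment. A
  derivation at \<open>a\<close> applied to it sees only the first-order terms, which is how
  derivations become combinations of coordinate derivatives.\<close>

lemma hadamard:
  fixes f :: "'e::real_inner \<Rightarrow> real"
  assumes B: "orthonormal_basis (B :: 'e set)" and f: "smooth_on (ball a r) f" and r: "r > 0"
  shows "\<exists>g. (\<forall>b. smooth_on (ball a r) (g b)) \<and> (\<forall>b. g b a = frechet_derivative f (at a) b) \<and>
    (\<forall>x\<in>ball a r. f x = f a + (\<Sum>b\<in>B. inner (x - a) b * g b x))"
proof -
  \<comment> \<open>The factor \<open>t ^ 0\<close> is kept so that the star integral lemmas apply
    with m = 0.\<close>
  define g where "g b x = integral {0..1} (\<lambda>t. t ^ 0 * frechet_derivative f (at (a + t *\<^sub>R (x - a))) b)" for b x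
  have fin: "finite B" using B by (simp add: orthonormal_basis_def)
  have "f x = f a + (\<Sum>b\<in>B. inner (x - a) b * g b x)" if x: "x \<in> ball a r" for x
  proof -
    have "((\<lambda>t. frechet_derivative f (at (a + t *\<^sub>R (x - a))) (x - a)) has_integral
        (f (a + 1 *\<^sub>R (x - a)) - f (a + 0 *\<^sub>R (x - a)))) {0..1}"
    proof (rule fundamental_theorem_of_calculus)
      fix t :: real assume t: "t \<in> {0..1}"
      then have i: "a + t *\<^sub>R (x - a) \<in> ball a r" using segment_in_ball[OF x] by simp
      have "((\<lambda>t. a + t *\<^sub>R (x - a)) has_derivative (\<lambda>h. h *\<^sub>R (x - a))) (at t within {0..1})"
        by (auto intro!: derivative_eq_intros)
      from has_derivative_compose[OF this smooth_on_has_derivative[OF f i]]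
      show "((\<lambda>t. f (a + t *\<^sub>R (x - a))) has_vector_derivative
        frechet_derivative f (at (a + t *\<^sub>R (x - a))) (x - a)) (at t within {0..1})"
        unfolding has_vector_derivative_def
        using linear_scale[OF has_derivative_linear[OF smooth_on_has_derivative[OF f i]]] by simp
    qed simp
    moreover have "((\<lambda>t. frechet_derivative f (at (a + t *\<^sub>R (x - a))) (x - a)) has_integral
        (\<Sum>b\<in>B. inner (x - a) b * g b x)) {0..1}"
    proof (rule has_integral_eq)
      show "((\<lambda>t. \<Sum>b\<in>B. inner (x - a) b * (t ^ 0 * frechet_derivative f (at (a + t *\<^sub>R (x - a))) b))
          has_integral (\<Sum>b\<in>B. inner (x - a) b * g b x)) {0..1}"
        unfolding g_def
        by (intro has_integral_sum fin has_integral_mult_right integrable_integral star_integrable[OF _ x]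
            smooth_on_continuous smooth_on_frechet_derivative f)
      fix t :: real assume "t \<in> {0..1}"
      then have i: "a + t *\<^sub>R (x - a) \<in> ball a r" using segment_in_ball[OF x] by simp
      show "(\<Sum>b\<in>B. inner (x - a) b * (t ^ 0 * frechet_derivative f (at (a + t *\<^sub>R (x - a))) b)) =
          frechet_derivative f (at (a + t *\<^sub>R (x - a))) (x - a)"
        unfolding power_0 mult_1
        by (rule orthonormal_basis_linear[OF B has_derivative_linear[OF smooth_on_has_derivative[OF f i]],
              unfolded real_scaleR_def, symmetric])
    qed
    ultimately have "f (a + 1 *\<^sub>R (x - a)) - f (a + 0 *\<^sub>R (x - a)) = (\<Sum>b\<in>B. inner (x - a) b * g b x)"
      by (rule has_integral_unique)
    then show ?thesis by simp
  qed
  moreover have "smooth_on (ball a r) (g b)" for b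
    unfolding g_def by (intro star_integral_smooth[OF B] smooth_on_frechet_derivative f)
  moreover have "g b a = frechet_derivative f (at a) b" for b
    by (simp add: g_def)
  ultimately show ?thesis by (intro exI[of _ g]) simp
qed

subsection \<open>Smooth functions on a manifold\<close>

lemma subspace_tangent_space: "subspace (tangent_space A p)"
  unfolding subspace_def tangent_space_def
  by (auto simp: scaleR_fun_def algebra_simps)

locale smooth_mfd =
  fixes A :: "('a::{t2_space, second_countable_topology}, 'e::real_inner) atlas"
  assumes mfd: "smooth_manifold A"
begin

abbreviation smooth_functions ("\<C>")
  where "\<C> \<equiv> smooth_funs A UNIV"

definition basis :: "'e set"
  where "basis = (SOME B. orthonormal_basis B)"

lemma basis: "orthonormal_basis basis"
  unfolding basis_def using mfd orthonormal_basis_exists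
  by (metis smooth_manifold_def someI_ex)

definition basis_list :: "'e list"
  where "basis_list = (SOME l. set l = basis \<and> distinct l)"

lemma basis_list: "set basis_list = basis" "distinct basis_list"
proof -
  have "\<exists>l. set l = basis \<and> distinct l"
    using basis finite_distinct_list unfolding orthonormal_basis_def by blast
  then have "set basis_list = basis \<and> distinct basis_list"
    unfolding basis_list_def by (rule someI_ex)
  then show "set basis_list = basis" "distinct basis_list" by auto
qed

definition mdim :: nat
  where "mdim = length basis_list"

lemma sum_basis: "(\<Sum>b\<in>basis. P b) = (\<Sum>i<mdim. P (basis_list ! i))"
proof -
  have "bij_betw ((!) basis_list) {..<mdim} basis"
    using basis_list by (intro bij_betw_nth) (auto simp: mdim_def)
  then show ?thesis by (rule sum.reindex_bij_betw[symmetric])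
qed

lemma inner_basis: "i < mdim \<Longrightarrow> j < mdim \<Longrightarrow> inner (basis_list ! i) (basis_list ! j) = (if i = j then 1 else 0)"
  using basis basis_list nth_eq_iff_index_eq[OF basis_list(2)]
  unfolding orthonormal_basis_def mdim_def by (metis nth_mem)

lemma chart_cover: "\<exists>U \<phi>. (U, \<phi>) \<in> A \<and> p \<in> U"
proof -
  have "p \<in> (\<Union>(U, \<phi>)\<in>A. U)" using mfd by (simp add: smooth_manifold_def)
  then show ?thesis by auto
qed

lemma chart:
  assumes "(U, \<phi>) \<in> A"
  shows "open U" "open (\<phi> ` U)" "inj_on \<phi> U" "homeomorphism U (\<phi> ` U) \<phi> (inv_into U \<phi>)"
  using mfd assms unfolding smooth_manifold_def by blast+

lemma chart_transition:
  assumes "(U, \<phi>) \<in> A" "(V, \<psi>) \<in> A"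
  shows "smooth_on (\<phi> ` (U \<inter> V)) (\<lambda>x. \<psi> (inv_into U \<phi> x))"
  using mfd assms unfolding smooth_manifold_def by blast

lemma chart_inv [simp]: "(U, \<phi>) \<in> A \<Longrightarrow> q \<in> U \<Longrightarrow> inv_into U \<phi> (\<phi> q) = q"
  by (simp add: chart(3))

lemma chart_image_open:
  assumes "(U, \<phi>) \<in> A" "open W"
  shows "open (\<phi> ` (U \<inter> W))"
proof -
  have "openin (top_of_set (\<phi> ` U)) (\<phi> ` (U \<inter> W))"
    using homeomorphism_imp_open_map[OF chart(4)[OF assms(1)]] assms(2) by blast
  then show ?thesis using chart(2)[OF assms(1)] openin_open_trans by blast
qed

lemma chart_preimage_open:
  assumes "(U, \<phi>) \<in> A" "open T"
  shows "open {q \<in> U. \<phi> q \<in> T}"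
proof -
  have "continuous_on U \<phi>" using chart(4)[OF assms(1)] by (simp add: homeomorphism_def)
  then have "open (U \<inter> \<phi> -` T)"
    by (intro continuous_open_preimage chart(1)[OF assms(1)] assms(2))
  then show ?thesis by (simp add: Int_def vimage_def)
qed

lemma smooth_funsI:
  "(\<And>U \<phi>. (U, \<phi>) \<in> A \<Longrightarrow> smooth_on (\<phi> ` (U \<inter> W)) (\<lambda>x. f (inv_into U \<phi> x))) \<Longrightarrow> f \<in> smooth_funs A W"
  by (auto simp: smooth_funs_def)

lemma smooth_funsD:
  "f \<in> smooth_funs A W \<Longrightarrow> (U, \<phi>) \<in> A \<Longrightarrow> smooth_on (\<phi> ` (U \<inter> W)) (\<lambda>x. f (inv_into U \<phi> x))"
  by (auto simp: smooth_funs_def)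

lemma smooth_funs_const: "(\<lambda>x. c) \<in> smooth_funs A W"
  by (rule smooth_funsI) simp

lemma smooth_funs_add:
  "open W \<Longrightarrow> f \<in> smooth_funs A W \<Longrightarrow> g \<in> smooth_funs A W \<Longrightarrow> (\<lambda>x. f x + g x) \<in> smooth_funs A W"
  by (rule smooth_funsI, rule smooth_on_add, erule (1) chart_image_open, (erule (1) smooth_funsD)+)

lemma smooth_funs_mult:
  "open W \<Longrightarrow> f \<in> smooth_funs A W \<Longrightarrow> g \<in> smooth_funs A W \<Longrightarrow> (\<lambda>x. f x * g x) \<in> smooth_funs A W"
  by (rule smooth_funsI, rule smooth_on_mult, erule (1) chart_image_open, (erule (1) smooth_funsD)+)

lemma smooth_funs_sum:
  "open W \<Longrightarrow> (\<And>i. i \<in> I \<Longrightarrow> f i \<in> smooth_funs A W) \<Longrightarrow> (\<lambda>x. \<Sum>i\<in>I. f i x) \<in> smooth_funs A W"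
  by (rule smooth_funsI, rule smooth_on_sum, erule (1) chart_image_open, rule smooth_funsD, blast+)

lemma smooth_funs_minus: "open W \<Longrightarrow> f \<in> smooth_funs A W \<Longrightarrow> (\<lambda>x. - f x) \<in> smooth_funs A W"
  using smooth_funs_mult[OF _ smooth_funs_const[of "-1"], of W f] by simp

lemma smooth_funs_diff:
  "open W \<Longrightarrow> f \<in> smooth_funs A W \<Longrightarrow> g \<in> smooth_funs A W \<Longrightarrow> (\<lambda>x. f x - g x) \<in> smooth_funs A W"
  using smooth_funs_add[OF _ _ smooth_funs_minus, of W f g] by simp

lemma smooth_funs_prod:
  "open W \<Longrightarrow> (\<And>i. i \<in> I \<Longrightarrow> f i \<in> smooth_funs A W) \<Longrightarrow> (\<lambda>x. \<Prod>i\<in>I. f i x) \<in> smooth_funs A W"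
  by (induction I rule: infinite_finite_induct) (auto intro: smooth_funs_const smooth_funs_mult)

lemmas smooth_funs_intros = smooth_funs_const smooth_funs_add smooth_funs_mult smooth_funs_sum
  smooth_funs_minus smooth_funs_diff smooth_funs_prod

lemma smooth_funs_subset: "f \<in> smooth_funs A W \<Longrightarrow> V \<subseteq> W \<Longrightarrow> f \<in> smooth_funs A V"
  by (rule smooth_funsI, rule smooth_on_subset, erule (1) smooth_funsD, blast)

lemma smooth_funs_cong:
  assumes "open W" "\<And>q. q \<in> W \<Longrightarrow> f q = g q"
  shows "f \<in> smooth_funs A W \<longleftrightarrow> g \<in> smooth_funs A W"
proof -
  have "smooth_on (\<phi> ` (U \<inter> W)) (\<lambda>x. f (inv_into U \<phi> x)) \<longleftrightarrow> smooth_on (\<phi> ` (U \<inter> W)) (\<lambda>x. g (inv_into U \<phi> x))"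
    if "(U, \<phi>) \<in> A" for U \<phi>
    using that assms by (intro smooth_on_cong chart_image_open) auto
  then show ?thesis by (auto simp: smooth_funs_def)
qed

lemma smooth_funs_local:
  assumes "\<And>p. p \<in> W \<Longrightarrow> \<exists>V. open V \<and> p \<in> V \<and> f \<in> smooth_funs A V"
  shows "f \<in> smooth_funs A W"
proof (rule smooth_funsI, rule smooth_on_local)
  fix U \<phi> x assume c: "(U, \<phi>) \<in> A" and "x \<in> \<phi> ` (U \<inter> W)"
  then obtain q where q: "q \<in> U" "q \<in> W" "x = \<phi> q" by auto
  obtain V where V: "open V" "q \<in> V" "f \<in> smooth_funs A V" using assms q by blast
  show "\<exists>T. open T \<and> x \<in> T \<and> smooth_on T (\<lambda>x. f (inv_into U \<phi> x))"
    using chart_image_open[OF c V(1)] smooth_funsD[OF V(3) c] q V(2)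
    by (intro exI[of _ "\<phi> ` (U \<inter> V)"]) auto
qed

text \<open>One chart decides smoothness inside its domain, since every other chart differs from it
  by a smooth transition map.\<close>

lemma smooth_funs_chartI:
  assumes c: "(U, \<phi>) \<in> A" and W: "W \<subseteq> U" "open W"
    and f: "smooth_on (\<phi> ` W) (\<lambda>x. f (inv_into U \<phi> x))"
  shows "f \<in> smooth_funs A W"
proof (rule smooth_funsI)
  fix V \<psi> assume d: "(V, \<psi>) \<in> A"
  let ?S = "\<psi> ` (V \<inter> W)"
  have o: "open ?S" by (rule chart_image_open[OF d W(2)])
  have "smooth_on ?S (\<lambda>x. (\<lambda>y. f (inv_into U \<phi> y)) (\<phi> (inv_into V \<psi> x)))"
  proof (rule smooth_on_compose[OF basis o _ f])
    show "(\<lambda>x. \<phi> (inv_into V \<psi> x)) ` ?S \<subseteq> \<phi> ` W" using d by auto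
    show "smooth_on ?S (\<lambda>x. \<phi> (inv_into V \<psi> x))"
      using chart_transition[OF d c] by (rule smooth_on_subset) (use W in auto)
  qed
  then show "smooth_on ?S (\<lambda>x. f (inv_into V \<psi> x))"
    by (rule smooth_on_cong[OF o, THEN iffD1, rotated]) (use W c d in auto)
qed

text \<open>The function is smooth through the chart on the preimage of the ball of radius
  \<open>t\<close> and zero off the compact set \<open>K\<close> coming from radius
  \<open>s\<close>. \<open>K\<close> is closed because the manifold is Hausdorff, so these two open
  sets cover it; the gap between \<open>s\<close> and \<open>t\<close> places \<open>K\<close>
  inside the first one.\<close>

lemma extend_by_bump:
  assumes c: "(U, \<phi>) \<in> A" and s: "s < t" "ball a t \<subseteq> \<phi> ` U"
    and h: "smooth_on UNIV h" "\<And>x. norm (x - a) \<ge> s \<Longrightarrow> h x = 0"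
    and g: "smooth_on (ball a t) g"
  shows "(\<lambda>q. if q \<in> U then h (\<phi> q) * g (\<phi> q) else 0 :: real) \<in> \<C>" (is "?f \<in> _")
proof (rule smooth_funs_local)
  fix p :: 'a
  define K where "K = inv_into U \<phi> ` cball a s"
  have sub: "cball a s \<subseteq> \<phi> ` U" using s by auto
  have "continuous_on (cball a s) (inv_into U \<phi>)"
    using chart(4)[OF c] sub by (auto simp: homeomorphism_def intro: continuous_on_subset)
  then have "closed K"
    unfolding K_def by (intro compact_imp_closed compact_continuous_image compact_cball_orthonormal_basis[OF basis])
  show "\<exists>V. open V \<and> p \<in> V \<and> ?f \<in> smooth_funs A V"
  proof (cases "p \<in> K")
    case True
    let ?V = "{q \<in> U. \<phi> q \<in> ball a t}"
    have V: "open ?V" by (rule chart_preimage_open[OF c open_ball])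
    have pV: "p \<in> ?V"
    proof -
      obtain x where x: "x \<in> cball a s" "p = inv_into U \<phi> x" using True by (auto simp: K_def)
      then obtain q where "q \<in> U" "x = \<phi> q" using sub by blast
      then show ?thesis using x s(1) c by auto
    qed
    have im: "\<phi> ` ?V \<subseteq> ball a t" by auto
    have oi: "open (\<phi> ` ?V)"
      using chart_image_open[OF c V] by (simp add: Int_def conj_ac)
    have "?f \<in> smooth_funs A ?V"
    proof (rule smooth_funs_chartI[OF c _ V])
      have "smooth_on (\<phi> ` ?V) (\<lambda>x. h x * g x)"
        by (intro smooth_on_mult oi smooth_on_subset[OF h(1)] smooth_on_subset[OF g] im) auto
      then show "smooth_on (\<phi> ` ?V) (\<lambda>x. ?f (inv_into U \<phi> x))"
        by (rule smooth_on_cong[OF oi, THEN iffD1, rotated]) (use c in auto)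
    qed auto
    then show ?thesis using V pV by blast
  next
    case False
    have "?f q = 0" if "q \<in> - K" for q
    proof (cases "q \<in> U")
      case True
      then have "\<phi> q \<notin> cball a s" using that c unfolding K_def by (metis ComplD chart_inv imageI)
      then have "h (\<phi> q) = 0" by (intro h(2)) (simp add: dist_norm norm_minus_commute)
      then show ?thesis by simp
    qed simp
    then have "?f \<in> smooth_funs A (- K)"
      using smooth_funs_cong[of "- K" ?f "\<lambda>_. 0"] \<open>closed K\<close> smooth_funs_const by blast
    then show ?thesis using False \<open>closed K\<close> by (intro exI[of _ "- K"]) auto
  qed
qed

text \<open>Its uses multiply an object defined near \<open>p\<close> by \<beta>: the product
  becomes global and keeps its value at \<open>p\<close>, for which \<beta> p = 1 suffices.\<close>

lemma bump_exists:
  assumes "open W" "p \<in> W"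
  shows "\<exists>\<beta>\<in>\<C>. \<beta> p = 1 \<and> (\<forall>q. q \<notin> W \<longrightarrow> \<beta> q = 0)"
proof -
  obtain U \<phi> where c: "(U, \<phi>) \<in> A" "p \<in> U" using chart_cover by blast
  have "open (\<phi> ` (U \<inter> W))" by (rule chart_image_open[OF c(1) assms(1)])
  then obtain t where t: "t > 0" "ball (\<phi> p) t \<subseteq> \<phi> ` (U \<inter> W)"
    using c(2) assms(2) by (rule_tac openE) auto
  obtain h :: "'e \<Rightarrow> real" where h: "smooth_on UNIV h" "\<forall>x. norm (x - \<phi> p) \<le> t / 3 \<longrightarrow> h x = 1"
    "\<forall>x. norm (x - \<phi> p) \<ge> t / 2 \<longrightarrow> h x = 0"
    using bump_function[OF basis, of "t / 3" "t / 2" "\<phi> p"] t(1) by auto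
  let ?\<beta> = "\<lambda>q. if q \<in> U then h (\<phi> q) * 1 else 0"
  have "?\<beta> \<in> \<C>"
  proof (rule extend_by_bump[OF c(1)])
    show "t / 2 < t" using t by simp
    show "ball (\<phi> p) t \<subseteq> \<phi> ` U" using t by auto
  qed (use h in auto)
  moreover have "?\<beta> p = 1" using h t c by simp
  moreover have "?\<beta> q = 0" if "q \<notin> W" for q
  proof (cases "q \<in> U")
    case True
    have "\<phi> q \<notin> ball (\<phi> p) t"
    proof
      assume "\<phi> q \<in> ball (\<phi> p) t"
      then obtain q' where "q' \<in> U" "q' \<in> W" "\<phi> q = \<phi> q'" using t(2) by blast
      then show False using chart(3)[OF c(1)] True that by (auto dest: inj_onD)
    qed
    then have "norm (\<phi> q - \<phi> p) \<ge> t / 2" using t(1) by (simp add: dist_norm norm_minus_commute)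
    then show ?thesis using h(3) by simp
  qed simp
  ultimately show ?thesis by (intro bexI[of _ ?\<beta>]) auto
qed

subsection \<open>Tangent vectors and vector fields\<close>

lemma tangentD:
  assumes "v \<in> tangent_space A p" "f \<in> \<C>" "g \<in> \<C>"
  shows "v (\<lambda>x. f x + g x) = v f + v g" "v (\<lambda>x. f x * g x) = f p * v g + g p * v f"
    "v (\<lambda>x. c * f x) = c * v f"
  using assms by (auto simp: tangent_space_def)

lemma tangent_outside: "v \<in> tangent_space A p \<Longrightarrow> f \<notin> \<C> \<Longrightarrow> v f = 0"
  by (auto simp: tangent_space_def)

lemma tangent_const: 
  assumes "v \<in> tangent_space A p"
  shows "v (\<lambda>x. c) = 0"
proof -
  have "v (\<lambda>x. 1 * 1) = 1 * v (\<lambda>x. 1) + 1 * v (\<lambda>x. 1)"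
    by (rule tangentD(2)[OF assms smooth_funs_const smooth_funs_const])
  then have "v (\<lambda>x. 1) = 0" by simp
  then show ?thesis using tangentD(3)[OF assms smooth_funs_const[of 1] smooth_funs_const[of 1], of c] by simp
qed

lemma tangent_minus: "v \<in> tangent_space A p \<Longrightarrow> f \<in> \<C> \<Longrightarrow> v (\<lambda>x. - f x) = - v f"
  using tangentD(3)[of v p f f "-1"] by simp

lemma tangent_diff:
  "v \<in> tangent_space A p \<Longrightarrow> f \<in> \<C> \<Longrightarrow> g \<in> \<C> \<Longrightarrow> v (\<lambda>x. f x - g x) = v f - v g"
  using tangentD(1)[of v p f "\<lambda>x. - g x"] by (simp add: tangent_minus smooth_funs_minus)

lemma tangent_sum:
  assumes "v \<in> tangent_space A p" "\<And>i. i \<in> I \<Longrightarrow> f i \<in> \<C>"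
  shows "v (\<lambda>x. \<Sum>i\<in>I. f i x) = (\<Sum>i\<in>I. v (f i))"
  using assms(2)
proof (induction I rule: infinite_finite_induct)
  case (insert i I)
  then show ?case by (simp add: tangentD(1)[OF assms(1)] smooth_funs_sum)
qed (simp_all add: tangent_const[OF assms(1)])

text \<open>For a bump \<beta> at \<open>p\<close> vanishing off \<open>W\<close>, the product
  \<beta> (f - g) is identically zero, and the product rule at \<open>p\<close> reduces its
  derivative to that of f - g.\<close>

lemma tangent_local:
  assumes v: "v \<in> tangent_space A p" and f: "f \<in> \<C>" "g \<in> \<C>"
    and W: "open W" "p \<in> W" "\<And>q. q \<in> W \<Longrightarrow> f q = g q"
  shows "v f = v g"
proof -
  obtain \<beta> where b: "\<beta> \<in> \<C>" "\<beta> p = 1" "\<And>q. q \<notin> W \<Longrightarrow> \<beta> q = 0"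
    using bump_exists[OF W(1,2)] by blast
  have d: "(\<lambda>x. f x - g x) \<in> \<C>" by (intro smooth_funs_diff f open_UNIV)
  have "(\<lambda>x. \<beta> x * (f x - g x)) = (\<lambda>x. 0)" using b W by (metis diff_self mult_eq_0_iff)
  then have "v (\<lambda>x. \<beta> x * (f x - g x)) = 0" using tangent_const[OF v] by simp
  then have "v (\<lambda>x. f x - g x) = 0" using tangentD(2)[OF v b(1) d] b(2) W by simp
  then show ?thesis using tangent_diff[OF v f] by simp
qed

lemma vector_fieldI:
  "(\<And>p. X p \<in> tangent_space A p) \<Longrightarrow> (\<And>f. f \<in> \<C> \<Longrightarrow> (\<lambda>p. X p f) \<in> \<C>) \<Longrightarrow> X \<in> vector_fields A"
  by (simp add: tangent_bundle_def)

lemma vector_field_tangent: "X \<in> vector_fields A \<Longrightarrow> X p \<in> tangent_space A p"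
  and vector_field_smooth: "X \<in> vector_fields A \<Longrightarrow> f \<in> \<C> \<Longrightarrow> (\<lambda>p. X p f) \<in> \<C>"
  by (simp_all add: tangent_bundle_def)

text \<open>Coordinates and coordinate fields after cutting off: both are globally smooth, so
  derivations and forms can be applied to them, while duality and spanning are claimed only on
  \<open>U\<close>.\<close>

definition chart_frame :: "'a set \<Rightarrow> (nat \<Rightarrow> 'a \<Rightarrow> real) \<Rightarrow> (nat \<Rightarrow> 'a \<Rightarrow> 'a tvec) \<Rightarrow> bool"
  where "chart_frame U x E \<longleftrightarrow> open U \<and>
    (\<forall>i<mdim. x i \<in> \<C> \<and> E i \<in> vector_fields A) \<and>
    (\<forall>q\<in>U. \<forall>i<mdim. \<forall>j<mdim. E i q (x j) = (if i = j then 1 else 0)) \<and>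
    (\<forall>q\<in>U. \<forall>v\<in>tangent_space A q. v = (\<Sum>i<mdim. v (x i) *\<^sub>R E i q))"

lemma sum_fun_apply: "(\<Sum>i\<in>I. f i) x = (\<Sum>i\<in>I. f i x)"
  by (induction I rule: infinite_finite_induct) auto

text \<open>The chart coordinates and partial derivatives are multiplied by one bump function; where
  it equals 1 they are the genuine ones. Spanning is the Hadamard expansion at the point considered,
  fed to a derivation.\<close>

lemma chart_frame_exists: "\<exists>U x E. p \<in> U \<and> chart_frame U x E"
proof -
  obtain U \<phi> where c: "(U, \<phi>) \<in> A" "p \<in> U" using chart_cover by blast
  define J where "J = inv_into U \<phi>"
  have J: "J (\<phi> q) = q" if "q \<in> U" for q using c that by (simp add: J_def)
  define a where "a = \<phi> p"
  obtain t where t: "t > 0" "ball a t \<subseteq> \<phi> ` U"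
    using chart(2)[OF c(1)] c(2) unfolding a_def by (rule_tac openE) auto
  obtain h :: "'e \<Rightarrow> real" where h: "smooth_on UNIV h" "\<And>x. norm (x - a) \<le> t / 3 \<Longrightarrow> h x = 1"
    "\<And>x. norm (x - a) \<ge> t / 2 \<Longrightarrow> h x = 0"
    using bump_function[OF basis, of "t / 3" "t / 2" a] t(1) by auto
  have ext: "(\<lambda>q. if q \<in> U then h (\<phi> q) * g (\<phi> q) else 0) \<in> \<C>" if "smooth_on (ball a t) g" for g
    by (rule extend_by_bump[OF c(1) _ t(2) h(1) _ that, where s = "t / 2"]) (use t h in auto)
  define x where "x i q = (if q \<in> U then h (\<phi> q) * inner (\<phi> q) (basis_list ! i) else 0)" for i q
  \<comment> \<open>The inner case distinction sends nonsmooth functions to 0, as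
    \<open>tangent_space\<close> demands.\<close>
  define E where "E i q f = (if q \<in> U then h (\<phi> q) * (if f \<in> \<C> then
      frechet_derivative (\<lambda>y. f (J y)) (at (\<phi> q)) (basis_list ! i) else 0) else 0)" for i q f
  \<comment> \<open>The cut-off \<open>h\<close> is 1 here, so \<open>x\<close> and \<open>E\<close>
    are the true coordinates and partial derivatives.\<close>
  define W where "W = {q \<in> U. \<phi> q \<in> ball a (t / 3)}"
  have W: "open W" "p \<in> W" "W \<subseteq> U"
    unfolding W_def using chart_preimage_open[OF c(1) open_ball] c(2) t(1) by (simp_all add: a_def Collect_mono_iff subset_iff del: mem_ball)
  have sm: "smooth_on (\<phi> ` U) (\<lambda>y. f (J y))" if "f \<in> \<C>" for f
    using smooth_funsD[OF that c(1)] by (simp add: J_def)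
  have hd: "((\<lambda>y. f (J y)) has_derivative frechet_derivative (\<lambda>y. f (J y)) (at (\<phi> q))) (at (\<phi> q))"
    if "f \<in> \<C>" "q \<in> U" for f q
    using smooth_on_has_derivative[OF sm[OF that(1)]] that(2) by blast
  have x_C: "x i \<in> \<C>" for i
    unfolding x_def by (intro ext smooth_on_bounded_linear bounded_linear_inner_left) auto
  have E_T: "E i q \<in> tangent_space A q" for i q
  proof (cases "q \<in> U")
    case True
    have "frechet_derivative (\<lambda>y. f (J y) + g (J y)) (at (\<phi> q)) b =
        frechet_derivative (\<lambda>y. f (J y)) (at (\<phi> q)) b + frechet_derivative (\<lambda>y. g (J y)) (at (\<phi> q)) b"
      and "frechet_derivative (\<lambda>y. f (J y) * g (J y)) (at (\<phi> q)) b =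
        f q * frechet_derivative (\<lambda>y. g (J y)) (at (\<phi> q)) b + g q * frechet_derivative (\<lambda>y. f (J y)) (at (\<phi> q)) b"
      if f: "f \<in> \<C>" and g: "g \<in> \<C>" for f g b
    proof -
      show "frechet_derivative (\<lambda>y. f (J y) + g (J y)) (at (\<phi> q)) b =
        frechet_derivative (\<lambda>y. f (J y)) (at (\<phi> q)) b + frechet_derivative (\<lambda>y. g (J y)) (at (\<phi> q)) b"
        by (subst frechet_derivative_eqI[OF has_derivative_add[OF hd[OF f True] hd[OF g True]]]) simp
      show "frechet_derivative (\<lambda>y. f (J y) * g (J y)) (at (\<phi> q)) b =
        f q * frechet_derivative (\<lambda>y. g (J y)) (at (\<phi> q)) b + g q * frechet_derivative (\<lambda>y. f (J y)) (at (\<phi> q)) b"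
        by (subst frechet_derivative_eqI[OF has_derivative_mult[OF hd[OF f True] hd[OF g True]]])
           (simp add: J[OF True])
    qed
    moreover have "frechet_derivative (\<lambda>y. k * f (J y)) (at (\<phi> q)) b = k * frechet_derivative (\<lambda>y. f (J y)) (at (\<phi> q)) b"
      if f: "f \<in> \<C>" for f b k
      by (subst frechet_derivative_eqI[OF has_derivative_mult_right[OF hd[OF f True]]]) simp
    ultimately show ?thesis
      unfolding tangent_space_def using True
      by (auto simp: E_def smooth_funs_add smooth_funs_mult smooth_funs_const algebra_simps)
  next
    case False
    then show ?thesis by (auto simp: tangent_space_def E_def)
  qed
  have E_VF: "E i \<in> vector_fields A" for i
  proof (rule vector_fieldI[OF E_T])
    fix f assume f: "f \<in> \<C>"
    have "(\<lambda>q. if q \<in> U then h (\<phi> q) * (\<lambda>y. frechet_derivative (\<lambda>y. f (J y)) (at y) (basis_list ! i)) (\<phi> q) else 0) \<in> \<C>"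
      by (intro ext smooth_on_frechet_derivative smooth_on_subset[OF sm[OF f] t(2)])
    then show "(\<lambda>q. E i q f) \<in> \<C>" unfolding E_def if_P[OF f] .
  qed
  have Ex: "E i q (x j) = (if i = j then 1 else 0)" if "q \<in> W" "i < mdim" "j < mdim" for i j q
  proof -
    have q: "q \<in> U" "\<phi> q \<in> ball a (t / 3)" using that by (auto simp: W_def)
    then have h1: "h (\<phi> q) = 1" by (intro h(2)) (simp add: dist_norm norm_minus_commute)
    have "x j (J y) = inner y (basis_list ! j)" if y: "y \<in> ball a (t / 3)" for y
    proof -
      have "y \<in> \<phi> ` U" using t y by (auto intro: subsetD[OF t(2)])
      then obtain q' where "q' \<in> U" "y = \<phi> q'" by auto
      moreover have "h y = 1" using y by (intro h(2)) (simp add: dist_norm norm_minus_commute)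
      ultimately show ?thesis by (simp add: x_def J)
    qed
    then have "frechet_derivative (\<lambda>y. x j (J y)) (at (\<phi> q)) = frechet_derivative (\<lambda>y. inner y (basis_list ! j)) (at (\<phi> q))"
      by (intro frechet_derivative_cong_open[OF open_ball q(2)])
    also have "... = (\<lambda>v. inner v (basis_list ! j))"
      by (rule frechet_derivative_eqI) (auto intro!: derivative_eq_intros)
    finally show ?thesis using h1 q x_C inner_basis[OF that(2,3)] by (simp add: E_def)
  qed
  \<comment> \<open>Hadamard's lemma is centred at the image of \<open>q\<close>, not of
    \<open>p\<close>, and a second bump \<open>k\<close> extends its coefficients to the global
    functions \<open>G\<close>.\<close>
  have exp: "v f = (\<Sum>i<mdim. v (x i) * E i q f)" if q: "q \<in> W" and v: "v \<in> tangent_space A q" and f: "f \<in> \<C>" for q v f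
  proof -
    let ?y = "\<phi> q"
    have qU: "q \<in> U" "?y \<in> ball a (t / 3)" using q by (auto simp: W_def)
    obtain r where r: "r > 0" "ball ?y r \<subseteq> ball a (t / 3)" by (rule openE[OF open_ball qU(2)])
    have sub: "ball a (t / 3) \<subseteq> ball a t" using t(1) by (intro subset_ball) simp
    have "smooth_on (ball ?y r) (\<lambda>y. f (J y))"
      by (rule smooth_on_subset[OF sm[OF f]]) (use r sub t in blast)
    then obtain g where g: "\<And>b. smooth_on (ball ?y r) (g b)" "\<And>b. g b ?y = frechet_derivative (\<lambda>y. f (J y)) (at ?y) b"
      "\<And>y. y \<in> ball ?y r \<Longrightarrow> f (J y) = f (J ?y) + (\<Sum>b\<in>basis. inner (y - ?y) b * g b y)"
      using hadamard[OF basis _ r(1)] by blast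
    obtain k :: "'e \<Rightarrow> real" where k: "smooth_on UNIV k" "\<And>x. norm (x - ?y) \<le> r / 3 \<Longrightarrow> k x = 1"
      "\<And>x. norm (x - ?y) \<ge> r / 2 \<Longrightarrow> k x = 0"
      using bump_function[OF basis, of "r / 3" "r / 2" ?y] r(1) by auto
    define G where "G i q = (if q \<in> U then k (\<phi> q) * g (basis_list ! i) (\<phi> q) else 0)" for i q
    have G_C: "G i \<in> \<C>" for i
      unfolding G_def
      by (rule extend_by_bump[OF c(1) _ _ k(1) _ g(1), where s = "r / 2"]) (use r t sub k in auto)
    have G_q: "G i q = E i q f" for i
    proof -
      have "h ?y = 1" using qU(2) by (intro h(2)) (simp add: dist_norm norm_minus_commute)
      then show ?thesis using qU f g(2) k(2)[of ?y] r(1) by (simp add: G_def E_def)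
    qed
    have x_q: "x i q' = inner (\<phi> q') (basis_list ! i)" if "q' \<in> U" "\<phi> q' \<in> ball ?y r" for i q'
    proof -
      have "h (\<phi> q') = 1" using subsetD[OF r(2) that(2)] by (intro h(2)) (simp add: dist_norm norm_minus_commute)
      then show ?thesis using that by (simp add: x_def)
    qed
    have "v f = v (\<lambda>q'. f q + (\<Sum>i<mdim. (x i q' - x i q) * G i q'))"
    proof (rule tangent_local[OF v f])
      show "(\<lambda>q'. f q + (\<Sum>i<mdim. (x i q' - x i q) * G i q')) \<in> \<C>"
        by (intro smooth_funs_intros open_UNIV x_C G_C)
      show "open {q' \<in> U. \<phi> q' \<in> ball ?y (r / 3)}" by (rule chart_preimage_open[OF c(1) open_ball])
      show "q \<in> {q' \<in> U. \<phi> q' \<in> ball ?y (r / 3)}" using qU r by simp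
      fix q' assume "q' \<in> {q' \<in> U. \<phi> q' \<in> ball ?y (r / 3)}"
      then have q': "q' \<in> U" "dist ?y (\<phi> q') < r / 3" by auto
      then have q'r: "\<phi> q' \<in> ball ?y r" and k1: "k (\<phi> q') = 1"
        using r(1) by (auto intro!: k(2) simp: dist_norm norm_minus_commute)
      have "f q' = f q + (\<Sum>i<mdim. inner (\<phi> q' - ?y) (basis_list ! i) * g (basis_list ! i) (\<phi> q'))"
        using g(3)[OF q'r] q'(1) qU(1) by (simp add: J sum_basis)
      then show "f q' = f q + (\<Sum>i<mdim. (x i q' - x i q) * G i q')"
        using q'(1) k1 x_q[OF q'(1) q'r] x_q[OF qU(1)] r(1) by (simp add: G_def inner_diff_left)
    qed
    also have "... = (\<Sum>i<mdim. v (\<lambda>q'. (x i q' - x i q) * G i q'))"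
    proof -
      have "(\<lambda>q'. (x i q' - x i q) * G i q') \<in> \<C>" for i
        by (intro smooth_funs_intros open_UNIV x_C G_C)
      then show ?thesis
        by (simp add: tangentD(1)[OF v smooth_funs_const] smooth_funs_sum tangent_const[OF v] tangent_sum[OF v])
    qed
    also have "... = (\<Sum>i<mdim. v (x i) * E i q f)"
    proof (rule sum.cong[OF refl])
      fix i
      \<comment> \<open>The first factor vanishes at \<open>q\<close>, so the product rule leaves
        only the derivative of the coordinate.\<close>
      have "v (\<lambda>q'. (x i q' - x i q) * G i q') = (x i q - x i q) * v (G i) + G i q * v (\<lambda>q'. x i q' - x i q)"
        by (rule tangentD(2)[OF v]) (intro smooth_funs_intros open_UNIV x_C G_C)+
      also have "v (\<lambda>q'. x i q' - x i q) = v (x i)"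
        using tangent_diff[OF v x_C smooth_funs_const] by (simp add: tangent_const[OF v])
      finally show "v (\<lambda>q'. (x i q' - x i q) * G i q') = v (x i) * E i q f" by (simp add: G_q)
    qed
    finally show ?thesis .
  qed
  have exp': "v = (\<Sum>i<mdim. v (x i) *\<^sub>R E i q)" if q: "q \<in> W" and v: "v \<in> tangent_space A q" for q v
  proof
    fix f
    show "v f = (\<Sum>i<mdim. v (x i) *\<^sub>R E i q) f"
    proof (cases "f \<in> \<C>")
      case True
      then show ?thesis using exp[OF q v] by (simp add: sum_fun_apply scaleR_fun_def)
    next
      case False
      then show ?thesis using tangent_outside[OF v] tangent_outside[OF E_T] by (simp add: sum_fun_apply scaleR_fun_def)
    qed
  qed
  have "chart_frame W x E"
    unfolding chart_frame_def
    by (intro conjI ballI allI impI) (rule W(1) x_C E_VF | rule Ex exp', assumption+)+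
  then show ?thesis using W(2) by blast
qed

end

subsection \<open>Alternating maps\<close>

lemma length_delete_nth: "i < length xs \<Longrightarrow> length (delete_nth i xs) = length xs - 1"
  by (simp add: delete_nth_def)

lemma set_delete_nth: "set (delete_nth i xs) \<subseteq> set xs"
  unfolding delete_nth_def using set_take_subset[of i xs] set_drop_subset[of "Suc i" xs] by auto

lemma nth_delete_nth:
  assumes "i < length xs" "j < length xs - 1"
  shows "delete_nth i xs ! j = xs ! (if j < i then j else Suc j)"
proof (cases "j < i")
  case True
  then show ?thesis using assms by (simp add: delete_nth_def nth_append)
next
  case False
  have "length (take i xs) = i" using assms by simp
  then have "delete_nth i xs ! j = drop (Suc i) xs ! (j - i)"
    using False by (simp only: delete_nth_def nth_append if_False)
  also have "... = xs ! (Suc i + (j - i))" using assms by (intro nth_drop) simp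
  also have "Suc i + (j - i) = Suc j" using False by simp
  finally show ?thesis using False by simp
qed

lemma map_delete_nth: "map f (delete_nth i xs) = delete_nth i (map f xs)"
  by (simp add: delete_nth_def take_map drop_map)

lemma delete_nth_0 [simp]: "delete_nth 0 (x # xs) = xs"
  and delete_nth_Suc [simp]: "delete_nth (Suc i) (x # xs) = x # delete_nth i xs"
  by (simp_all add: delete_nth_def)

lemma set_update_subset: "set vs \<subseteq> V \<Longrightarrow> u \<in> V \<Longrightarrow> set (vs[i := u]) \<subseteq> V"
  using set_update_subset_insert[of vs i u] by auto

lemma alt_outside:
  assumes "\<omega> \<in> alt_maps k V" "\<not> (length vs = k \<and> set vs \<subseteq> V)"
  shows "\<omega> vs = 0"
proof -
  have "\<forall>vs. \<not> (length vs = k \<and> set vs \<subseteq> V) \<longrightarrow> \<omega> vs = 0"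
    using assms(1) unfolding alt_maps_def mem_Collect_eq by (rule conjunct2)
  then show ?thesis using assms(2) by (elim allE impE)
qed

lemma alt_add:
  "\<omega> \<in> alt_maps k V \<Longrightarrow> length vs = k \<Longrightarrow> set vs \<subseteq> V \<Longrightarrow> i < k \<Longrightarrow> u \<in> V \<Longrightarrow> w \<in> V \<Longrightarrow>
    \<omega> (vs[i := u + w]) = \<omega> (vs[i := u]) + \<omega> (vs[i := w])"
  unfolding alt_maps_def by blast

lemma alt_scale:
  "\<omega> \<in> alt_maps k V \<Longrightarrow> length vs = k \<Longrightarrow> set vs \<subseteq> V \<Longrightarrow> i < k \<Longrightarrow> u \<in> V \<Longrightarrow>
    \<omega> (vs[i := c *\<^sub>R u]) = c * \<omega> (vs[i := u])"
  unfolding alt_maps_def by blast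

lemma alt_eq_0:
  assumes "\<omega> \<in> alt_maps k V" "length vs = k" "set vs \<subseteq> V" "i < k" "j < k" "i \<noteq> j" "vs ! i = vs ! j"
  shows "\<omega> vs = 0"
proof (cases "j < i")
  case True
  then show ?thesis using assms unfolding alt_maps_def by blast
next
  case False
  then have "i < j" using assms by simp
  then show ?thesis using assms(1-3,5) assms(7)[symmetric] unfolding alt_maps_def by blast
qed

lemma alt_mapsI:
  assumes "\<And>vs. \<not> (length vs = k \<and> set vs \<subseteq> V) \<Longrightarrow> \<omega> vs = 0"
    and "\<And>vs i u w. length vs = k \<Longrightarrow> set vs \<subseteq> V \<Longrightarrow> i < k \<Longrightarrow> u \<in> V \<Longrightarrow> w \<in> V \<Longrightarrow>
      \<omega> (vs[i := u + w]) = \<omega> (vs[i := u]) + \<omega> (vs[i := w])"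
    and "\<And>vs i u c. length vs = k \<Longrightarrow> set vs \<subseteq> V \<Longrightarrow> i < k \<Longrightarrow> u \<in> V \<Longrightarrow>
      \<omega> (vs[i := c *\<^sub>R u]) = c * \<omega> (vs[i := u])"
    and "\<And>vs i j. length vs = k \<Longrightarrow> set vs \<subseteq> V \<Longrightarrow> j < i \<Longrightarrow> i < k \<Longrightarrow> vs ! i = vs ! j \<Longrightarrow> \<omega> vs = 0"
  shows "\<omega> \<in> alt_maps k V"
  unfolding alt_maps_def using assms by simp

lemma subspace_alt_maps: "subspace (alt_maps k V)"
  unfolding subspace_def
proof (intro conjI ballI allI)
  show "0 \<in> alt_maps k V" by (rule alt_mapsI) simp_all
next
  fix \<omega> \<eta> assume a: "\<omega> \<in> alt_maps k V" "\<eta> \<in> alt_maps k V"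
  show "\<omega> + \<eta> \<in> alt_maps k V"
  proof (rule alt_mapsI)
    fix vs i j assume "length vs = k" "set vs \<subseteq> V" "j < i" "i < k" "vs ! i = vs ! j"
    then show "(\<omega> + \<eta>) vs = 0"
      using alt_eq_0[OF a(1), of vs i j] alt_eq_0[OF a(2), of vs i j] by simp
  qed (simp_all add: alt_outside[OF a(1)] alt_outside[OF a(2)] alt_add[OF a(1)] alt_add[OF a(2)]
          alt_scale[OF a(1)] alt_scale[OF a(2)] algebra_simps)
next
  fix c :: real and \<omega> assume a: "\<omega> \<in> alt_maps k V"
  show "c *\<^sub>R \<omega> \<in> alt_maps k V"
  proof (rule alt_mapsI)
    fix vs i j assume "length vs = k" "set vs \<subseteq> V" "j < i" "i < k" "vs ! i = vs ! j"
    then show "(c *\<^sub>R \<omega>) vs = 0"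
      using alt_eq_0[OF a, of vs i j] by (simp add: scaleR_fun_def)
  qed (simp_all add: scaleR_fun_def alt_outside[OF a] alt_add[OF a] alt_scale[OF a] algebra_simps)
qed

lemma alt_sum:
  assumes a: "\<omega> \<in> alt_maps k V" and V: "subspace V"
    and vs: "length vs = k" "set vs \<subseteq> V" "i < k" and b: "\<And>m. m \<in> S \<Longrightarrow> b m \<in> V"
  shows "\<omega> (vs[i := (\<Sum>m\<in>S. c m *\<^sub>R b m)]) = (\<Sum>m\<in>S. c m * \<omega> (vs[i := b m]))"
  using b
proof (induction S rule: infinite_finite_induct)
  case (infinite S)
  then show ?case using alt_scale[OF a vs subspace_0[OF V], of 0] by simp
next
  case empty
  then show ?case using alt_scale[OF a vs subspace_0[OF V], of 0] by simp
next
  case (insert m S)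
  have "(\<Sum>m\<in>S. c m *\<^sub>R b m) \<in> V" by (intro subspace_sum subspace_scale V) (simp add: insert)
  moreover have "c m *\<^sub>R b m \<in> V" by (intro subspace_scale V) (simp add: insert)
  ultimately show ?case using insert by (simp add: alt_add[OF a vs] alt_scale[OF a vs])
qed

lemma alt_swap:
  assumes a: "\<omega> \<in> alt_maps k V" and V: "subspace V"
    and vs: "length vs = k" "set vs \<subseteq> V" "i < k" "j < k" "i \<noteq> j" and u: "u \<in> V" "w \<in> V"
  shows "\<omega> (vs[i := u, j := w]) = - \<omega> (vs[i := w, j := u])"
proof -
  note up = set_update_subset[OF vs(2)]
  have s: "u + w \<in> V" using u V by (simp add: subspace_add)
  have e: "\<omega> (vs[i := z, j := z]) = 0" if "z \<in> V" for z
    by (rule alt_eq_0[OF a, of _ i j]) (use vs that in \<open>simp_all add: nth_list_update set_update_subset\<close>)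
  have "0 = \<omega> (vs[i := u + w, j := u + w])" by (rule e[OF s, symmetric])
  also have "... = \<omega> (vs[i := u + w, j := u]) + \<omega> (vs[i := u + w, j := w])"
    by (rule alt_add[OF a]) (use vs u up[OF s] in auto)
  also have "\<omega> (vs[i := u + w, j := u]) = \<omega> (vs[j := u, i := u]) + \<omega> (vs[j := u, i := w])"
    unfolding list_update_swap[OF vs(5)] by (rule alt_add[OF a]) (use vs u up in auto)
  also have "\<omega> (vs[i := u + w, j := w]) = \<omega> (vs[j := w, i := u]) + \<omega> (vs[j := w, i := w])"
    unfolding list_update_swap[OF vs(5)] by (rule alt_add[OF a]) (use vs u up in auto)
  finally show ?thesis
    using e[OF u(1)] e[OF u(2)] by (simp add: list_update_swap[OF vs(5)])
qed

lemma alt_swap_nth: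
  assumes "\<omega> \<in> alt_maps k V" "subspace V" "length vs = k" "set vs \<subseteq> V" "i < k" "j < k" "i \<noteq> j"
  shows "\<omega> (vs[i := vs ! j, j := vs ! i]) = - \<omega> vs"
proof -
  have "vs ! i \<in> V" "vs ! j \<in> V" using assms by auto
  from alt_swap[OF assms this(2,1)] show ?thesis using assms by simp
qed

text \<open>Moving an argument from slot j to the front costs j transpositions, one per induction
  step. This is the source of the alternating signs in contractions, in \<open>d_wedge\<close> and
  in the exterior derivative.\<close>

lemma alt_rotate:
  assumes a: "\<omega> \<in> alt_maps k V" and V: "subspace V"
    and vs: "length vs = k" "set vs \<subseteq> V" "j < k" and v: "v \<in> V"
  shows "\<omega> (v # delete_nth j vs) = (-1) ^ j * \<omega> (vs[j := v])"
  using vs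
proof (induction j arbitrary: vs)
  case 0
  then show ?case by (cases vs) auto
next
  case (Suc j)
  \<comment> \<open>Copying entry j into slot j + 1 makes deletion at j give the list that deletion
    at j + 1 gives for \<open>vs\<close>.\<close>
  let ?ws = "vs[Suc j := vs ! j]"
  have vj: "vs ! j \<in> V" using Suc.prems by auto
  have d: "delete_nth (Suc j) vs = delete_nth j ?ws"
    using Suc.prems by (intro nth_equalityI) (auto simp: length_delete_nth nth_delete_nth nth_list_update)
  have "\<omega> (v # delete_nth (Suc j) vs) = (-1) ^ j * \<omega> (?ws[j := v])"
    unfolding d by (rule Suc.IH) (use Suc.prems vj in \<open>simp_all add: set_update_subset\<close>)
  also have "\<omega> (?ws[j := v]) = - \<omega> (vs[Suc j := v, j := vs ! j])"
    by (rule alt_swap[OF a V]) (use Suc.prems v vj in auto)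
  also have "vs[Suc j := v, j := vs ! j] = vs[Suc j := v]"
    using Suc.prems by (intro nth_equalityI) (auto simp: nth_list_update)
  finally show ?case by simp
qed

lemma alt_interior:
  assumes a: "\<omega> \<in> alt_maps (Suc k) V" and v: "v \<in> V"
  shows "(\<lambda>vs. \<omega> (v # vs)) \<in> alt_maps k V"
proof (rule alt_mapsI)
  fix vs assume "\<not> (length vs = k \<and> set vs \<subseteq> V)"
  then show "\<omega> (v # vs) = 0" using v by (intro alt_outside[OF a]) auto
next
  fix vs i u w assume "length vs = k" "set vs \<subseteq> V" "i < k" "u \<in> V" "w \<in> V"
  then show "\<omega> (v # vs[i := u + w]) = \<omega> (v # vs[i := u]) + \<omega> (v # vs[i := w])"
    using alt_add[OF a, of "v # vs" "Suc i" u w] v by simp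
next
  fix vs i u c assume "length vs = k" "set vs \<subseteq> V" "i < k" "u \<in> V"
  then show "\<omega> (v # vs[i := c *\<^sub>R u]) = c * \<omega> (v # vs[i := u])"
    using alt_scale[OF a, of "v # vs" "Suc i" u c] v by simp
next
  fix vs i j assume "length vs = k" "set vs \<subseteq> V" "j < i" "i < k" "vs ! i = vs ! j"
  then show "\<omega> (v # vs) = 0"
    using v by (intro alt_eq_0[OF a, of _ "Suc i" "Suc j"]) auto
qed

text \<open>\<open>alt_eq_0_on_basis\<close> asks only whether a value vanishes, so the sign of the
  permutation is not tracked.\<close>

lemma alt_permute_eq_0:
  assumes a: "\<omega> \<in> alt_maps k V" and V: "subspace V" and p: "p permutes {..<k}"
    and vs: "length vs = k" "set vs \<subseteq> V"
  shows "\<omega> (permute_list p vs) = 0 \<longleftrightarrow> \<omega> vs = 0"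
proof -
  have "\<forall>vs. length vs = k \<longrightarrow> set vs \<subseteq> V \<longrightarrow> (\<omega> (permute_list p vs) = 0 \<longleftrightarrow> \<omega> vs = 0)"
    using p finite_lessThan
  proof (induction p rule: permutes_induct)
    case id
    then show ?case by simp
  next
    case (swap a' b p)
    show ?case
    proof (intro allI impI)
      fix vs assume vs: "length vs = k" "set vs \<subseteq> V"
      let ?ws = "permute_list (Transposition.transpose a' b) vs"
      have tp: "Transposition.transpose a' b permutes {..<k}"
        using swap by (intro permutes_swap_id) auto
      have ws: "?ws = vs[a' := vs ! b, b := vs ! a']"
        using swap vs tp
        by (intro nth_equalityI) (auto simp: permute_list_nth nth_list_update transpose_def)
      have "permute_list (Transposition.transpose a' b \<circ> p) vs = permute_list p ?ws"
        using swap vs by (intro permute_list_compose) simp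
      moreover have "\<omega> (permute_list p ?ws) = 0 \<longleftrightarrow> \<omega> ?ws = 0"
        using swap.IH vs tp by simp
      moreover have "\<omega> ?ws = - \<omega> vs"
        unfolding ws using swap vs by (intro alt_swap_nth[OF a V]) auto
      ultimately show "\<omega> (permute_list (Transposition.transpose a' b \<circ> p) vs) = 0 \<longleftrightarrow> \<omega> vs = 0"
        by simp
    qed
  qed
  then show ?thesis using vs by blast
qed

definition increasing :: "nat \<Rightarrow> nat \<Rightarrow> nat list set"
  where "increasing d k = {J. length J = k \<and> set J \<subseteq> {..<d} \<and> sorted_wrt (<) J}"

lemma finite_increasing: "finite (increasing d k)"
  by (rule finite_subset[OF _ finite_lists_length_eq[of "{..<d}" k]]) (auto simp: increasing_def)

text \<open>A list of indices either has a repetition, giving 0, or is a permutation of an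
  increasing list. General arguments reduce to such lists by expanding one slot at a time.\<close>

lemma alt_eq_0_on_basis:
  assumes a: "\<omega> \<in> alt_maps k V" and V: "subspace V"
    and b: "\<And>i. i < d \<Longrightarrow> b i \<in> V" "\<And>v. v \<in> V \<Longrightarrow> \<exists>c. v = (\<Sum>i<d. c i *\<^sub>R b i)"
    and z: "\<And>J. J \<in> increasing d k \<Longrightarrow> \<omega> (map b J) = 0"
  shows "\<omega> vs = 0"
proof -
  have basis: "\<omega> (map b J) = 0" if J: "length J = k" "set J \<subseteq> {..<d}" for J
  proof (cases "distinct J")
    case False
    then obtain i j where "i < k" "j < k" "i \<noteq> j" "J ! i = J ! j"
      using J(1) by (auto simp: distinct_conv_nth)
    then show ?thesis using J b(1) by (intro alt_eq_0[OF a, of _ i j]) auto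
  next
    case True
    have "sort J \<in> increasing d k"
      using True J by (simp add: increasing_def strict_sorted_iff)
    then have zz: "\<omega> (map b (sort J)) = 0" by (rule z)
    have "mset (map b J) = mset (map b (sort J))" by simp
    then obtain p where p: "p permutes {..<length (map b (sort J))}"
      "permute_list p (map b (sort J)) = map b J"
      by (rule mset_eq_permutation)
    have "\<omega> (permute_list p (map b (sort J))) = 0 \<longleftrightarrow> \<omega> (map b (sort J)) = 0"
      using J b(1) p(1) by (intro alt_permute_eq_0[OF a V]) auto
    then show ?thesis using zz p(2) by simp
  qed
  \<comment> \<open>\<open>m\<close> counts the leading slots that still hold arbitrary vectors; all
    later slots hold members of the spanning family.\<close>
  have "\<omega> vs = 0" if "m \<le> k" "length vs = k" "set vs \<subseteq> V" "\<And>i. m \<le> i \<Longrightarrow> i < k \<Longrightarrow> vs ! i \<in> b ` {..<d}" for m vs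
    using that
  proof (induction m arbitrary: vs)
    case 0
    then have "\<forall>i<k. \<exists>j. vs ! i = b j \<and> j < d" by auto
    then obtain f where f: "\<And>i. i < k \<Longrightarrow> vs ! i = b (f i) \<and> f i < d" by metis
    have "vs = map b (map f [0..<k])"
      using f 0 by (intro nth_equalityI) auto
    then show ?case using f by (simp only:) (intro basis, auto)
  next
    case (Suc m)
    have "vs ! m \<in> V" using Suc.prems by auto
    then obtain c where c: "vs ! m = (\<Sum>i<d. c i *\<^sub>R b i)" using b(2) by blast
    have "\<omega> vs = \<omega> (vs[m := (\<Sum>i<d. c i *\<^sub>R b i)])" using c by (metis list_update_id)
    also have "... = (\<Sum>i<d. c i * \<omega> (vs[m := b i]))"
      using Suc.prems b(1) by (intro alt_sum[OF a V]) auto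
    also have "... = 0"
    proof (rule sum.neutral, rule ballI)
      fix i assume i: "i \<in> {..<d}"
      have "\<omega> (vs[m := b i]) = 0"
      proof (rule Suc.IH)
        show "set (vs[m := b i]) \<subseteq> V" using i Suc.prems b(1) by (intro set_update_subset) auto
        show "vs[m := b i] ! l \<in> b ` {..<d}" if "m \<le> l" "l < k" for l
          using Suc.prems that i by (cases "l = m") auto
      qed (use Suc.prems in auto)
      then show "c i * \<omega> (vs[m := b i]) = 0" by simp
    qed
    finally show ?case .
  qed
  from this[of k vs] show ?thesis using alt_outside[OF a] by force
qed

lemma alt_ext_basis:
  assumes a: "\<omega> \<in> alt_maps k V" "\<eta> \<in> alt_maps k V" and V: "subspace V"
    and b: "\<And>i. i < d \<Longrightarrow> b i \<in> V" "\<And>v. v \<in> V \<Longrightarrow> \<exists>c. v = (\<Sum>i<d. c i *\<^sub>R b i)"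
    and z: "\<And>J. J \<in> increasing d k \<Longrightarrow> \<omega> (map b J) = \<eta> (map b J)"
  shows "\<omega> = \<eta>"
proof
  fix vs
  have "\<omega> - \<eta> \<in> alt_maps k V" by (intro subspace_diff subspace_alt_maps a)
  from alt_eq_0_on_basis[OF this V b, of vs] z show "\<omega> vs = \<eta> vs" by simp
qed

subsection \<open>Exterior products\<close>

lemma alt_maps_1_add: "\<xi> \<in> alt_maps 1 V \<Longrightarrow> u \<in> V \<Longrightarrow> w \<in> V \<Longrightarrow> \<xi> [u + w] = \<xi> [u] + \<xi> [w]"
  using alt_add[of \<xi> 1 V "[u]" 0 u w] by simp

lemma alt_maps_1_scale: "\<xi> \<in> alt_maps 1 V \<Longrightarrow> u \<in> V \<Longrightarrow> \<xi> [c *\<^sub>R u] = c * \<xi> [u]"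
  using alt_scale[of \<xi> 1 V "[u]" 0 u c] by simp

lemma cotangent_space_eq: "cotangent_space A p = alt_maps 1 (tangent_space A p)"
  by (simp add: form_bundle_def)

lemma wedge_outside: "\<not> (length vs = length \<xi>s \<and> set vs \<subseteq> tangent_space A p) \<Longrightarrow> wedge A p \<xi>s vs = 0"
  by (auto simp: wedge_def)

text \<open>Makes Laplace expansion and the vanishing for equal rows or columns available for
  \<open>wedge\<close>.\<close>

lemma wedge_det:
  assumes "length \<xi>s = k" "length vs = k" "set vs \<subseteq> tangent_space A p"
  shows "wedge A p \<xi>s vs = Determinant.det (mat k k (\<lambda>(i, j). (\<xi>s ! i) [vs ! j]))"
proof -
  have "wedge A p \<xi>s vs = (\<Sum>\<sigma> | \<sigma> permutes {0..<k}. of_int (sign \<sigma>) * (\<Prod>i = 0..<k. (\<xi>s ! i) [vs ! \<sigma> i]))"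
    using assms by (simp add: wedge_def atLeast0LessThan)
  also have "... = (\<Sum>\<sigma> | \<sigma> permutes {0..<k}. of_int (sign \<sigma>) *
      (\<Prod>i = 0..<k. mat k k (\<lambda>(i, j). (\<xi>s ! i) [vs ! j]) $$ (i, \<sigma> i)))"
  proof (rule sum.cong[OF refl])
    fix \<sigma> assume "\<sigma> \<in> {\<sigma>. \<sigma> permutes {0..<k}}"
    then have "\<sigma> i < k" if "i < k" for i using that permutes_in_image[of \<sigma> "{0..<k}" i] by simp
    then have "(\<Prod>i = 0..<k. (\<xi>s ! i) [vs ! \<sigma> i]) =
        (\<Prod>i = 0..<k. mat k k (\<lambda>(i, j). (\<xi>s ! i) [vs ! j]) $$ (i, \<sigma> i))"
      by (intro prod.cong) auto
    then show "of_int (sign \<sigma>) * (\<Prod>i = 0..<k. (\<xi>s ! i) [vs ! \<sigma> i]) = of_int (sign \<sigma>) *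
        (\<Prod>i = 0..<k. mat k k (\<lambda>(i, j). (\<xi>s ! i) [vs ! j]) $$ (i, \<sigma> i))"
      by (simp only:)
  qed
  also have "... = Determinant.det (mat k k (\<lambda>(i, j). (\<xi>s ! i) [vs ! j]))"
    by (simp only: Determinant.det_def dim_row_mat dim_col_mat if_True simp_thms)
  finally show ?thesis .
qed

lemma wedge_alt:
  assumes \<xi>: "set \<xi>s \<subseteq> cotangent_space A p" and k: "length \<xi>s = k"
  shows "wedge A p \<xi>s \<in> alt_maps k (tangent_space A p)"
proof (rule alt_mapsI)
  let ?T = "tangent_space A p"
  \<comment> \<open>For each permutation exactly one factor involves slot i, namely the one at the
    preimage of i; linearity in the slot follows term by term.\<close>
  have prod_split: "(\<Prod>l<k. (\<xi>s ! l) [vs[i := u] ! \<sigma> l]) =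
      (\<xi>s ! Hilbert_Choice.inv \<sigma> i) [u] * (\<Prod>l\<in>{..<k} - {Hilbert_Choice.inv \<sigma> i}. (\<xi>s ! l) [vs ! \<sigma> l])"
    if "\<sigma> permutes {..<k}" "i < k" "length vs = k" for \<sigma> i vs u
  proof -
    have s: "Hilbert_Choice.inv \<sigma> i \<in> {..<k}" using permutes_in_image[OF permutes_inv[OF that(1)]] that(2) by simp
    have "(\<Prod>l\<in>{..<k} - {Hilbert_Choice.inv \<sigma> i}. (\<xi>s ! l) [vs[i := u] ! \<sigma> l]) = (\<Prod>l\<in>{..<k} - {Hilbert_Choice.inv \<sigma> i}. (\<xi>s ! l) [vs ! \<sigma> l])"
    proof (rule prod.cong[OF refl])
      fix l assume "l \<in> {..<k} - {Hilbert_Choice.inv \<sigma> i}"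
      then have "\<sigma> l \<noteq> i" using permutes_inverses(2)[OF that(1), of l] by auto
      then show "(\<xi>s ! l) [vs[i := u] ! \<sigma> l] = (\<xi>s ! l) [vs ! \<sigma> l]" by simp
    qed
    then show ?thesis
      using that permutes_inverses[OF that(1)] s by (subst prod.remove[of _ "Hilbert_Choice.inv \<sigma> i"]) auto
  qed
  have \<xi>_in: "\<xi>s ! Hilbert_Choice.inv \<sigma> i \<in> alt_maps 1 ?T" if "\<sigma> permutes {..<k}" "i < k" for \<sigma> i
  proof -
    have "Hilbert_Choice.inv \<sigma> i \<in> {..<k}" using permutes_in_image[OF permutes_inv[OF that(1)]] that(2) by simp
    then show ?thesis using \<xi> k nth_mem[of "Hilbert_Choice.inv \<sigma> i" \<xi>s] unfolding cotangent_space_eq by auto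
  qed
  {
    fix vs assume "\<not> (length vs = k \<and> set vs \<subseteq> ?T)"
    then show "wedge A p \<xi>s vs = 0" using k by (auto simp: wedge_def)
  next
    fix vs i u w assume v: "length vs = k" "set vs \<subseteq> ?T" "i < k" "u \<in> ?T" "w \<in> ?T"
    have "u + w \<in> ?T" by (rule subspace_add[OF subspace_tangent_space v(4,5)])
    then show "wedge A p \<xi>s (vs[i := u + w]) = wedge A p \<xi>s (vs[i := u]) + wedge A p \<xi>s (vs[i := w])"
      using k v set_update_subset[OF v(2)]
      by (simp add: wedge_def prod_split alt_maps_1_add[OF \<xi>_in] algebra_simps flip: sum.distrib)
  next
    fix vs i u c assume v: "length vs = k" "set vs \<subseteq> ?T" "i < k" "u \<in> ?T"
    have "c *\<^sub>R u \<in> ?T" by (rule subspace_scale[OF subspace_tangent_space v(4)])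
    then show "wedge A p \<xi>s (vs[i := c *\<^sub>R u]) = c * wedge A p \<xi>s (vs[i := u])"
      using k v set_update_subset[OF v(2)]
      by (simp add: wedge_def prod_split alt_maps_1_scale[OF \<xi>_in] mult_ac sum_distrib_left)
  next
    fix vs i j assume v: "length vs = k" "set vs \<subseteq> ?T" "j < i" "i < k" "vs ! i = vs ! j"
    then show "wedge A p \<xi>s vs = 0"
      unfolding wedge_det[OF k v(1,2)]
      by (intro Determinant.det_identical_columns[of _ k i j]) (auto intro!: eq_vecI)
  }
qed

text \<open>Outside lists of covectors \<open>wedge\<close> need not vanish, hence the case distinction.\<close>

lemma wedge_alt_covectors:
  assumes vs: "length vs = k" "set vs \<subseteq> tangent_space A p"
  shows "(\<lambda>\<xi>s. if length \<xi>s = k \<and> set \<xi>s \<subseteq> cotangent_space A p then wedge A p \<xi>s vs else 0)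
    \<in> alt_maps k (cotangent_space A p)" (is "?W \<in> _")
proof (rule alt_mapsI)
  let ?V = "cotangent_space A p"
  have V: "subspace ?V" unfolding cotangent_space_eq by (rule subspace_alt_maps)
  have prod_split: "(\<Prod>l<k. (\<xi>s[i := \<eta>] ! l) [vs ! \<sigma> l]) = \<eta> [vs ! \<sigma> i] * (\<Prod>l\<in>{..<k} - {i}. (\<xi>s ! l) [vs ! \<sigma> l])"
    if "i < k" "length \<xi>s = k" for \<sigma> i \<xi>s \<eta>
    using that by (subst prod.remove[of _ i]) auto
  {
    fix \<xi>s i \<eta> \<zeta> assume v: "length \<xi>s = k" "set \<xi>s \<subseteq> ?V" "i < k" "\<eta> \<in> ?V" "\<zeta> \<in> ?V"
    have "\<eta> + \<zeta> \<in> ?V" using v V by (simp add: subspace_add)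
    then show "?W (\<xi>s[i := \<eta> + \<zeta>]) = ?W (\<xi>s[i := \<eta>]) + ?W (\<xi>s[i := \<zeta>])"
      using v vs set_update_subset[OF v(2)]
      by (simp add: wedge_def prod_split algebra_simps flip: sum.distrib)
  next
    fix \<xi>s i \<eta> c assume v: "length \<xi>s = k" "set \<xi>s \<subseteq> ?V" "i < k" "\<eta> \<in> ?V"
    have "c *\<^sub>R \<eta> \<in> ?V" using v V by (simp add: subspace_scale)
    then show "?W (\<xi>s[i := c *\<^sub>R \<eta>]) = c * ?W (\<xi>s[i := \<eta>])"
      using v vs set_update_subset[OF v(2)]
      by (simp add: wedge_def prod_split scaleR_fun_def mult_ac sum_distrib_left)
  next
    fix \<xi>s i j assume v: "length \<xi>s = k" "set \<xi>s \<subseteq> ?V" "j < i" "i < k" "\<xi>s ! i = \<xi>s ! j"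
    then have "wedge A p \<xi>s vs = 0"
      unfolding wedge_det[OF v(1) vs]
      by (intro Determinant.det_identical_rows[of _ k i j]) (auto intro!: eq_vecI)
    then show "?W \<xi>s = 0" by simp
  }
qed auto

text \<open>Laplace expansion along the first row. It is the model for
  \<open>covector_wedge\<close>.\<close>

lemma wedge_Cons:
  assumes "length \<xi>s = k" "length vs = Suc k" "set vs \<subseteq> tangent_space A p"
  shows "wedge A p (\<xi> # \<xi>s) vs = (\<Sum>i\<le>k. (-1) ^ i * \<xi> [vs ! i] * wedge A p \<xi>s (delete_nth i vs))"
proof -
  let ?M = "mat (Suc k) (Suc k) (\<lambda>(i, j). ((\<xi> # \<xi>s) ! i) [vs ! j])"
  have "wedge A p (\<xi> # \<xi>s) vs = Determinant.det ?M"
    using assms by (intro wedge_det) auto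
  also have "... = (\<Sum>j<Suc k. ?M $$ (0, j) * cofactor ?M 0 j)"
    by (rule laplace_expansion_row) auto
  also have "... = (\<Sum>i\<le>k. (-1) ^ i * \<xi> [vs ! i] * wedge A p \<xi>s (delete_nth i vs))"
  proof (rule sum.cong)
    fix j assume "j \<in> {..k}"
    then have j: "j \<le> k" by simp
    have "wedge A p \<xi>s (delete_nth j vs) = Determinant.det (mat k k (\<lambda>(i, l). (\<xi>s ! i) [delete_nth j vs ! l]))"
      using assms j set_delete_nth[of j vs] by (intro wedge_det) (auto simp: length_delete_nth)
    also have "mat k k (\<lambda>(i, l). (\<xi>s ! i) [delete_nth j vs ! l]) = mat_delete ?M 0 j"
      using assms j by (auto simp: mat_delete_def nth_delete_nth intro!: eq_matI)
    finally show "?M $$ (0, j) * cofactor ?M 0 j = (-1) ^ j * \<xi> [vs ! j] * wedge A p \<xi>s (delete_nth j vs)"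
      using j by (simp add: cofactor_def)
  qed auto
  finally show ?thesis .
qed

text \<open>Laplace expansion along the first column: the contraction of a wedge is a signed sum of
  shorter wedges.\<close>

lemma wedge_interior:
  assumes "length \<xi>s = Suc k" "length vs = k" "set vs \<subseteq> tangent_space A p" "v \<in> tangent_space A p"
  shows "wedge A p \<xi>s (v # vs) = (\<Sum>i\<le>k. (-1) ^ i * (\<xi>s ! i) [v] * wedge A p (delete_nth i \<xi>s) vs)"
proof -
  let ?M = "mat (Suc k) (Suc k) (\<lambda>(i, j). (\<xi>s ! i) [(v # vs) ! j])"
  have "wedge A p \<xi>s (v # vs) = Determinant.det ?M"
    using assms by (intro wedge_det) auto
  also have "... = (\<Sum>i<Suc k. ?M $$ (i, 0) * cofactor ?M i 0)"
    by (rule laplace_expansion_column) auto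
  also have "... = (\<Sum>i\<le>k. (-1) ^ i * (\<xi>s ! i) [v] * wedge A p (delete_nth i \<xi>s) vs)"
  proof (rule sum.cong)
    fix i assume "i \<in> {..k}"
    then have i: "i \<le> k" by simp
    have "wedge A p (delete_nth i \<xi>s) vs = Determinant.det (mat k k (\<lambda>(l, j). (delete_nth i \<xi>s ! l) [vs ! j]))"
      using assms i by (intro wedge_det) (auto simp: length_delete_nth)
    also have "mat k k (\<lambda>(l, j). (delete_nth i \<xi>s ! l) [vs ! j]) = mat_delete ?M i 0"
      using assms i by (auto simp: mat_delete_def nth_delete_nth intro!: eq_matI)
    finally show "?M $$ (i, 0) * cofactor ?M i 0 = (-1) ^ i * (\<xi>s ! i) [v] * wedge A p (delete_nth i \<xi>s) vs"
      using i by (simp add: cofactor_def)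
  qed auto
  finally show ?thesis .
qed

text \<open>Each permutation contributes a product of Kronecker deltas, nonzero only if it carries
  \<open>J\<close> entrywise to \<open>K\<close>. Increasing lists with the same entries are equal,
  and then the permutation is the identity.\<close>

lemma wedge_dual_basis:
  assumes J: "J \<in> increasing d k" and K: "K \<in> increasing d k"
    and E: "\<And>i. i < d \<Longrightarrow> E i \<in> tangent_space A p"
    and dual: "\<And>i j. i < d \<Longrightarrow> j < d \<Longrightarrow> \<xi> j [E i] = (if i = j then 1 else 0)"
  shows "wedge A p (map \<xi> K) (map E J) = (if J = K then 1 else 0)"
proof -
  have J': "length J = k" "set J \<subseteq> {..<d}" "distinct J" "sorted J"
    using J by (auto simp: increasing_def strict_sorted_iff)
  have K': "length K = k" "set K \<subseteq> {..<d}" "distinct K" "sorted K"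
    using K by (auto simp: increasing_def strict_sorted_iff)
  have prod: "(\<Prod>i<k. (map \<xi> K ! i) [map E J ! \<sigma> i]) = (if J = K \<and> \<sigma> = id then 1 else 0)"
    if s: "\<sigma> permutes {..<k}" for \<sigma>
  proof -
    have s_in: "\<sigma> i < k" if "i < k" for i using permutes_in_image[OF s] that by auto
    have f: "(map \<xi> K ! i) [map E J ! \<sigma> i] = (if J ! \<sigma> i = K ! i then 1 else 0)" if "i < k" for i
    proof -
      have "K ! i < d" "J ! \<sigma> i < d"
        using that s_in[OF that] J'(1,2) K'(1,2) nth_mem[of i K] nth_mem[of "\<sigma> i" J]
        by (metis lessThan_iff subsetD)+
      then show ?thesis using that s_in[OF that] J'(1) K'(1) dual by simp
    qed
    show ?thesis
    proof (cases "\<forall>i<k. J ! \<sigma> i = K ! i")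
      case True
      have "set K \<subseteq> set J"
      proof
        fix x assume "x \<in> set K"
        then obtain i where "i < k" "x = K ! i" using K'(1) by (auto simp: in_set_conv_nth)
        then show "x \<in> set J" using True s_in J'(1) by (metis nth_mem)
      qed
      then have "set K = set J"
        using J' K' by (intro card_subset_eq) (auto simp: distinct_card)
      then have JK: "J = K" using J' K' sorted_distinct_set_unique by metis
      have "\<sigma> i = id i" for i
      proof (cases "i < k")
        case T: True
        then show ?thesis using True JK K'(3) s_in[OF T] nth_eq_iff_index_eq[OF K'(3), of "\<sigma> i" i] K'(1) by simp
      next
        case F: False
        then show ?thesis using s by (simp add: permutes_def)
      qed
      then have "\<sigma> = id" by (rule ext)
      moreover have "(\<Prod>i<k. (map \<xi> K ! i) [map E J ! \<sigma> i]) = 1"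
        using f True by (intro prod.neutral) auto
      ultimately show ?thesis using JK by simp
    next
      case False
      then obtain i where i: "i < k" "J ! \<sigma> i \<noteq> K ! i" by blast
      then have "(\<Prod>i<k. (map \<xi> K ! i) [map E J ! \<sigma> i]) = 0"
        using f by (intro prod_zero) auto
      moreover have "\<not> (J = K \<and> \<sigma> = id)" using i by auto
      ultimately show ?thesis by auto
    qed
  qed
  have "set (map E J) \<subseteq> tangent_space A p" using E J' by auto
  then have "wedge A p (map \<xi> K) (map E J) =
      (\<Sum>\<sigma> | \<sigma> permutes {..<k}. of_int (sign \<sigma>) * (\<Prod>i<k. (map \<xi> K ! i) [map E J ! \<sigma> i]))"
    using J'(1) K'(1) by (simp add: wedge_def)
  also have "... = (\<Sum>\<sigma> | \<sigma> permutes {..<k}. if \<sigma> = id then (if J = K then 1 else 0) else 0)"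
  proof (rule sum.cong[OF refl])
    fix \<sigma> assume "\<sigma> \<in> {\<sigma>. \<sigma> permutes {..<k}}"
    then have "\<sigma> permutes {..<k}" by simp
    note prod[OF this]
    then show "of_int (sign \<sigma>) * (\<Prod>i<k. (map \<xi> K ! i) [map E J ! \<sigma> i]) =
        (if \<sigma> = id then (if J = K then 1 else 0) else 0)"
      by (cases "\<sigma> = id") (simp_all only: sign_id simp_thms of_int_1 mult_1 if_True if_False mult_zero_right)
  qed
  also have "... = (if J = K then 1 else 0)"
    by (subst sum.delta) (auto simp: finite_permutations permutes_id)
  finally show ?thesis .
qed

subsection \<open>Coordinate frames of vector bundles\<close>

text \<open>A local frame together with its dual functionals \<open>c\<close>. Smoothness of a
  section becomes smoothness of concrete coordinate functions, instead of the existence of suitable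
  coefficients as in \<open>local_frame\<close>.\<close>

definition coordinate_frame ::
    "('a::topological_space, 'e::real_inner) atlas \<Rightarrow> ('a, 'v::real_vector) vbundle \<Rightarrow> 'a set \<Rightarrow> nat
      \<Rightarrow> (nat \<Rightarrow> 'a \<Rightarrow> 'v) \<Rightarrow> (nat \<Rightarrow> 'a \<Rightarrow> 'v \<Rightarrow> real) \<Rightarrow> bool"
  where "coordinate_frame A E U r e c \<longleftrightarrow> open U \<and>
    (\<forall>p\<in>U. (\<forall>i<r. e i p \<in> fibre E p) \<and>
       (\<forall>i<r. \<forall>j<r. c i p (e j p) = (if i = j then 1 else 0)) \<and>
       (\<forall>i<r. \<forall>u\<in>fibre E p. \<forall>w\<in>fibre E p. c i p (u + w) = c i p u + c i p w) \<and>
       (\<forall>i<r. \<forall>u\<in>fibre E p. \<forall>t. c i p (t *\<^sub>R u) = t * c i p u) \<and>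
       (\<forall>u\<in>fibre E p. u = (\<Sum>i<r. c i p u *\<^sub>R e i p))) \<and>
    (\<forall>W s. open W \<longrightarrow> W \<subseteq> U \<longrightarrow>
       (s \<in> sections E W \<longleftrightarrow>
         (\<forall>p\<in>W. s p \<in> fibre E p) \<and> (\<forall>i<r. (\<lambda>p. c i p (s p)) \<in> smooth_funs A W)))"

lemma coordinate_frameD:
  assumes "coordinate_frame A E U r e c"
  shows "open U"
    and "\<And>p i. p \<in> U \<Longrightarrow> i < r \<Longrightarrow> e i p \<in> fibre E p"
    and "\<And>p i j. p \<in> U \<Longrightarrow> i < r \<Longrightarrow> j < r \<Longrightarrow> c i p (e j p) = (if i = j then 1 else 0)"
    and "\<And>p i u w. p \<in> U \<Longrightarrow> i < r \<Longrightarrow> u \<in> fibre E p \<Longrightarrow> w \<in> fibre E p \<Longrightarrow> c i p (u + w) = c i p u + c i p w"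
    and "\<And>p i u t. p \<in> U \<Longrightarrow> i < r \<Longrightarrow> u \<in> fibre E p \<Longrightarrow> c i p (t *\<^sub>R u) = t * c i p u"
    and "\<And>p u. p \<in> U \<Longrightarrow> u \<in> fibre E p \<Longrightarrow> u = (\<Sum>i<r. c i p u *\<^sub>R e i p)"
    and "\<And>W s. open W \<Longrightarrow> W \<subseteq> U \<Longrightarrow> s \<in> sections E W \<longleftrightarrow>
         (\<forall>p\<in>W. s p \<in> fibre E p) \<and> (\<forall>i<r. (\<lambda>p. c i p (s p)) \<in> smooth_funs A W)"
  using assms unfolding coordinate_frame_def by (blast, blast, blast, blast, blast, blast, blast)

lemma coordinate_frame_sum:
  assumes f: "coordinate_frame A E U r e c" and V: "subspace (fibre E p)" and p: "p \<in> U" "i < r"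
  shows "c i p (\<Sum>j<r. a j *\<^sub>R e j p) = a i"
proof -
  note D = coordinate_frameD[OF f]
  have "(\<Sum>j\<in>S. a j *\<^sub>R e j p) \<in> fibre E p \<and> c i p (\<Sum>j\<in>S. a j *\<^sub>R e j p) = (\<Sum>j\<in>S. a j * c i p (e j p))"
    if "S \<subseteq> {..<r}" for S
    using finite_subset[OF that finite_lessThan] that
  proof (induction S)
    case empty
    have "c i p (0 *\<^sub>R 0) = 0 * c i p 0" using p V by (intro D(5)) (auto simp: subspace_0)
    then show ?case using V by (simp add: subspace_0)
  next
    case (insert j S)
    then have "a j *\<^sub>R e j p \<in> fibre E p" "e j p \<in> fibre E p"
      using V p D(2) by (auto intro: subspace_scale)
    then show ?case using insert V p D(4,5) by (auto intro: subspace_add)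
  qed
  from this[of "{..<r}"] have "c i p (\<Sum>j<r. a j *\<^sub>R e j p) = (\<Sum>j<r. a j * c i p (e j p))" by simp
  also have "... = (\<Sum>j<r. if j = i then a i else 0)" using D(3) p by (intro sum.cong) auto
  finally show ?thesis using p by simp
qed

context smooth_mfd
begin

lemma local_frame_coordinate_frame:
  assumes f: "coordinate_frame A E U r e c" and V: "\<And>p. subspace (fibre E p)"
  shows "local_frame A E U (map e [0..<r])"
proof -
  note D = coordinate_frameD[OF f]
  have 1: "distinct (map (\<lambda>f. f p) (map e [0..<r]))
      \<and> independent (set (map (\<lambda>f. f p) (map e [0..<r]))) \<and> span (set (map (\<lambda>f. f p) (map e [0..<r]))) = fibre E p"
    if p: "p \<in> U" for p
  proof -
    have inj: "inj_on (\<lambda>i. e i p) {..<r}"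
      using D(3)[OF p] by (intro inj_onI) (metis lessThan_iff zero_neq_one)
    have set: "set (map (\<lambda>f. f p) (map e [0..<r])) = (\<lambda>i. e i p) ` {..<r}"
      by (auto simp: image_iff)
    have "distinct (map (\<lambda>f. f p) (map e [0..<r]))"
      using inj by (simp add: distinct_map comp_def atLeast0LessThan)
    moreover have "independent ((\<lambda>i. e i p) ` {..<r})"
    proof (rule independent_if_scalars_zero)
      fix g x assume g: "(\<Sum>x\<in>(\<lambda>i. e i p) ` {..<r}. g x *\<^sub>R x) = 0" and "x \<in> (\<lambda>i. e i p) ` {..<r}"
      then obtain i where i: "i < r" "x = e i p" by auto
      have "(\<Sum>j<r. g (e j p) *\<^sub>R e j p) = 0" using g by (simp add: sum.reindex[OF inj])
      then have "c i p 0 = g x" using coordinate_frame_sum[OF f V p i(1), of "\<lambda>j. g (e j p)"] i by simp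
      moreover have "c i p 0 = 0" using D(5)[OF p i(1) subspace_0[OF V], of 0] by simp
      ultimately show "g x = 0" by simp
    qed simp
    moreover have "span ((\<lambda>i. e i p) ` {..<r}) = fibre E p"
    proof
      show "span ((\<lambda>i. e i p) ` {..<r}) \<subseteq> fibre E p"
        using D(2)[OF p] by (intro span_minimal V) auto
      show "fibre E p \<subseteq> span ((\<lambda>i. e i p) ` {..<r})"
      proof
        fix u assume "u \<in> fibre E p"
        then have "u = (\<Sum>i<r. c i p u *\<^sub>R e i p)" by (rule D(6)[OF p])
        also have "... \<in> span ((\<lambda>i. e i p) ` {..<r})"
          by (intro span_sum span_scale span_base) auto
        finally show "u \<in> span ((\<lambda>i. e i p) ` {..<r})" .
      qed
    qed
    ultimately show ?thesis unfolding set by simp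
  qed
  have 2: "s \<in> sections E W \<longleftrightarrow> (\<exists>a. (\<forall>i<r. a i \<in> smooth_funs A W) \<and> (\<forall>p\<in>W. s p = (\<Sum>i<r. a i p *\<^sub>R e i p)))"
    if W: "open W" "W \<subseteq> U" for W s
  proof
    assume "s \<in> sections E W"
    then have s: "(\<forall>p\<in>W. s p \<in> fibre E p) \<and> (\<forall>i<r. (\<lambda>p. c i p (s p)) \<in> smooth_funs A W)" using D(7)[OF W] by simp
    show "\<exists>a. (\<forall>i<r. a i \<in> smooth_funs A W) \<and> (\<forall>p\<in>W. s p = (\<Sum>i<r. a i p *\<^sub>R e i p))"
    proof (intro exI[of _ "\<lambda>i p. c i p (s p)"] conjI ballI)
      show "\<forall>i<r. (\<lambda>p. c i p (s p)) \<in> smooth_funs A W" using s by simp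
      fix p assume "p \<in> W"
      then show "s p = (\<Sum>i<r. c i p (s p) *\<^sub>R e i p)" using s W(2) by (intro D(6)) blast+
    qed
  next
    assume "\<exists>a. (\<forall>i<r. a i \<in> smooth_funs A W) \<and> (\<forall>p\<in>W. s p = (\<Sum>i<r. a i p *\<^sub>R e i p))"
    then obtain a where a: "\<forall>i<r. a i \<in> smooth_funs A W" "\<And>p. p \<in> W \<Longrightarrow> s p = (\<Sum>i<r. a i p *\<^sub>R e i p)" by blast
    have "s p \<in> fibre E p" if "p \<in> W" for p
      unfolding a(2)[OF that] using that W D(2) by (intro subspace_sum subspace_scale V) auto
    moreover have "(\<lambda>p. c i p (s p)) \<in> smooth_funs A W" if "i < r" for i
    proof -
      have "c i p (s p) = a i p" if "p \<in> W" for p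
        unfolding a(2)[OF that] using that W \<open>i < r\<close> by (intro coordinate_frame_sum[OF f V]) auto
      then show ?thesis using smooth_funs_cong[OF W(1), of "\<lambda>p. c i p (s p)" "a i"] a(1) that by simp
    qed
    ultimately show "s \<in> sections E W" using D(7)[OF W] by blast
  qed
  show ?thesis unfolding local_frame_def using 1 2 D(1) by simp
qed

lemma smooth_funs_congI:
  "open W \<Longrightarrow> g \<in> smooth_funs A W \<Longrightarrow> (\<And>q. q \<in> W \<Longrightarrow> f q = g q) \<Longrightarrow> f \<in> smooth_funs A W"
  using smooth_funs_cong by blast

text \<open>The restriction and gluing clauses of \<open>vector_bundle\<close>, separated because
  they pass to direct sums and to restrictions independently of frames.\<close>

definition sheaf :: "('a, 'v) vbundle \<Rightarrow> bool"
  where "sheaf E \<longleftrightarrow>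
    (\<forall>W W' s. open W \<longrightarrow> open W' \<longrightarrow> W' \<subseteq> W \<longrightarrow> s \<in> sections E W \<longrightarrow> s \<in> sections E W') \<and>
    (\<forall>W s. open W \<longrightarrow>
       (\<forall>p\<in>W. \<exists>W'. open W' \<and> p \<in> W' \<and> W' \<subseteq> W \<and> s \<in> sections E W') \<longrightarrow> s \<in> sections E W)"

lemma vector_bundleI:
  assumes "\<And>p. subspace (fibre E p)" "sheaf E" "\<And>p. \<exists>U e c. p \<in> U \<and> coordinate_frame A E U r e c"
  shows "vector_bundle A E"
proof -
  have "\<exists>U es. p \<in> U \<and> length es = r \<and> local_frame A E U es" for p
  proof -
    obtain U e c where "p \<in> U" "coordinate_frame A E U r e c" using assms(3) by blast
    then show ?thesis using local_frame_coordinate_frame[OF _ assms(1)]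
      by (intro exI[of _ U] exI[of _ "map e [0..<r]"]) auto
  qed
  then have "\<exists>r. \<forall>p. \<exists>U es. p \<in> U \<and> length es = r \<and> local_frame A E U es" by blast
  then show ?thesis
    unfolding vector_bundle_def
    by (intro conjI allI assms(1) conjunct1[OF assms(2)[unfolded sheaf_def]] conjunct2[OF assms(2)[unfolded sheaf_def]])
qed

lemma sheaf_tangent_bundle: "sheaf (tangent_bundle A)"
  unfolding sheaf_def
proof (intro conjI allI impI)
  fix W W' :: "'a set" and s :: "'a \<Rightarrow> 'a tvec"
  assume "W' \<subseteq> W" "s \<in> sections (tangent_bundle A) W"
  then show "s \<in> sections (tangent_bundle A) W'"
    by (auto simp: tangent_bundle_def intro: smooth_funs_subset)
next
  fix W :: "'a set" and s :: "'a \<Rightarrow> 'a tvec"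
  assume l: "\<forall>p\<in>W. \<exists>W'. open W' \<and> p \<in> W' \<and> W' \<subseteq> W \<and> s \<in> sections (tangent_bundle A) W'"
  have "(\<lambda>p. s p f) \<in> smooth_funs A W" if "f \<in> \<C>" for f
    using l that by (intro smooth_funs_local) (fastforce simp: tangent_bundle_def)
  moreover have "s p \<in> tangent_space A p" if "p \<in> W" for p
    using l that by (fastforce simp: tangent_bundle_def)
  ultimately show "s \<in> sections (tangent_bundle A) W" by (simp add: tangent_bundle_def)
qed

lemma sheaf_form_bundle: "sheaf (form_bundle A k)"
  unfolding sheaf_def
proof (intro conjI allI impI)
  fix W W' :: "'a set" and s :: "'a \<Rightarrow> 'a form"
  assume "W' \<subseteq> W" "s \<in> sections (form_bundle A k) W"
  then show "s \<in> sections (form_bundle A k) W'"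
    by (auto simp: form_bundle_def intro: smooth_funs_subset)
next
  fix W :: "'a set" and s :: "'a \<Rightarrow> 'a form"
  assume l: "\<forall>p\<in>W. \<exists>W'. open W' \<and> p \<in> W' \<and> W' \<subseteq> W \<and> s \<in> sections (form_bundle A k) W'"
  have "(\<lambda>p. s p (map (\<lambda>X. X p) Xs)) \<in> smooth_funs A W" if "length Xs = k" "set Xs \<subseteq> vector_fields A" for Xs
  proof (rule smooth_funs_local)
    fix p assume "p \<in> W"
    then obtain W' where "open W'" "p \<in> W'" "s \<in> sections (form_bundle A k) W'" using l by blast
    then show "\<exists>V. open V \<and> p \<in> V \<and> (\<lambda>p. s p (map (\<lambda>X. X p) Xs)) \<in> smooth_funs A V"
      using that by (intro exI[of _ W']) (simp add: form_bundle_def)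
  qed
  moreover have "s p \<in> alt_maps k (tangent_space A p)" if p: "p \<in> W" for p
  proof -
    obtain W' where "p \<in> W'" "s \<in> sections (form_bundle A k) W'" using l p by blast
    then show ?thesis by (simp add: form_bundle_def)
  qed
  ultimately show "s \<in> sections (form_bundle A k) W" by (simp add: form_bundle_def)
qed

lemma sheaf_restrict:
  assumes "sheaf E" "open W" "open W'" "W' \<subseteq> W" "s \<in> sections E W"
  shows "s \<in> sections E W'"
proof -
  have "\<forall>W W' s. open W \<longrightarrow> open W' \<longrightarrow> W' \<subseteq> W \<longrightarrow> s \<in> sections E W \<longrightarrow> s \<in> sections E W'"
    using assms(1) unfolding sheaf_def by (rule conjunct1)
  from this[rule_format, OF assms(2-5)] show ?thesis .
qed

lemma sheaf_glue:
  assumes "sheaf E" "open W" "\<And>p. p \<in> W \<Longrightarrow> \<exists>W'. open W' \<and> p \<in> W' \<and> W' \<subseteq> W \<and> s \<in> sections E W'"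
  shows "s \<in> sections E W"
proof -
  have "\<forall>W s. open W \<longrightarrow> (\<forall>p\<in>W. \<exists>W'. open W' \<and> p \<in> W' \<and> W' \<subseteq> W \<and> s \<in> sections E W') \<longrightarrow> s \<in> sections E W"
    using assms(1) unfolding sheaf_def by (rule conjunct2)
  then show ?thesis using assms(2,3) by simp
qed

lemma sheaf_direct_sum:
  assumes E: "sheaf E" and F: "sheaf F"
  shows "sheaf (direct_sum E F)"
  unfolding sheaf_def
proof (intro conjI allI impI)
  fix W W' :: "'a set" and s
  assume W: "open W" "open W'" "W' \<subseteq> W" and "s \<in> sections (direct_sum E F) W"
  then show "s \<in> sections (direct_sum E F) W'"
    using sheaf_restrict[OF E W, of "\<lambda>p. fst (s p)"] sheaf_restrict[OF F W, of "\<lambda>p. snd (s p)"]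
    by (simp add: direct_sum_def)
next
  fix W :: "'a set" and s
  assume W: "open W" and l: "\<forall>p\<in>W. \<exists>W'. open W' \<and> p \<in> W' \<and> W' \<subseteq> W \<and> s \<in> sections (direct_sum E F) W'"
  have "(\<lambda>p. fst (s p)) \<in> sections E W"
    by (rule sheaf_glue[OF E W]) (use l in \<open>fastforce simp: direct_sum_def\<close>)
  moreover have "(\<lambda>p. snd (s p)) \<in> sections F W"
    by (rule sheaf_glue[OF F W]) (use l in \<open>fastforce simp: direct_sum_def\<close>)
  ultimately show "s \<in> sections (direct_sum E F) W" by (simp add: direct_sum_def)
qed

lemma sheaf_restrict_bundle:
  assumes E: "sheaf E"
  shows "sheaf (restrict_bundle E F)"
  unfolding sheaf_def
proof (intro conjI allI impI)
  fix W W' :: "'a set" and s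
  assume W: "open W" "open W'" "W' \<subseteq> W" and "s \<in> sections (restrict_bundle E F) W"
  then show "s \<in> sections (restrict_bundle E F) W'"
    using sheaf_restrict[OF E W, of s] by (auto simp: restrict_bundle_def)
next
  fix W :: "'a set" and s
  assume W: "open W" and l: "\<forall>p\<in>W. \<exists>W'. open W' \<and> p \<in> W' \<and> W' \<subseteq> W \<and> s \<in> sections (restrict_bundle E F) W'"
  have "s \<in> sections E W"
    by (rule sheaf_glue[OF E W]) (use l in \<open>fastforce simp: restrict_bundle_def\<close>)
  moreover have "s p \<in> F p" if "p \<in> W" for p
    using l that by (fastforce simp: restrict_bundle_def)
  ultimately show "s \<in> sections (restrict_bundle E F) W" by (simp add: restrict_bundle_def)
qed

lemma sum_lessThan_add:
  fixes r s :: nat and g :: "nat \<Rightarrow> 'v::comm_monoid_add"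
  shows "(\<Sum>i<r + s. g i) = (\<Sum>i<r. g i) + (\<Sum>i<s. g (r + i))"
  by (induction s) (simp_all add: add.assoc)

lemma coordinate_frame_direct_sum:
  assumes f: "coordinate_frame A E U r e c" and g: "coordinate_frame A F U s f b"
    and V: "\<And>p. subspace (fibre E p)" "\<And>p. subspace (fibre F p)"
  shows "coordinate_frame A (direct_sum E F) U (r + s)
    (\<lambda>i p. if i < r then (e i p, 0) else (0, f (i - r) p))
    (\<lambda>i p u. if i < r then c i p (fst u) else b (i - r) p (snd u))"
    (is "coordinate_frame A _ U _ ?e ?c")
proof -
  note D = coordinate_frameD[OF f] and G = coordinate_frameD[OF g]
  have z: "c i p 0 = 0" if "p \<in> U" "i < r" for i p
    using D(5)[OF that subspace_0[OF V(1)], of 0] by simp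
  have z': "b i p 0 = 0" if "p \<in> U" "i < s" for i p
    using G(5)[OF that subspace_0[OF V(2)], of 0] by simp
  show ?thesis
    unfolding coordinate_frame_def
  proof (intro conjI ballI allI impI)
    show "open U" by (rule D(1))
  next
    fix p i assume "p \<in> U" "i < r + s"
    then show "?e i p \<in> fibre (direct_sum E F) p"
      using D(2) G(2) V by (simp add: direct_sum_def subspace_0)
  next
    fix p i j assume "p \<in> U" "i < r + s" "j < r + s"
    then show "?c i p (?e j p) = (if i = j then 1 else 0)"
      using D(3) G(3) z z' by auto
  next
    fix p i u w assume "p \<in> U" "i < r + s" "u \<in> fibre (direct_sum E F) p" "w \<in> fibre (direct_sum E F) p"
    then show "?c i p (u + w) = ?c i p u + ?c i p w"
      using D(4) G(4) by (auto simp: direct_sum_def)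
  next
    fix p i u t assume "p \<in> U" "i < r + s" "u \<in> fibre (direct_sum E F) p"
    then show "?c i p (t *\<^sub>R u) = t * ?c i p u"
      using D(5) G(5) by (auto simp: direct_sum_def)
  next
    fix p u assume p: "p \<in> U" and u: "u \<in> fibre (direct_sum E F) p"
    have "(\<Sum>i<r + s. ?c i p u *\<^sub>R ?e i p) = (\<Sum>i<r. c i p (fst u) *\<^sub>R (e i p, 0)) + (\<Sum>i<s. b i p (snd u) *\<^sub>R (0, f i p))"
      unfolding sum_lessThan_add by simp
    also have "... = ((\<Sum>i<r. c i p (fst u) *\<^sub>R e i p), (\<Sum>i<s. b i p (snd u) *\<^sub>R f i p))"
      by (simp add: prod_eq_iff fst_sum snd_sum)
    also have "... = u"
      using D(6)[OF p, of "fst u"] G(6)[OF p, of "snd u"] u by (auto simp: direct_sum_def prod_eq_iff)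
    finally show "u = (\<Sum>i<r + s. ?c i p u *\<^sub>R ?e i p)" by simp
  next
    fix W t assume W: "open W" "W \<subseteq> U"
    have split: "(\<forall>i<r + s. P i) \<longleftrightarrow> (\<forall>i<r. P i) \<and> (\<forall>i<s. P (r + i))" for P
      by (metis add_diff_inverse_nat nat_add_left_cancel_less not_less trans_less_add1)
    show "t \<in> sections (direct_sum E F) W \<longleftrightarrow> (\<forall>p\<in>W. t p \<in> fibre (direct_sum E F) p) \<and>
        (\<forall>i<r + s. (\<lambda>p. ?c i p (t p)) \<in> smooth_funs A W)"
      unfolding split using D(7)[OF W, of "\<lambda>p. fst (t p)"] G(7)[OF W, of "\<lambda>p. snd (t p)"]
      by (auto simp: direct_sum_def mem_Times_iff)
  qed
qed

subsection \<open>The frames of the tangent bundle and of the bundles of forms\<close>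

lemma differential_cotangent: "differential A f p \<in> cotangent_space A p"
proof -
  have T: "u + w \<in> tangent_space A p" "c *\<^sub>R u \<in> tangent_space A p"
    if "u \<in> tangent_space A p" "w \<in> tangent_space A p" for u w c
    using that subspace_tangent_space subspace_add subspace_scale by blast+
  show ?thesis
    unfolding cotangent_space_eq
  proof (rule alt_mapsI)
    fix vs :: "'a tvec list" and i :: nat and u w
    assume "length vs = 1" "set vs \<subseteq> tangent_space A p" "i < 1" "u \<in> tangent_space A p" "w \<in> tangent_space A p"
    then show "differential A f p (vs[i := u + w]) = differential A f p (vs[i := u]) + differential A f p (vs[i := w])"
      using T by (auto simp: differential_def length_Suc_conv)
  next
    fix vs :: "'a tvec list" and i :: nat and u c
    assume "length vs = 1" "set vs \<subseteq> tangent_space A p" "i < 1" "u \<in> tangent_space A p"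
    then show "differential A f p (vs[i := c *\<^sub>R u]) = c * differential A f p (vs[i := u])"
      using T by (auto simp: differential_def length_Suc_conv scaleR_fun_def)
  qed (auto simp: differential_def)
qed

lemma differential_apply: "v \<in> tangent_space A p \<Longrightarrow> differential A f p [v] = v f"
  by (simp add: differential_def)

abbreviation frame_at :: "(nat \<Rightarrow> 'a \<Rightarrow> 'a tvec) \<Rightarrow> 'a \<Rightarrow> nat list \<Rightarrow> 'a tvec list"
  where "frame_at E p J \<equiv> map (\<lambda>i. E i p) J"

abbreviation coframe_at :: "(nat \<Rightarrow> 'a \<Rightarrow> real) \<Rightarrow> 'a \<Rightarrow> nat list \<Rightarrow> 'a form list"
  where "coframe_at x p J \<equiv> map (\<lambda>i. differential A (x i) p) J"

lemma chart_frameD: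
  assumes "chart_frame U x E"
  shows "open U" "\<And>i. i < mdim \<Longrightarrow> x i \<in> \<C>" "\<And>i. i < mdim \<Longrightarrow> E i \<in> vector_fields A"
    "\<And>q i j. q \<in> U \<Longrightarrow> i < mdim \<Longrightarrow> j < mdim \<Longrightarrow> E i q (x j) = (if i = j then 1 else 0)"
    "\<And>q v. q \<in> U \<Longrightarrow> v \<in> tangent_space A q \<Longrightarrow> v = (\<Sum>i<mdim. v (x i) *\<^sub>R E i q)"
    "\<And>q i. i < mdim \<Longrightarrow> E i q \<in> tangent_space A q"
proof -
  show "E i q \<in> tangent_space A q" if "i < mdim" for q i
    using assms that by (intro vector_field_tangent) (simp add: chart_frame_def)
  show "v = (\<Sum>i<mdim. v (x i) *\<^sub>R E i q)" if "q \<in> U" "v \<in> tangent_space A q" for q v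
    using assms that unfolding chart_frame_def by blast
qed (use assms in \<open>simp_all add: chart_frame_def\<close>)

lemma frame_at_tangent:
  "chart_frame U x E \<Longrightarrow> set J \<subseteq> {..<mdim} \<Longrightarrow> set (frame_at E p J) \<subseteq> tangent_space A p"
  using chart_frameD(6) by fastforce

lemma coframe_at_cotangent: "set (coframe_at x p J) \<subseteq> cotangent_space A p"
  using differential_cotangent by auto

lemma wedge_dual_chart_frame:
  assumes f: "chart_frame U x E" and q: "q \<in> U"
    and J: "J \<in> increasing mdim k" and K: "K \<in> increasing mdim k"
  shows "wedge A q (coframe_at x q K) (frame_at E q J) = (if J = K then 1 else 0)"
  by (rule wedge_dual_basis[OF J K])
     (use chart_frameD[OF f] q in \<open>simp_all add: differential_apply\<close>)

lemma coframe_expand: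
  assumes f: "chart_frame U x E" and q: "q \<in> U" and \<xi>: "\<xi> \<in> cotangent_space A q"
  shows "\<xi> = (\<Sum>i<mdim. \<xi> [E i q] *\<^sub>R differential A (x i) q)"
proof (rule alt_ext_basis[where d = mdim and b = "\<lambda>i. E i q"])
  note D = chart_frameD[OF f]
  show "\<xi> \<in> alt_maps 1 (tangent_space A q)" using \<xi> unfolding cotangent_space_eq .
  show "(\<Sum>i<mdim. \<xi> [E i q] *\<^sub>R differential A (x i) q) \<in> alt_maps 1 (tangent_space A q)"
    using differential_cotangent unfolding cotangent_space_eq
    by (intro subspace_sum subspace_scale subspace_alt_maps)
  show "subspace (tangent_space A q)" by (rule subspace_tangent_space)
  show "\<exists>c. v = (\<Sum>i<mdim. c i *\<^sub>R E i q)" if "v \<in> tangent_space A q" for v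
    using D(5)[OF q that] by (intro exI[of _ "\<lambda>i. v (x i)"])
  fix J assume "J \<in> increasing mdim 1"
  then obtain j where J: "J = [j]" "j < mdim" by (auto simp: increasing_def length_Suc_conv)
  have "(\<Sum>i<mdim. \<xi> [E i q] * differential A (x i) q [E j q]) = (\<Sum>i<mdim. if i = j then \<xi> [E j q] else 0)"
    using D(4)[OF q J(2)] D(6)[OF J(2)] by (intro sum.cong) (auto simp: differential_apply)
  then show "\<xi> (frame_at E q J) = (\<Sum>i<mdim. \<xi> [E i q] *\<^sub>R differential A (x i) q) (frame_at E q J)"
    using J by (simp add: sum_fun_apply scaleR_fun_def)
qed (use chart_frameD(6)[OF f] in auto)

text \<open>By duality both sides agree on the increasing lists of frame vectors, and an alternating
  map is determined there.\<close>

lemma form_expand: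
  assumes f: "chart_frame U x E" and q: "q \<in> U" and \<omega>: "\<omega> \<in> alt_maps k (tangent_space A q)"
  shows "\<omega> = (\<Sum>J\<in>increasing mdim k. \<omega> (frame_at E q J) *\<^sub>R wedge A q (coframe_at x q J))"
proof (rule alt_ext_basis[where d = mdim and b = "\<lambda>i. E i q", OF \<omega>])
  note D = chart_frameD[OF f]
  show "(\<Sum>J\<in>increasing mdim k. \<omega> (frame_at E q J) *\<^sub>R wedge A q (coframe_at x q J)) \<in> alt_maps k (tangent_space A q)"
    by (intro subspace_sum subspace_scale subspace_alt_maps wedge_alt coframe_at_cotangent) (simp add: increasing_def)
  show "subspace (tangent_space A q)" by (rule subspace_tangent_space)
  show "\<exists>c. v = (\<Sum>i<mdim. c i *\<^sub>R E i q)" if "v \<in> tangent_space A q" for v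
    using D(5)[OF q that] by (intro exI[of _ "\<lambda>i. v (x i)"])
  fix K assume K: "K \<in> increasing mdim k"
  have "(\<Sum>J\<in>increasing mdim k. \<omega> (frame_at E q J) * wedge A q (coframe_at x q J) (frame_at E q K)) =
      (\<Sum>J\<in>increasing mdim k. if J = K then \<omega> (frame_at E q K) else 0)"
    using wedge_dual_chart_frame[OF f q K] by (intro sum.cong) auto
  then show "\<omega> (frame_at E q K) =
      (\<Sum>J\<in>increasing mdim k. \<omega> (frame_at E q J) *\<^sub>R wedge A q (coframe_at x q J)) (frame_at E q K)"
    using K finite_increasing by (simp add: sum_fun_apply scaleR_fun_def)
qed (use chart_frameD(6)[OF f] in auto)

lemma vector_fields_tangent:
  assumes "set Xs \<subseteq> vector_fields A"
  shows "set (map (\<lambda>X. X p) Xs) \<subseteq> tangent_space A p"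
proof
  fix v assume "v \<in> set (map (\<lambda>X. X p) Xs)"
  then obtain X where "X \<in> set Xs" "v = X p" by auto
  then show "v \<in> tangent_space A p" using assms vector_field_tangent[of X p] by auto
qed

lemma wedge_differentials_smooth:
  assumes fs: "set fs \<subseteq> \<C>" and Xs: "length Xs = length fs" "set Xs \<subseteq> vector_fields A"
  shows "(\<lambda>p. wedge A p (map (\<lambda>f. differential A f p) fs) (map (\<lambda>X. X p) Xs)) \<in> \<C>"
proof -
  have eq: "wedge A p (map (\<lambda>f. differential A f p) fs) (map (\<lambda>X. X p) Xs) =
      (\<Sum>\<sigma> | \<sigma> permutes {..<length fs}. of_int (sign \<sigma>) * (\<Prod>i<length fs. (Xs ! \<sigma> i) p (fs ! i)))" for p
  proof -
    have "set (map (\<lambda>X. X p) Xs) \<subseteq> tangent_space A p" by (rule vector_fields_tangent[OF Xs(2)])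
    moreover have "(map (\<lambda>f. differential A f p) fs ! i) [map (\<lambda>X. X p) Xs ! \<sigma> i] = (Xs ! \<sigma> i) p (fs ! i)"
      if "\<sigma> permutes {..<length fs}" "i < length fs" for \<sigma> i
    proof -
      have s: "\<sigma> i < length Xs" using permutes_in_image[OF that(1), of i] that(2) Xs by simp
      then have "Xs ! \<sigma> i \<in> vector_fields A" using Xs by auto
      then have "(Xs ! \<sigma> i) p \<in> tangent_space A p" by (rule vector_field_tangent)
      then show ?thesis using s that by (simp add: differential_apply)
    qed
    ultimately show ?thesis using Xs by (simp add: wedge_def)
  qed
  have sm: "(\<lambda>p. (Xs ! \<sigma> i) p (fs ! i)) \<in> \<C>" if "\<sigma> permutes {..<length fs}" "i < length fs" for \<sigma> i
  proof -
    have "\<sigma> i < length Xs" using permutes_in_image[OF that(1), of i] that(2) Xs by simp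
    then have "Xs ! \<sigma> i \<in> vector_fields A" "fs ! i \<in> \<C>" using that fs Xs by auto
    then show ?thesis by (rule vector_field_smooth[of "Xs ! \<sigma> i" "fs ! i"])
  qed
  show ?thesis
    unfolding eq
    by (intro smooth_funs_sum smooth_funs_mult smooth_funs_const smooth_funs_prod open_UNIV sm) simp_all
qed

lemma wedge_differentials_form:
  assumes "set fs \<subseteq> \<C>" "length fs = k"
  shows "(\<lambda>p. wedge A p (map (\<lambda>f. differential A f p) fs)) \<in> forms A k"
proof -
  have "wedge A p (map (\<lambda>f. differential A f p) fs) \<in> alt_maps k (tangent_space A p)" for p
    using differential_cotangent assms by (intro wedge_alt) auto
  then show ?thesis using wedge_differentials_smooth[OF assms(1)] assms(2) by (simp add: form_bundle_def)
qed

lemma coordinate_frame_tangent: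
  assumes f: "chart_frame U x E"
  shows "coordinate_frame A (tangent_bundle A) U mdim E (\<lambda>i p v. v (x i))"
proof -
  note D = chart_frameD[OF f]
  show ?thesis
    unfolding coordinate_frame_def
  proof (intro conjI ballI allI impI)
    fix W s assume W: "open W" "W \<subseteq> U"
    show "s \<in> sections (tangent_bundle A) W \<longleftrightarrow>
        (\<forall>p\<in>W. s p \<in> fibre (tangent_bundle A) p) \<and> (\<forall>i<mdim. (\<lambda>p. s p (x i)) \<in> smooth_funs A W)"
    proof (intro iffI conjI)
      assume r: "(\<forall>p\<in>W. s p \<in> fibre (tangent_bundle A) p) \<and> (\<forall>i<mdim. (\<lambda>p. s p (x i)) \<in> smooth_funs A W)"
      have "(\<lambda>p. s p g) \<in> smooth_funs A W" if g: "g \<in> \<C>" for g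
      proof -
        have "s p g = (\<Sum>i<mdim. s p (x i) * E i p g)" if "p \<in> W" for p
        proof -
          have "s p = (\<Sum>i<mdim. s p (x i) *\<^sub>R E i p)"
            using r W that by (intro D(5)) (auto simp: tangent_bundle_def)
          from fun_cong[OF this, of g] show ?thesis by (simp add: sum_fun_apply scaleR_fun_def)
        qed
        note eq = this
        have sm: "(\<lambda>p. \<Sum>i<mdim. s p (x i) * E i p g) \<in> smooth_funs A W"
          using r g by (intro smooth_funs_sum smooth_funs_mult W smooth_funs_subset[OF vector_field_smooth[OF D(3)]]) auto
        show ?thesis by (rule smooth_funs_congI[OF W(1) sm]) (rule eq)
      qed
      then show "s \<in> sections (tangent_bundle A) W" using r by (simp add: tangent_bundle_def)
    next
      assume s: "s \<in> sections (tangent_bundle A) W"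
      then show "\<forall>p\<in>W. s p \<in> fibre (tangent_bundle A) p" by (simp add: tangent_bundle_def)
      show "\<forall>i<mdim. (\<lambda>p. s p (x i)) \<in> smooth_funs A W" using s D(2) by (simp add: tangent_bundle_def)
    qed
  next
    fix p u assume "p \<in> U" "u \<in> fibre (tangent_bundle A) p"
    then show "u = (\<Sum>i<mdim. u (x i) *\<^sub>R E i p)" by (intro D(5)) (simp_all add: tangent_bundle_def)
  next
    show "open U" by (rule D(1))
  next
    fix p i assume "p \<in> U" "i < mdim"
    then show "E i p \<in> fibre (tangent_bundle A) p" using D(6) by (simp add: tangent_bundle_def)
  next
    fix p i j assume "p \<in> U" "i < mdim" "j < mdim"
    then show "E j p (x i) = (if i = j then 1 else 0)" using D(4)[of p j i] by simp
  qed (simp_all add: scaleR_fun_def)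
qed

text \<open>\<open>coordinate_frame\<close> is indexed by an initial segment of the naturals, so the
  finite set of increasing lists has to be enumerated.\<close>

definition multi_indices :: "nat \<Rightarrow> nat list list"
  where "multi_indices k = (SOME l. set l = increasing mdim k \<and> distinct l)"

lemma multi_indices: "set (multi_indices k) = increasing mdim k" "distinct (multi_indices k)"
proof -
  have "\<exists>l. set l = increasing mdim k \<and> distinct l"
    using finite_distinct_list[OF finite_increasing] .
  then have "set (multi_indices k) = increasing mdim k \<and> distinct (multi_indices k)"
    unfolding multi_indices_def by (rule someI_ex)
  then show "set (multi_indices k) = increasing mdim k" "distinct (multi_indices k)" by auto
qed

lemma sum_multi_indices:
  "(\<Sum>J\<in>increasing mdim k. P J) = (\<Sum>i<length (multi_indices k). P (multi_indices k ! i))"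
  using multi_indices by (intro sum.reindex_bij_betw[symmetric] bij_betw_nth) auto

lemma multi_indices_nth: "i < length (multi_indices k) \<Longrightarrow> multi_indices k ! i \<in> increasing mdim k"
  using multi_indices by (metis nth_mem)

text \<open>For the smoothness of a section with smooth coordinates, the pointwise expansion is
  evaluated on global fields: what remains are the coordinates and wedges of differentials, smooth
  by \<open>wedge_differentials_smooth\<close>.\<close>

lemma coordinate_frame_form:
  assumes f: "chart_frame U x E"
  shows "coordinate_frame A (form_bundle A k) U (length (multi_indices k))
    (\<lambda>i p. wedge A p (coframe_at x p (multi_indices k ! i)))
    (\<lambda>i p \<omega>. \<omega> (frame_at E p (multi_indices k ! i)))"
proof -
  note D = chart_frameD[OF f]
  show ?thesis
    unfolding coordinate_frame_def
  proof (intro conjI ballI allI impI)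
    show "open U" by (rule D(1))
  next
    fix p i assume "p \<in> U" "i < length (multi_indices k)"
    then have "multi_indices k ! i \<in> increasing mdim k" by (intro multi_indices_nth)
    then have "wedge A p (coframe_at x p (multi_indices k ! i)) \<in> alt_maps k (tangent_space A p)"
      by (intro wedge_alt coframe_at_cotangent) (simp add: increasing_def)
    then show "wedge A p (coframe_at x p (multi_indices k ! i)) \<in> fibre (form_bundle A k) p"
      by (simp add: form_bundle_def)
  next
    fix p i j assume "p \<in> U" "i < length (multi_indices k)" "j < length (multi_indices k)"
    then show "wedge A p (coframe_at x p (multi_indices k ! j)) (frame_at E p (multi_indices k ! i)) = (if i = j then 1 else 0)"
      using wedge_dual_chart_frame[OF f _ multi_indices_nth multi_indices_nth] multi_indices(2)
      by (simp add: nth_eq_iff_index_eq)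
  next
    fix p u assume "p \<in> U" "u \<in> fibre (form_bundle A k) p"
    then show "u = (\<Sum>i<length (multi_indices k). u (frame_at E p (multi_indices k ! i)) *\<^sub>R
        wedge A p (coframe_at x p (multi_indices k ! i)))"
      using form_expand[OF f, of p u k] by (simp add: sum_multi_indices form_bundle_def)
  next
    fix W s assume W: "open W" "W \<subseteq> U"
    show "s \<in> sections (form_bundle A k) W \<longleftrightarrow> (\<forall>p\<in>W. s p \<in> fibre (form_bundle A k) p) \<and>
        (\<forall>i<length (multi_indices k). (\<lambda>p. s p (frame_at E p (multi_indices k ! i))) \<in> smooth_funs A W)"
    proof (intro iffI conjI allI impI)
      assume s: "s \<in> sections (form_bundle A k) W"
      then show "\<forall>p\<in>W. s p \<in> fibre (form_bundle A k) p" by (simp add: form_bundle_def)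
      fix i assume "i < length (multi_indices k)"
      then have J: "length (multi_indices k ! i) = k" "set (multi_indices k ! i) \<subseteq> {..<mdim}"
        using multi_indices_nth by (auto simp: increasing_def)
      have "(\<lambda>p. s p (map (\<lambda>X. X p) Xs)) \<in> smooth_funs A W" if "length Xs = k" "set Xs \<subseteq> vector_fields A" for Xs
        using s that by (simp add: form_bundle_def)
      from this[of "map E (multi_indices k ! i)"] J D(3)
      show "(\<lambda>p. s p (frame_at E p (multi_indices k ! i))) \<in> smooth_funs A W"
        by (auto simp: comp_def)
    next
      assume r: "(\<forall>p\<in>W. s p \<in> fibre (form_bundle A k) p) \<and>
        (\<forall>i<length (multi_indices k). (\<lambda>p. s p (frame_at E p (multi_indices k ! i))) \<in> smooth_funs A W)"
      have "(\<lambda>p. s p (map (\<lambda>X. X p) Xs)) \<in> smooth_funs A W" if Xs: "length Xs = k" "set Xs \<subseteq> vector_fields A" for Xs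
      proof -
        have "s p (map (\<lambda>X. X p) Xs) = (\<Sum>i<length (multi_indices k). s p (frame_at E p (multi_indices k ! i)) *
            wedge A p (map (\<lambda>f. differential A f p) (map x (multi_indices k ! i))) (map (\<lambda>X. X p) Xs))" if "p \<in> W" for p
        proof -
          have "s p = (\<Sum>i<length (multi_indices k). s p (frame_at E p (multi_indices k ! i)) *\<^sub>R
              wedge A p (coframe_at x p (multi_indices k ! i)))"
            using r W that form_expand[OF f, of p "s p" k] by (auto simp: sum_multi_indices form_bundle_def)
          from fun_cong[OF this, of "map (\<lambda>X. X p) Xs"] show ?thesis
            by (simp add: sum_fun_apply scaleR_fun_def comp_def)
        qed
        note eq = this
        have sm: "(\<lambda>p. \<Sum>i<length (multi_indices k). s p (frame_at E p (multi_indices k ! i)) *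
            wedge A p (map (\<lambda>f. differential A f p) (map x (multi_indices k ! i))) (map (\<lambda>X. X p) Xs)) \<in> smooth_funs A W"
        proof (intro smooth_funs_sum smooth_funs_mult W)
          fix i assume i: "i \<in> {..<length (multi_indices k)}"
          then show "(\<lambda>p. s p (frame_at E p (multi_indices k ! i))) \<in> smooth_funs A W" using r by simp
          have "multi_indices k ! i \<in> increasing mdim k" using i multi_indices_nth by simp
          then show "(\<lambda>p. wedge A p (map (\<lambda>f. differential A f p) (map x (multi_indices k ! i))) (map (\<lambda>X. X p) Xs)) \<in> smooth_funs A W"
            using D(2) Xs by (intro smooth_funs_subset[OF wedge_differentials_smooth]) (auto simp: increasing_def)
        qed
        show ?thesis by (rule smooth_funs_congI[OF W(1) sm]) (rule eq)
      qed
      then show "s \<in> sections (form_bundle A k) W" using r by (simp add: form_bundle_def)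
    qed
  qed (simp_all add: scaleR_fun_def)
qed

lemma subspace_fibre_form: "subspace (fibre (form_bundle A k) p)"
  by (simp add: form_bundle_def subspace_alt_maps)

lemma subspace_fibre_tangent: "subspace (fibre (tangent_bundle A) p)"
  by (simp add: tangent_bundle_def subspace_tangent_space)

lemma vector_bundle_form: "vector_bundle A (form_bundle A k)"
proof (rule vector_bundleI[where r = "length (multi_indices k)"])
  fix p
  obtain U x E where "p \<in> U" "chart_frame U x E" using chart_frame_exists by blast
  then show "\<exists>U e c. p \<in> U \<and> coordinate_frame A (form_bundle A k) U (length (multi_indices k)) e c"
    using coordinate_frame_form by blast
qed (rule subspace_fibre_form sheaf_form_bundle)+

lemma vector_bundle_generalized_tangent: "vector_bundle A (generalized_tangent_bundle A k)"
  unfolding generalized_tangent_bundle_def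
proof (rule vector_bundleI[where r = "mdim + length (multi_indices k)"])
  fix p
  show "subspace (fibre (direct_sum (tangent_bundle A) (form_bundle A k)) p)"
    unfolding direct_sum_def vbundle.simps by (intro subspace_Times subspace_fibre_form subspace_fibre_tangent)
  show "sheaf (direct_sum (tangent_bundle A) (form_bundle A k))"
    by (intro sheaf_direct_sum sheaf_tangent_bundle sheaf_form_bundle)
  obtain U x E where "p \<in> U" "chart_frame U x E" using chart_frame_exists by blast
  then show "\<exists>U e c. p \<in> U \<and> coordinate_frame A (direct_sum (tangent_bundle A) (form_bundle A k)) U
      (mdim + length (multi_indices k)) e c"
    using coordinate_frame_direct_sum[OF coordinate_frame_tangent coordinate_frame_form
        subspace_fibre_tangent subspace_fibre_form] by blast
qed

subsection \<open>The Lie algebra of vector fields\<close>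

lemma vector_field_outside: "X \<in> vector_fields A \<Longrightarrow> f \<notin> \<C> \<Longrightarrow> X p f = 0"
  by (rule tangent_outside[OF vector_field_tangent])

lemma vector_field_eqI:
  assumes "X \<in> vector_fields A" "Y \<in> vector_fields A" "\<And>p f. f \<in> \<C> \<Longrightarrow> X p f = Y p f"
  shows "X = Y"
proof (intro ext)
  fix p f
  show "X p f = Y p f"
    using assms(3) vector_field_outside[OF assms(1)] vector_field_outside[OF assms(2)] by (cases "f \<in> \<C>") simp_all
qed

lemma vector_field_add:
  assumes "X \<in> vector_fields A" "Y \<in> vector_fields A"
  shows "X + Y \<in> vector_fields A"
proof (rule vector_fieldI)
  show "(X + Y) p \<in> tangent_space A p" for p
    using subspace_add[OF subspace_tangent_space vector_field_tangent[OF assms(1)] vector_field_tangent[OF assms(2)]]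
    by simp
  show "(\<lambda>p. (X + Y) p f) \<in> \<C>" if "f \<in> \<C>" for f
    using smooth_funs_add[OF open_UNIV vector_field_smooth[OF assms(1) that] vector_field_smooth[OF assms(2) that]]
    by simp
qed

lemma vector_field_scale:
  assumes "f \<in> \<C>" "X \<in> vector_fields A"
  shows "(\<lambda>p. f p *\<^sub>R X p) \<in> vector_fields A"
proof (rule vector_fieldI)
  show "f p *\<^sub>R X p \<in> tangent_space A p" for p
    by (rule subspace_scale[OF subspace_tangent_space vector_field_tangent[OF assms(2)]])
  show "(\<lambda>p. (f p *\<^sub>R X p) g) \<in> \<C>" if "g \<in> \<C>" for g
    using smooth_funs_mult[OF open_UNIV assms(1) vector_field_smooth[OF assms(2) that]]
    by (simp add: scaleR_fun_def)
qed

lemma vector_field_zero: "0 \<in> vector_fields A"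
  by (rule vector_fieldI) (simp_all add: smooth_funs_const subspace_0[OF subspace_tangent_space])

lemma vector_field_uminus: "X \<in> vector_fields A \<Longrightarrow> - X \<in> vector_fields A"
  using vector_field_scale[OF smooth_funs_const[of "-1"], of X] by (simp add: fun_Compl_def)

lemma vector_field_diff: "X \<in> vector_fields A \<Longrightarrow> Y \<in> vector_fields A \<Longrightarrow> X - Y \<in> vector_fields A"
  using vector_field_add[OF _ vector_field_uminus, of X Y] by simp

lemma lie_bracket_vector_field:
  assumes X: "X \<in> vector_fields A" and Y: "Y \<in> vector_fields A"
  shows "lie_bracket X Y \<in> vector_fields A"
proof (rule vector_fieldI)
  fix p
  note T = vector_field_tangent[OF X] vector_field_tangent[OF Y]
  note S = vector_field_smooth[OF X] vector_field_smooth[OF Y]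
  show "lie_bracket X Y p \<in> tangent_space A p"
    unfolding tangent_space_def mem_Collect_eq
  proof (intro conjI ballI allI impI)
    fix f g assume fg: "f \<in> \<C>" "g \<in> \<C>"
    show "lie_bracket X Y p (\<lambda>x. f x + g x) = lie_bracket X Y p f + lie_bracket X Y p g"
      by (simp add: lie_bracket_def tangentD(1)[OF T(1)] tangentD(1)[OF T(2)] fg S)
    show "lie_bracket X Y p (\<lambda>x. f x * g x) = f p * lie_bracket X Y p g + g p * lie_bracket X Y p f"
      by (simp add: lie_bracket_def tangentD(1)[OF T(1)] tangentD(1)[OF T(2)]
          tangentD(2)[OF T(1)] tangentD(2)[OF T(2)] fg S smooth_funs_mult algebra_simps)
  next
    fix f c assume f: "f \<in> \<C>"
    show "lie_bracket X Y p (\<lambda>x. c * f x) = c * lie_bracket X Y p f"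
      by (simp add: lie_bracket_def tangentD(3)[OF T(1) f f] tangentD(3)[OF T(2) f f]
          tangentD(3)[OF T(1) S(2)[OF f] f] tangentD(3)[OF T(2) S(1)[OF f] f] algebra_simps)
  next
    \<comment> \<open>On a nonsmooth f the inner fields give the constant function 0, and the outer
      derivations kill constants.\<close>
    fix f assume "f \<notin> \<C>"
    then show "lie_bracket X Y p f = 0"
      by (simp add: lie_bracket_def vector_field_outside[OF X] vector_field_outside[OF Y] tangent_const[OF T(1)] tangent_const[OF T(2)])
  qed
next
  fix f assume f: "f \<in> \<C>"
  show "(\<lambda>p. lie_bracket X Y p f) \<in> \<C>"
    unfolding lie_bracket_def
    by (rule smooth_funs_diff[OF open_UNIV vector_field_smooth[OF X vector_field_smooth[OF Y f]]
          vector_field_smooth[OF Y vector_field_smooth[OF X f]]])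
qed

lemma lie_bracket_add:
  assumes "X \<in> vector_fields A" "Y \<in> vector_fields A" "Z \<in> vector_fields A"
  shows "lie_bracket X (Y + Z) = lie_bracket X Y + lie_bracket X Z"
proof (rule vector_field_eqI)
  fix p f assume "f \<in> \<C>"
  then show "lie_bracket X (Y + Z) p f = (lie_bracket X Y + lie_bracket X Z) p f"
    by (simp add: lie_bracket_def tangentD(1)[OF vector_field_tangent[OF assms(1)]]
        vector_field_smooth[OF assms(2)] vector_field_smooth[OF assms(3)])
qed (intro vector_field_add lie_bracket_vector_field assms)+

lemma lie_bracket_antisym: "lie_bracket X Y = - lie_bracket Y X"
  by (intro ext) (simp add: lie_bracket_def)

lemma lie_bracket_self: "lie_bracket X X = 0"
  by (intro ext) (simp add: lie_bracket_def)

lemma lie_bracket_scale: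
  assumes X: "X \<in> vector_fields A" and Y: "Y \<in> vector_fields A" and f: "f \<in> \<C>"
  shows "lie_bracket X (\<lambda>p. f p *\<^sub>R Y p) = (\<lambda>p. f p *\<^sub>R lie_bracket X Y p) + (\<lambda>p. X p f *\<^sub>R Y p)"
proof (rule vector_field_eqI)
  fix p g assume g: "g \<in> \<C>"
  show "lie_bracket X (\<lambda>p. f p *\<^sub>R Y p) p g = ((\<lambda>p. f p *\<^sub>R lie_bracket X Y p) + (\<lambda>p. X p f *\<^sub>R Y p)) p g"
    by (simp add: lie_bracket_def scaleR_fun_def tangentD(2)[OF vector_field_tangent[OF X] f vector_field_smooth[OF Y g]]
        algebra_simps)
qed (intro vector_field_add vector_field_scale lie_bracket_vector_field X Y f vector_field_smooth[OF X f])+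

lemma lie_bracket_scale_left:
  assumes "X \<in> vector_fields A" "Y \<in> vector_fields A" "f \<in> \<C>"
  shows "lie_bracket (\<lambda>p. f p *\<^sub>R X p) Y = (\<lambda>p. f p *\<^sub>R lie_bracket X Y p) + (\<lambda>p. (- Y p f) *\<^sub>R X p)"
  unfolding lie_bracket_antisym[of "\<lambda>p. f p *\<^sub>R X p" Y] lie_bracket_scale[OF assms(2,1,3)]
  by (subst lie_bracket_antisym[of Y X]) (simp add: fun_eq_iff scaleR_fun_def)

lemma jacobi:
  assumes X: "X \<in> vector_fields A" and Y: "Y \<in> vector_fields A" and Z: "Z \<in> vector_fields A"
  shows "lie_bracket X (lie_bracket Y Z) = lie_bracket (lie_bracket X Y) Z + lie_bracket Y (lie_bracket X Z)"
proof (rule vector_field_eqI)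
  fix p f assume f: "f \<in> \<C>"
  note S = vector_field_smooth[OF X] vector_field_smooth[OF Y] vector_field_smooth[OF Z]
  show "lie_bracket X (lie_bracket Y Z) p f = (lie_bracket (lie_bracket X Y) Z + lie_bracket Y (lie_bracket X Z)) p f"
    by (simp add: lie_bracket_def f S tangent_diff[OF vector_field_tangent[OF X]] tangent_diff[OF vector_field_tangent[OF Y]]
        tangent_diff[OF vector_field_tangent[OF Z]])
qed (intro vector_field_add lie_bracket_vector_field X Y Z)+

text \<open>The fields of a chart frame are already global, so constant coefficients extend a
  vector.\<close>

lemma extend_vector:
  assumes "v \<in> tangent_space A p"
  shows "\<exists>X\<in>vector_fields A. X p = v"
proof -
  obtain U x E where p: "p \<in> U" and f: "chart_frame U x E" using chart_frame_exists by blast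
  define S where "S m = (\<lambda>q. \<Sum>i<m. v (x i) *\<^sub>R E i q)" for m
  have "m \<le> mdim \<Longrightarrow> S m \<in> vector_fields A" for m
  proof (induction m)
    case 0
    then show ?case using vector_field_zero by (simp add: S_def zero_fun_def)
  next
    case (Suc m)
    have s: "S (Suc m) = S m + (\<lambda>q. v (x m) *\<^sub>R E m q)" by (simp add: S_def plus_fun_def)
    show ?case
      unfolding s
      by (rule vector_field_add[OF _ vector_field_scale[OF smooth_funs_const chart_frameD(3)[OF f]]]) (use Suc in simp_all)
  qed
  then have "S mdim \<in> vector_fields A" by simp
  moreover have "S mdim p = v" unfolding S_def by (rule chart_frameD(5)[OF f p assms, symmetric])
  ultimately show ?thesis by blast
qed

definition lift :: "'a \<Rightarrow> 'a tvec \<Rightarrow> 'a \<Rightarrow> 'a tvec"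
  where "lift p v = (SOME X. X \<in> vector_fields A \<and> X p = v)"

lemma lift:
  assumes "v \<in> tangent_space A p"
  shows "lift p v \<in> vector_fields A" "lift p v p = v"
proof -
  have "\<exists>X. X \<in> vector_fields A \<and> X p = v" using extend_vector[OF assms] by blast
  from someI_ex[OF this] show "lift p v \<in> vector_fields A" "lift p v p = v" by (simp_all add: lift_def)
qed

subsection \<open>Forms as multilinear operators on vector fields\<close>

definition VFs :: "nat \<Rightarrow> ('a \<Rightarrow> 'a tvec) list set"
  where "VFs k = {Xs. length Xs = k \<and> set Xs \<subseteq> vector_fields A}"

lemma VFsD: "Xs \<in> VFs k \<Longrightarrow> length Xs = k" "Xs \<in> VFs k \<Longrightarrow> set Xs \<subseteq> vector_fields A"
  by (simp_all add: VFs_def)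

lemma VFs_nth: "Xs \<in> VFs k \<Longrightarrow> i < k \<Longrightarrow> Xs ! i \<in> vector_fields A"
  by (auto simp: VFs_def)

lemma VFs_Cons [simp]: "X # Xs \<in> VFs (Suc k) \<longleftrightarrow> X \<in> vector_fields A \<and> Xs \<in> VFs k"
  by (auto simp: VFs_def)

lemma VFs_0 [simp]: "Xs \<in> VFs 0 \<longleftrightarrow> Xs = []"
  by (auto simp: VFs_def)

lemma VFs_SucE:
  assumes "Xs \<in> VFs (Suc k)"
  obtains Y Ys where "Xs = Y # Ys" "Y \<in> vector_fields A" "Ys \<in> VFs k"
  using assms by (cases Xs) (auto simp: VFs_def)

lemma VFs_update: "Xs \<in> VFs k \<Longrightarrow> X \<in> vector_fields A \<Longrightarrow> Xs[i := X] \<in> VFs k"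
  by (simp add: VFs_def set_update_subset)

lemma VFs_delete: "Xs \<in> VFs (Suc k) \<Longrightarrow> i \<le> k \<Longrightarrow> delete_nth i Xs \<in> VFs k"
  using set_delete_nth[of i Xs] by (auto simp: VFs_def length_delete_nth)

lemma VFs_at: "Xs \<in> VFs k \<Longrightarrow> length (map (\<lambda>X. X p) Xs) = k" "Xs \<in> VFs k \<Longrightarrow> set (map (\<lambda>X. X p) Xs) \<subseteq> tangent_space A p"
  using vector_fields_tangent[OF VFsD(2)] by (simp_all add: VFsD(1))

text \<open>Alternating operators on global vector fields that are linear over smooth functions and
  have smooth values. By \<open>tensorial_local\<close> their value at a point depends only on the
  fields there, which justifies \<open>form_of_operator\<close>.\<close>

definition tensorial :: "nat \<Rightarrow> (('a \<Rightarrow> 'a tvec) list \<Rightarrow> 'a \<Rightarrow> real) \<Rightarrow> bool"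
  where "tensorial k Q \<longleftrightarrow>
    (\<forall>Xs\<in>VFs k. Q Xs \<in> \<C>) \<and>
    (\<forall>Xs\<in>VFs k. \<forall>i<k. \<forall>X\<in>vector_fields A. \<forall>Y\<in>vector_fields A. \<forall>p.
       Q (Xs[i := X + Y]) p = Q (Xs[i := X]) p + Q (Xs[i := Y]) p) \<and>
    (\<forall>Xs\<in>VFs k. \<forall>i<k. \<forall>X\<in>vector_fields A. \<forall>f\<in>\<C>. \<forall>p.
       Q (Xs[i := (\<lambda>q. f q *\<^sub>R X q)]) p = f p * Q (Xs[i := X]) p) \<and>
    (\<forall>Xs\<in>VFs k. \<forall>i<k. \<forall>j<i. \<forall>p. Xs ! i = Xs ! j \<longrightarrow> Q Xs p = 0)"

lemma tensorialI:
  assumes "\<And>Xs. Xs \<in> VFs k \<Longrightarrow> Q Xs \<in> \<C>"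
    and "\<And>Xs i X Y p. Xs \<in> VFs k \<Longrightarrow> i < k \<Longrightarrow> X \<in> vector_fields A \<Longrightarrow> Y \<in> vector_fields A \<Longrightarrow>
       Q (Xs[i := X + Y]) p = Q (Xs[i := X]) p + Q (Xs[i := Y]) p"
    and "\<And>Xs i X f p. Xs \<in> VFs k \<Longrightarrow> i < k \<Longrightarrow> X \<in> vector_fields A \<Longrightarrow> f \<in> \<C> \<Longrightarrow>
       Q (Xs[i := (\<lambda>q. f q *\<^sub>R X q)]) p = f p * Q (Xs[i := X]) p"
    and "\<And>Xs i j p. Xs \<in> VFs k \<Longrightarrow> i < k \<Longrightarrow> j < i \<Longrightarrow> Xs ! i = Xs ! j \<Longrightarrow> Q Xs p = 0"
  shows "tensorial k Q"
  unfolding tensorial_def by (intro conjI ballI allI impI) (rule assms; assumption)+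

lemma tensorial_smooth: "tensorial k Q \<Longrightarrow> Xs \<in> VFs k \<Longrightarrow> Q Xs \<in> \<C>"
  unfolding tensorial_def by (elim conjE bspec)

lemma tensorial_add:
  assumes "tensorial k Q" "Xs \<in> VFs k" "i < k" "X \<in> vector_fields A" "Y \<in> vector_fields A"
  shows "Q (Xs[i := X + Y]) p = Q (Xs[i := X]) p + Q (Xs[i := Y]) p"
  using assms(1)[unfolded tensorial_def, THEN conjunct2, THEN conjunct1] assms(2-) by simp

lemma tensorial_scale:
  assumes "tensorial k Q" "Xs \<in> VFs k" "i < k" "X \<in> vector_fields A" "f \<in> \<C>"
  shows "Q (Xs[i := (\<lambda>q. f q *\<^sub>R X q)]) p = f p * Q (Xs[i := X]) p"
  using assms(1)[unfolded tensorial_def, THEN conjunct2, THEN conjunct2, THEN conjunct1] assms(2-) by simp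

lemma tensorial_eq_0:
  assumes "tensorial k Q" "Xs \<in> VFs k" "i < k" "j < k" "i \<noteq> j" "Xs ! i = Xs ! j"
  shows "Q Xs p = 0"
proof -
  note t = assms(1)[unfolded tensorial_def, THEN conjunct2, THEN conjunct2, THEN conjunct2, rule_format, OF assms(2)]
  show ?thesis
  proof (cases "j < i")
    case True
    then show ?thesis using t[OF assms(3) True assms(6)] by simp
  next
    case False
    then have "i < j" using assms(5) by simp
    then show ?thesis using t[OF assms(4) _ assms(6)[symmetric]] by simp
  qed
qed

text \<open>The difference Z of the two fields vanishes at \<open>p\<close>. After multiplication by
  a bump it is a global combination of frame fields whose coefficients vanish at \<open>p\<close>,
  and linearity over functions pulls these coefficients out.\<close>

lemma tensorial_local_slot:
  assumes Q: "tensorial k Q" and Xs: "Xs \<in> VFs k" "i < k"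
    and X: "X \<in> vector_fields A" and Y: "Y \<in> vector_fields A" and e: "X p = Y p"
  shows "Q (Xs[i := X]) p = Q (Xs[i := Y]) p"
proof -
  define Z where "Z = X - Y"
  have Z: "Z \<in> vector_fields A" "Z p = 0" "X = Z + Y" using X Y e by (simp_all add: Z_def vector_field_diff)
  obtain U x E where p: "p \<in> U" and f: "chart_frame U x E" using chart_frame_exists by blast
  note D = chart_frameD[OF f]
  obtain \<beta> where b: "\<beta> \<in> \<C>" "\<beta> p = 1" "\<And>q. q \<notin> U \<Longrightarrow> \<beta> q = 0" using bump_exists[OF D(1) p] by blast
  \<comment> \<open>With the factor \<beta> the expansion of \<beta> Z in the fields
    \<open>E j\<close> holds everywhere, since off \<open>U\<close> both sides are 0.\<close>
  define g where "g j = (\<lambda>q. \<beta> q * Z q (x j))" for j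
  have g: "g j \<in> \<C>" if "j < mdim" for j
    unfolding g_def by (rule smooth_funs_mult[OF open_UNIV b(1) vector_field_smooth[OF Z(1) D(2)[OF that]]])
  define S where "S m = (\<lambda>q. \<Sum>j<m. g j q *\<^sub>R E j q)" for m
  have S: "S m \<in> vector_fields A \<and> Q (Xs[i := S m]) p = (\<Sum>j<m. g j p * Q (Xs[i := E j]) p)" if "m \<le> mdim" for m
    using that
  proof (induction m)
    case 0
    have s: "S 0 = (\<lambda>q. 0 *\<^sub>R Z q)" by (rule ext) (simp add: S_def)
    show ?case
      using tensorial_scale[OF Q Xs Z(1) smooth_funs_const[of 0], of p] vector_field_scale[OF smooth_funs_const[of 0] Z(1)]
      unfolding s by (simp only: lessThan_0 sum.empty mult_zero_left simp_thms)
  next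
    case (Suc m)
    have s: "S (Suc m) = S m + (\<lambda>q. g m q *\<^sub>R E m q)" by (simp add: S_def plus_fun_def)
    have m: "m < mdim" using Suc by simp
    have e: "(\<lambda>q. g m q *\<^sub>R E m q) \<in> vector_fields A" by (rule vector_field_scale[OF g[OF m] D(3)[OF m]])
    have "Q (Xs[i := S (Suc m)]) p = Q (Xs[i := S m]) p + Q (Xs[i := (\<lambda>q. g m q *\<^sub>R E m q)]) p"
      unfolding s using Suc e by (intro tensorial_add[OF Q Xs]) auto
    also have "Q (Xs[i := (\<lambda>q. g m q *\<^sub>R E m q)]) p = g m p * Q (Xs[i := E m]) p"
      by (rule tensorial_scale[OF Q Xs D(3)[OF m] g[OF m]])
    finally have q: "Q (Xs[i := S (Suc m)]) p = Q (Xs[i := S m]) p + g m p * Q (Xs[i := E m]) p" .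
    have IH: "S m \<in> vector_fields A" "Q (Xs[i := S m]) p = (\<Sum>j<m. g j p * Q (Xs[i := E j]) p)" using Suc by simp_all
    have "S (Suc m) \<in> vector_fields A" unfolding s by (rule vector_field_add[OF IH(1) e])
    then show ?case using q IH(2) by simp
  qed
  have "(\<lambda>q. \<beta> q *\<^sub>R Z q) = S mdim"
  proof
    fix q
    show "\<beta> q *\<^sub>R Z q = S mdim q"
    proof (cases "q \<in> U")
      case True
      have "Z q = (\<Sum>j<mdim. Z q (x j) *\<^sub>R E j q)" by (rule D(5)[OF True vector_field_tangent[OF Z(1)]])
      then have "\<beta> q *\<^sub>R Z q = \<beta> q *\<^sub>R (\<Sum>j<mdim. Z q (x j) *\<^sub>R E j q)" by (rule arg_cong)
      then show ?thesis by (simp add: S_def g_def scaleR_sum_right)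
    qed (simp add: S_def g_def b(3))
  qed
  then have "Q (Xs[i := Z]) p = (\<Sum>j<mdim. g j p * Q (Xs[i := E j]) p)"
    using tensorial_scale[OF Q Xs Z(1) b(1), of p] b(2) S[of mdim] by simp
  also have "... = 0" using Z(2) by (simp add: g_def)
  finally show ?thesis using tensorial_add[OF Q Xs Z(1) Y, of p] Z(3) by simp
qed

text \<open>The fields are exchanged one slot at a time, through the mixed lists
  \<open>take m Ys @ drop m Xs\<close>.\<close>

lemma tensorial_local:
  assumes Q: "tensorial k Q" and Xs: "Xs \<in> VFs k" and Ys: "Ys \<in> VFs k"
    and e: "map (\<lambda>X. X p) Xs = map (\<lambda>X. X p) Ys"
  shows "Q Xs p = Q Ys p"
proof -
  have "m \<le> k \<Longrightarrow> take m Ys @ drop m Xs \<in> VFs k \<and> Q (take m Ys @ drop m Xs) p = Q Xs p" for m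
  proof (induction m)
    case 0
    then show ?case using Xs by simp
  next
    case (Suc m)
    let ?Zs = "take m Ys @ drop m Xs"
    have l: "length Xs = k" "length Ys = k" using Xs Ys by (simp_all add: VFsD)
    have m: "m < k" using Suc by simp
    have 1: "take (Suc m) Ys @ drop (Suc m) Xs = ?Zs[m := Ys ! m]"
      using l m by (simp add: take_Suc_conv_app_nth list_update_append Cons_nth_drop_Suc[symmetric])
    have 2: "?Zs = ?Zs[m := Xs ! m]"
      using l m by (simp add: list_update_append Cons_nth_drop_Suc[symmetric])
    have Z: "?Zs \<in> VFs k" "Q ?Zs p = Q Xs p" using Suc by simp_all
    have "(Ys ! m) p = (Xs ! m) p" using arg_cong[OF e, of "\<lambda>l. l ! m"] l m by simp
    then have "Q (?Zs[m := Ys ! m]) p = Q (?Zs[m := Xs ! m]) p"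
      by (rule tensorial_local_slot[OF Q Z(1) m VFs_nth[OF Ys m] VFs_nth[OF Xs m]])
    then show ?case using 1 2 Z VFs_update[OF Z(1) VFs_nth[OF Ys m], of m] by simp
  qed
  from this[of k] show ?thesis using Xs Ys by (simp add: VFsD)
qed

definition ev :: "('a \<Rightarrow> 'a form) \<Rightarrow> ('a \<Rightarrow> 'a tvec) list \<Rightarrow> 'a \<Rightarrow> real"
  where "ev \<alpha> Xs p = \<alpha> p (map (\<lambda>X. X p) Xs)"

lemma form_alt: "\<alpha> \<in> forms A k \<Longrightarrow> \<alpha> p \<in> alt_maps k (tangent_space A p)"
  by (simp add: form_bundle_def)

lemma form_smooth: "\<alpha> \<in> forms A k \<Longrightarrow> Xs \<in> VFs k \<Longrightarrow> ev \<alpha> Xs \<in> \<C>"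
  by (simp add: form_bundle_def VFs_def ev_def[abs_def])

lemma formI:
  assumes "\<And>p. \<alpha> p \<in> alt_maps k (tangent_space A p)" "\<And>Xs. Xs \<in> VFs k \<Longrightarrow> ev \<alpha> Xs \<in> \<C>"
  shows "\<alpha> \<in> forms A k"
  using assms by (simp add: form_bundle_def VFs_def ev_def[abs_def])

lemma tensorial_ev:
  assumes a: "\<alpha> \<in> forms A k"
  shows "tensorial k (ev \<alpha>)"
proof (rule tensorialI)
  fix Xs assume Xs: "Xs \<in> VFs k"
  show "ev \<alpha> Xs \<in> \<C>" by (rule form_smooth[OF a Xs])
  note at = VFs_at[OF Xs]
  fix i p assume i: "i < k"
  {
    fix X Y assume X: "X \<in> vector_fields A" and Y: "Y \<in> vector_fields A"
    show "ev \<alpha> (Xs[i := X + Y]) p = ev \<alpha> (Xs[i := X]) p + ev \<alpha> (Xs[i := Y]) p"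
      using alt_add[OF form_alt[OF a] at i vector_field_tangent[OF X] vector_field_tangent[OF Y]]
      by (simp add: ev_def map_update)
  next
    fix X f assume X: "X \<in> vector_fields A"
    show "ev \<alpha> (Xs[i := (\<lambda>q. f q *\<^sub>R X q)]) p = f p * ev \<alpha> (Xs[i := X]) p"
      using alt_scale[OF form_alt[OF a] at i vector_field_tangent[OF X]]
      by (simp add: ev_def map_update)
  next
    fix j assume "j < i" "Xs ! i = Xs ! j"
    then show "ev \<alpha> Xs p = 0"
      using alt_eq_0[OF form_alt[OF a] at i, of j p] i VFsD(1)[OF Xs] by (simp add: ev_def)
  }
qed

lemma ev_swap:
  assumes a: "\<alpha> \<in> forms A k" and Xs: "Xs \<in> VFs k" and i: "i < k" "j < k" "i \<noteq> j"
    and X: "X \<in> vector_fields A" and Y: "Y \<in> vector_fields A"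
  shows "ev \<alpha> (Xs[i := X, j := Y]) p = - ev \<alpha> (Xs[i := Y, j := X]) p"
  using alt_swap[OF form_alt[OF a] subspace_tangent_space VFs_at[OF Xs] i vector_field_tangent[OF X] vector_field_tangent[OF Y]]
  by (simp add: ev_def map_update)

lemma ev_rotate:
  assumes a: "\<alpha> \<in> forms A k" and Xs: "Xs \<in> VFs k" and j: "j < k" and X: "X \<in> vector_fields A"
  shows "ev \<alpha> (X # delete_nth j Xs) p = (-1) ^ j * ev \<alpha> (Xs[j := X]) p"
  using alt_rotate[OF form_alt[OF a] subspace_tangent_space VFs_at[OF Xs] j vector_field_tangent[OF X]]
  by (simp add: ev_def map_update map_delete_nth)

lemma lifts:
  assumes "length vs = k" "set vs \<subseteq> tangent_space A p"
  shows "map (lift p) vs \<in> VFs k" "map (\<lambda>X. X p) (map (lift p) vs) = vs"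
  using assms lift by (auto simp: VFs_def intro!: map_idI)

lemma form_eqI:
  assumes a: "\<alpha> \<in> forms A k" "\<beta> \<in> forms A k" and e: "\<And>Xs p. Xs \<in> VFs k \<Longrightarrow> ev \<alpha> Xs p = ev \<beta> Xs p"
  shows "\<alpha> = \<beta>"
proof (intro ext)
  fix p vs
  show "\<alpha> p vs = \<beta> p vs"
  proof (cases "length vs = k \<and> set vs \<subseteq> tangent_space A p")
    case True
    then have l: "map (lift p) vs \<in> VFs k" "map (\<lambda>X. X p) (map (lift p) vs) = vs" using lifts by blast+
    show ?thesis using e[OF l(1), of p] unfolding ev_def l(2) .
  next
    case False
    then show ?thesis using alt_outside[OF form_alt[OF a(1)]] alt_outside[OF form_alt[OF a(2)]] by metis
  qed
qed

text \<open>The fields picked by \<open>SOME\<close> agree with \<open>Xs\<close> at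
  \<open>p\<close>, and locality makes the choice irrelevant.\<close>

lemma form_of_operator_ev:
  assumes Q: "tensorial k Q" and Xs: "Xs \<in> VFs k"
  shows "ev (form_of_operator A k Q) Xs p = Q Xs p"
proof -
  let ?P = "\<lambda>Ys. length Ys = k \<and> set Ys \<subseteq> vector_fields A \<and> map (\<lambda>X. X p) Ys = map (\<lambda>X. X p) Xs"
  have "\<exists>Ys. ?P Ys" using Xs by (intro exI[of _ Xs]) (simp add: VFsD)
  from someI_ex[OF this] have P: "?P (SOME Ys. ?P Ys)" .
  have "ev (form_of_operator A k Q) Xs p = Q (SOME Ys. ?P Ys) p"
    using VFs_at[OF Xs, of p] by (simp add: ev_def form_of_operator_def)
  also have "... = Q Xs p"
    using P by (intro tensorial_local[OF Q _ Xs]) (simp_all add: VFs_def)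
  finally show ?thesis .
qed

lemma form_of_operator_at:
  assumes Q: "tensorial k Q" and vs: "length vs = k" "set vs \<subseteq> tangent_space A p"
  shows "form_of_operator A k Q p vs = Q (map (lift p) vs) p"
  using form_of_operator_ev[OF Q lifts(1)[OF vs], of p] unfolding ev_def lifts(2)[OF vs] .

lemma form_of_operator_form:
  assumes Q: "tensorial k Q"
  shows "form_of_operator A k Q \<in> forms A k"
proof (rule formI)
  fix Xs assume "Xs \<in> VFs k"
  then have "ev (form_of_operator A k Q) Xs = Q Xs" using form_of_operator_ev[OF Q] by (intro ext)
  then show "ev (form_of_operator A k Q) Xs \<in> \<C>" using tensorial_smooth[OF Q \<open>Xs \<in> VFs k\<close>] by simp
next
  fix p
  let ?T = "tangent_space A p"
  show "form_of_operator A k Q p \<in> alt_maps k ?T"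
  proof (rule alt_mapsI)
    fix vs assume "\<not> (length vs = k \<and> set vs \<subseteq> ?T)"
    then show "form_of_operator A k Q p vs = 0" by (auto simp: form_of_operator_def)
  next
    fix vs i u w assume vs: "length vs = k" "set vs \<subseteq> ?T" and i: "i < k" and u: "u \<in> ?T" and w: "w \<in> ?T"
    note uw = subspace_add[OF subspace_tangent_space u w]
    have at: "form_of_operator A k Q p (vs[i := z]) = Q ((map (lift p) vs)[i := lift p z]) p" if "z \<in> ?T" for z
      using form_of_operator_at[OF Q, of "vs[i := z]" p] vs set_update_subset[OF vs(2) that] by (simp add: map_update)
    \<comment> \<open>The lift of a sum is in general not the sum of the lifts; the two fields agree
      at \<open>p\<close>, which is enough by locality.\<close>
    have "Q ((map (lift p) vs)[i := lift p (u + w)]) p = Q ((map (lift p) vs)[i := lift p u + lift p w]) p"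
      by (rule tensorial_local_slot[OF Q lifts(1)[OF vs] i lift(1)[OF uw] vector_field_add[OF lift(1)[OF u] lift(1)[OF w]]])
         (simp add: lift(2) u w uw)
    also have "... = Q ((map (lift p) vs)[i := lift p u]) p + Q ((map (lift p) vs)[i := lift p w]) p"
      by (rule tensorial_add[OF Q lifts(1)[OF vs] i lift(1)[OF u] lift(1)[OF w]])
    finally show "form_of_operator A k Q p (vs[i := u + w]) = form_of_operator A k Q p (vs[i := u]) + form_of_operator A k Q p (vs[i := w])"
      by (simp add: at u w uw)
  next
    fix vs i u c assume vs: "length vs = k" "set vs \<subseteq> ?T" and i: "i < k" and u: "u \<in> ?T"
    note cu = subspace_scale[OF subspace_tangent_space u, of c]
    have at: "form_of_operator A k Q p (vs[i := z]) = Q ((map (lift p) vs)[i := lift p z]) p" if "z \<in> ?T" for z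
      using form_of_operator_at[OF Q, of "vs[i := z]" p] vs set_update_subset[OF vs(2) that] by (simp add: map_update)
    have "Q ((map (lift p) vs)[i := lift p (c *\<^sub>R u)]) p = Q ((map (lift p) vs)[i := (\<lambda>q. (\<lambda>_. c) q *\<^sub>R lift p u q)]) p"
      by (rule tensorial_local_slot[OF Q lifts(1)[OF vs] i lift(1)[OF cu] vector_field_scale[OF smooth_funs_const lift(1)[OF u]]])
         (simp add: lift(2) u cu)
    also have "... = c * Q ((map (lift p) vs)[i := lift p u]) p"
      by (rule tensorial_scale[OF Q lifts(1)[OF vs] i lift(1)[OF u] smooth_funs_const])
    finally show "form_of_operator A k Q p (vs[i := c *\<^sub>R u]) = c * form_of_operator A k Q p (vs[i := u])"
      by (simp add: at u cu)
  next
    fix vs i j assume vs: "length vs = k" "set vs \<subseteq> ?T" and i: "j < i" "i < k" and e: "vs ! i = vs ! j"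
    show "form_of_operator A k Q p vs = 0"
      unfolding form_of_operator_at[OF Q vs]
      by (rule tensorial_eq_0[OF Q lifts(1)[OF vs], of i j]) (use vs i e in simp_all)
  qed
qed

lemma form_add: 
  assumes "\<alpha> \<in> forms A k" "\<beta> \<in> forms A k"
  shows "\<alpha> + \<beta> \<in> forms A k"
proof (rule formI)
  show "(\<alpha> + \<beta>) p \<in> alt_maps k (tangent_space A p)" for p
    using subspace_add[OF subspace_alt_maps form_alt[OF assms(1)] form_alt[OF assms(2)]] by simp
  show "ev (\<alpha> + \<beta>) Xs \<in> \<C>" if "Xs \<in> VFs k" for Xs
    using smooth_funs_add[OF open_UNIV form_smooth[OF assms(1) that] form_smooth[OF assms(2) that]]
    by (simp add: ev_def[abs_def])
qed

lemma form_scale: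
  assumes "f \<in> \<C>" "\<alpha> \<in> forms A k"
  shows "(\<lambda>p. f p *\<^sub>R \<alpha> p) \<in> forms A k"
proof (rule formI)
  show "f p *\<^sub>R \<alpha> p \<in> alt_maps k (tangent_space A p)" for p
    by (rule subspace_scale[OF subspace_alt_maps form_alt[OF assms(2)]])
  show "ev (\<lambda>p. f p *\<^sub>R \<alpha> p) Xs \<in> \<C>" if "Xs \<in> VFs k" for Xs
    using smooth_funs_mult[OF open_UNIV assms(1) form_smooth[OF assms(2) that]]
    by (simp add: ev_def[abs_def] scaleR_fun_def)
qed

lemma form_zero: "0 \<in> forms A k"
  by (rule formI) (simp_all add: subspace_0[OF subspace_alt_maps] ev_def[abs_def] smooth_funs_const)

lemma form_uminus: "\<alpha> \<in> forms A k \<Longrightarrow> - \<alpha> \<in> forms A k"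
  using form_scale[OF smooth_funs_const[of "-1"], of \<alpha>] by (simp add: fun_Compl_def)

lemma form_diff: "\<alpha> \<in> forms A k \<Longrightarrow> \<beta> \<in> forms A k \<Longrightarrow> \<alpha> - \<beta> \<in> forms A k"
  using form_add[OF _ form_uminus, of \<alpha> k \<beta>] by simp

lemma ev_add [simp]: "ev (\<alpha> + \<beta>) Xs p = ev \<alpha> Xs p + ev \<beta> Xs p"
  and ev_diff [simp]: "ev (\<alpha> - \<beta>) Xs p = ev \<alpha> Xs p - ev \<beta> Xs p"
  and ev_zero [simp]: "ev 0 Xs p = 0"
  and ev_scale [simp]: "ev (\<lambda>p. f p *\<^sub>R \<alpha> p) Xs p = f p * ev \<alpha> Xs p"
  by (simp_all add: ev_def scaleR_fun_def)

lemma ev_add_fun: "ev (\<alpha> + \<beta>) Xs = (\<lambda>p. ev \<alpha> Xs p + ev \<beta> Xs p)"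
  and ev_scale_fun: "ev (\<lambda>p. f p *\<^sub>R \<alpha> p) Xs = (\<lambda>p. f p * ev \<alpha> Xs p)"
  by (intro ext; simp)+

subsection \<open>Interior products\<close>

lemma interior_product_form:
  assumes "\<alpha> \<in> forms A (Suc k)" "X \<in> vector_fields A"
  shows "interior_product X \<alpha> \<in> forms A k"
proof (rule formI)
  show "interior_product X \<alpha> p \<in> alt_maps k (tangent_space A p)" for p
    unfolding interior_product_def by (rule alt_interior[OF form_alt[OF assms(1)] vector_field_tangent[OF assms(2)]])
  show "ev (interior_product X \<alpha>) Xs \<in> \<C>" if "Xs \<in> VFs k" for Xs
    using form_smooth[OF assms(1), of "X # Xs"] assms(2) that by (simp add: ev_def[abs_def] interior_product_def)
qed

lemma ev_interior_product: "ev (interior_product X \<alpha>) Xs = ev \<alpha> (X # Xs)"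
  by (simp add: ev_def[abs_def] interior_product_def)

text \<open>Reduces an identity in positive degree to contractions, one degree lower; it drives the
  inductions of the Cartan calculus.\<close>

lemma interior_product_eqI:
  assumes "\<alpha> \<in> forms A (Suc k)" "\<beta> \<in> forms A (Suc k)"
    and "\<And>Z. Z \<in> vector_fields A \<Longrightarrow> interior_product Z \<alpha> = interior_product Z \<beta>"
  shows "\<alpha> = \<beta>"
proof (rule form_eqI[OF assms(1,2)])
  fix Xs p assume "Xs \<in> VFs (Suc k)"
  then obtain Z Zs where "Xs = Z # Zs" "Z \<in> vector_fields A" by (rule VFs_SucE)
  then show "ev \<alpha> Xs p = ev \<beta> Xs p" using assms(3) by (metis ev_interior_product)
qed

lemma interior_product_add: "interior_product X (\<alpha> + \<beta>) = interior_product X \<alpha> + interior_product X \<beta>"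
  and interior_product_diff: "interior_product X (\<alpha> - \<beta>) = interior_product X \<alpha> - interior_product X \<beta>"
  and interior_product_scale: "interior_product X (\<lambda>p. f p *\<^sub>R \<alpha> p) = (\<lambda>p. f p *\<^sub>R interior_product X \<alpha> p)"
  by (intro ext; simp add: interior_product_def scaleR_fun_def)+

lemma interior_product_vadd:
  assumes a: "\<alpha> \<in> forms A (Suc k)" and X: "X \<in> vector_fields A" and Y: "Y \<in> vector_fields A"
  shows "interior_product (X + Y) \<alpha> = interior_product X \<alpha> + interior_product Y \<alpha>"
proof (rule form_eqI)
  fix Xs p assume Xs: "Xs \<in> VFs k"
  show "ev (interior_product (X + Y) \<alpha>) Xs p = ev (interior_product X \<alpha> + interior_product Y \<alpha>) Xs p"
    using tensorial_add[OF tensorial_ev[OF a], of "X # Xs" 0 X Y p] X Y Xs by (simp add: ev_interior_product)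
qed (intro form_add interior_product_form[OF a] vector_field_add X Y)+

lemma interior_product_vscale:
  assumes a: "\<alpha> \<in> forms A (Suc k)" and X: "X \<in> vector_fields A" and f: "f \<in> \<C>"
  shows "interior_product (\<lambda>p. f p *\<^sub>R X p) \<alpha> = (\<lambda>p. f p *\<^sub>R interior_product X \<alpha> p)"
proof (rule form_eqI)
  fix Xs p assume Xs: "Xs \<in> VFs k"
  show "ev (interior_product (\<lambda>p. f p *\<^sub>R X p) \<alpha>) Xs p = ev (\<lambda>p. f p *\<^sub>R interior_product X \<alpha> p) Xs p"
    using tensorial_scale[OF tensorial_ev[OF a], of "X # Xs" 0 X f p] X f Xs by (simp add: ev_interior_product)
qed (intro form_scale interior_product_form[OF a] vector_field_scale X f)+

lemma interior_product_self:
  assumes a: "\<alpha> \<in> forms A (Suc (Suc k))" and X: "X \<in> vector_fields A"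
  shows "interior_product X (interior_product X \<alpha>) = 0"
proof (rule form_eqI)
  fix Xs p assume Xs: "Xs \<in> VFs k"
  show "ev (interior_product X (interior_product X \<alpha>)) Xs p = ev 0 Xs p"
    using tensorial_eq_0[OF tensorial_ev[OF a], of "X # X # Xs" 0 1 p] X Xs by (simp add: ev_interior_product)
qed (intro form_zero interior_product_form[OF interior_product_form[OF a]] X)+

lemma tensorial_zero_slot:
  assumes "tensorial k Q" "Xs \<in> VFs k" "i < k"
  shows "Q (Xs[i := 0]) p = 0"
  using tensorial_add[OF assms vector_field_zero vector_field_zero, of p] by simp

lemma tensorial_swap:
  assumes Q: "tensorial k Q" and Xs: "Xs \<in> VFs k" "i < k" "j < k" "i \<noteq> j"
    and X: "X \<in> vector_fields A" and Y: "Y \<in> vector_fields A"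
  shows "Q (Xs[i := X, j := Y]) p = - Q (Xs[i := Y, j := X]) p"
proof -
  note XY = vector_field_add[OF X Y]
  note up = VFs_update[OF Xs(1)]
  have e: "Q (Xs[i := Z, j := Z]) p = 0" if "Z \<in> vector_fields A" for Z
    by (rule tensorial_eq_0[OF Q VFs_update[OF up[OF that] that] Xs(2-4)])
       (use Xs VFsD(1)[OF Xs(1)] in simp)
  have "0 = Q (Xs[i := X + Y, j := X + Y]) p" by (rule e[OF XY, symmetric])
  also have "... = Q (Xs[i := X + Y, j := X]) p + Q (Xs[i := X + Y, j := Y]) p"
    by (rule tensorial_add[OF Q up[OF XY] Xs(3) X Y])
  also have "Q (Xs[i := X + Y, j := X]) p = Q (Xs[j := X, i := X]) p + Q (Xs[j := X, i := Y]) p"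
    unfolding list_update_swap[OF Xs(4)] by (rule tensorial_add[OF Q up[OF X] Xs(2) X Y])
  also have "Q (Xs[i := X + Y, j := Y]) p = Q (Xs[j := Y, i := X]) p + Q (Xs[j := Y, i := Y]) p"
    unfolding list_update_swap[OF Xs(4)] by (rule tensorial_add[OF Q up[OF Y] Xs(2) X Y])
  finally show ?thesis
    using e[OF X] e[OF Y] by (simp add: list_update_swap[OF Xs(4)])
qed

subsection \<open>Lie derivative and exterior derivative\<close>

text \<open>\<open>lie_op\<close> and \<open>ext_op\<close> are the operators inside
  \<open>lie_derivative\<close> and \<open>ext_derivative\<close>, stated separately so that their
  tensoriality can be proved before they are treated as forms.\<close>

definition lie_op :: "nat \<Rightarrow> ('a \<Rightarrow> 'a tvec) \<Rightarrow> ('a \<Rightarrow> 'a form) \<Rightarrow> ('a \<Rightarrow> 'a tvec) list \<Rightarrow> 'a \<Rightarrow> real"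
  where "lie_op k X \<alpha> Ys p = X p (ev \<alpha> Ys) - (\<Sum>i<k. ev \<alpha> (Ys[i := lie_bracket X (Ys ! i)]) p)"

definition ext_op :: "nat \<Rightarrow> ('a \<Rightarrow> 'a form) \<Rightarrow> ('a \<Rightarrow> 'a tvec) list \<Rightarrow> 'a \<Rightarrow> real"
  where "ext_op k \<alpha> Xs p =
    (\<Sum>i\<le>k. (-1) ^ i * (Xs ! i) p (ev \<alpha> (delete_nth i Xs))) +
    (\<Sum>j\<le>k. \<Sum>i<j. (-1) ^ (i + j) * ev \<alpha> (lie_bracket (Xs ! i) (Xs ! j) # delete_nth i (delete_nth j Xs)) p)"

lemma lie_derivative_eq: "lie_derivative A k X \<alpha> = form_of_operator A k (lie_op k X \<alpha>)"
  by (simp add: lie_derivative_def lie_op_def[abs_def] ev_def[abs_def])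

lemma ext_derivative_eq: "ext_derivative A k \<alpha> = form_of_operator A (Suc k) (ext_op k \<alpha>)"
  by (simp add: ext_derivative_def ext_op_def[abs_def] ev_def[abs_def])

lemma lie_op_slot:
  assumes "length Ys = k" "j < k"
  shows "lie_op k X \<alpha> (Ys[j := Z]) p = X p (ev \<alpha> (Ys[j := Z])) - ev \<alpha> (Ys[j := lie_bracket X Z]) p -
    (\<Sum>i\<in>{..<k} - {j}. ev \<alpha> ((Ys[i := lie_bracket X (Ys ! i)])[j := Z]) p)"
proof -
  have "(\<Sum>i<k. ev \<alpha> ((Ys[j := Z])[i := lie_bracket X (Ys[j := Z] ! i)]) p) =
      ev \<alpha> (Ys[j := lie_bracket X Z]) p +
      (\<Sum>i\<in>{..<k} - {j}. ev \<alpha> ((Ys[j := Z])[i := lie_bracket X (Ys[j := Z] ! i)]) p)"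
    using assms by (subst sum.remove[of _ j]) auto
  also have "(\<Sum>i\<in>{..<k} - {j}. ev \<alpha> ((Ys[j := Z])[i := lie_bracket X (Ys[j := Z] ! i)]) p) =
      (\<Sum>i\<in>{..<k} - {j}. ev \<alpha> ((Ys[i := lie_bracket X (Ys ! i)])[j := Z]) p)"
    by (intro sum.cong) (auto simp: list_update_swap)
  finally show ?thesis by (simp add: lie_op_def)
qed

text \<open>For a multiple f U in one slot, the derivative of f along X occurs once from
  differentiating the value and once from the bracket of X with f U, and the two cancel. If entries
  i and j coincide, the summands at i and j cancel by a swap and every other summand still has two
  equal entries.\<close>

lemma tensorial_lie_op:
  assumes a: "\<alpha> \<in> forms A k" and X: "X \<in> vector_fields A"
  shows "tensorial k (lie_op k X \<alpha>)"
proof (rule tensorialI)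
  note t = tensorial_ev[OF a]
  note T = vector_field_tangent[OF X]
  fix Ys assume Ys: "Ys \<in> VFs k"
  note l = VFsD(1)[OF Ys]
  have up: "Ys[i := lie_bracket X (Ys ! i)] \<in> VFs k" if "i < k" for i
    by (rule VFs_update[OF Ys lie_bracket_vector_field[OF X VFs_nth[OF Ys that]]])
  have "(\<lambda>p. X p (ev \<alpha> Ys) - (\<Sum>i<k. ev \<alpha> (Ys[i := lie_bracket X (Ys ! i)]) p)) \<in> \<C>"
  proof (rule smooth_funs_diff[OF open_UNIV vector_field_smooth[OF X form_smooth[OF a Ys]] smooth_funs_sum[OF open_UNIV]])
    fix i assume "i \<in> {..<k}"
    then show "(\<lambda>p. ev \<alpha> (Ys[i := lie_bracket X (Ys ! i)]) p) \<in> \<C>" using form_smooth[OF a up] by simp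
  qed
  then show "lie_op k X \<alpha> Ys \<in> \<C>" by (simp add: lie_op_def[abs_def])
  fix j p assume j: "j < k"
  have other: "Ys[i := lie_bracket X (Ys ! i)] \<in> VFs k" if "i \<in> {..<k} - {j}" for i using up that by simp
  {
    fix U W assume U: "U \<in> vector_fields A" and W: "W \<in> vector_fields A"
    have e: "ev \<alpha> (Ys[j := U + W]) = (\<lambda>q. ev \<alpha> (Ys[j := U]) q + ev \<alpha> (Ys[j := W]) q)"
      by (rule ext) (rule tensorial_add[OF t Ys j U W])
    show "lie_op k X \<alpha> (Ys[j := U + W]) p = lie_op k X \<alpha> (Ys[j := U]) p + lie_op k X \<alpha> (Ys[j := W]) p"
      unfolding lie_op_slot[OF l j] lie_bracket_add[OF X U W]
        tensorial_add[OF t Ys j lie_bracket_vector_field[OF X U] lie_bracket_vector_field[OF X W]]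
      unfolding e tangentD(1)[OF T form_smooth[OF a VFs_update[OF Ys U]] form_smooth[OF a VFs_update[OF Ys W]]]
      using tensorial_add[OF t other j U W, of _ p] by (simp add: sum.distrib)
  next
    fix U f assume U: "U \<in> vector_fields A" and f: "f \<in> \<C>"
    have e: "ev \<alpha> (Ys[j := (\<lambda>q. f q *\<^sub>R U q)]) = (\<lambda>q. f q * ev \<alpha> (Ys[j := U]) q)"
      by (rule ext) (rule tensorial_scale[OF t Ys j U f])
    have b: "ev \<alpha> (Ys[j := lie_bracket X (\<lambda>q. f q *\<^sub>R U q)]) p =
        f p * ev \<alpha> (Ys[j := lie_bracket X U]) p + X p f * ev \<alpha> (Ys[j := U]) p"
      unfolding lie_bracket_scale[OF X U f]
        tensorial_add[OF t Ys j vector_field_scale[OF f lie_bracket_vector_field[OF X U]]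
          vector_field_scale[OF vector_field_smooth[OF X f] U]]
        tensorial_scale[OF t Ys j lie_bracket_vector_field[OF X U] f]
        tensorial_scale[OF t Ys j U vector_field_smooth[OF X f]] ..
    show "lie_op k X \<alpha> (Ys[j := (\<lambda>q. f q *\<^sub>R U q)]) p = f p * lie_op k X \<alpha> (Ys[j := U]) p"
      unfolding lie_op_slot[OF l j] b
      unfolding e tangentD(2)[OF T f form_smooth[OF a VFs_update[OF Ys U]]]
      using tensorial_scale[OF t other j U f, of _ p] by (simp add: sum_distrib_left algebra_simps)
  next
    fix i assume i: "i < j" and e: "Ys ! j = Ys ! i"
    have ik: "i < k" using i j by simp
    have "ev \<alpha> Ys = (\<lambda>q. 0)" by (rule ext) (rule tensorial_eq_0[OF t Ys j ik _ e], use i in simp)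
    then have 1: "X p (ev \<alpha> Ys) = 0" using tangent_const[OF T] by simp
    let ?t = "\<lambda>m. ev \<alpha> (Ys[m := lie_bracket X (Ys ! m)]) p"
    have "?t m = 0" if "m \<in> {..<k} - {i, j}" for m
      by (rule tensorial_eq_0[OF t up j ik]) (use that e i in auto)
    then have "(\<Sum>m<k. ?t m) = (\<Sum>m\<in>{i, j}. ?t m)"
      using ik j by (intro sum.mono_neutral_right) auto
    also have "... = ?t i + ?t j" using i by simp
    also have "?t i = ev \<alpha> (Ys[i := lie_bracket X (Ys ! j), j := Ys ! j]) p"
    proof -
      have "i \<noteq> j" using i by simp
      then have "Ys[i := lie_bracket X (Ys ! j), j := Ys ! j] = Ys[i := lie_bracket X (Ys ! j)]"
        by (simp only: list_update_swap[OF \<open>i \<noteq> j\<close>] list_update_id)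
      then show ?thesis using e by simp
    qed
    also have "... = - ev \<alpha> (Ys[i := Ys ! j, j := lie_bracket X (Ys ! j)]) p"
      by (rule ev_swap[OF a Ys ik j _ lie_bracket_vector_field[OF X VFs_nth[OF Ys j]] VFs_nth[OF Ys j]]) (use i in simp)
    also have "Ys[i := Ys ! j, j := lie_bracket X (Ys ! j)] = Ys[j := lie_bracket X (Ys ! j)]"
      unfolding e by simp
    finally show "lie_op k X \<alpha> Ys p = 0" using 1 by (simp add: lie_op_def)
  }
qed

lemma lie_derivative_form: "\<alpha> \<in> forms A k \<Longrightarrow> X \<in> vector_fields A \<Longrightarrow> lie_derivative A k X \<alpha> \<in> forms A k"
  unfolding lie_derivative_eq by (intro form_of_operator_form tensorial_lie_op)

lemma ev_lie_derivative:
  "\<alpha> \<in> forms A k \<Longrightarrow> X \<in> vector_fields A \<Longrightarrow> Ys \<in> VFs k \<Longrightarrow> ev (lie_derivative A k X \<alpha>) Ys p = lie_op k X \<alpha> Ys p"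
  unfolding lie_derivative_eq by (intro form_of_operator_ev tensorial_lie_op)

lemma lie_op_add:
  assumes "\<alpha> \<in> forms A k" "\<beta> \<in> forms A k" "X \<in> vector_fields A" "Ys \<in> VFs k"
  shows "lie_op k X (\<alpha> + \<beta>) Ys p = lie_op k X \<alpha> Ys p + lie_op k X \<beta> Ys p"
  using tangentD(1)[OF vector_field_tangent[OF assms(3)] form_smooth[OF assms(1,4)] form_smooth[OF assms(2,4)]]
  by (simp add: lie_op_def ev_add_fun sum.distrib)

lemma lie_op_scale:
  assumes "\<alpha> \<in> forms A k" "f \<in> \<C>" "X \<in> vector_fields A" "Ys \<in> VFs k"
  shows "lie_op k X (\<lambda>p. f p *\<^sub>R \<alpha> p) Ys p = f p * lie_op k X \<alpha> Ys p + X p f * ev \<alpha> Ys p"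
  using tangentD(2)[OF vector_field_tangent[OF assms(3)] assms(2) form_smooth[OF assms(1,4)]]
  by (simp add: lie_op_def ev_scale_fun sum_distrib_left algebra_simps)

lemma lie_op_vadd:
  assumes a: "\<alpha> \<in> forms A k" and X: "X \<in> vector_fields A" and Y: "Y \<in> vector_fields A" and Ys: "Ys \<in> VFs k"
  shows "lie_op k (X + Y) \<alpha> Ys p = lie_op k X \<alpha> Ys p + lie_op k Y \<alpha> Ys p"
proof -
  have "ev \<alpha> (Ys[i := lie_bracket (X + Y) (Ys ! i)]) p =
      ev \<alpha> (Ys[i := lie_bracket X (Ys ! i)]) p + ev \<alpha> (Ys[i := lie_bracket Y (Ys ! i)]) p" if i: "i < k" for i
  proof -
    note Z = VFs_nth[OF Ys i]
    have "lie_bracket (X + Y) (Ys ! i) = lie_bracket X (Ys ! i) + lie_bracket Y (Ys ! i)"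
      using lie_bracket_add[OF Z X Y] lie_bracket_antisym[of _ "Ys ! i"] by (metis minus_add_distrib)
    then show ?thesis
      using tensorial_add[OF tensorial_ev[OF a] Ys i lie_bracket_vector_field[OF X Z] lie_bracket_vector_field[OF Y Z]] by simp
  qed
  then show ?thesis by (simp add: lie_op_def sum.distrib)
qed

text \<open>The extra sum is the failure of linearity over functions in X. In
  \<open>tensorial_ext_op\<close> it cancels against the extra sum of
  \<open>ext_op_scale\<close>.\<close>

lemma lie_op_vscale:
  assumes a: "\<alpha> \<in> forms A k" and X: "X \<in> vector_fields A" and f: "f \<in> \<C>" and Ys: "Ys \<in> VFs k"
  shows "lie_op k (\<lambda>p. f p *\<^sub>R X p) \<alpha> Ys p =
    f p * lie_op k X \<alpha> Ys p + (\<Sum>i<k. (Ys ! i) p f * ev \<alpha> (Ys[i := X]) p)"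
proof -
  have "ev \<alpha> (Ys[i := lie_bracket (\<lambda>p. f p *\<^sub>R X p) (Ys ! i)]) p =
      f p * ev \<alpha> (Ys[i := lie_bracket X (Ys ! i)]) p - (Ys ! i) p f * ev \<alpha> (Ys[i := X]) p" if i: "i < k" for i
  proof -
    note Z = VFs_nth[OF Ys i]
    note t = tensorial_ev[OF a]
    have g: "(\<lambda>p. - (Ys ! i) p f) \<in> \<C>" by (rule smooth_funs_minus[OF open_UNIV vector_field_smooth[OF Z f]])
    show ?thesis
      unfolding lie_bracket_scale_left[OF X Z f]
        tensorial_add[OF t Ys i vector_field_scale[OF f lie_bracket_vector_field[OF X Z]] vector_field_scale[OF g X]]
        tensorial_scale[OF t Ys i lie_bracket_vector_field[OF X Z] f] tensorial_scale[OF t Ys i X g]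
      by simp
  qed
  then have "(\<Sum>i<k. ev \<alpha> (Ys[i := lie_bracket (\<lambda>p. f p *\<^sub>R X p) (Ys ! i)]) p) =
      (\<Sum>i<k. f p * ev \<alpha> (Ys[i := lie_bracket X (Ys ! i)]) p - (Ys ! i) p f * ev \<alpha> (Ys[i := X]) p)"
    by (intro sum.cong) (simp_all only: lessThan_iff)
  moreover have "(f p *\<^sub>R X p) (ev \<alpha> Ys) = f p * X p (ev \<alpha> Ys)" by (simp add: scaleR_fun_def)
  ultimately show ?thesis
    unfolding lie_op_def by (simp only: sum_subtractf sum_distrib_left right_diff_distrib)
qed

lemma ext_op_0: "X \<in> vector_fields A \<Longrightarrow> ext_op 0 \<alpha> [X] p = X p (ev \<alpha> [])"
  by (simp add: ext_op_def delete_nth_def)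

text \<open>Cartan's formula serves as a recursion from which alternation and tensoriality of the exterior
  derivative follow by induction on the degree.\<close>

lemma ext_op_Cons:
  assumes a: "\<alpha> \<in> forms A (Suc k)" and Y: "Y \<in> vector_fields A" and Xs: "Xs \<in> VFs (Suc k)"
  shows "ext_op (Suc k) \<alpha> (Y # Xs) p = lie_op (Suc k) Y \<alpha> Xs p - ext_op k (interior_product Y \<alpha>) Xs p"
proof -
  have 1: "(\<Sum>i\<le>Suc k. (-1) ^ i * ((Y # Xs) ! i) p (ev \<alpha> (delete_nth i (Y # Xs)))) =
      Y p (ev \<alpha> Xs) - (\<Sum>i\<le>k. (-1) ^ i * (Xs ! i) p (ev (interior_product Y \<alpha>) (delete_nth i Xs)))"
    unfolding sum.atMost_Suc_shift by (simp add: ev_interior_product sum_negf)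
  \<comment> \<open>Double-sum terms without a bracket with Y: moving Y in front of the bracket
    costs one sign and exhibits a contraction with Y.\<close>
  have sw: "ev \<alpha> (lie_bracket (Xs ! i) (Xs ! j) # Y # delete_nth i (delete_nth j Xs)) p =
      - ev (interior_product Y \<alpha>) (lie_bracket (Xs ! i) (Xs ! j) # delete_nth i (delete_nth j Xs)) p"
    if "i < j" "j \<le> k" for i j
  proof -
    have "k \<noteq> 0" using that by simp
    then obtain l where k: "k = Suc l" using not0_implies_Suc by blast
    let ?Z = "lie_bracket (Xs ! i) (Xs ! j)" and ?R = "delete_nth i (delete_nth j Xs)"
    have Z: "?Z \<in> vector_fields A" using that Xs by (intro lie_bracket_vector_field VFs_nth[OF Xs]) auto
    have R: "?R \<in> VFs l" using VFs_delete[OF VFs_delete[OF Xs[unfolded k], of j], of i] that k by simp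
    have "Y # Y # ?R \<in> VFs (Suc k)" using R Y k by simp
    from ev_swap[OF a this, of 0 1 ?Z Y p] Z Y k show ?thesis by (simp add: ev_interior_product)
  qed
  \<comment> \<open>Double-sum terms with a bracket with Y: rotation to slot j cancels their sign
    and yields the bracket terms of the Lie derivative.\<close>
  have rot: "ev \<alpha> (lie_bracket Y (Xs ! j) # delete_nth j Xs) p = (-1) ^ j * ev \<alpha> (Xs[j := lie_bracket Y (Xs ! j)]) p"
    if "j \<le> k" for j
    using that by (intro ev_rotate[OF a Xs] lie_bracket_vector_field Y VFs_nth[OF Xs]) auto
  have "(\<Sum>j\<le>Suc k. \<Sum>i<j. (-1) ^ (i + j) *
        ev \<alpha> (lie_bracket ((Y # Xs) ! i) ((Y # Xs) ! j) # delete_nth i (delete_nth j (Y # Xs))) p) =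
      (\<Sum>j\<le>k. (\<Sum>i<Suc j. (-1) ^ (i + Suc j) *
        ev \<alpha> (lie_bracket ((Y # Xs) ! i) (Xs ! j) # delete_nth i (Y # delete_nth j Xs)) p))"
    unfolding sum.atMost_Suc_shift by simp
  also have "... = (\<Sum>j\<le>k. - ev \<alpha> (Xs[j := lie_bracket Y (Xs ! j)]) p -
      (\<Sum>i<j. (-1) ^ (i + j) * ev (interior_product Y \<alpha>) (lie_bracket (Xs ! i) (Xs ! j) # delete_nth i (delete_nth j Xs)) p))"
  proof (rule sum.cong[OF refl])
    fix j assume "j \<in> {..k}"
    then have j: "j \<le> k" by simp
    have sq: "(-1 :: real) ^ j * ((-1) ^ j * c) = c" for c by (simp add: mult.assoc[symmetric] power_add[symmetric])
    have "(\<Sum>i<j. (-1) ^ (Suc i + Suc j) * ev \<alpha> (lie_bracket (Xs ! i) (Xs ! j) # Y # delete_nth i (delete_nth j Xs)) p) =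
        (\<Sum>i<j. - ((-1) ^ (i + j) * ev (interior_product Y \<alpha>) (lie_bracket (Xs ! i) (Xs ! j) # delete_nth i (delete_nth j Xs)) p))"
      by (rule sum.cong[OF refl]) (simp add: sw j)
    then show "(\<Sum>i<Suc j. (-1) ^ (i + Suc j) *
        ev \<alpha> (lie_bracket ((Y # Xs) ! i) (Xs ! j) # delete_nth i (Y # delete_nth j Xs)) p) =
      - ev \<alpha> (Xs[j := lie_bracket Y (Xs ! j)]) p -
      (\<Sum>i<j. (-1) ^ (i + j) * ev (interior_product Y \<alpha>) (lie_bracket (Xs ! i) (Xs ! j) # delete_nth i (delete_nth j Xs)) p)"
      unfolding sum.lessThan_Suc_shift by (simp add: rot[OF j] sq sum_negf)
  qed
  finally show ?thesis
    unfolding ext_op_def[of "Suc k"] 1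
    by (simp add: ext_op_def lie_op_def sum_subtractf sum_negf lessThan_Suc_atMost algebra_simps)
qed

lemma ext_op_add:
  assumes a: "\<alpha> \<in> forms A k" "\<beta> \<in> forms A k" and Xs: "Xs \<in> VFs (Suc k)"
  shows "ext_op k (\<alpha> + \<beta>) Xs p = ext_op k \<alpha> Xs p + ext_op k \<beta> Xs p"
proof -
  have "(Xs ! i) p (ev (\<alpha> + \<beta>) (delete_nth i Xs)) = (Xs ! i) p (ev \<alpha> (delete_nth i Xs)) + (Xs ! i) p (ev \<beta> (delete_nth i Xs))"
    if "i \<le> k" for i
    unfolding ev_add_fun using that
    by (intro tangentD(1)[OF vector_field_tangent[OF VFs_nth[OF Xs]]] form_smooth[OF a(1)] form_smooth[OF a(2)] VFs_delete[OF Xs]) auto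
  then show ?thesis by (simp add: ext_op_def sum.distrib algebra_simps)
qed

lemma ext_op_scale:
  assumes a: "\<alpha> \<in> forms A k" and f: "f \<in> \<C>" and Xs: "Xs \<in> VFs (Suc k)"
  shows "ext_op k (\<lambda>p. f p *\<^sub>R \<alpha> p) Xs p = f p * ext_op k \<alpha> Xs p + (\<Sum>i\<le>k. (-1) ^ i * (Xs ! i) p f * ev \<alpha> (delete_nth i Xs) p)"
proof -
  have "(Xs ! i) p (ev (\<lambda>p. f p *\<^sub>R \<alpha> p) (delete_nth i Xs)) =
      f p * (Xs ! i) p (ev \<alpha> (delete_nth i Xs)) + ev \<alpha> (delete_nth i Xs) p * (Xs ! i) p f"
    if "i \<le> k" for i
    unfolding ev_scale_fun using that
    by (intro tangentD(2)[OF vector_field_tangent[OF VFs_nth[OF Xs]] f] form_smooth[OF a(1)] VFs_delete[OF Xs]) auto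
  then show ?thesis
    by (simp add: ext_op_def sum.distrib sum_distrib_left algebra_simps)
qed

lemma tensorial_ext_op: "\<alpha> \<in> forms A k \<Longrightarrow> tensorial (Suc k) (ext_op k \<alpha>)"
proof (induction k arbitrary: \<alpha>)
  case 0
  have e: "ext_op 0 \<alpha> [X] = (\<lambda>p. X p (ev \<alpha> []))" if "X \<in> vector_fields A" for X
    by (rule ext) (rule ext_op_0[OF that])
  have s: "ev \<alpha> [] \<in> \<C>" using form_smooth[OF 0] by simp
  show ?case
  proof (rule tensorialI)
    fix Xs assume "Xs \<in> VFs (Suc 0)"
    then obtain Z where Z: "Xs = [Z]" "Z \<in> vector_fields A" by (elim VFs_SucE) simp
    show "ext_op 0 \<alpha> Xs \<in> \<C>" unfolding Z(1) e[OF Z(2)] by (rule vector_field_smooth[OF Z(2) s])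
    {
      fix i X Y p assume "i < Suc 0" "X \<in> vector_fields A" "Y \<in> vector_fields A"
      then show "ext_op 0 \<alpha> (Xs[i := X + Y]) p = ext_op 0 \<alpha> (Xs[i := X]) p + ext_op 0 \<alpha> (Xs[i := Y]) p"
        using Z by (simp add: ext_op_0 vector_field_add)
    next
      fix i X f p assume i: "i < Suc 0" and X: "X \<in> vector_fields A" and f: "f \<in> \<C>"
      have "ext_op 0 \<alpha> [\<lambda>q. f q *\<^sub>R X q] p = f p * ext_op 0 \<alpha> [X] p"
        unfolding ext_op_0[OF X] ext_op_0[OF vector_field_scale[OF f X]] by (simp add: scaleR_fun_def)
      then show "ext_op 0 \<alpha> (Xs[i := (\<lambda>q. f q *\<^sub>R X q)]) p = f p * ext_op 0 \<alpha> (Xs[i := X]) p"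
        using Z i by simp
    }
  qed simp
next
  case (Suc k)
  note a = Suc.prems
  have IH: "tensorial (Suc k) (ext_op k (interior_product Y \<alpha>))" if "Y \<in> vector_fields A" for Y
    by (rule Suc.IH[OF interior_product_form[OF a that]])
  have L: "tensorial (Suc k) (lie_op (Suc k) Y \<alpha>)" if "Y \<in> vector_fields A" for Y
    by (rule tensorial_lie_op[OF a that])
  show ?case
  proof (rule tensorialI)
    fix Zs assume "Zs \<in> VFs (Suc (Suc k))"
    then obtain Y Xs where Zs: "Zs = Y # Xs" and Y: "Y \<in> vector_fields A" and Xs: "Xs \<in> VFs (Suc k)"
      by (rule VFs_SucE)
    have "ext_op (Suc k) \<alpha> Zs = (\<lambda>p. lie_op (Suc k) Y \<alpha> Xs p - ext_op k (interior_product Y \<alpha>) Xs p)"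
      unfolding Zs by (rule ext) (rule ext_op_Cons[OF a Y Xs])
    then show "ext_op (Suc k) \<alpha> Zs \<in> \<C>"
      using smooth_funs_diff[OF open_UNIV tensorial_smooth[OF L[OF Y] Xs] tensorial_smooth[OF IH[OF Y] Xs]] by simp
    {
      fix i U W p assume i: "i < Suc (Suc k)" and U: "U \<in> vector_fields A" and W: "W \<in> vector_fields A"
      show "ext_op (Suc k) \<alpha> (Zs[i := U + W]) p = ext_op (Suc k) \<alpha> (Zs[i := U]) p + ext_op (Suc k) \<alpha> (Zs[i := W]) p"
      proof (cases i)
        case 0
        then show ?thesis
          using ext_op_add[OF interior_product_form[OF a U] interior_product_form[OF a W] Xs]
          by (simp add: Zs ext_op_Cons[OF a _ Xs] U W vector_field_add lie_op_vadd[OF a U W Xs] interior_product_vadd[OF a U W])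
      next
        case (Suc i')
        then have i': "i' < Suc k" using i by simp
        show ?thesis
          using tensorial_add[OF IH[OF Y] Xs i' U W] tensorial_add[OF L[OF Y] Xs i' U W]
          by (simp add: Zs Suc ext_op_Cons[OF a Y VFs_update[OF Xs]] U W vector_field_add)
      qed
    next
      fix i U f p assume i: "i < Suc (Suc k)" and U: "U \<in> vector_fields A" and f: "f \<in> \<C>"
      show "ext_op (Suc k) \<alpha> (Zs[i := (\<lambda>q. f q *\<^sub>R U q)]) p = f p * ext_op (Suc k) \<alpha> (Zs[i := U]) p"
      proof (cases i)
        case 0
        \<comment> \<open>The defect of the exterior derivative of f times the contracted form
          equals the defect of the Lie derivative along f U, after rotation of U back into slot
          i.\<close>
        have sums: "(\<Sum>i\<le>k. (-1) ^ i * (Xs ! i) p f * ev (interior_product U \<alpha>) (delete_nth i Xs) p) =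
            (\<Sum>i<Suc k. (Xs ! i) p f * ev \<alpha> (Xs[i := U]) p)"
          unfolding lessThan_Suc_atMost
        proof (rule sum.cong[OF refl])
          fix i assume "i \<in> {..k}"
          then have "ev (interior_product U \<alpha>) (delete_nth i Xs) p = (-1) ^ i * ev \<alpha> (Xs[i := U]) p"
            unfolding ev_interior_product by (intro ev_rotate[OF a Xs _ U]) simp
          then show "(-1) ^ i * (Xs ! i) p f * ev (interior_product U \<alpha>) (delete_nth i Xs) p = (Xs ! i) p f * ev \<alpha> (Xs[i := U]) p"
            by (simp add: mult.assoc[symmetric] mult.commute[of _ "(Xs ! i) p f"] power_add[symmetric])
        qed
        have "ext_op (Suc k) \<alpha> ((\<lambda>q. f q *\<^sub>R U q) # Xs) p = f p * ext_op (Suc k) \<alpha> (U # Xs) p"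
          unfolding ext_op_Cons[OF a U Xs] ext_op_Cons[OF a vector_field_scale[OF f U] Xs]
            lie_op_vscale[OF a U f Xs] interior_product_vscale[OF a U f]
            ext_op_scale[OF interior_product_form[OF a U] f Xs] sums
          by (simp add: right_diff_distrib)
        then show ?thesis using 0 Zs by simp
      next
        case (Suc i')
        then have i': "i' < Suc k" using i by simp
        show ?thesis
          using tensorial_scale[OF IH[OF Y] Xs i' U f, of p] tensorial_scale[OF L[OF Y] Xs i' U f, of p]
          by (simp add: Zs Suc ext_op_Cons[OF a Y VFs_update[OF Xs]] U f vector_field_scale algebra_simps)
      qed
    next
      fix i j p assume i: "i < Suc (Suc k)" "j < i" and e: "Zs ! i = Zs ! j"
      \<comment> \<open>Equal arguments behind the head: both terms of Cartan's formula are already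
        known to alternate in these arguments.\<close>
      have rest: "ext_op (Suc k) \<alpha> (Y' # Xs') p = 0"
        if "Y' \<in> vector_fields A" "Xs' \<in> VFs (Suc k)" "i' < Suc k" "j' < Suc k" "i' \<noteq> j'" "Xs' ! i' = Xs' ! j'" for Y' Xs' i' j'
        using tensorial_eq_0[OF IH[OF that(1)] that(2-6)] tensorial_eq_0[OF L[OF that(1)] that(2-6)]
        by (simp add: ext_op_Cons[OF a that(1,2)])
      \<comment> \<open>Equal leading arguments: applying Cartan's formula twice leaves only the
        exterior derivative of the double contraction with Y, which is 0. For k = 0 there is no
        second contraction, hence the separate case.\<close>
      have first: "ext_op (Suc k) \<alpha> (Y # Y # Ys) p = 0" if Ys: "Ys \<in> VFs k" for Ys
      proof (cases k)
        case 0
        then have "Ys = []" using Ys by simp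
        then show ?thesis
          using 0 a Y ext_op_Cons[OF a Y, of "[Y]" p] ext_op_0[OF Y]
          by (simp add: lie_op_def lie_bracket_self ev_interior_product
              tensorial_zero_slot[OF tensorial_ev[OF a], of "[Y]" 0, simplified])
      next
        case (Suc l)
        let ?b = "interior_product Y \<alpha>"
        have b: "?b \<in> forms A (Suc l)" using interior_product_form[OF a Y] Suc by simp
        have "lie_op (Suc k) Y \<alpha> (Y # Ys) p = lie_op k Y ?b Ys p"
          using tensorial_zero_slot[OF tensorial_ev[OF a], of "Y # Ys" 0 p] Y Ys
          unfolding lie_op_def sum.lessThan_Suc_shift by (simp add: ev_interior_product lie_bracket_self)
        moreover have "ext_op k ?b (Y # Ys) p = lie_op k Y ?b Ys p - ext_op l (interior_product Y ?b) Ys p"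
          using ext_op_Cons[OF b Y, of Ys p] Ys Suc by simp
        moreover have "interior_product Y ?b = 0"
          using interior_product_self[of \<alpha> l Y] a Y Suc by simp
        moreover have "ext_op l 0 Ys p = 0"
          using ext_op_add[OF form_zero[of l] form_zero[of l], of Ys p] Ys Suc by simp
        ultimately show ?thesis using Y Ys by (simp add: ext_op_Cons[OF a Y])
      qed
      show "ext_op (Suc k) \<alpha> Zs p = 0"
      proof (cases j)
        case (Suc j')
        then obtain i' where "i = Suc i'" using i by (cases i) auto
        then show ?thesis
          unfolding Zs using Suc i e Zs by (intro rest[OF Y Xs, of i' j']) auto
      next
        case 0
        obtain i' where i': "i = Suc i'" "i' < Suc k" using i 0 by (cases i) auto
        obtain W Ys where W: "Xs = W # Ys" "W \<in> vector_fields A" "Ys \<in> VFs k" using Xs by (rule VFs_SucE)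
        have e': "Xs ! i' = Y" using e 0 i' Zs by simp
        show ?thesis
        proof (cases i')
          case 0
          then show ?thesis using e' W first Zs by simp
        next
          case (Suc m)
          have Ym: "Ys ! m = Y" "m < k" using e' W Suc i' by simp_all
          \<comment> \<open>The second Y sits further back; exchanging it with W brings it next to
            the first. The swap is made in the two terms of Cartan's formula, which are tensorial in
            the tail.\<close>
          have "ext_op (Suc k) \<alpha> (Y # W # Ys) p = - ext_op (Suc k) \<alpha> (Y # Y # Ys[m := W]) p"
          proof -
            have s: "Q (Xs) p = - Q (Y # Ys[m := W]) p" if Q: "tensorial (Suc k) Q" for Q
            proof -
              have V: "Y # Ys[m := W] \<in> VFs (Suc k)" using Y W VFs_update by simp
              have Xs': "Xs[0 := W, Suc m := Y] = Xs" "Xs[0 := Y, Suc m := W] = Y # Ys[m := W]"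
                using W(1) Ym by (simp_all, metis list_update_id)
              show ?thesis
                using tensorial_swap[OF Q Xs, of 0 "Suc m" W Y p] Y W Ym(2) unfolding Xs' by simp
            qed
            have V: "Y # Ys[m := W] \<in> VFs (Suc k)" using Y W VFs_update by simp
            show ?thesis
              using s[OF IH[OF Y]] s[OF L[OF Y]] W(1)
              by (simp add: ext_op_Cons[OF a Y V] ext_op_Cons[OF a Y Xs[unfolded W(1)]])
          qed
          then show ?thesis using first[OF VFs_update[OF W(3,2)]] Zs W by simp
        qed
      qed
    }
  qed
qed

abbreviation (input) "LD \<equiv> lie_derivative A"
abbreviation (input) "dd \<equiv> ext_derivative A"
abbreviation (input) "ip \<equiv> interior_product"

lemma ext_derivative_form: "\<alpha> \<in> forms A k \<Longrightarrow> dd k \<alpha> \<in> forms A (Suc k)"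
  unfolding ext_derivative_eq by (intro form_of_operator_form tensorial_ext_op)

lemma ev_ext_derivative: "\<alpha> \<in> forms A k \<Longrightarrow> Xs \<in> VFs (Suc k) \<Longrightarrow> ev (dd k \<alpha>) Xs p = ext_op k \<alpha> Xs p"
  unfolding ext_derivative_eq by (intro form_of_operator_ev tensorial_ext_op)

subsection \<open>The Cartan calculus\<close>

lemma cartan:
  assumes a: "\<alpha> \<in> forms A (Suc k)" and Y: "Y \<in> vector_fields A"
  shows "ip Y (dd (Suc k) \<alpha>) = LD (Suc k) Y \<alpha> - dd k (ip Y \<alpha>)"
proof (rule form_eqI)
  fix Xs p assume Xs: "Xs \<in> VFs (Suc k)"
  then show "ev (ip Y (dd (Suc k) \<alpha>)) Xs p = ev (LD (Suc k) Y \<alpha> - dd k (ip Y \<alpha>)) Xs p"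
    using ext_op_Cons[OF a Y Xs, of p] Y
    by (simp add: ev_interior_product ev_ext_derivative[OF a] ev_lie_derivative[OF a Y] ev_ext_derivative[OF interior_product_form[OF a Y]])
qed (intro form_diff interior_product_form ext_derivative_form lie_derivative_form a Y)+

lemma cartan_0:
  assumes a: "\<alpha> \<in> forms A 0" and Y: "Y \<in> vector_fields A"
  shows "ip Y (dd 0 \<alpha>) = LD 0 Y \<alpha>"
proof (rule form_eqI)
  fix Xs p assume "Xs \<in> VFs 0"
  then show "ev (ip Y (dd 0 \<alpha>)) Xs p = ev (LD 0 Y \<alpha>) Xs p"
    using Y by (simp add: ev_interior_product ev_ext_derivative[OF a] ev_lie_derivative[OF a Y] ext_op_0 lie_op_def)
qed (intro interior_product_form ext_derivative_form lie_derivative_form a Y)+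

lemma lie_derivative_add:
  assumes "\<alpha> \<in> forms A k" "\<beta> \<in> forms A k" "X \<in> vector_fields A"
  shows "LD k X (\<alpha> + \<beta>) = LD k X \<alpha> + LD k X \<beta>"
  by (rule form_eqI[of _ k])
     (simp_all add: assms form_add lie_derivative_form ev_lie_derivative lie_op_add)

lemma lie_derivative_diff:
  assumes "\<alpha> \<in> forms A k" "\<beta> \<in> forms A k" "X \<in> vector_fields A"
  shows "LD k X (\<alpha> - \<beta>) = LD k X \<alpha> - LD k X \<beta>"
  using lie_derivative_add[OF form_diff[OF assms(1,2)] assms(2,3)] by (simp add: algebra_simps)

lemma lie_derivative_vadd:
  assumes "\<alpha> \<in> forms A k" "X \<in> vector_fields A" "Y \<in> vector_fields A"
  shows "LD k (X + Y) \<alpha> = LD k X \<alpha> + LD k Y \<alpha>"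
  by (rule form_eqI[of _ k])
     (simp_all add: assms form_add vector_field_add lie_derivative_form ev_lie_derivative lie_op_vadd)

lemma lie_derivative_scale:
  assumes "\<alpha> \<in> forms A k" "f \<in> \<C>" "X \<in> vector_fields A"
  shows "LD k X (\<lambda>p. f p *\<^sub>R \<alpha> p) = (\<lambda>p. f p *\<^sub>R LD k X \<alpha> p) + (\<lambda>p. X p f *\<^sub>R \<alpha> p)"
proof (rule form_eqI[of _ k])
  fix Xs p assume "Xs \<in> VFs k"
  then show "ev (LD k X (\<lambda>p. f p *\<^sub>R \<alpha> p)) Xs p = ev ((\<lambda>p. f p *\<^sub>R LD k X \<alpha> p) + (\<lambda>p. X p f *\<^sub>R \<alpha> p)) Xs p"
    unfolding ev_add ev_scale ev_lie_derivative[OF form_scale[OF assms(2,1)] assms(3) \<open>Xs \<in> VFs k\<close>]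
      ev_lie_derivative[OF assms(1,3) \<open>Xs \<in> VFs k\<close>]
    by (rule lie_op_scale[OF assms])
qed (intro form_add form_scale lie_derivative_form assms vector_field_smooth[OF assms(3,2)])+

lemma ext_derivative_add:
  assumes "\<alpha> \<in> forms A k" "\<beta> \<in> forms A k"
  shows "dd k (\<alpha> + \<beta>) = dd k \<alpha> + dd k \<beta>"
  by (rule form_eqI[of _ "Suc k"])
     (simp_all add: assms form_add ext_derivative_form ev_ext_derivative ext_op_add)

lemma ext_derivative_diff:
  assumes "\<alpha> \<in> forms A k" "\<beta> \<in> forms A k"
  shows "dd k (\<alpha> - \<beta>) = dd k \<alpha> - dd k \<beta>"
  using ext_derivative_add[OF form_diff[OF assms] assms(2)] by (simp add: algebra_simps)

text \<open>This is \<open>df \<and> \<alpha>\<close>, obtained as the defect of the Leibniz rule instead of from a wedge product of forms.\<close>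

definition d_wedge :: "nat \<Rightarrow> ('a \<Rightarrow> real) \<Rightarrow> ('a \<Rightarrow> 'a form) \<Rightarrow> 'a \<Rightarrow> 'a form"
  where "d_wedge k f \<alpha> = dd k (\<lambda>p. f p *\<^sub>R \<alpha> p) - (\<lambda>p. f p *\<^sub>R dd k \<alpha> p)"

lemma ext_derivative_scale: "dd k (\<lambda>p. f p *\<^sub>R \<alpha> p) = (\<lambda>p. f p *\<^sub>R dd k \<alpha> p) + d_wedge k f \<alpha>"
  by (simp add: d_wedge_def)

lemma d_wedge_form: "f \<in> \<C> \<Longrightarrow> \<alpha> \<in> forms A k \<Longrightarrow> d_wedge k f \<alpha> \<in> forms A (Suc k)"
  unfolding d_wedge_def by (intro form_diff form_scale ext_derivative_form)

lemma ev_d_wedge: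
  assumes a: "\<alpha> \<in> forms A k" and f: "f \<in> \<C>" and Xs: "Xs \<in> VFs (Suc k)"
  shows "ev (d_wedge k f \<alpha>) Xs p = (\<Sum>i\<le>k. (-1) ^ i * (Xs ! i) p f * ev \<alpha> (delete_nth i Xs) p)"
  unfolding d_wedge_def ev_diff ev_scale ev_ext_derivative[OF a Xs] ev_ext_derivative[OF form_scale[OF f a] Xs]
    ext_op_scale[OF a f Xs] by simp

lemma d_wedge_const:
  assumes "\<alpha> \<in> forms A k"
  shows "d_wedge k (\<lambda>_. c) \<alpha> = 0"
proof (rule form_eqI)
  fix Xs p assume Xs: "Xs \<in> VFs (Suc k)"
  have "(\<Sum>i\<le>k. (-1) ^ i * (Xs ! i) p (\<lambda>_. c) * ev \<alpha> (delete_nth i Xs) p) = 0"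
    using tangent_const[OF vector_field_tangent[OF VFs_nth[OF Xs]]] by (intro sum.neutral) auto
  then show "ev (d_wedge k (\<lambda>_. c) \<alpha>) Xs p = ev 0 Xs p"
    unfolding ev_d_wedge[OF assms smooth_funs_const Xs] by simp
qed (intro d_wedge_form smooth_funs_const assms form_zero)+

lemma lie_derivative_vscale:
  assumes a: "\<alpha> \<in> forms A (Suc k)" and f: "f \<in> \<C>" and X: "X \<in> vector_fields A"
  shows "LD (Suc k) (\<lambda>p. f p *\<^sub>R X p) \<alpha> = (\<lambda>p. f p *\<^sub>R LD (Suc k) X \<alpha> p) + d_wedge k f (ip X \<alpha>)"
proof -
  have "LD (Suc k) (\<lambda>p. f p *\<^sub>R X p) \<alpha> = ip (\<lambda>p. f p *\<^sub>R X p) (dd (Suc k) \<alpha>) + dd k (ip (\<lambda>p. f p *\<^sub>R X p) \<alpha>)"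
    by (simp add: cartan[OF a vector_field_scale[OF f X]])
  also have "ip (\<lambda>p. f p *\<^sub>R X p) (dd (Suc k) \<alpha>) = (\<lambda>p. f p *\<^sub>R (LD (Suc k) X \<alpha> - dd k (ip X \<alpha>)) p)"
    unfolding interior_product_vscale[OF ext_derivative_form[OF a] X f] cartan[OF a X] ..
  also have "dd k (ip (\<lambda>p. f p *\<^sub>R X p) \<alpha>) = (\<lambda>p. f p *\<^sub>R dd k (ip X \<alpha>) p) + d_wedge k f (ip X \<alpha>)"
    unfolding interior_product_vscale[OF a X f] ext_derivative_scale ..
  finally show ?thesis by (simp add: fun_eq_iff scaleR_fun_def algebra_simps)
qed

text \<open>The commutator of Lie derivative and contraction: the slot 0 summand of
  \<open>lie_op\<close> is the contraction with the bracket.\<close>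

lemma interior_product_lie_derivative:
  assumes a: "\<alpha> \<in> forms A (Suc k)" and X: "X \<in> vector_fields A" and Y: "Y \<in> vector_fields A"
  shows "ip Y (LD (Suc k) X \<alpha>) = LD k X (ip Y \<alpha>) - ip (lie_bracket X Y) \<alpha>"
proof (rule form_eqI)
  fix Xs p assume Xs: "Xs \<in> VFs k"
  have YXs: "Y # Xs \<in> VFs (Suc k)" using Y Xs by simp
  show "ev (ip Y (LD (Suc k) X \<alpha>)) Xs p = ev (LD k X (ip Y \<alpha>) - ip (lie_bracket X Y) \<alpha>) Xs p"
    unfolding ev_diff ev_interior_product ev_lie_derivative[OF a X YXs]
      ev_lie_derivative[OF interior_product_form[OF a Y] X Xs] lie_op_def sum.lessThan_Suc_shift
    by simp
qed (intro form_diff interior_product_form lie_derivative_form lie_bracket_vector_field a X Y)+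

text \<open>Degree 0 is the definition of the bracket. In higher degree, contraction with Z gives
  the same identity for the contracted form, and the leftover contractions match by the Jacobi
  identity.\<close>

lemma lie_derivative_commutator:
  assumes "\<alpha> \<in> forms A k" and X: "X \<in> vector_fields A" and Y: "Y \<in> vector_fields A"
  shows "LD k X (LD k Y \<alpha>) = LD k (lie_bracket X Y) \<alpha> + LD k Y (LD k X \<alpha>)"
  using assms(1)
proof (induction k arbitrary: \<alpha>)
  case 0
  note XY = lie_bracket_vector_field[OF X Y]
  have e: "ev (LD 0 Z \<beta>) [] = (\<lambda>p. Z p (ev \<beta> []))" if "Z \<in> vector_fields A" "\<beta> \<in> forms A 0" for Z \<beta>
    by (rule ext) (simp add: ev_lie_derivative that lie_op_def)
  show ?case
  proof (rule form_eqI)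
    fix Xs p assume "Xs \<in> VFs 0"
    then show "ev (LD 0 X (LD 0 Y \<alpha>)) Xs p = ev (LD 0 (lie_bracket X Y) \<alpha> + LD 0 Y (LD 0 X \<alpha>)) Xs p"
      by (simp add: e 0 X Y XY lie_derivative_form) (simp add: lie_bracket_def)
  qed (intro form_add lie_derivative_form 0 X Y XY)+
next
  case (Suc k)
  note a = Suc.prems
  note XY = lie_bracket_vector_field[OF X Y]
  show ?case
  proof (rule interior_product_eqI[where k = k])
    fix Z assume Z: "Z \<in> vector_fields A"
    note YZ = lie_bracket_vector_field[OF Y Z] and XZ = lie_bracket_vector_field[OF X Z]
    note i = interior_product_form[OF a]
    have j: "ip (lie_bracket X (lie_bracket Y Z)) \<alpha> =
        ip (lie_bracket (lie_bracket X Y) Z) \<alpha> + ip (lie_bracket Y (lie_bracket X Z)) \<alpha>"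
      unfolding jacobi[OF X Y Z]
      by (rule interior_product_vadd[OF a lie_bracket_vector_field[OF XY Z] lie_bracket_vector_field[OF Y XZ]])
    have 1: "ip Z (LD (Suc k) X (LD (Suc k) Y \<alpha>)) = LD k X (LD k Y (ip Z \<alpha>)) - LD k X (ip (lie_bracket Y Z) \<alpha>)
        - (LD k Y (ip (lie_bracket X Z) \<alpha>) - ip (lie_bracket Y (lie_bracket X Z)) \<alpha>)"
      unfolding interior_product_lie_derivative[OF lie_derivative_form[OF a Y] X Z]
        interior_product_lie_derivative[OF a Y Z] interior_product_lie_derivative[OF a Y XZ]
        lie_derivative_diff[OF lie_derivative_form[OF i[OF Z] Y] i[OF YZ] X] ..
    have 2: "ip Z (LD (Suc k) Y (LD (Suc k) X \<alpha>)) = LD k Y (LD k X (ip Z \<alpha>)) - LD k Y (ip (lie_bracket X Z) \<alpha>)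
        - (LD k X (ip (lie_bracket Y Z) \<alpha>) - ip (lie_bracket X (lie_bracket Y Z)) \<alpha>)"
      unfolding interior_product_lie_derivative[OF lie_derivative_form[OF a X] Y Z]
        interior_product_lie_derivative[OF a X Z] interior_product_lie_derivative[OF a X YZ]
        lie_derivative_diff[OF lie_derivative_form[OF i[OF Z] X] i[OF XZ] Y] ..
    have 3: "ip Z (LD (Suc k) (lie_bracket X Y) \<alpha>) = LD k (lie_bracket X Y) (ip Z \<alpha>) - ip (lie_bracket (lie_bracket X Y) Z) \<alpha>"
      by (rule interior_product_lie_derivative[OF a XY Z])
    show "ip Z (LD (Suc k) X (LD (Suc k) Y \<alpha>)) = ip Z (LD (Suc k) (lie_bracket X Y) \<alpha> + LD (Suc k) Y (LD (Suc k) X \<alpha>))"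
      unfolding interior_product_add 1 2 3 Suc.IH[OF i[OF Z]] j by (simp add: algebra_simps)
  qed (intro form_add lie_derivative_form a X Y XY)+
qed

text \<open>Contraction with Z and Cartan's formula reduce the claim to the commutator of Lie
  derivatives and to one degree lower.\<close>

lemma lie_derivative_ext_derivative:
  assumes "\<alpha> \<in> forms A k" and X: "X \<in> vector_fields A"
  shows "LD (Suc k) X (dd k \<alpha>) = dd k (LD k X \<alpha>)"
  using assms(1)
proof (induction k arbitrary: \<alpha>)
  case 0
  show ?case
  proof (rule interior_product_eqI[where k = 0])
    fix Z assume Z: "Z \<in> vector_fields A"
    note XZ = lie_bracket_vector_field[OF X Z]
    show "ip Z (LD (Suc 0) X (dd 0 \<alpha>)) = ip Z (dd 0 (LD 0 X \<alpha>))"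
      unfolding interior_product_lie_derivative[OF ext_derivative_form[OF 0] X Z] cartan_0[OF 0 Z] cartan_0[OF 0 XZ]
        cartan_0[OF lie_derivative_form[OF 0 X] Z] lie_derivative_commutator[OF 0 X Z] by simp
  qed (intro lie_derivative_form ext_derivative_form 0 X)+
next
  case (Suc k)
  note a = Suc.prems
  show ?case
  proof (rule interior_product_eqI[where k = "Suc k"])
    fix Z assume Z: "Z \<in> vector_fields A"
    note XZ = lie_bracket_vector_field[OF X Z]
    note i = interior_product_form[OF a]
    have 1: "ip Z (LD (Suc (Suc k)) X (dd (Suc k) \<alpha>)) = LD (Suc k) X (LD (Suc k) Z \<alpha>) - dd k (LD k X (ip Z \<alpha>))
        - (LD (Suc k) (lie_bracket X Z) \<alpha> - dd k (ip (lie_bracket X Z) \<alpha>))"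
      unfolding interior_product_lie_derivative[OF ext_derivative_form[OF a] X Z] cartan[OF a Z] cartan[OF a XZ]
        lie_derivative_diff[OF lie_derivative_form[OF a Z] ext_derivative_form[OF i[OF Z]] X] Suc.IH[OF i[OF Z]] ..
    have 2: "ip Z (dd (Suc k) (LD (Suc k) X \<alpha>)) = LD (Suc k) Z (LD (Suc k) X \<alpha>) -
        (dd k (LD k X (ip Z \<alpha>)) - dd k (ip (lie_bracket X Z) \<alpha>))"
      unfolding cartan[OF lie_derivative_form[OF a X] Z] interior_product_lie_derivative[OF a X Z]
        ext_derivative_diff[OF lie_derivative_form[OF i[OF Z] X] i[OF XZ]] ..
    show "ip Z (LD (Suc (Suc k)) X (dd (Suc k) \<alpha>)) = ip Z (dd (Suc k) (LD (Suc k) X \<alpha>))"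
      unfolding 1 2 lie_derivative_commutator[OF a X Z] by (simp add: algebra_simps)
  qed (intro lie_derivative_form ext_derivative_form a X)+
qed

text \<open>By Cartan's formula and commutation with Lie derivatives, contracting dd\<alpha> with Z
  gives dd of the contraction of \<alpha> with Z, which is 0 by induction.\<close>

lemma ext_derivative_squared:
  assumes "\<alpha> \<in> forms A k"
  shows "dd (Suc k) (dd k \<alpha>) = 0"
  using assms
proof (induction k arbitrary: \<alpha>)
  case 0
  show ?case
  proof (rule interior_product_eqI[where k = "Suc 0"])
    fix Z assume Z: "Z \<in> vector_fields A"
    show "ip Z (dd (Suc 0) (dd 0 \<alpha>)) = ip Z 0"
      unfolding cartan[OF ext_derivative_form[OF 0] Z] lie_derivative_ext_derivative[OF 0 Z] cartan_0[OF 0 Z]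
      by (simp add: interior_product_def zero_fun_def)
  qed (intro ext_derivative_form form_zero 0)+
next
  case (Suc k)
  note a = Suc.prems
  show ?case
  proof (rule interior_product_eqI[where k = "Suc (Suc k)"])
    fix Z assume Z: "Z \<in> vector_fields A"
    note i = interior_product_form[OF a Z]
    show "ip Z (dd (Suc (Suc k)) (dd (Suc k) \<alpha>)) = ip Z 0"
      unfolding cartan[OF ext_derivative_form[OF a] Z] lie_derivative_ext_derivative[OF a Z] cartan[OF a Z]
        ext_derivative_diff[OF lie_derivative_form[OF a Z] ext_derivative_form[OF i]] Suc.IH[OF i]
      by (simp add: interior_product_def zero_fun_def)
  qed (intro ext_derivative_form form_zero a)+
qed

subsection \<open>The Dorfman bracket\<close>

abbreviation (input) "GTB \<equiv> generalized_tangent_bundle A"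

lemma GTB_section: "s \<in> global_sections (GTB n) \<longleftrightarrow>
    (\<lambda>p. fst (s p)) \<in> vector_fields A \<and> (\<lambda>p. snd (s p)) \<in> forms A n"
  by (simp add: generalized_tangent_bundle_def direct_sum_def)

lemma GTB_pair: "X \<in> vector_fields A \<Longrightarrow> \<alpha> \<in> forms A n \<Longrightarrow> (\<lambda>p. (X p, \<alpha> p)) \<in> global_sections (GTB n)"
  by (simp add: GTB_section)

text \<open>Cartan's formula merges the last two terms of the bracket into one contraction of
  d\<alpha>, which makes linearity over functions in Y visible.\<close>

lemma dorfman_pair:
  assumes "\<alpha> \<in> forms A (Suc m)" "Y \<in> vector_fields A"
  shows "dorfman A (Suc m) (\<lambda>p. (X p, \<alpha> p)) (\<lambda>p. (Y p, \<beta> p)) =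
    (\<lambda>p. (lie_bracket X Y p, (LD (Suc m) X \<beta> - ip Y (dd (Suc m) \<alpha>)) p))"
  unfolding cartan[OF assms] by (simp add: dorfman_def Let_def fun_eq_iff)

lemma GTB_sectionE:
  assumes "s \<in> global_sections (GTB n)"
  obtains X \<alpha> where "X \<in> vector_fields A" "\<alpha> \<in> forms A n" "s = (\<lambda>p. (X p, \<alpha> p))"
proof
  show "(\<lambda>p. fst (s p)) \<in> vector_fields A" "(\<lambda>p. snd (s p)) \<in> forms A n" "s = (\<lambda>p. (fst (s p), snd (s p)))"
    using assms by (simp_all add: GTB_section)
qed

lemma dorfman_form:
  assumes "X \<in> vector_fields A" "Y \<in> vector_fields A" "\<alpha> \<in> forms A (Suc m)" "\<beta> \<in> forms A (Suc m)"
  shows "LD (Suc m) X \<beta> - ip Y (dd (Suc m) \<alpha>) \<in> forms A (Suc m)"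
  by (intro form_diff lie_derivative_form interior_product_form ext_derivative_form assms)

text \<open>The form part of the Leibniz identity: all terms are brought to compositions of two Lie
  derivatives, or of a Lie derivative with a contraction of an exact form, and compared.\<close>

lemma dorfman_leibniz:
  assumes X: "X \<in> vector_fields A" and Y: "Y \<in> vector_fields A" and Z: "Z \<in> vector_fields A"
    and a: "\<alpha> \<in> forms A (Suc m)" and b: "\<beta> \<in> forms A (Suc m)" and c: "\<gamma> \<in> forms A (Suc m)"
  shows "LD (Suc m) X (LD (Suc m) Y \<gamma> - ip Z (dd (Suc m) \<beta>)) - ip (lie_bracket Y Z) (dd (Suc m) \<alpha>) =
    (LD (Suc m) (lie_bracket X Y) \<gamma> - ip Z (dd (Suc m) (LD (Suc m) X \<beta> - ip Y (dd (Suc m) \<alpha>)))) +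
    (LD (Suc m) Y (LD (Suc m) X \<gamma> - ip Z (dd (Suc m) \<alpha>)) - ip (lie_bracket X Z) (dd (Suc m) \<beta>))"
proof -
  let ?n = "Suc m"
  note da = ext_derivative_form[OF a] and db = ext_derivative_form[OF b]
  have 1: "LD ?n X (LD ?n Y \<gamma> - ip Z (dd ?n \<beta>)) = LD ?n (lie_bracket X Y) \<gamma> + LD ?n Y (LD ?n X \<gamma>) - LD ?n X (ip Z (dd ?n \<beta>))"
    unfolding lie_derivative_diff[OF lie_derivative_form[OF c Y] interior_product_form[OF db Z] X]
      lie_derivative_commutator[OF c X Y] ..
  have 2: "LD ?n Y (LD ?n X \<gamma> - ip Z (dd ?n \<alpha>)) = LD ?n Y (LD ?n X \<gamma>) - LD ?n Y (ip Z (dd ?n \<alpha>))"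
    by (rule lie_derivative_diff[OF lie_derivative_form[OF c X] interior_product_form[OF da Z] Y])
  \<comment> \<open>Cartan's formula for the closed form d\<alpha>.\<close>
  have dLY: "dd ?n (ip Y (dd ?n \<alpha>)) = LD (Suc ?n) Y (dd ?n \<alpha>)"
  proof -
    have "ip Y (dd (Suc ?n) (dd ?n \<alpha>)) = LD (Suc ?n) Y (dd ?n \<alpha>) - dd ?n (ip Y (dd ?n \<alpha>))"
      by (rule cartan[OF da Y])
    moreover have "ip Y 0 = 0" by (simp add: interior_product_def zero_fun_def)
    ultimately show ?thesis unfolding ext_derivative_squared[OF a] by simp
  qed
  have 3: "ip Z (dd ?n (LD ?n X \<beta> - ip Y (dd ?n \<alpha>))) =
      (LD ?n X (ip Z (dd ?n \<beta>)) - ip (lie_bracket X Z) (dd ?n \<beta>)) -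
      (LD ?n Y (ip Z (dd ?n \<alpha>)) - ip (lie_bracket Y Z) (dd ?n \<alpha>))"
    unfolding ext_derivative_diff[OF lie_derivative_form[OF b X] interior_product_form[OF da Y]]
      dLY lie_derivative_ext_derivative[OF b X, symmetric] interior_product_diff
      interior_product_lie_derivative[OF db X Z] interior_product_lie_derivative[OF da Y Z] ..
  show ?thesis unfolding 1 2 3 by (simp add: algebra_simps)
qed

lemma fun_pair_add: "(\<lambda>p. (X p, \<alpha> p)) + (\<lambda>p. (Y p, \<beta> p)) = (\<lambda>p. ((X + Y) p, (\<alpha> + \<beta>) p))"
  by (simp add: fun_eq_iff)

lemma fun_pair_scale: "(t :: real) *\<^sub>R (\<lambda>p. (X p, \<alpha> p)) = (\<lambda>p. ((\<lambda>p. t *\<^sub>R X p) p, (\<lambda>p. t *\<^sub>R \<alpha> p) p))"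
  by (simp add: fun_eq_iff scaleR_fun_def)

lemma leibniz_algebroid_dorfman:
  "leibniz_algebroid A (GTB (Suc m)) (dorfman A (Suc m)) dorfman_anchor"
  unfolding leibniz_algebroid_def
proof (intro conjI ballI allI)
  show "vector_bundle A (GTB (Suc m))" by (rule vector_bundle_generalized_tangent)
  show "bundle_morphism (GTB (Suc m)) (tangent_bundle A) dorfman_anchor"
    by (auto simp: bundle_morphism_def dorfman_anchor_def generalized_tangent_bundle_def direct_sum_def)
next
  fix a b assume "a \<in> global_sections (GTB (Suc m))" "b \<in> global_sections (GTB (Suc m))"
  then obtain X \<alpha> Y \<beta> where a: "X \<in> vector_fields A" "\<alpha> \<in> forms A (Suc m)" "a = (\<lambda>p. (X p, \<alpha> p))"
    and b: "Y \<in> vector_fields A" "\<beta> \<in> forms A (Suc m)" "b = (\<lambda>p. (Y p, \<beta> p))"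
    by (elim GTB_sectionE)
  show "dorfman A (Suc m) a b \<in> global_sections (GTB (Suc m))"
    unfolding a(3) b(3) dorfman_pair[OF a(2) b(1)]
    by (intro GTB_pair lie_bracket_vector_field dorfman_form a b)
  show "(\<lambda>p. dorfman_anchor p (dorfman A (Suc m) a b p)) = lie_bracket (\<lambda>p. dorfman_anchor p (a p)) (\<lambda>p. dorfman_anchor p (b p))"
    unfolding a(3) b(3) dorfman_pair[OF a(2) b(1)] by (simp add: dorfman_anchor_def)
  {
    fix f assume f: "f \<in> \<C>"
    have "dorfman A (Suc m) (\<lambda>p. (X p, \<alpha> p)) (\<lambda>p. ((\<lambda>p. f p *\<^sub>R Y p) p, (\<lambda>p. f p *\<^sub>R \<beta> p) p)) =
      (\<lambda>p. f p *\<^sub>R dorfman A (Suc m) a b p + X p f *\<^sub>R (Y p, \<beta> p))"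
      unfolding a(3) b(3) dorfman_pair[OF a(2) b(1)] dorfman_pair[OF a(2) vector_field_scale[OF f b(1)]]
        lie_bracket_scale[OF a(1) b(1) f] lie_derivative_scale[OF b(2) f a(1)]
        interior_product_vscale[OF ext_derivative_form[OF a(2)] b(1) f]
      by (simp add: fun_eq_iff scaleR_fun_def algebra_simps)
    then show "dorfman A (Suc m) a (\<lambda>p. f p *\<^sub>R b p) =
        (\<lambda>p. f p *\<^sub>R dorfman A (Suc m) a b p + dorfman_anchor p (a p) f *\<^sub>R b p)"
      by (simp add: a(3) b(3) dorfman_anchor_def)
  }
  fix t :: real
  note c = smooth_funs_const[of t UNIV]
  have lb: "lie_bracket (\<lambda>p. t *\<^sub>R X p) Y = (\<lambda>p. t *\<^sub>R lie_bracket X Y p)" "lie_bracket X (\<lambda>p. t *\<^sub>R Y p) = (\<lambda>p. t *\<^sub>R lie_bracket X Y p)"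
    unfolding lie_bracket_scale[OF a(1) b(1) c] lie_bracket_scale_left[OF a(1) b(1) c]
    by (simp_all add: fun_eq_iff tangent_const[OF vector_field_tangent[OF b(1)]] tangent_const[OF vector_field_tangent[OF a(1)]])
  show "dorfman A (Suc m) (t *\<^sub>R a) b = t *\<^sub>R dorfman A (Suc m) a b"
    unfolding a(3) b(3) fun_pair_scale dorfman_pair[OF a(2) b(1)] dorfman_pair[OF form_scale[OF c a(2)] b(1)] lb
      lie_derivative_vscale[OF b(2) c a(1)] d_wedge_const[OF interior_product_form[OF b(2) a(1)]]
      ext_derivative_scale d_wedge_const[OF a(2)]
    by (simp add: fun_eq_iff scaleR_fun_def interior_product_def algebra_simps)
  show "dorfman A (Suc m) a (t *\<^sub>R b) = t *\<^sub>R dorfman A (Suc m) a b"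
    unfolding a(3) b(3) fun_pair_scale dorfman_pair[OF a(2) b(1)] dorfman_pair[OF a(2) vector_field_scale[OF c b(1)]] lb
      lie_derivative_scale[OF b(2) c a(1)] interior_product_vscale[OF ext_derivative_form[OF a(2)] b(1) c]
    by (simp add: fun_eq_iff scaleR_fun_def tangent_const[OF vector_field_tangent[OF a(1)]] algebra_simps)
next
  fix a b c assume "a \<in> global_sections (GTB (Suc m))" "b \<in> global_sections (GTB (Suc m))" "c \<in> global_sections (GTB (Suc m))"
  then obtain X \<alpha> Y \<beta> Z \<gamma> where a: "X \<in> vector_fields A" "\<alpha> \<in> forms A (Suc m)" "a = (\<lambda>p. (X p, \<alpha> p))"
    and b: "Y \<in> vector_fields A" "\<beta> \<in> forms A (Suc m)" "b = (\<lambda>p. (Y p, \<beta> p))"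
    and c: "Z \<in> vector_fields A" "\<gamma> \<in> forms A (Suc m)" "c = (\<lambda>p. (Z p, \<gamma> p))"
    by (elim GTB_sectionE)
  have lb: "lie_bracket (X + Y) Z = lie_bracket X Z + lie_bracket Y Z"
    using lie_bracket_add[OF c(1) a(1) b(1)] lie_bracket_antisym[of _ Z] by (metis minus_add_distrib)
  show "dorfman A (Suc m) (a + b) c = dorfman A (Suc m) a c + dorfman A (Suc m) b c"
    unfolding a(3) b(3) c(3) fun_pair_add dorfman_pair[OF a(2) c(1)] dorfman_pair[OF b(2) c(1)]
      dorfman_pair[OF form_add[OF a(2) b(2)] c(1)] lb lie_derivative_vadd[OF c(2) a(1) b(1)]
      ext_derivative_add[OF a(2) b(2)] interior_product_add
    by (simp add: fun_eq_iff algebra_simps)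
  show "dorfman A (Suc m) a (b + c) = dorfman A (Suc m) a b + dorfman A (Suc m) a c"
    unfolding a(3) b(3) c(3) fun_pair_add dorfman_pair[OF a(2) c(1)] dorfman_pair[OF a(2) b(1)]
      dorfman_pair[OF a(2) vector_field_add[OF b(1) c(1)]] lie_bracket_add[OF a(1) b(1) c(1)]
      lie_derivative_add[OF b(2) c(2) a(1)] interior_product_vadd[OF ext_derivative_form[OF a(2)] b(1) c(1)]
    by (simp add: fun_eq_iff algebra_simps)
  show "dorfman A (Suc m) a (dorfman A (Suc m) b c) =
      dorfman A (Suc m) (dorfman A (Suc m) a b) c + dorfman A (Suc m) b (dorfman A (Suc m) a c)"
    unfolding a(3) b(3) c(3) dorfman_pair[OF a(2) c(1)] dorfman_pair[OF a(2) b(1)] dorfman_pair[OF b(2) c(1)]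
      dorfman_pair[OF a(2) lie_bracket_vector_field[OF b(1) c(1)]]
      dorfman_pair[OF dorfman_form[OF a(1) b(1) a(2) b(2)] c(1)]
      dorfman_pair[OF b(2) lie_bracket_vector_field[OF a(1) c(1)]] fun_pair_add
      dorfman_leibniz[OF a(1) b(1) c(1) a(2) b(2) c(2)] jacobi[OF a(1) b(1) c(1)] ..
qed

end

section \<open>Alternating maps with a fixed last argument, and maps linear on a subspace\<close>

lemma alt_last:
  assumes a: "\<omega> \<in> alt_maps (Suc k) V" and v: "v \<in> V"
  shows "(\<lambda>vs. \<omega> (vs @ [v])) \<in> alt_maps k V"
proof (rule alt_mapsI)
  fix vs assume "\<not> (length vs = k \<and> set vs \<subseteq> V)"
  then show "\<omega> (vs @ [v]) = 0" using v by (intro alt_outside[OF a]) auto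
next
  fix vs i u w assume "length vs = k" "set vs \<subseteq> V" "i < k" "u \<in> V" "w \<in> V"
  then show "\<omega> (vs[i := u + w] @ [v]) = \<omega> (vs[i := u] @ [v]) + \<omega> (vs[i := w] @ [v])"
    using alt_add[OF a, of "vs @ [v]" i u w] v by (simp add: list_update_append)
next
  fix vs i u c assume "length vs = k" "set vs \<subseteq> V" "i < k" "u \<in> V"
  then show "\<omega> (vs[i := c *\<^sub>R u] @ [v]) = c * \<omega> (vs[i := u] @ [v])"
    using alt_scale[OF a, of "vs @ [v]" i u c] v by (simp add: list_update_append)
next
  fix vs i j assume "length vs = k" "set vs \<subseteq> V" "j < i" "i < k" "vs ! i = vs ! j"
  then show "\<omega> (vs @ [v]) = 0"
    using v by (intro alt_eq_0[OF a, of _ i j]) (auto simp: nth_append)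
qed

lemma alt_last_add:
  assumes "\<omega> \<in> alt_maps (Suc k) V" "length vs = k" "set vs \<subseteq> V" "u \<in> V" "w \<in> V"
  shows "\<omega> (vs @ [u + w]) = \<omega> (vs @ [u]) + \<omega> (vs @ [w])"
  using alt_add[OF assms(1)[folded assms(2)], of "vs @ [u]" "length vs" u w] assms(3-) by simp

lemma alt_last_scale:
  assumes "\<omega> \<in> alt_maps (Suc k) V" "length vs = k" "set vs \<subseteq> V" "u \<in> V"
  shows "\<omega> (vs @ [c *\<^sub>R u]) = c * \<omega> (vs @ [u])"
  using alt_scale[OF assms(1)[folded assms(2)], of "vs @ [u]" "length vs" u c] assms(3-) by simp

lemma linear_on_sum:
  fixes T :: "'v::real_vector \<Rightarrow> 'w::real_vector"
  assumes V: "subspace V" and add: "\<And>u w. u \<in> V \<Longrightarrow> w \<in> V \<Longrightarrow> T (u + w) = T u + T w"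
    and scale: "\<And>c u. u \<in> V \<Longrightarrow> T (c *\<^sub>R u) = c *\<^sub>R T u" and b: "\<And>i. i \<in> S \<Longrightarrow> b i \<in> V"
  shows "T (\<Sum>i\<in>S. c i *\<^sub>R b i) = (\<Sum>i\<in>S. c i *\<^sub>R T (b i))"
  using b
proof (induction S rule: infinite_finite_induct)
  case (infinite S)
  then show ?case using scale[OF subspace_0[OF V], of 0] by simp
next
  case empty
  then show ?case using scale[OF subspace_0[OF V], of 0] by simp
next
  case (insert i S)
  have "(\<Sum>i\<in>S. c i *\<^sub>R b i) \<in> V" by (intro subspace_sum subspace_scale V) (simp add: insert)
  moreover have "c i *\<^sub>R b i \<in> V" by (intro subspace_scale V) (simp add: insert)
  ultimately show ?case using insert by (simp add: add scale)
qed

context smooth_mfd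
begin

section \<open>Differentials, and covectors as differentials of global functions\<close>

lemma differential_add:
  assumes "f \<in> \<C>" "g \<in> \<C>"
  shows "differential A (\<lambda>x. f x + g x) p = differential A f p + differential A g p"
  by (rule ext) (auto simp: differential_def length_Suc_conv tangentD(1) assms)

lemma differential_mult:
  assumes "f \<in> \<C>" "g \<in> \<C>"
  shows "differential A (\<lambda>x. f x * g x) p = f p *\<^sub>R differential A g p + g p *\<^sub>R differential A f p"
  by (rule ext) (auto simp: differential_def scaleR_fun_def length_Suc_conv tangentD(2) assms)

lemma differential_cmult:
  assumes "f \<in> \<C>"
  shows "differential A (\<lambda>x. c * f x) p = c *\<^sub>R differential A f p"
  by (rule ext) (auto simp: differential_def scaleR_fun_def length_Suc_conv tangentD(3)[OF _ assms assms])

lemma differential_form: "f \<in> \<C> \<Longrightarrow> differential A f \<in> forms A 1"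
proof (rule formI)
  fix p show "differential A f p \<in> alt_maps 1 (tangent_space A p)"
    using differential_cotangent unfolding cotangent_space_eq .
next
  fix Xs assume f: "f \<in> \<C>" and "Xs \<in> VFs 1"
  then obtain X where X: "Xs = [X]" "X \<in> vector_fields A"
    unfolding One_nat_def by (elim VFs_SucE) simp
  have "ev (differential A f) Xs = (\<lambda>p. X p f)"
    by (rule ext) (simp add: X(1) ev_def differential_apply[OF vector_field_tangent[OF X(2)]])
  then show "ev (differential A f) Xs \<in> \<C>" using vector_field_smooth[OF X(2) f] by simp
qed

text \<open>A combination of cut-off coordinates with constant coefficients has the prescribed
  differential. This turns identities between brackets of functions into pointwise identities for
  \<pi>.\<close>

lemma covector_differential:
  assumes "\<xi> \<in> cotangent_space A p"
  shows "\<exists>f\<in>\<C>. \<xi> = differential A f p"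
proof -
  obtain U x E where p: "p \<in> U" and f: "chart_frame U x E" using chart_frame_exists by blast
  define g where "g = (\<lambda>q. \<Sum>i<mdim. \<xi> [E i p] * x i q)"
  have g: "g \<in> \<C>"
    unfolding g_def using chart_frameD(2)[OF f] by (intro smooth_funs_sum smooth_funs_mult smooth_funs_const open_UNIV) simp
  have "differential A g p = (\<Sum>i<mdim. \<xi> [E i p] *\<^sub>R differential A (x i) p)"
  proof
    fix vs
    show "differential A g p vs = (\<Sum>i<mdim. \<xi> [E i p] *\<^sub>R differential A (x i) p) vs"
    proof (cases "length vs = 1 \<and> set vs \<subseteq> tangent_space A p")
      case True
      then obtain v where v: "vs = [v]" "v \<in> tangent_space A p" by (auto simp: length_Suc_conv)
      have "v g = (\<Sum>i<mdim. v (\<lambda>q. \<xi> [E i p] * x i q))"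
        unfolding g_def using chart_frameD(2)[OF f] by (intro tangent_sum[OF v(2)] smooth_funs_mult smooth_funs_const open_UNIV) simp
      also have "... = (\<Sum>i<mdim. \<xi> [E i p] * v (x i))"
        using chart_frameD(2)[OF f] by (intro sum.cong refl tangentD(3)[OF v(2)]) auto
      finally show ?thesis using v by (simp add: differential_apply sum_fun_apply scaleR_fun_def)
    next
      case False
      then have "differential A h p vs = 0" for h unfolding differential_def by (rule if_not_P)
      then show ?thesis by (simp add: sum_fun_apply scaleR_fun_def)
    qed
  qed
  then show ?thesis using coframe_expand[OF f p assms] g by (intro bexI[of _ g]) simp
qed

lemma covector_differentials:
  assumes "set \<xi>s \<subseteq> cotangent_space A p"
  shows "\<exists>fs. set fs \<subseteq> \<C> \<and> \<xi>s = map (\<lambda>f. differential A f p) fs"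
  using assms
proof (induction \<xi>s)
  case Nil
  then show ?case by simp
next
  case (Cons \<xi> \<xi>s)
  then obtain fs where "set fs \<subseteq> \<C>" "\<xi>s = map (\<lambda>f. differential A f p) fs" by auto
  moreover obtain f where "f \<in> \<C>" "\<xi> = differential A f p" using covector_differential Cons.prems by (meson list.set_intros(1) subsetD)
  ultimately show ?case by (intro exI[of _ "f # fs"]) simp
qed

subsection \<open>Exterior multiplication by a covector\<close>

text \<open>The product of \<xi> with an arbitrary alternating \<omega>, by the formula that
  \<open>wedge_Cons\<close> proves for decomposable \<omega>.\<close>

definition covector_wedge :: "nat \<Rightarrow> 'a \<Rightarrow> 'a form \<Rightarrow> 'a form \<Rightarrow> 'a form"
  where "covector_wedge k p \<xi> \<omega> = (\<lambda>vs. if length vs = Suc k \<and> set vs \<subseteq> tangent_space A p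
    then \<Sum>i\<le>k. (-1) ^ i * \<xi> [vs ! i] * \<omega> (delete_nth i vs) else 0)"

lemma covector_wedge_wedge:
  assumes "length \<xi>s = k"
  shows "covector_wedge k p \<xi> (wedge A p \<xi>s) = wedge A p (\<xi> # \<xi>s)"
proof
  fix vs
  show "covector_wedge k p \<xi> (wedge A p \<xi>s) vs = wedge A p (\<xi> # \<xi>s) vs"
    using wedge_Cons[OF assms, where vs = vs and p = p and \<xi> = \<xi> and A = A]
      wedge_outside[where vs = vs and \<xi>s = "\<xi> # \<xi>s" and p = p and A = A] assms
    by (auto simp: covector_wedge_def)
qed

lemma covector_wedge_add: "covector_wedge k p \<xi> (\<omega> + \<eta>) = covector_wedge k p \<xi> \<omega> + covector_wedge k p \<xi> \<eta>"
  by (rule ext) (simp add: covector_wedge_def algebra_simps sum.distrib)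

lemma covector_wedge_scale: "covector_wedge k p \<xi> (c *\<^sub>R \<omega>) = c *\<^sub>R covector_wedge k p \<xi> \<omega>"
  by (rule ext) (simp add: covector_wedge_def scaleR_fun_def algebra_simps sum_distrib_left)

text \<open>Alternation is not checked on the formula: expansion of \<omega> in coordinate wedges
  reduces it to \<open>wedge_alt\<close>.\<close>

lemma covector_wedge_alt:
  assumes \<xi>: "\<xi> \<in> cotangent_space A p" and \<omega>: "\<omega> \<in> alt_maps k (tangent_space A p)"
  shows "covector_wedge k p \<xi> \<omega> \<in> alt_maps (Suc k) (tangent_space A p)"
proof -
  obtain U x E where p: "p \<in> U" and f: "chart_frame U x E" using chart_frame_exists by blast
  have "covector_wedge k p \<xi> \<omega> = covector_wedge k p \<xi> (\<Sum>J\<in>increasing mdim k. \<omega> (frame_at E p J) *\<^sub>R wedge A p (coframe_at x p J))"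
    using form_expand[OF f p \<omega>] by simp
  also have "... = (\<Sum>J\<in>increasing mdim k. \<omega> (frame_at E p J) *\<^sub>R covector_wedge k p \<xi> (wedge A p (coframe_at x p J)))"
    by (rule linear_on_sum[OF subspace_UNIV, where T = "covector_wedge k p \<xi>"])
       (simp_all add: covector_wedge_add covector_wedge_scale)
  also have "... = (\<Sum>J\<in>increasing mdim k. \<omega> (frame_at E p J) *\<^sub>R wedge A p (\<xi> # coframe_at x p J))"
    by (intro sum.cong refl) (simp add: covector_wedge_wedge increasing_def)
  also have "... \<in> alt_maps (Suc k) (tangent_space A p)"
  proof (intro subspace_sum subspace_scale subspace_alt_maps wedge_alt)
    fix J assume "J \<in> increasing mdim k"
    then show "length (\<xi> # coframe_at x p J) = Suc k" by (simp add: increasing_def)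
    show "set (\<xi> # coframe_at x p J) \<subseteq> cotangent_space A p" using \<xi> coframe_at_cotangent by simp
  qed
  finally show ?thesis .
qed

text \<open>The defect of the Leibniz rule is thereby a pointwise product, whose image under the
  sharp map can be studied at one point.\<close>

lemma d_wedge_at:
  assumes a: "\<alpha> \<in> forms A k" and f: "f \<in> \<C>"
  shows "d_wedge k f \<alpha> p = covector_wedge k p (differential A f p) (\<alpha> p)"
proof
  fix vs
  show "d_wedge k f \<alpha> p vs = covector_wedge k p (differential A f p) (\<alpha> p) vs"
  proof (cases "length vs = Suc k \<and> set vs \<subseteq> tangent_space A p")
    case True
    then have vs: "length vs = Suc k" "set vs \<subseteq> tangent_space A p" by auto
    note l = lifts[OF vs]
    have "d_wedge k f \<alpha> p vs = ev (d_wedge k f \<alpha>) (map (lift p) vs) p" unfolding ev_def l(2) ..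
    also have "... = (\<Sum>i\<le>k. (-1) ^ i * (map (lift p) vs ! i) p f * ev \<alpha> (delete_nth i (map (lift p) vs)) p)"
      by (rule ev_d_wedge[OF a f l(1)])
    also have "... = (\<Sum>i\<le>k. (-1) ^ i * differential A f p [vs ! i] * \<alpha> p (delete_nth i vs))"
    proof (rule sum.cong[OF refl])
      fix i assume "i \<in> {..k}"
      then have i: "i < length vs" using vs by simp
      then have v: "vs ! i \<in> tangent_space A p" using vs(2) by auto
      have "ev \<alpha> (delete_nth i (map (lift p) vs)) p = \<alpha> p (delete_nth i vs)"
        unfolding ev_def map_delete_nth l(2) ..
      then show "(-1) ^ i * (map (lift p) vs ! i) p f * ev \<alpha> (delete_nth i (map (lift p) vs)) p =
          (-1) ^ i * differential A f p [vs ! i] * \<alpha> p (delete_nth i vs)"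
        using i by (simp add: lift(2)[OF v] differential_apply[OF v])
    qed
    finally show ?thesis using True by (simp add: covector_wedge_def)
  next
    case False
    then show ?thesis using alt_outside[OF form_alt[OF d_wedge_form[OF f a]]] by (auto simp: covector_wedge_def)
  qed
qed

subsection \<open>Exterior products of exact forms\<close>

definition exact_wedge :: "('a \<Rightarrow> real) list \<Rightarrow> 'a \<Rightarrow> 'a form"
  where "exact_wedge fs = (\<lambda>p. wedge A p (map (\<lambda>f. differential A f p) fs))"

lemma exact_wedge_form: "set fs \<subseteq> \<C> \<Longrightarrow> length fs = k \<Longrightarrow> exact_wedge fs \<in> forms A k"
  unfolding exact_wedge_def by (rule wedge_differentials_form)

lemma exact_wedge_Cons:
  assumes "set (f # fs) \<subseteq> \<C>" "length fs = k"
  shows "exact_wedge (f # fs) = d_wedge k f (exact_wedge fs)"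
proof
  fix p
  show "exact_wedge (f # fs) p = d_wedge k f (exact_wedge fs) p"
    using assms d_wedge_at[OF exact_wedge_form, of fs k f p] covector_wedge_wedge[of "map (\<lambda>f. differential A f p) fs" k p "differential A f p"]
    by (simp add: exact_wedge_def)
qed

lemma exact_wedge_Nil: "ev (exact_wedge []) [] = (\<lambda>p. 1)"
  by (rule ext) (simp add: ev_def exact_wedge_def wedge_def)

text \<open>A nonempty wedge of differentials is exact: with a closed remainder, prepending df is
  the exterior derivative of f times the remainder.\<close>

lemma ext_derivative_exact_wedge:
  assumes "set fs \<subseteq> \<C>" "length fs = k"
  shows "dd k (exact_wedge fs) = 0"
  using assms
proof (induction fs arbitrary: k)
  case Nil
  then have a: "exact_wedge [] \<in> forms A 0" by (intro exact_wedge_form) auto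
  have "dd 0 (exact_wedge []) = 0"
  proof (rule form_eqI)
    fix Xs p assume Xs: "Xs \<in> VFs (Suc 0)"
    then obtain X where X: "Xs = [X]" "X \<in> vector_fields A" by (elim VFs_SucE) simp
    then show "ev (dd 0 (exact_wedge [])) Xs p = ev 0 Xs p"
      by (simp add: ev_ext_derivative[OF a] ext_op_0 exact_wedge_Nil tangent_const[OF vector_field_tangent[OF X(2)]])
  qed (intro ext_derivative_form a form_zero)+
  then show ?case using Nil by simp
next
  case (Cons f fs)
  obtain l where k: "k = Suc l" "length fs = l" using Cons.prems by auto
  have fs: "set fs \<subseteq> \<C>" "f \<in> \<C>" using Cons.prems by auto
  note w = exact_wedge_form[OF fs(1) k(2)]
  have "exact_wedge (f # fs) = dd l (\<lambda>p. f p *\<^sub>R exact_wedge fs p)"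
    unfolding exact_wedge_Cons[OF Cons.prems(1) k(2)] d_wedge_def Cons.IH[OF fs(1) k(2)] by (simp add: fun_eq_iff)
  then show ?case unfolding k(1) using ext_derivative_squared[OF form_scale[OF fs(2) w]] by simp
qed

lemma d_wedge_add:
  assumes "f \<in> \<C>" "\<alpha> \<in> forms A k" "\<beta> \<in> forms A k"
  shows "d_wedge k f (\<alpha> + \<beta>) = d_wedge k f \<alpha> + d_wedge k f \<beta>"
  by (rule ext) (simp add: d_wedge_at assms form_add covector_wedge_add)

lemma d_wedge_zero: "f \<in> \<C> \<Longrightarrow> d_wedge k f 0 = 0"
  using d_wedge_add[OF _ form_zero form_zero, of f k] by simp

lemma lie_derivative_d_wedge:
  assumes a: "\<alpha> \<in> forms A k" and f: "f \<in> \<C>" and X: "X \<in> vector_fields A"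
  shows "LD (Suc k) X (d_wedge k f \<alpha>) = d_wedge k (\<lambda>p. X p f) \<alpha> + d_wedge k f (LD k X \<alpha>)"
proof -
  note Xf = vector_field_smooth[OF X f]
  note da = ext_derivative_form[OF a] and la = lie_derivative_form[OF a X]
  have "LD (Suc k) X (d_wedge k f \<alpha>) = dd k (LD k X (\<lambda>p. f p *\<^sub>R \<alpha> p)) - LD (Suc k) X (\<lambda>p. f p *\<^sub>R dd k \<alpha> p)"
    unfolding d_wedge_def lie_derivative_diff[OF ext_derivative_form[OF form_scale[OF f a]] form_scale[OF f da] X]
      lie_derivative_ext_derivative[OF form_scale[OF f a] X] ..
  also have "dd k (LD k X (\<lambda>p. f p *\<^sub>R \<alpha> p)) = dd k (\<lambda>p. f p *\<^sub>R LD k X \<alpha> p) + dd k (\<lambda>p. X p f *\<^sub>R \<alpha> p)"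
    unfolding lie_derivative_scale[OF a f X] by (rule ext_derivative_add[OF form_scale[OF f la] form_scale[OF Xf a]])
  also have "LD (Suc k) X (\<lambda>p. f p *\<^sub>R dd k \<alpha> p) = (\<lambda>p. f p *\<^sub>R dd k (LD k X \<alpha>) p) + (\<lambda>p. X p f *\<^sub>R dd k \<alpha> p)"
    unfolding lie_derivative_scale[OF da f X] lie_derivative_ext_derivative[OF a X] ..
  finally have e: "LD (Suc k) X (d_wedge k f \<alpha>) = dd k (\<lambda>p. f p *\<^sub>R LD k X \<alpha> p) + dd k (\<lambda>p. X p f *\<^sub>R \<alpha> p) -
      ((\<lambda>p. f p *\<^sub>R dd k (LD k X \<alpha>) p) + (\<lambda>p. X p f *\<^sub>R dd k \<alpha> p))" .
  show ?thesis
    unfolding e d_wedge_def[of k "\<lambda>p. X p f"] d_wedge_def[of k f "LD k X \<alpha>"] by (simp add: fun_eq_iff algebra_simps)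
qed

text \<open>The Lie derivative is a derivation of the product and commutes with d, so X acts on the
  functions one after the other.\<close>

lemma lie_derivative_exact_wedge:
  assumes "set fs \<subseteq> \<C>" "length fs = k" and X: "X \<in> vector_fields A"
  shows "LD k X (exact_wedge fs) = (\<Sum>i<k. exact_wedge (fs[i := (\<lambda>p. X p (fs ! i))]))"
  using assms(1,2)
proof (induction fs arbitrary: k)
  case Nil
  then have a: "exact_wedge [] \<in> forms A 0" by (intro exact_wedge_form) auto
  have "LD 0 X (exact_wedge []) = 0"
  proof (rule form_eqI)
    fix Xs p assume Xs: "Xs \<in> VFs 0"
    then show "ev (LD 0 X (exact_wedge [])) Xs p = ev 0 Xs p"
      by (simp add: ev_lie_derivative[OF a X] lie_op_def exact_wedge_Nil tangent_const[OF vector_field_tangent[OF X]])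
  qed (intro lie_derivative_form a X form_zero)+
  then show ?case using Nil by simp
next
  case (Cons f fs)
  obtain l where k: "k = Suc l" "length fs = l" using Cons.prems by auto
  have fs: "set fs \<subseteq> \<C>" "f \<in> \<C>" using Cons.prems by auto
  note w = exact_wedge_form[OF fs(1) k(2)]
  note Xf = vector_field_smooth[OF X fs(2)]
  have up: "set (fs[i := (\<lambda>p. X p (fs ! i))]) \<subseteq> \<C>" if "i < l" for i
    using that k fs nth_mem[of i fs] by (intro set_update_subset[OF fs(1)] vector_field_smooth[OF X]) auto
  \<comment> \<open>Distributes \<open>d_wedge\<close> over the sum one summand at a time; the first
    conjunct keeps the partial sums among the forms, as \<open>d_wedge_add\<close> requires.\<close>
  have s: "(\<Sum>i<j. exact_wedge (fs[i := (\<lambda>p. X p (fs ! i))])) \<in> forms A l \<and>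
      d_wedge l f (\<Sum>i<j. exact_wedge (fs[i := (\<lambda>p. X p (fs ! i))])) =
      (\<Sum>i<j. exact_wedge (f # fs[i := (\<lambda>p. X p (fs ! i))]))" if "j \<le> l" for j
    using that
  proof (induction j)
    case 0
    show ?case
      unfolding lessThan_0 sum.empty by (intro conjI form_zero d_wedge_zero fs)
  next
    case (Suc j)
    then have j: "j < l" by simp
    have "exact_wedge (fs[j := (\<lambda>p. X p (fs ! j))]) \<in> forms A l" by (rule exact_wedge_form[OF up[OF j]]) (simp add: k)
    note w = this
    have IH: "(\<Sum>i<j. exact_wedge (fs[i := (\<lambda>p. X p (fs ! i))])) \<in> forms A l"
      "d_wedge l f (\<Sum>i<j. exact_wedge (fs[i := (\<lambda>p. X p (fs ! i))])) =
        (\<Sum>i<j. exact_wedge (f # fs[i := (\<lambda>p. X p (fs ! i))]))" using Suc by simp_all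
    have c: "exact_wedge (f # fs[j := (\<lambda>p. X p (fs ! j))]) = d_wedge l f (exact_wedge (fs[j := (\<lambda>p. X p (fs ! j))]))"
      using up[OF j] fs(2) k(2) by (intro exact_wedge_Cons) simp_all
    show ?case
      unfolding sum.lessThan_Suc d_wedge_add[OF fs(2) IH(1) w] IH(2) c by (intro conjI form_add IH(1) w refl)
  qed
  have "LD (Suc l) X (exact_wedge (f # fs)) = d_wedge l (\<lambda>p. X p f) (exact_wedge fs) + d_wedge l f (LD l X (exact_wedge fs))"
    unfolding exact_wedge_Cons[OF Cons.prems(1) k(2)] by (rule lie_derivative_d_wedge[OF w fs(2) X])
  also have "d_wedge l (\<lambda>p. X p f) (exact_wedge fs) = exact_wedge ((\<lambda>p. X p f) # fs)"
    using Xf fs k by (intro exact_wedge_Cons[symmetric]) auto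
  also have "LD l X (exact_wedge fs) = (\<Sum>i<l. exact_wedge (fs[i := (\<lambda>p. X p (fs ! i))]))"
    by (rule Cons.IH[OF fs(1) k(2)])
  finally show ?case unfolding k(1) sum.lessThan_Suc_shift using s[of l] by simp
qed

text \<open>Reduces a statement about all forms to wedges of coordinate differentials, provided it
  is expressed by a functional that is linear over functions at \<open>p\<close>. Used for the
  deviation, once in each argument.\<close>

lemma tensorial_form_vanish:
  fixes G :: "('a \<Rightarrow> 'a form) \<Rightarrow> real"
  assumes f: "chart_frame U x E" and p: "p \<in> U"
    and add: "\<And>\<alpha> \<beta>. \<alpha> \<in> forms A k \<Longrightarrow> \<beta> \<in> forms A k \<Longrightarrow> G (\<alpha> + \<beta>) = G \<alpha> + G \<beta>"
    and scale: "\<And>g \<alpha>. g \<in> \<C> \<Longrightarrow> \<alpha> \<in> forms A k \<Longrightarrow> G (\<lambda>q. g q *\<^sub>R \<alpha> q) = g p * G \<alpha>"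
    and z: "\<And>J. J \<in> increasing mdim k \<Longrightarrow> G (exact_wedge (map x J)) = 0"
    and a: "\<alpha> \<in> forms A k"
  shows "G \<alpha> = 0"
proof -
  note D = chart_frameD[OF f]
  obtain \<beta> where b: "\<beta> \<in> \<C>" "\<beta> p = 1" "\<And>q. q \<notin> U \<Longrightarrow> \<beta> q = 0" using bump_exists[OF D(1) p] by blast
  define g where "g J = (\<lambda>q. \<beta> q * \<alpha> q (frame_at E q J))" for J
  have J: "length J = k" "set J \<subseteq> {..<mdim}" if "J \<in> increasing mdim k" for J using that by (auto simp: increasing_def)
  have g: "g J \<in> \<C>" if "J \<in> increasing mdim k" for J
  proof -
    have "map E J \<in> VFs k" using J[OF that] D(3) by (auto simp: VFs_def)
    from form_smooth[OF a this] have "(\<lambda>q. \<alpha> q (frame_at E q J)) \<in> \<C>" by (simp add: ev_def[abs_def] comp_def)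
    then show ?thesis unfolding g_def by (rule smooth_funs_mult[OF open_UNIV b(1)])
  qed
  have w: "exact_wedge (map x J) \<in> forms A k" if "J \<in> increasing mdim k" for J
    using J[OF that] D(2) by (intro exact_wedge_form) auto
  have zero: "G 0 = 0" using add[OF form_zero form_zero] by simp
  have s: "(\<Sum>J\<in>S. (\<lambda>q. g J q *\<^sub>R exact_wedge (map x J) q)) \<in> forms A k \<and>
      G (\<Sum>J\<in>S. (\<lambda>q. g J q *\<^sub>R exact_wedge (map x J) q)) = 0"
    if "S \<subseteq> increasing mdim k" for S
    using finite_subset[OF that finite_increasing] that
  proof (induction S)
    case empty
    show ?case unfolding sum.empty by (intro conjI zero form_zero)
  next
    case (insert J S)
    then have J: "J \<in> increasing mdim k" and IH: "(\<Sum>J\<in>S. (\<lambda>q. g J q *\<^sub>R exact_wedge (map x J) q)) \<in> forms A k"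
      "G (\<Sum>J\<in>S. (\<lambda>q. g J q *\<^sub>R exact_wedge (map x J) q)) = 0" by auto
    note e = form_scale[OF g[OF J] w[OF J]]
    have G: "G (\<lambda>q. g J q *\<^sub>R exact_wedge (map x J) q) = 0" using scale[OF g[OF J] w[OF J]] z[OF J] by simp
    show ?case
      unfolding sum.insert[OF insert(1,2)] add[OF e IH(1)] IH(2) G by (intro conjI form_add e IH(1)) simp
  qed
  \<comment> \<open>The coordinate expansion holds on \<open>U\<close>; multiplied by \<beta>, which
    vanishes off \<open>U\<close>, it becomes an identity of global forms.\<close>
  have "(\<lambda>q. \<beta> q *\<^sub>R \<alpha> q) = (\<Sum>J\<in>increasing mdim k. (\<lambda>q. g J q *\<^sub>R exact_wedge (map x J) q))"
  proof
    fix q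
    show "\<beta> q *\<^sub>R \<alpha> q = (\<Sum>J\<in>increasing mdim k. (\<lambda>q. g J q *\<^sub>R exact_wedge (map x J) q)) q"
    proof (cases "q \<in> U")
      case True
      have "\<alpha> q = (\<Sum>J\<in>increasing mdim k. \<alpha> q (frame_at E q J) *\<^sub>R wedge A q (coframe_at x q J))"
        by (rule form_expand[OF f True form_alt[OF a]])
      then have "\<beta> q *\<^sub>R \<alpha> q = \<beta> q *\<^sub>R (\<Sum>J\<in>increasing mdim k. \<alpha> q (frame_at E q J) *\<^sub>R wedge A q (coframe_at x q J))"
        by (rule arg_cong)
      then show ?thesis
        unfolding sum_fun_apply g_def exact_wedge_def scaleR_sum_right by (simp add: comp_def)
    qed (simp add: sum_fun_apply g_def b(3))
  qed
  then have "G (\<lambda>q. \<beta> q *\<^sub>R \<alpha> q) = 0" using s[of "increasing mdim k"] by simp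
  then show ?thesis using scale[OF b(1) a] b(2) by simp
qed

lemma interior_product_d_wedge:
  assumes a: "\<alpha> \<in> forms A (Suc k)" and f: "f \<in> \<C>" and Y: "Y \<in> vector_fields A"
  shows "ip Y (d_wedge (Suc k) f \<alpha>) = (\<lambda>p. Y p f *\<^sub>R \<alpha> p) - d_wedge k f (ip Y \<alpha>)"
proof (rule form_eqI)
  fix Xs p assume Xs: "Xs \<in> VFs (Suc k)"
  then have YXs: "Y # Xs \<in> VFs (Suc (Suc k))" using Y by simp
  show "ev (ip Y (d_wedge (Suc k) f \<alpha>)) Xs p = ev ((\<lambda>p. Y p f *\<^sub>R \<alpha> p) - d_wedge k f (ip Y \<alpha>)) Xs p"
    unfolding ev_diff ev_scale ev_d_wedge[OF interior_product_form[OF a Y] f Xs] ev_interior_product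
      ev_d_wedge[OF a f YXs] sum.atMost_Suc_shift
    by (simp add: sum_negf)
qed (intro form_diff form_scale d_wedge_form interior_product_form a f Y vector_field_smooth[OF Y f])+

end

text \<open>Writing the order as \<open>Suc m\<close> builds in n \<ge> 1 and turns
  \<open>n - 1\<close>, the degree of contracted forms, into \<open>m\<close>.\<close>

locale nambu_mfd = smooth_mfd A
  for A :: "('a::{t2_space, second_countable_topology}, 'e::real_inner) atlas" +
  fixes m :: nat and \<pi> :: "'a \<Rightarrow> 'a form list \<Rightarrow> real"
  assumes nambu: "nambu_poisson A (Suc m) \<pi>"
begin

abbreviation (input) "n \<equiv> Suc m"
abbreviation "br fs \<equiv> nambu_function_bracket A \<pi> fs"

subsection \<open>The map \<open>\<pi>\<^sup>\<sharp>\<close>\<close>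

lemma pi_alt: "\<pi> p \<in> alt_maps (Suc n) (cotangent_space A p)"
  using nambu by (simp add: nambu_poisson_def multivector_fields_def)

lemma bracket_smooth:
  assumes "set fs \<subseteq> \<C>" "length fs = Suc n"
  shows "br fs \<in> \<C>"
proof -
  have "\<forall>\<xi>s. length \<xi>s = Suc n \<longrightarrow> set \<xi>s \<subseteq> forms A 1 \<longrightarrow> (\<lambda>p. \<pi> p (map (\<lambda>\<xi>. \<xi> p) \<xi>s)) \<in> \<C>"
    using nambu by (simp add: nambu_poisson_def multivector_fields_def)
  moreover have "set (map (differential A) fs) \<subseteq> forms A 1" using assms(1) differential_form by auto
  ultimately show ?thesis
    using assms(2) by (auto dest!: spec[of _ "map (differential A) fs"] simp: nambu_function_bracket_def[abs_def] comp_def)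
qed

lemma fundamental_identity:
  assumes "length fs = n" "set fs \<subseteq> \<C>" "length gs = Suc n" "set gs \<subseteq> \<C>"
  shows "br (fs @ [br gs]) p = (\<Sum>i<Suc n. br (gs[i := br (fs @ [gs ! i])]) p)"
proof -
  have "br (fs @ [br gs]) = (\<lambda>p. \<Sum>i<n + 1. br (gs[i := br (fs @ [gs ! i])]) p)"
    using nambu assms by (simp add: nambu_poisson_def)
  then show ?thesis by simp
qed

text \<open>The vector that the definition of \<open>sharp\<close> prescribes on a wedge; for \<xi>s
  consisting of differentials it is the Hamiltonian vector field at \<open>p\<close>.\<close>

definition hamiltonian :: "'a \<Rightarrow> 'a form list \<Rightarrow> 'a tvec"
  where "hamiltonian p \<xi>s = (\<lambda>f. if f \<in> \<C> then \<pi> p (\<xi>s @ [differential A f p]) else 0)"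

lemma hamiltonian_tangent:
  assumes "length \<xi>s = n" "set \<xi>s \<subseteq> cotangent_space A p"
  shows "hamiltonian p \<xi>s \<in> tangent_space A p"
proof -
  note add = alt_last_add[OF pi_alt assms] and scale = alt_last_scale[OF pi_alt assms]
  note d = differential_cotangent[where p = p]
  have V: "subspace (cotangent_space A p)" unfolding cotangent_space_eq by (rule subspace_alt_maps)
  have s: "c *\<^sub>R differential A f p \<in> cotangent_space A p" for c f by (rule subspace_scale[OF V d])
  show ?thesis
    unfolding tangent_space_def mem_Collect_eq
  proof (intro conjI ballI allI impI)
    fix f g assume "f \<in> \<C>" "g \<in> \<C>"
    then show "hamiltonian p \<xi>s (\<lambda>x. f x + g x) = hamiltonian p \<xi>s f + hamiltonian p \<xi>s g"
      and "hamiltonian p \<xi>s (\<lambda>x. f x * g x) = f p * hamiltonian p \<xi>s g + g p * hamiltonian p \<xi>s f"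
      by (simp_all add: hamiltonian_def smooth_funs_add smooth_funs_mult differential_add differential_mult
          add[OF d d] add[OF s s] scale[OF d])
  next
    fix f c assume "f \<in> \<C>"
    then show "hamiltonian p \<xi>s (\<lambda>x. c * f x) = c * hamiltonian p \<xi>s f"
      using smooth_funs_mult[OF open_UNIV smooth_funs_const[of c]] by (simp add: hamiltonian_def differential_cmult scale[OF d])
  qed (simp add: hamiltonian_def)
qed

text \<open>The coordinate formula that serves as witness for the definite description in
  \<open>sharp\<close>; the value 0 outside the fibre is its last clause.\<close>

definition sharp_sum :: "(nat \<Rightarrow> 'a \<Rightarrow> real) \<Rightarrow> (nat \<Rightarrow> 'a \<Rightarrow> 'a tvec) \<Rightarrow> 'a \<Rightarrow> 'a form \<Rightarrow> 'a tvec"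
  where "sharp_sum x E p \<omega> = (if \<omega> \<in> alt_maps n (tangent_space A p)
    then \<Sum>J\<in>increasing mdim n. \<omega> (frame_at E p J) *\<^sub>R hamiltonian p (coframe_at x p J) else 0)"

text \<open>The formula is built from coordinate wedges but has to be right on every wedge.
  Evaluated on a function h, both sides are alternating in the covectors, so it is enough to compare
  them on increasing lists of the coframe.\<close>

lemma sharp_sum_wedge:
  assumes f: "chart_frame U x E" and p: "p \<in> U" and \<xi>s: "length \<xi>s = n" "set \<xi>s \<subseteq> cotangent_space A p"
  shows "sharp_sum x E p (wedge A p \<xi>s) = hamiltonian p \<xi>s"
proof
  fix h
  let ?V = "cotangent_space A p"
  show "sharp_sum x E p (wedge A p \<xi>s) h = hamiltonian p \<xi>s h"
  proof (cases "h \<in> \<C>")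
    case True
    let ?W = "\<lambda>J \<xi>s. if length \<xi>s = n \<and> set \<xi>s \<subseteq> ?V then wedge A p \<xi>s (frame_at E p J) else 0"
    let ?h = "differential A h p"
    have J: "length J = n" "set J \<subseteq> {..<mdim}" if "J \<in> increasing mdim n" for J using that by (auto simp: increasing_def)
    have "(\<Sum>J\<in>increasing mdim n. \<pi> p (coframe_at x p J @ [?h]) *\<^sub>R ?W J) = (\<lambda>\<xi>s. \<pi> p (\<xi>s @ [?h]))"
    proof (rule alt_ext_basis[where d = mdim and b = "\<lambda>i. differential A (x i) p" and V = ?V and k = n])
      show "(\<Sum>J\<in>increasing mdim n. \<pi> p (coframe_at x p J @ [?h]) *\<^sub>R ?W J) \<in> alt_maps n ?V"
      proof (intro subspace_sum subspace_scale subspace_alt_maps)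
        fix J assume "J \<in> increasing mdim n"
        then show "?W J \<in> alt_maps n ?V"
          using J frame_at_tangent[OF f] by (intro wedge_alt_covectors) auto
      qed
      show "(\<lambda>\<xi>s. \<pi> p (\<xi>s @ [?h])) \<in> alt_maps n ?V"
        by (rule alt_last[OF pi_alt differential_cotangent])
      show "subspace ?V" unfolding cotangent_space_eq by (rule subspace_alt_maps)
      show "\<exists>c. \<xi> = (\<Sum>i<mdim. c i *\<^sub>R differential A (x i) p)" if "\<xi> \<in> ?V" for \<xi>
        using coframe_expand[OF f p that] by (intro exI[of _ "\<lambda>i. \<xi> [E i p]"])
      show "differential A (x i) p \<in> ?V" for i by (rule differential_cotangent)
      fix K assume K: "K \<in> increasing mdim n"
      have "(\<Sum>J\<in>increasing mdim n. \<pi> p (coframe_at x p J @ [?h]) *\<^sub>R ?W J) (coframe_at x p K) =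
          (\<Sum>J\<in>increasing mdim n. \<pi> p (coframe_at x p J @ [?h]) * ?W J (coframe_at x p K))"
        by (simp only: sum_fun_apply scaleR_fun_def real_scaleR_def)
      also have "... = (\<Sum>J\<in>increasing mdim n. if J = K then \<pi> p (coframe_at x p K @ [?h]) else 0)"
      proof (rule sum.cong[OF refl])
        fix J assume "J \<in> increasing mdim n"
        then have "?W J (coframe_at x p K) = (if J = K then 1 else 0)"
          using wedge_dual_chart_frame[OF f p _ K] J[OF K] coframe_at_cotangent by simp
        then show "\<pi> p (coframe_at x p J @ [?h]) * ?W J (coframe_at x p K) = (if J = K then \<pi> p (coframe_at x p K @ [?h]) else 0)"
          by (simp only: mult_1_right mult_zero_right split: if_split) simp
      qed
      also have "... = \<pi> p (coframe_at x p K @ [?h])" using K finite_increasing by simp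
      finally show "(\<Sum>J\<in>increasing mdim n. \<pi> p (coframe_at x p J @ [?h]) *\<^sub>R ?W J) (coframe_at x p K) = \<pi> p (coframe_at x p K @ [?h])" .
    qed
    from fun_cong[OF this, of \<xi>s]
    have "(\<Sum>J\<in>increasing mdim n. \<pi> p (coframe_at x p J @ [?h]) * wedge A p \<xi>s (frame_at E p J)) = \<pi> p (\<xi>s @ [?h])"
      using \<xi>s by (simp add: sum_fun_apply scaleR_fun_def)
    then show ?thesis
      using True wedge_alt[OF \<xi>s(2,1)]
      by (simp add: sharp_sum_def hamiltonian_def sum_fun_apply scaleR_fun_def mult.commute)
  qed (simp add: sharp_sum_def hamiltonian_def sum_fun_apply scaleR_fun_def)
qed

lemma fibre_form_eq: "fibre (form_bundle A k) p = alt_maps k (tangent_space A p)"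
  by (simp add: form_bundle_def)

lemma sharp_eq:
  assumes f: "chart_frame U x E" and p: "p \<in> U"
  shows "sharp A n \<pi> p = sharp_sum x E p"
  unfolding sharp_def
proof (rule the_equality)
  let ?T = "alt_maps n (tangent_space A p)"
  note S = subspace_alt_maps[of n "tangent_space A p"]
  let ?P = "\<lambda>L. (\<forall>\<xi>\<in>fibre (form_bundle A n) p. \<forall>\<eta>\<in>fibre (form_bundle A n) p. L (\<xi> + \<eta>) = L \<xi> + L \<eta>) \<and>
    (\<forall>\<xi>\<in>fibre (form_bundle A n) p. \<forall>c. L (c *\<^sub>R \<xi>) = c *\<^sub>R L \<xi>) \<and>
    (\<forall>\<xi>s. length \<xi>s = n \<longrightarrow> set \<xi>s \<subseteq> cotangent_space A p \<longrightarrow>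
       L (wedge A p \<xi>s) = (\<lambda>f. if f \<in> \<C> then \<pi> p (\<xi>s @ [differential A f p]) else 0)) \<and>
    (\<forall>\<xi>. \<xi> \<notin> fibre (form_bundle A n) p \<longrightarrow> L \<xi> = 0)"
  have P: "?P (sharp_sum x E p)"
  proof (intro conjI ballI allI impI)
    fix \<xi> \<eta> assume "\<xi> \<in> fibre (form_bundle A n) p" "\<eta> \<in> fibre (form_bundle A n) p"
    then have a: "\<xi> \<in> ?T" "\<eta> \<in> ?T" unfolding fibre_form_eq .
    show "sharp_sum x E p (\<xi> + \<eta>) = sharp_sum x E p \<xi> + sharp_sum x E p \<eta>"
      unfolding sharp_sum_def if_P[OF a(1)] if_P[OF a(2)] if_P[OF subspace_add[OF S a]]
      by (simp add: scaleR_add_left sum.distrib)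
  next
    fix \<xi> c assume "\<xi> \<in> fibre (form_bundle A n) p"
    then have a: "\<xi> \<in> ?T" unfolding fibre_form_eq .
    have e: "(c *\<^sub>R \<xi>) vs = c * \<xi> vs" for vs by (simp add: scaleR_fun_def)
    show "sharp_sum x E p (c *\<^sub>R \<xi>) = c *\<^sub>R sharp_sum x E p \<xi>"
      unfolding sharp_sum_def if_P[OF a] if_P[OF subspace_scale[OF S a]] e scaleR_sum_right scaleR_scaleR ..
  next
    fix \<xi>s assume "length \<xi>s = n" "set \<xi>s \<subseteq> cotangent_space A p"
    then show "sharp_sum x E p (wedge A p \<xi>s) = (\<lambda>f. if f \<in> \<C> then \<pi> p (\<xi>s @ [differential A f p]) else 0)"
      unfolding sharp_sum_wedge[OF f p] hamiltonian_def by (rule sharp_sum_wedge[OF f p, unfolded hamiltonian_def])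
  next
    fix \<xi> assume "\<xi> \<notin> fibre (form_bundle A n) p"
    then have "\<xi> \<notin> ?T" unfolding fibre_form_eq .
    then show "sharp_sum x E p \<xi> = 0" unfolding sharp_sum_def by (rule if_not_P)
  qed
  show "?P (sharp_sum x E p)" by (rule P)
  fix L assume L: "?P L"
  \<comment> \<open>Used for \<open>L\<close> and for \<open>sharp_sum\<close> alike: linearity and
    the values on wedges force the coordinate formula.\<close>
  have ex: "M \<omega> = (\<Sum>J\<in>increasing mdim n. \<omega> (frame_at E p J) *\<^sub>R hamiltonian p (coframe_at x p J))"
    if M: "?P M" and \<omega>: "\<omega> \<in> ?T" for M \<omega>
  proof -
    have wa: "wedge A p (coframe_at x p J) \<in> ?T" if "J \<in> increasing mdim n" for J
      using that by (intro wedge_alt coframe_at_cotangent) (simp add: increasing_def)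
    have "M \<omega> = M (\<Sum>J\<in>increasing mdim n. \<omega> (frame_at E p J) *\<^sub>R wedge A p (coframe_at x p J))"
      using form_expand[OF f p \<omega>] by simp
    also have "... = (\<Sum>J\<in>increasing mdim n. \<omega> (frame_at E p J) *\<^sub>R M (wedge A p (coframe_at x p J)))"
      by (rule linear_on_sum[OF S, where T = M]) (use M wa in \<open>simp_all add: fibre_form_eq\<close>)
    also have "... = (\<Sum>J\<in>increasing mdim n. \<omega> (frame_at E p J) *\<^sub>R hamiltonian p (coframe_at x p J))"
    proof (rule sum.cong[OF refl])
      fix J assume "J \<in> increasing mdim n"
      then have "M (wedge A p (coframe_at x p J)) = hamiltonian p (coframe_at x p J)"
        using M coframe_at_cotangent unfolding hamiltonian_def by (simp add: increasing_def)
      then show "\<omega> (frame_at E p J) *\<^sub>R M (wedge A p (coframe_at x p J)) = \<omega> (frame_at E p J) *\<^sub>R hamiltonian p (coframe_at x p J)"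
        by simp
    qed
    finally show ?thesis .
  qed
  show "L = sharp_sum x E p"
  proof
    fix \<omega>
    show "L \<omega> = sharp_sum x E p \<omega>"
    proof (cases "\<omega> \<in> ?T")
      case True
      show ?thesis unfolding ex[OF L True] ex[OF P True] ..
    next
      case False
      then have "\<omega> \<notin> fibre (form_bundle A n) p" unfolding fibre_form_eq .
      then show ?thesis using L P by simp
    qed
  qed
qed

abbreviation (input) "\<Omega> p \<equiv> alt_maps n (tangent_space A p)"

lemma sharp_expand:
  assumes "chart_frame U x E" "p \<in> U" "\<omega> \<in> \<Omega> p"
  shows "sharp A n \<pi> p \<omega> = (\<Sum>J\<in>increasing mdim n. \<omega> (frame_at E p J) *\<^sub>R hamiltonian p (coframe_at x p J))"
  unfolding sharp_eq[OF assms(1,2)] sharp_sum_def if_P[OF assms(3)] ..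

lemma sharp_wedge:
  assumes "length \<xi>s = n" "set \<xi>s \<subseteq> cotangent_space A p"
  shows "sharp A n \<pi> p (wedge A p \<xi>s) = hamiltonian p \<xi>s"
proof -
  obtain U x E where "p \<in> U" "chart_frame U x E" using chart_frame_exists by blast
  then show ?thesis using sharp_sum_wedge[OF _ _ assms] sharp_eq by simp
qed

lemma sharp_add:
  assumes a: "\<omega> \<in> \<Omega> p" "\<eta> \<in> \<Omega> p"
  shows "sharp A n \<pi> p (\<omega> + \<eta>) = sharp A n \<pi> p \<omega> + sharp A n \<pi> p \<eta>"
proof -
  obtain U x E where p: "p \<in> U" and f: "chart_frame U x E" using chart_frame_exists by blast
  show ?thesis
    unfolding sharp_expand[OF f p a(1)] sharp_expand[OF f p a(2)] sharp_expand[OF f p subspace_add[OF subspace_alt_maps a]]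
    by (simp add: scaleR_add_left sum.distrib)
qed

lemma sharp_scale:
  assumes a: "\<omega> \<in> \<Omega> p"
  shows "sharp A n \<pi> p (c *\<^sub>R \<omega>) = c *\<^sub>R sharp A n \<pi> p \<omega>"
proof -
  obtain U x E where p: "p \<in> U" and f: "chart_frame U x E" using chart_frame_exists by blast
  have e: "(c *\<^sub>R \<omega>) vs = c * \<omega> vs" for vs by (simp add: scaleR_fun_def)
  show ?thesis
    unfolding sharp_expand[OF f p a] sharp_expand[OF f p subspace_scale[OF subspace_alt_maps a]]
      e scaleR_sum_right scaleR_scaleR ..
qed

lemma sharp_tangent:
  assumes a: "\<omega> \<in> \<Omega> p"
  shows "sharp A n \<pi> p \<omega> \<in> tangent_space A p"
proof -
  obtain U x E where p: "p \<in> U" and f: "chart_frame U x E" using chart_frame_exists by blast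
  show ?thesis
    unfolding sharp_expand[OF f p a]
    by (intro subspace_sum subspace_scale subspace_tangent_space hamiltonian_tangent coframe_at_cotangent)
       (simp add: increasing_def)
qed

text \<open>In a frame, the image acts on h as a combination of the components of \<open>s\<close>
  with brackets of coordinates and h, which are smooth because \<pi> is.\<close>

lemma sharp_section:
  assumes W: "open W" and s: "s \<in> sections (form_bundle A n) W"
  shows "(\<lambda>p. sharp A n \<pi> p (s p)) \<in> sections (tangent_bundle A) W"
proof -
  have a: "s p \<in> \<Omega> p" if "p \<in> W" for p using s that by (simp add: form_bundle_def)
  have "(\<lambda>p. sharp A n \<pi> p (s p) h) \<in> smooth_funs A W" if h: "h \<in> \<C>" for h
  proof (rule smooth_funs_local)
    fix p assume pW: "p \<in> W"
    obtain U x E where p: "p \<in> U" and f: "chart_frame U x E" using chart_frame_exists by blast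
    note D = chart_frameD[OF f]
    have o: "open (U \<inter> W)" using D(1) W by auto
    have "(\<lambda>q. \<Sum>J\<in>increasing mdim n. s q (frame_at E q J) * br (map x J @ [h]) q) \<in> smooth_funs A (U \<inter> W)"
    proof (intro smooth_funs_sum smooth_funs_mult o)
      fix J assume "J \<in> increasing mdim n"
      then have J: "length J = n" "set J \<subseteq> {..<mdim}" by (auto simp: increasing_def)
      have "(\<lambda>p. s p (map (\<lambda>X. X p) Xs)) \<in> smooth_funs A W" if "length Xs = n" "set Xs \<subseteq> vector_fields A" for Xs
        using s that by (simp add: form_bundle_def)
      from this[of "map E J"] J D(3) have "(\<lambda>q. s q (frame_at E q J)) \<in> smooth_funs A W" by (auto simp: comp_def)
      then show "(\<lambda>q. s q (frame_at E q J)) \<in> smooth_funs A (U \<inter> W)" by (rule smooth_funs_subset) simp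
      have "br (map x J @ [h]) \<in> \<C>" using J D(2) h by (intro bracket_smooth) auto
      then show "(\<lambda>q. br (map x J @ [h]) q) \<in> smooth_funs A (U \<inter> W)" by (rule smooth_funs_subset) simp
    qed
    then have "(\<lambda>p. sharp A n \<pi> p (s p) h) \<in> smooth_funs A (U \<inter> W)"
    proof (rule smooth_funs_congI[OF o])
      fix q assume "q \<in> U \<inter> W"
      then have q: "q \<in> U" "s q \<in> \<Omega> q" using a by auto
      show "sharp A n \<pi> q (s q) h = (\<Sum>J\<in>increasing mdim n. s q (frame_at E q J) * br (map x J @ [h]) q)"
        unfolding sharp_expand[OF f q] using h
        by (simp add: sum_fun_apply scaleR_fun_def hamiltonian_def nambu_function_bracket_def comp_def)
    qed
    then show "\<exists>V. open V \<and> p \<in> V \<and> (\<lambda>p. sharp A n \<pi> p (s p) h) \<in> smooth_funs A V"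
      using o p pW by blast
  qed
  then show ?thesis using a sharp_tangent by (simp add: tangent_bundle_def)
qed

lemma sharp_bundle_morphism: "bundle_morphism (form_bundle A n) (tangent_bundle A) (sharp A n \<pi>)"
  unfolding bundle_morphism_def fibre_form_eq
proof (intro conjI allI ballI impI)
  fix p u assume u: "u \<in> \<Omega> p"
  show "sharp A n \<pi> p u \<in> fibre (tangent_bundle A) p" using sharp_tangent[OF u] by (simp add: tangent_bundle_def)
  show "sharp A n \<pi> p (c *\<^sub>R u) = c *\<^sub>R sharp A n \<pi> p u" for c by (rule sharp_scale[OF u])
  show "sharp A n \<pi> p (u + w) = sharp A n \<pi> p u + sharp A n \<pi> p w" if "w \<in> \<Omega> p" for w by (rule sharp_add[OF u that])
qed (rule sharp_section)

section \<open>The graph as a subbundle\<close>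

lemma sharp_graph_iff: "u \<in> sharp_graph A n \<pi> p \<longleftrightarrow> snd u \<in> \<Omega> p \<and> fst u = sharp A n \<pi> p (snd u)"
  by (cases u) (auto simp: sharp_graph_def fibre_form_eq)

lemma subspace_sharp_graph: "subspace (sharp_graph A n \<pi> p)"
  unfolding subspace_def sharp_graph_iff
proof (intro conjI ballI allI impI)
  note S = subspace_alt_maps[of n "tangent_space A p"]
  show "snd (0 :: 'a tvec \<times> 'a form) \<in> \<Omega> p" by (simp add: subspace_0[OF S])
  show "fst 0 = sharp A n \<pi> p (snd 0)" using sharp_scale[OF subspace_0[OF S], of 0] by simp
  {
    fix u w assume "u \<in> sharp_graph A n \<pi> p" "w \<in> sharp_graph A n \<pi> p"
    then have u: "snd u \<in> \<Omega> p" "fst u = sharp A n \<pi> p (snd u)" and w: "snd w \<in> \<Omega> p" "fst w = sharp A n \<pi> p (snd w)"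
      by (simp_all add: sharp_graph_iff)
    show "snd (u + w) \<in> \<Omega> p" using subspace_add[OF S u(1) w(1)] by simp
    show "fst (u + w) = sharp A n \<pi> p (snd (u + w))" using sharp_add[OF u(1) w(1)] u(2) w(2) by simp
  next
    fix c u assume "u \<in> sharp_graph A n \<pi> p"
    then have u: "snd u \<in> \<Omega> p" "fst u = sharp A n \<pi> p (snd u)" by (simp_all add: sharp_graph_iff)
    show "snd (c *\<^sub>R u) \<in> \<Omega> p" using subspace_scale[OF S u(1)] by simp
    show "fst (c *\<^sub>R u) = sharp A n \<pi> p (snd (c *\<^sub>R u))" using sharp_scale[OF u(1)] u(2) by simp
  }
qed

text \<open>The projection to the form part identifies the graph with the bundle of forms, and the
  frame is transported along it. The vector part of a section is then smooth by
  \<open>sharp_section\<close>.\<close>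

lemma coordinate_frame_sharp_graph:
  assumes f: "coordinate_frame A (form_bundle A n) U r e c"
  shows "coordinate_frame A (restrict_bundle (generalized_tangent_bundle A n) (sharp_graph A n \<pi>)) U r
    (\<lambda>i p. (sharp A n \<pi> p (e i p), e i p)) (\<lambda>i p u. c i p (snd u))"
  unfolding coordinate_frame_def
proof (intro conjI ballI allI impI)
  note D = coordinate_frameD[OF f, unfolded fibre_form_eq]
  let ?G = "restrict_bundle (generalized_tangent_bundle A n) (sharp_graph A n \<pi>)"
  have G: "fibre ?G p = sharp_graph A n \<pi> p" for p by (simp add: restrict_bundle_def)
  show "open U" by (rule D(1))
  {
    fix p i assume "p \<in> U" "i < r"
    then show "(sharp A n \<pi> p (e i p), e i p) \<in> fibre ?G p" using D(2) by (simp add: G sharp_graph_iff)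
  next
    fix p i j assume "p \<in> U" "i < r" "j < r"
    then show "c i p (snd (sharp A n \<pi> p (e j p), e j p)) = (if i = j then 1 else 0)" using D(3) by simp
  next
    fix p i u w assume "p \<in> U" "i < r" "u \<in> fibre ?G p" "w \<in> fibre ?G p"
    then show "c i p (snd (u + w)) = c i p (snd u) + c i p (snd w)" using D(4) by (simp add: G sharp_graph_iff)
  next
    fix p i u t assume "p \<in> U" "i < r" "u \<in> fibre ?G p"
    then show "c i p (snd (t *\<^sub>R u)) = t * c i p (snd u)" using D(5) by (simp add: G sharp_graph_iff)
  next
    fix p u assume p: "p \<in> U" and "u \<in> fibre ?G p"
    then have u: "snd u \<in> \<Omega> p" "fst u = sharp A n \<pi> p (snd u)" by (simp_all add: G sharp_graph_iff)
    note e = D(6)[OF p u(1)]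
    have "sharp A n \<pi> p (\<Sum>i<r. c i p (snd u) *\<^sub>R e i p) = (\<Sum>i<r. c i p (snd u) *\<^sub>R sharp A n \<pi> p (e i p))"
      by (rule linear_on_sum[OF subspace_alt_maps[of n "tangent_space A p"], where T = "sharp A n \<pi> p"])
         (use D(2)[OF p] in \<open>auto intro: sharp_add sharp_scale\<close>)
    then have "fst u = (\<Sum>i<r. c i p (snd u) *\<^sub>R sharp A n \<pi> p (e i p))" using e u(2) by metis
    then show "u = (\<Sum>i<r. c i p (snd u) *\<^sub>R (sharp A n \<pi> p (e i p), e i p))"
      using e by (intro prod_eqI) (simp_all add: fst_sum snd_sum)
  next
    fix W s assume W: "open W" "W \<subseteq> U"
    show "s \<in> sections ?G W \<longleftrightarrow> (\<forall>p\<in>W. s p \<in> fibre ?G p) \<and> (\<forall>i<r. (\<lambda>p. c i p (snd (s p))) \<in> smooth_funs A W)"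
    proof (intro iffI conjI)
      assume s: "s \<in> sections ?G W"
      then show "\<forall>p\<in>W. s p \<in> fibre ?G p" by (simp add: restrict_bundle_def)
      have "(\<lambda>p. snd (s p)) \<in> sections (form_bundle A n) W"
        using s by (simp add: restrict_bundle_def generalized_tangent_bundle_def direct_sum_def)
      then show "\<forall>i<r. (\<lambda>p. c i p (snd (s p))) \<in> smooth_funs A W" using D(7)[OF W, of "\<lambda>p. snd (s p)"] by simp
    next
      assume s: "(\<forall>p\<in>W. s p \<in> fibre ?G p) \<and> (\<forall>i<r. (\<lambda>p. c i p (snd (s p))) \<in> smooth_funs A W)"
      have g: "s p \<in> sharp_graph A n \<pi> p" "snd (s p) \<in> \<Omega> p" "fst (s p) = sharp A n \<pi> p (snd (s p))" if "p \<in> W" for p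
        using s that by (simp_all add: G sharp_graph_iff)
      have 2: "(\<lambda>p. snd (s p)) \<in> sections (form_bundle A n) W" using D(7)[OF W, of "\<lambda>p. snd (s p)"] s g(2) by simp
      from sharp_section[OF W(1) this]
      have sm: "(\<lambda>p. sharp A n \<pi> p (snd (s p)) h) \<in> smooth_funs A W" if "h \<in> \<C>" for h
        using that by (simp add: tangent_bundle_def)
      have "(\<lambda>p. fst (s p) h) \<in> smooth_funs A W" if "h \<in> \<C>" for h
        by (rule smooth_funs_congI[OF W(1) sm[OF that]]) (simp add: g(3))
      then have 1: "(\<lambda>p. fst (s p)) \<in> sections (tangent_bundle A) W"
        using sharp_tangent[OF g(2)] g(3) by (simp add: tangent_bundle_def)
      show "s \<in> sections ?G W"
        using 1 2 g(1) by (simp add: restrict_bundle_def generalized_tangent_bundle_def direct_sum_def)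
    qed
  }
qed

lemma subbundle_sharp_graph: "subbundle A (generalized_tangent_bundle A n) (sharp_graph A n \<pi>)"
  unfolding subbundle_def
proof (intro conjI allI)
  show "vector_bundle A (generalized_tangent_bundle A n)" by (rule vector_bundle_generalized_tangent)
  show "sharp_graph A n \<pi> p \<subseteq> fibre (generalized_tangent_bundle A n) p" for p
  proof
    fix u assume "u \<in> sharp_graph A n \<pi> p"
    then have "snd u \<in> \<Omega> p" "fst u \<in> tangent_space A p" using sharp_tangent unfolding sharp_graph_iff by auto
    then show "u \<in> fibre (generalized_tangent_bundle A n) p"
      by (simp add: generalized_tangent_bundle_def direct_sum_def tangent_bundle_def fibre_form_eq mem_Times_iff)
  qed
  show "vector_bundle A (restrict_bundle (generalized_tangent_bundle A n) (sharp_graph A n \<pi>))"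
  proof (rule vector_bundleI[where r = "length (multi_indices n)"])
    fix p
    show "subspace (fibre (restrict_bundle (generalized_tangent_bundle A n) (sharp_graph A n \<pi>)) p)"
      using subspace_sharp_graph by (simp add: restrict_bundle_def)
    show "sheaf (restrict_bundle (generalized_tangent_bundle A n) (sharp_graph A n \<pi>))"
      unfolding generalized_tangent_bundle_def
      by (intro sheaf_restrict_bundle sheaf_direct_sum sheaf_tangent_bundle sheaf_form_bundle)
    obtain U x E where "p \<in> U" "chart_frame U x E" using chart_frame_exists by blast
    then show "\<exists>U e c. p \<in> U \<and> coordinate_frame A (restrict_bundle (generalized_tangent_bundle A n) (sharp_graph A n \<pi>)) U
        (length (multi_indices n)) e c"
      using coordinate_frame_sharp_graph[OF coordinate_frame_form] by blast
  qed
qed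

subsection \<open>The quadratic identities of a Nambu-Poisson structure\<close>

lemma cotangent_add: "\<xi> \<in> cotangent_space A p \<Longrightarrow> \<eta> \<in> cotangent_space A p \<Longrightarrow> \<xi> + \<eta> \<in> cotangent_space A p"
  and cotangent_scale: "\<xi> \<in> cotangent_space A p \<Longrightarrow> c *\<^sub>R \<xi> \<in> cotangent_space A p"
  unfolding cotangent_space_eq by (rule subspace_add[OF subspace_alt_maps] subspace_scale[OF subspace_alt_maps]; assumption)+

lemma subspace_cotangent: "subspace (cotangent_space A p)"
  unfolding cotangent_space_eq by (rule subspace_alt_maps)

abbreviation "differentials fs p \<equiv> map (\<lambda>f. differential A f p) fs"

lemma set_differentials: "set (differentials fs p) \<subseteq> cotangent_space A p"
  using differential_cotangent by auto

text \<open>The product rule in one slot, for the combination that bracketing with a product of two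
  functions creates.\<close>

lemma br_update_linear:
  assumes gs: "length gs = Suc n" and i: "i < Suc n" and C: "u \<in> \<C>" "w \<in> \<C>" "h \<in> \<C>" "k \<in> \<C>"
  shows "br (gs[i := (\<lambda>q. u q * h q + w q * k q)]) p =
    (u p * br (gs[i := h]) p + h p * br (gs[i := u]) p) + (w p * br (gs[i := k]) p + k p * br (gs[i := w]) p)"
proof -
  let ?d = "\<lambda>f. differential A f p"
  note d = differential_cotangent[where p = p]
  have l: "length (differentials gs p) = Suc n" using gs by simp
  note add = alt_add[OF pi_alt l set_differentials i] and scale = alt_scale[OF pi_alt l set_differentials i]
  have uh: "(\<lambda>q. u q * h q) \<in> \<C>" "(\<lambda>q. w q * k q) \<in> \<C>" by (intro smooth_funs_mult open_UNIV C)+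
  have "br (gs[i := (\<lambda>q. u q * h q + w q * k q)]) p =
      \<pi> p ((differentials gs p)[i := (u p *\<^sub>R ?d h + h p *\<^sub>R ?d u) + (w p *\<^sub>R ?d k + k p *\<^sub>R ?d w)])"
    by (simp add: nambu_function_bracket_def map_update differential_add[OF uh] differential_mult C)
  then show ?thesis
    by (simp add: nambu_function_bracket_def map_update add[OF cotangent_add[OF cotangent_scale[OF d] cotangent_scale[OF d]]
        cotangent_add[OF cotangent_scale[OF d] cotangent_scale[OF d]]]
        add[OF cotangent_scale[OF d] cotangent_scale[OF d]] scale[OF d])
qed

lemma br_Cons_mult:
  assumes fs: "length fs = n" and C: "u \<in> \<C>" "w \<in> \<C>"
  shows "br ((\<lambda>q. u q * w q) # fs) p = u p * br (w # fs) p + w p * br (u # fs) p"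
proof -
  let ?d = "\<lambda>f. differential A f p"
  note d = differential_cotangent[where p = p]
  have l: "length (?d u # differentials fs p) = Suc n" using fs by simp
  have s: "set (?d u # differentials fs p) \<subseteq> cotangent_space A p" using set_differentials d by simp
  have add: "\<pi> p ((\<xi> + \<eta>) # differentials fs p) = \<pi> p (\<xi> # differentials fs p) + \<pi> p (\<eta> # differentials fs p)"
    if "\<xi> \<in> cotangent_space A p" "\<eta> \<in> cotangent_space A p" for \<xi> \<eta>
    using alt_add[OF pi_alt l s, of 0 \<xi> \<eta>] that by simp
  have scale: "\<pi> p ((c *\<^sub>R \<xi>) # differentials fs p) = c * \<pi> p (\<xi> # differentials fs p)"
    if "\<xi> \<in> cotangent_space A p" for \<xi> c
    using alt_scale[OF pi_alt l s, of 0 \<xi> c] that by simp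
  show ?thesis
    by (simp add: nambu_function_bracket_def differential_mult C add[OF cotangent_scale[OF d] cotangent_scale[OF d]] scale[OF d])
qed

text \<open>The fundamental identity with the first Hamiltonian replaced by a product of functions is not
  a derivation identity; what is left over is this pointwise quadratic identity.\<close>

lemma quadratic_identity:
  assumes "\<upsilon> \<in> cotangent_space A p" "\<omega> \<in> cotangent_space A p" "length F = m" "set F \<subseteq> cotangent_space A p"
    and "length ys = Suc n" "set ys \<subseteq> cotangent_space A p"
  shows "(\<Sum>j<Suc n. \<pi> p (\<omega> # F @ [ys ! j]) * \<pi> p (ys[j := \<upsilon>]) + \<pi> p (\<upsilon> # F @ [ys ! j]) * \<pi> p (ys[j := \<omega>])) = 0"
proof -
  obtain u where u: "u \<in> \<C>" "\<upsilon> = differential A u p" using covector_differential[OF assms(1)] by blast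
  obtain w where w: "w \<in> \<C>" "\<omega> = differential A w p" using covector_differential[OF assms(2)] by blast
  obtain fs where fs: "set fs \<subseteq> \<C>" "F = differentials fs p" using covector_differentials[OF assms(4)] by blast
  obtain gs where gs: "set gs \<subseteq> \<C>" "ys = differentials gs p" using covector_differentials[OF assms(6)] by blast
  have l: "length fs = m" "length gs = Suc n" using assms fs gs by simp_all
  define h where "h i = br (w # fs @ [gs ! i])" for i
  define k where "k i = br (u # fs @ [gs ! i])" for i
  have gi: "gs ! i \<in> \<C>" if "i < Suc n" for i using gs(1) l that nth_mem[of i gs] by auto
  have hC: "h i \<in> \<C>" and kC: "k i \<in> \<C>" if "i < Suc n" for i
    unfolding h_def k_def using gi[OF that] fs(1) u(1) w(1) l by (auto intro!: bracket_smooth)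
  have gC: "br gs \<in> \<C>" by (rule bracket_smooth[OF gs(1) l(2)])
  have uw: "(\<lambda>q. u q * w q) \<in> \<C>" by (intro smooth_funs_mult open_UNIV u w)
  \<comment> \<open>An equality of functions, since on the right-hand side of the fundamental
    identity it is differentiated once more.\<close>
  have prod: "br ((\<lambda>q. u q * w q) # fs @ [g]) = (\<lambda>q. u q * br (w # fs @ [g]) q + w q * br (u # fs @ [g]) q)" for g
    using l by (intro ext br_Cons_mult u w) simp
  have "br (((\<lambda>q. u q * w q) # fs) @ [br gs]) p = (\<Sum>i<Suc n. br (gs[i := br (((\<lambda>q. u q * w q) # fs) @ [gs ! i])]) p)"
    using l fs(1) uw by (intro fundamental_identity gs) auto
  also have "... = (\<Sum>i<Suc n. br (gs[i := (\<lambda>q. u q * h i q + w q * k i q)]) p)"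
    by (simp only: append_Cons prod h_def k_def)
  also have "... = (\<Sum>i<Suc n. (u p * br (gs[i := h i]) p + h i p * br (gs[i := u]) p) +
      (w p * br (gs[i := k i]) p + k i p * br (gs[i := w]) p))"
    by (intro sum.cong refl br_update_linear l u w hC kC) auto
  also have "... = u p * (\<Sum>i<Suc n. br (gs[i := h i]) p) + w p * (\<Sum>i<Suc n. br (gs[i := k i]) p) +
      (\<Sum>i<Suc n. h i p * br (gs[i := u]) p + k i p * br (gs[i := w]) p)"
    by (simp only: sum.distrib sum_distrib_left algebra_simps)
  \<comment> \<open>The sums multiplied by the values of u and w are fundamental identities for
    \<open>w # fs\<close> and \<open>u # fs\<close>; they cancel against the left-hand side, and the
    cross terms remain.\<close>
  also have "(\<Sum>i<Suc n. br (gs[i := h i]) p) = br (w # fs @ [br gs]) p"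
    using fundamental_identity[of "w # fs" gs p] l fs(1) w(1) gs(1) unfolding h_def by simp
  also have "(\<Sum>i<Suc n. br (gs[i := k i]) p) = br (u # fs @ [br gs]) p"
    using fundamental_identity[of "u # fs" gs p] l fs(1) u(1) gs(1) unfolding k_def by simp
  finally have "(\<Sum>i<Suc n. h i p * br (gs[i := u]) p + k i p * br (gs[i := w]) p) = 0"
    unfolding append_Cons prod by linarith
  moreover have "\<pi> p (\<omega> # F @ [ys ! j]) = h j p" "\<pi> p (\<upsilon> # F @ [ys ! j]) = k j p" if "j < Suc n" for j
    using that l unfolding h_def k_def nambu_function_bracket_def u(2) w(2) fs(2) gs(2) by simp_all
  moreover have "\<pi> p (ys[j := \<upsilon>]) = br (gs[j := u]) p" "\<pi> p (ys[j := \<omega>]) = br (gs[j := w]) p" for j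
    unfolding nambu_function_bracket_def u(2) w(2) gs(2) by (simp_all add: map_update)
  ultimately show ?thesis by simp
qed

text \<open>An expression of Pluecker type: entry i of \<open>xs\<close> changes places with each
  entry of \<open>ys\<close> in turn. \<open>quadratic_identity\<close> compares these sums for
  different i.\<close>

definition exchange :: "'a \<Rightarrow> 'a form list \<Rightarrow> 'a form list \<Rightarrow> nat \<Rightarrow> real"
  where "exchange p xs ys i = (\<Sum>j<Suc n. \<pi> p (xs[i := ys ! j]) * \<pi> p (ys[j := xs ! i]))"

text \<open>For i = 0 this is \<open>quadratic_identity\<close>, with one summand rewritten by
  swapping the first and the last slot. Other slots are brought to the front by a
  transposition.\<close>

lemma exchange_last:
  assumes x: "length xs = Suc n" "set xs \<subseteq> cotangent_space A p"
    and y: "length ys = Suc n" "set ys \<subseteq> cotangent_space A p" and i: "i < Suc n"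
  shows "exchange p xs ys i = exchange p xs ys n"
proof -
  let ?V = "cotangent_space A p"
  have yj: "ys ! j \<in> ?V" if "j < Suc n" for j using that y by auto
  have first: "exchange p zs ys 0 = exchange p zs ys n" if z: "length zs = Suc n" "set zs \<subseteq> ?V" for zs
  proof -
    obtain \<omega> rest where 1: "zs = \<omega> # rest" using z(1) by (cases zs) auto
    obtain F \<upsilon> where 2: "rest = F @ [\<upsilon>]" using z(1) 1 by (cases rest rule: rev_cases) auto
    have zs: "zs = \<omega> # F @ [\<upsilon>]" and lF: "length F = m" using 1 2 z(1) by auto
    have V: "\<omega> \<in> ?V" "\<upsilon> \<in> ?V" "set F \<subseteq> ?V" using z(2) zs by auto
    have a: "exchange p zs ys n = (\<Sum>j<Suc n. \<pi> p (\<omega> # F @ [ys ! j]) * \<pi> p (ys[j := \<upsilon>]))"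
      unfolding exchange_def zs using lF by (simp add: list_update_append nth_append)
    have "exchange p zs ys 0 = (\<Sum>j<Suc n. - (\<pi> p (\<upsilon> # F @ [ys ! j]) * \<pi> p (ys[j := \<omega>])))"
      unfolding exchange_def
    proof (rule sum.cong[OF refl])
      fix j assume "j \<in> {..<Suc n}"
      then have j: "ys ! j \<in> ?V" using yj by simp
      have "\<pi> p (zs[0 := ys ! j, n := \<upsilon>]) = - \<pi> p (zs[0 := \<upsilon>, n := ys ! j])"
        by (rule alt_swap[OF pi_alt subspace_cotangent z]) (use j V in auto)
      moreover have "zs[0 := ys ! j, n := \<upsilon>] = zs[0 := ys ! j]" "zs[0 := \<upsilon>, n := ys ! j] = \<upsilon> # F @ [ys ! j]"
        unfolding zs using lF by (simp_all add: list_update_append)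
      ultimately show "\<pi> p (zs[0 := ys ! j]) * \<pi> p (ys[j := zs ! 0]) = - (\<pi> p (\<upsilon> # F @ [ys ! j]) * \<pi> p (ys[j := \<omega>]))"
        by (simp add: zs)
    qed
    then show ?thesis
      using a quadratic_identity[OF V(2,1) lF V(3) y] by (simp only: sum.distrib sum_negf)
  qed
  show ?thesis
  proof (cases "i = 0 \<or> i = n")
    case True
    then show ?thesis using first[OF x] by auto
  next
    case False
    then have i0: "0 < i" "i < n" using i by auto
    \<comment> \<open>Exchanging entries 0 and i reverses the sign of every first factor. It does so
      again when the last slot is considered, and the two signs cancel.\<close>
    let ?z = "xs[0 := xs ! i, i := xs ! 0]"
    have xi: "xs ! 0 \<in> ?V" "xs ! i \<in> ?V" using x i by auto
    have z: "length ?z = Suc n" "set ?z \<subseteq> ?V"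
      using x(1) set_update_subset[OF set_update_subset[OF x(2) xi(2)] xi(1)] by simp_all
    have z0: "?z ! 0 = xs ! i" "?z ! n = xs ! n" using i0 x(1) by simp_all
    have "\<pi> p (xs[i := \<eta>]) = - \<pi> p (?z[0 := \<eta>])" if "\<eta> \<in> ?V" for \<eta>
    proof -
      have "\<pi> p (xs[0 := xs ! 0, i := \<eta>]) = - \<pi> p (xs[0 := \<eta>, i := xs ! 0])"
        by (rule alt_swap[OF pi_alt subspace_cotangent x]) (use i0 xi that in auto)
      moreover have "?z[0 := \<eta>] = xs[0 := \<eta>, i := xs ! 0]" using i0 by (simp add: list_update_swap)
      ultimately show ?thesis by simp
    qed
    then have "exchange p xs ys i = - exchange p ?z ys 0"
      unfolding exchange_def z0 using yj by (simp add: sum_negf)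
    also have "exchange p ?z ys 0 = exchange p ?z ys n" by (rule first[OF z])
    also have "exchange p ?z ys n = - exchange p xs ys n"
    proof -
      have "\<pi> p (?z[n := \<eta>]) = - \<pi> p (xs[n := \<eta>])" if "\<eta> \<in> ?V" for \<eta>
      proof -
        have "\<pi> p ((xs[n := \<eta>])[0 := (xs[n := \<eta>]) ! i, i := (xs[n := \<eta>]) ! 0]) = - \<pi> p (xs[n := \<eta>])"
          by (rule alt_swap_nth[OF pi_alt subspace_cotangent _ set_update_subset[OF x(2) that]]) (use x(1) i0 in auto)
        moreover have "(xs[n := \<eta>])[0 := (xs[n := \<eta>]) ! i, i := (xs[n := \<eta>]) ! 0] = ?z[n := \<eta>]"
          using i0 x(1) by (intro nth_equalityI) (auto simp: nth_list_update)
        ultimately show ?thesis by simp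
      qed
      then show ?thesis unfolding exchange_def z0 using yj by (simp add: sum_negf)
    qed
    finally show ?thesis by simp
  qed
qed

text \<open>All the \<open>exchange p xs ys i\<close> agree, so each is their average over \<open>i\<close>, which is visibly
  symmetric in \<open>xs\<close> and \<open>ys\<close>.  This replaces the decomposability of Nambu-Poisson tensors.\<close>

lemma exchange_sym:
  assumes x: "length xs = Suc n" "set xs \<subseteq> cotangent_space A p"
    and y: "length ys = Suc n" "set ys \<subseteq> cotangent_space A p"
  shows "exchange p xs ys n = exchange p ys xs n"
proof -
  have "(\<Sum>i<Suc n. exchange p xs ys i) = (\<Sum>i<Suc n. exchange p xs ys n)"
    by (intro sum.cong refl exchange_last x y) simp
  then have "real (Suc n) * exchange p xs ys n = (\<Sum>i<Suc n. exchange p xs ys i)" by simp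
  also have "... = (\<Sum>i<Suc n. exchange p ys xs i)"
    unfolding exchange_def by (subst sum.swap) (simp only: mult.commute)
  also have "... = (\<Sum>i<Suc n. exchange p ys xs n)"
    by (intro sum.cong refl exchange_last x y) simp
  also have "... = real (Suc n) * exchange p ys xs n" by simp
  finally show ?thesis by simp
qed

text \<open>Symmetry of the exchange sum for \<open>\<xi>s @ [\<xi>]\<close> and
  \<open>\<eta>s @ [\<zeta>]\<close>. The summand j = n is common to both sides; in the others of
  one side, moving \<zeta> to the last slot gives the sign that turns the equality into a vanishing
  sum.\<close>

lemma exchange_identity:
  assumes \<xi>: "length \<xi>s = n" "set \<xi>s \<subseteq> cotangent_space A p" and \<eta>: "length \<eta>s = n" "set \<eta>s \<subseteq> cotangent_space A p"
    and \<zeta>: "\<xi> \<in> cotangent_space A p" "\<zeta> \<in> cotangent_space A p"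
  shows "(\<Sum>i<n. \<pi> p (\<xi>s @ [\<eta>s ! i]) * \<pi> p (\<eta>s[i := \<xi>] @ [\<zeta>])) +
    (\<Sum>i<n. \<pi> p (\<eta>s @ [\<xi>s ! i]) * \<pi> p (\<xi>s[i := \<xi>] @ [\<zeta>])) = 0"
proof -
  have x: "length (\<xi>s @ [\<xi>]) = Suc n" "set (\<xi>s @ [\<xi>]) \<subseteq> cotangent_space A p"
    and y: "length (\<eta>s @ [\<zeta>]) = Suc n" "set (\<eta>s @ [\<zeta>]) \<subseteq> cotangent_space A p" using assms by auto
  have last: "(vs @ [u])[n := u'] = vs @ [u']" "(vs @ [u]) ! n = u" if "length vs = n" for vs :: "'a form list" and u u'
    using that by (metis list_update_length, metis nth_append_length)
  have front: "(vs @ [u])[i := u'] = vs[i := u'] @ [u]" "(vs @ [u]) ! i = vs ! i" if "length vs = n" "i < n"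
    for vs :: "'a form list" and u u' i
    using that by (simp_all add: list_update_append nth_append)
  have 1: "exchange p (\<xi>s @ [\<xi>]) (\<eta>s @ [\<zeta>]) n =
      (\<Sum>i<n. \<pi> p (\<xi>s @ [\<eta>s ! i]) * \<pi> p (\<eta>s[i := \<xi>] @ [\<zeta>])) + \<pi> p (\<xi>s @ [\<zeta>]) * \<pi> p (\<eta>s @ [\<xi>])"
    unfolding exchange_def sum.lessThan_Suc[of _ n] last[OF \<xi>(1)] last[OF \<eta>(1)]
    using front[OF \<eta>(1)] by (intro arg_cong2[of _ _ _ _ "(+)"] sum.cong) simp_all
  have 2: "exchange p (\<eta>s @ [\<zeta>]) (\<xi>s @ [\<xi>]) n =
      (\<Sum>i<n. - (\<pi> p (\<eta>s @ [\<xi>s ! i]) * \<pi> p (\<xi>s[i := \<xi>] @ [\<zeta>]))) + \<pi> p (\<eta>s @ [\<xi>]) * \<pi> p (\<xi>s @ [\<zeta>])"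
    unfolding exchange_def sum.lessThan_Suc[of _ n] last[OF \<xi>(1)] last[OF \<eta>(1)]
  proof (intro arg_cong2[of _ _ _ _ "(+)"] sum.cong refl)
    fix i assume "i \<in> {..<n}"
    then have i: "i < n" by simp
    have "\<pi> p ((\<xi>s @ [\<xi>])[i := \<zeta>, n := \<xi>]) = - \<pi> p ((\<xi>s @ [\<xi>])[i := \<xi>, n := \<zeta>])"
      by (rule alt_swap[OF pi_alt subspace_cotangent x]) (use i \<zeta> in auto)
    then have "\<pi> p (\<xi>s[i := \<zeta>] @ [\<xi>]) = - \<pi> p (\<xi>s[i := \<xi>] @ [\<zeta>])"
      using \<xi>(1) by (simp only: front[OF \<xi>(1) i] last length_list_update)
    then show "\<pi> p (\<eta>s @ [(\<xi>s @ [\<xi>]) ! i]) * \<pi> p ((\<xi>s @ [\<xi>])[i := \<zeta>]) =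
        - (\<pi> p (\<eta>s @ [\<xi>s ! i]) * \<pi> p (\<xi>s[i := \<xi>] @ [\<zeta>]))"
      by (simp only: front[OF \<xi>(1) i] mult_minus_right)
  qed
  show ?thesis using exchange_sym[OF x y] unfolding 1 2 by (simp only: sum_negf mult.commute)
qed

definition exch_form :: "'a \<Rightarrow> 'a form \<Rightarrow> 'a form \<Rightarrow> 'a form \<Rightarrow> 'a tvec"
  where "exch_form p \<xi> \<alpha> \<beta> = sharp A n \<pi> p (covector_wedge m p \<xi> (\<lambda>vs. \<beta> (sharp A n \<pi> p \<alpha> # vs)))"

lemma exch_form_arg:
  assumes "\<xi> \<in> cotangent_space A p" "\<alpha> \<in> \<Omega> p" "\<beta> \<in> \<Omega> p"
  shows "covector_wedge m p \<xi> (\<lambda>vs. \<beta> (sharp A n \<pi> p \<alpha> # vs)) \<in> \<Omega> p"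
  by (rule covector_wedge_alt[OF assms(1) alt_interior[OF assms(3) sharp_tangent[OF assms(2)]]])

lemma exch_form_linear:
  assumes \<xi>: "\<xi> \<in> cotangent_space A p" and a: "\<alpha> \<in> \<Omega> p" and b: "\<beta> \<in> \<Omega> p" and c: "\<gamma> \<in> \<Omega> p"
  shows "exch_form p \<xi> (\<alpha> + \<beta>) \<gamma> = exch_form p \<xi> \<alpha> \<gamma> + exch_form p \<xi> \<beta> \<gamma>"
    and "exch_form p \<xi> (t *\<^sub>R \<alpha>) \<gamma> = t *\<^sub>R exch_form p \<xi> \<alpha> \<gamma>"
    and "exch_form p \<xi> \<gamma> (\<alpha> + \<beta>) = exch_form p \<xi> \<gamma> \<alpha> + exch_form p \<xi> \<gamma> \<beta>"
    and "exch_form p \<xi> \<gamma> (t *\<^sub>R \<alpha>) = t *\<^sub>R exch_form p \<xi> \<gamma> \<alpha>"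
proof -
  let ?T = "tangent_space A p"
  have add: "(\<lambda>vs. \<gamma> ((u + w) # vs)) = (\<lambda>vs. \<gamma> (u # vs)) + (\<lambda>vs. \<gamma> (w # vs))" if u: "u \<in> ?T" and w: "w \<in> ?T" for u w
  proof
    fix vs
    note uw = subspace_add[OF subspace_tangent_space u w]
    show "\<gamma> ((u + w) # vs) = ((\<lambda>vs. \<gamma> (u # vs)) + (\<lambda>vs. \<gamma> (w # vs))) vs"
    proof (cases "length vs = m \<and> set vs \<subseteq> ?T")
      case True
      then show ?thesis using alt_add[OF c, of "u # vs" 0 u w] u w by simp
    next
      case False
      then have "\<gamma> (z # vs) = 0" for z by (intro alt_outside[OF c]) auto
      then show ?thesis by simp
    qed
  qed
  have scale: "(\<lambda>vs. \<gamma> ((t *\<^sub>R u) # vs)) = t *\<^sub>R (\<lambda>vs. \<gamma> (u # vs))" if u: "u \<in> ?T" for u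
  proof
    fix vs
    show "\<gamma> ((t *\<^sub>R u) # vs) = (t *\<^sub>R (\<lambda>vs. \<gamma> (u # vs))) vs"
    proof (cases "length vs = m \<and> set vs \<subseteq> ?T")
      case True
      then show ?thesis using alt_scale[OF c, of "u # vs" 0 u t] u by (simp add: scaleR_fun_def)
    next
      case False
      then have "\<gamma> (z # vs) = 0" for z by (intro alt_outside[OF c]) auto
      then show ?thesis by (simp add: scaleR_fun_def)
    qed
  qed
  have e: "(\<lambda>vs. (\<alpha> + \<beta>) (v # vs)) = (\<lambda>vs. \<alpha> (v # vs)) + (\<lambda>vs. \<beta> (v # vs))"
    "(\<lambda>vs. (t *\<^sub>R \<alpha>) (v # vs)) = t *\<^sub>R (\<lambda>vs. \<alpha> (v # vs))" for v
    by (rule ext, simp add: scaleR_fun_def)+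
  note A = exch_form_arg[OF \<xi>]
  show "exch_form p \<xi> (\<alpha> + \<beta>) \<gamma> = exch_form p \<xi> \<alpha> \<gamma> + exch_form p \<xi> \<beta> \<gamma>"
    unfolding exch_form_def sharp_add[OF a b] add[OF sharp_tangent[OF a] sharp_tangent[OF b]] covector_wedge_add
    by (rule sharp_add[OF A[OF a c] A[OF b c]])
  show "exch_form p \<xi> (t *\<^sub>R \<alpha>) \<gamma> = t *\<^sub>R exch_form p \<xi> \<alpha> \<gamma>"
    unfolding exch_form_def sharp_scale[OF a] scale[OF sharp_tangent[OF a]] covector_wedge_scale
    by (rule sharp_scale[OF A[OF a c]])
  show "exch_form p \<xi> \<gamma> (\<alpha> + \<beta>) = exch_form p \<xi> \<gamma> \<alpha> + exch_form p \<xi> \<gamma> \<beta>"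
    unfolding exch_form_def e covector_wedge_add by (rule sharp_add[OF A[OF c a] A[OF c b]])
  show "exch_form p \<xi> \<gamma> (t *\<^sub>R \<alpha>) = t *\<^sub>R exch_form p \<xi> \<gamma> \<alpha>"
    unfolding exch_form_def e covector_wedge_scale by (rule sharp_scale[OF A[OF c a]])
qed

lemma covector_hamiltonian:
  assumes \<xi>s: "length \<xi>s = n" "set \<xi>s \<subseteq> cotangent_space A p" and \<eta>: "\<eta> \<in> cotangent_space A p"
  shows "\<eta> [hamiltonian p \<xi>s] = \<pi> p (\<xi>s @ [\<eta>])"
proof -
  obtain f where f: "f \<in> \<C>" "\<eta> = differential A f p" using covector_differential[OF \<eta>] by blast
  show ?thesis unfolding f(2) differential_apply[OF hamiltonian_tangent[OF \<xi>s]] using f(1) by (simp add: hamiltonian_def)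
qed

text \<open>Contracting a wedge deletes one factor with a sign and prepending \<xi> fills the gap
  from the front; rotating \<xi> back to the deleted place restores the same sign, and the two
  cancel.\<close>

lemma exch_form_wedge:
  assumes \<xi>s: "length \<xi>s = n" "set \<xi>s \<subseteq> cotangent_space A p" and \<eta>s: "length \<eta>s = n" "set \<eta>s \<subseteq> cotangent_space A p"
    and \<xi>: "\<xi> \<in> cotangent_space A p" and h: "h \<in> \<C>"
  shows "exch_form p \<xi> (wedge A p \<xi>s) (wedge A p \<eta>s) h =
    (\<Sum>i<n. \<pi> p (\<xi>s @ [\<eta>s ! i]) * \<pi> p (\<eta>s[i := \<xi>] @ [differential A h p]))"
proof -
  let ?v = "hamiltonian p \<xi>s"
  have v: "?v \<in> tangent_space A p" by (rule hamiltonian_tangent[OF \<xi>s])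
  have \<eta>i: "\<eta>s ! i \<in> cotangent_space A p" if "i \<le> m" for i using that \<eta>s nth_mem[of i \<eta>s] by auto
  have del: "length (delete_nth i \<eta>s) = m" "set (delete_nth i \<eta>s) \<subseteq> cotangent_space A p" if "i \<le> m" for i
    using that \<eta>s set_delete_nth[of i \<eta>s] by (auto simp: length_delete_nth)
  have contr: "(\<lambda>vs. wedge A p \<eta>s (?v # vs)) = (\<Sum>i\<le>m. ((-1) ^ i * \<pi> p (\<xi>s @ [\<eta>s ! i])) *\<^sub>R wedge A p (delete_nth i \<eta>s))"
  proof
    fix vs
    show "wedge A p \<eta>s (?v # vs) = (\<Sum>i\<le>m. ((-1) ^ i * \<pi> p (\<xi>s @ [\<eta>s ! i])) *\<^sub>R wedge A p (delete_nth i \<eta>s)) vs"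
    proof (cases "length vs = m \<and> set vs \<subseteq> tangent_space A p")
      case True
      have "wedge A p \<eta>s (?v # vs) = (\<Sum>i\<le>m. (-1) ^ i * (\<eta>s ! i) [?v] * wedge A p (delete_nth i \<eta>s) vs)"
        using True by (intro wedge_interior \<eta>s v) auto
      also have "... = (\<Sum>i\<le>m. (-1) ^ i * \<pi> p (\<xi>s @ [\<eta>s ! i]) * wedge A p (delete_nth i \<eta>s) vs)"
        using covector_hamiltonian[OF \<xi>s \<eta>i] by (intro sum.cong) auto
      finally show ?thesis by (simp only: sum_fun_apply scaleR_fun_def real_scaleR_def)
    next
      case False
      have "wedge A p (delete_nth i \<eta>s) vs = 0" if "i \<le> m" for i
        using False del(1)[OF that] by (intro wedge_outside) auto
      moreover have "wedge A p \<eta>s (?v # vs) = 0" using False \<eta>s by (intro wedge_outside) auto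
      ultimately show ?thesis by (simp add: sum_fun_apply scaleR_fun_def)
    qed
  qed
  let ?c = "\<lambda>i. (-1) ^ i * \<pi> p (\<xi>s @ [\<eta>s ! i])"
  have len: "length (\<xi> # delete_nth i \<eta>s) = n" "set (\<xi> # delete_nth i \<eta>s) \<subseteq> cotangent_space A p" if "i \<le> m" for i
    using del[OF that] \<xi> by auto
  have "exch_form p \<xi> (wedge A p \<xi>s) (wedge A p \<eta>s) =
      sharp A n \<pi> p (covector_wedge m p \<xi> (\<Sum>i\<le>m. ?c i *\<^sub>R wedge A p (delete_nth i \<eta>s)))"
    unfolding exch_form_def sharp_wedge[OF \<xi>s] contr ..
  also have "covector_wedge m p \<xi> (\<Sum>i\<le>m. ?c i *\<^sub>R wedge A p (delete_nth i \<eta>s)) =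
      (\<Sum>i\<le>m. ?c i *\<^sub>R covector_wedge m p \<xi> (wedge A p (delete_nth i \<eta>s)))"
    by (rule linear_on_sum[OF subspace_UNIV, where T = "covector_wedge m p \<xi>"])
       (simp_all add: covector_wedge_add covector_wedge_scale)
  also have "... = (\<Sum>i\<le>m. ?c i *\<^sub>R wedge A p (\<xi> # delete_nth i \<eta>s))"
    using del covector_wedge_wedge by (intro sum.cong) auto
  also have "sharp A n \<pi> p ... = (\<Sum>i\<le>m. ?c i *\<^sub>R sharp A n \<pi> p (wedge A p (\<xi> # delete_nth i \<eta>s)))"
  proof (rule linear_on_sum[OF subspace_alt_maps[of n "tangent_space A p"], where T = "sharp A n \<pi> p"])
    fix i assume "i \<in> {..m}"
    then show "wedge A p (\<xi> # delete_nth i \<eta>s) \<in> \<Omega> p" by (intro wedge_alt len) auto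
  qed (rule sharp_add sharp_scale; assumption)+
  also have "... = (\<Sum>i\<le>m. ?c i *\<^sub>R hamiltonian p (\<xi> # delete_nth i \<eta>s))"
    using sharp_wedge[OF len] by (intro sum.cong) auto
  finally have "exch_form p \<xi> (wedge A p \<xi>s) (wedge A p \<eta>s) h = (\<Sum>i\<le>m. ?c i * hamiltonian p (\<xi> # delete_nth i \<eta>s) h)"
    by (simp only: sum_fun_apply scaleR_fun_def real_scaleR_def)
  also have "... = (\<Sum>i\<le>m. \<pi> p (\<xi>s @ [\<eta>s ! i]) * \<pi> p (\<eta>s[i := \<xi>] @ [differential A h p]))"
  proof (rule sum.cong[OF refl])
    fix i assume "i \<in> {..m}"
    then have "i < n" by simp
    from alt_rotate[OF alt_last[OF pi_alt differential_cotangent] subspace_cotangent \<eta>s this \<xi>]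
    have "\<pi> p (\<xi> # delete_nth i \<eta>s @ [differential A h p]) = (-1) ^ i * \<pi> p (\<eta>s[i := \<xi>] @ [differential A h p])" by simp
    then have r: "hamiltonian p (\<xi> # delete_nth i \<eta>s) h = (-1) ^ i * \<pi> p (\<eta>s[i := \<xi>] @ [differential A h p])"
      using h by (simp add: hamiltonian_def)
    have "(-1) ^ i * (-1 :: real) ^ i = 1" by (simp add: power_add[symmetric])
    then show "?c i * hamiltonian p (\<xi> # delete_nth i \<eta>s) h = \<pi> p (\<xi>s @ [\<eta>s ! i]) * \<pi> p (\<eta>s[i := \<xi>] @ [differential A h p])"
      unfolding r by (simp add: algebra_simps)
  qed
  finally show ?thesis by (simp only: lessThan_Suc_atMost)
qed

text \<open>Bilinearity reduces the claim to coordinate wedges, where \<open>exch_form_wedge\<close>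
  turns it into \<open>exchange_identity\<close>.\<close>

lemma exch_form_antisym:
  assumes \<xi>: "\<xi> \<in> cotangent_space A p" and a: "\<alpha> \<in> \<Omega> p" and b: "\<beta> \<in> \<Omega> p"
  shows "exch_form p \<xi> \<alpha> \<beta> + exch_form p \<xi> \<beta> \<alpha> = 0"
proof -
  obtain U x E where p: "p \<in> U" and f: "chart_frame U x E" using chart_frame_exists by blast
  let ?I = "increasing mdim n"
  let ?w = "\<lambda>J. wedge A p (coframe_at x p J)"
  have J: "length (coframe_at x p J) = n" if "J \<in> ?I" for J using that by (simp add: increasing_def)
  have w: "?w J \<in> \<Omega> p" if "J \<in> ?I" for J by (intro wedge_alt coframe_at_cotangent J that)
  have ex: "exch_form p \<xi> \<gamma> \<delta> = (\<Sum>J\<in>?I. \<Sum>K\<in>?I. \<gamma> (frame_at E p J) *\<^sub>R \<delta> (frame_at E p K) *\<^sub>R exch_form p \<xi> (?w J) (?w K))"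
    if c: "\<gamma> \<in> \<Omega> p" and d: "\<delta> \<in> \<Omega> p" for \<gamma> \<delta>
  proof -
    have "exch_form p \<xi> \<gamma> \<delta> = exch_form p \<xi> (\<Sum>J\<in>?I. \<gamma> (frame_at E p J) *\<^sub>R ?w J) \<delta>"
      using form_expand[OF f p c] by simp
    also have "... = (\<Sum>J\<in>?I. \<gamma> (frame_at E p J) *\<^sub>R exch_form p \<xi> (?w J) \<delta>)"
      by (rule linear_on_sum[OF subspace_alt_maps[of n "tangent_space A p"], where T = "\<lambda>\<gamma>. exch_form p \<xi> \<gamma> \<delta>"])
         (use w exch_form_linear[OF \<xi> _ _ d] in auto)
    also have "... = (\<Sum>J\<in>?I. \<gamma> (frame_at E p J) *\<^sub>R (\<Sum>K\<in>?I. \<delta> (frame_at E p K) *\<^sub>R exch_form p \<xi> (?w J) (?w K)))"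
    proof (rule sum.cong[OF refl])
      fix J assume J: "J \<in> ?I"
      have "exch_form p \<xi> (?w J) \<delta> = exch_form p \<xi> (?w J) (\<Sum>K\<in>?I. \<delta> (frame_at E p K) *\<^sub>R ?w K)"
        using form_expand[OF f p d] by simp
      also have "... = (\<Sum>K\<in>?I. \<delta> (frame_at E p K) *\<^sub>R exch_form p \<xi> (?w J) (?w K))"
        by (rule linear_on_sum[OF subspace_alt_maps[of n "tangent_space A p"], where T = "exch_form p \<xi> (?w J)"])
           (use w exch_form_linear[OF \<xi> _ _ w[OF J]] in auto)
      finally show "\<gamma> (frame_at E p J) *\<^sub>R exch_form p \<xi> (?w J) \<delta> =
          \<gamma> (frame_at E p J) *\<^sub>R (\<Sum>K\<in>?I. \<delta> (frame_at E p K) *\<^sub>R exch_form p \<xi> (?w J) (?w K))" by simp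
    qed
    finally show ?thesis by (simp only: scaleR_sum_right)
  qed
  have z: "exch_form p \<xi> (?w J) (?w K) h + exch_form p \<xi> (?w K) (?w J) h = 0" if "J \<in> ?I" "K \<in> ?I" "h \<in> \<C>" for J K h
    unfolding exch_form_wedge[OF J[OF that(1)] coframe_at_cotangent J[OF that(2)] coframe_at_cotangent \<xi> that(3)]
      exch_form_wedge[OF J[OF that(2)] coframe_at_cotangent J[OF that(1)] coframe_at_cotangent \<xi> that(3)]
    by (rule exchange_identity[OF J[OF that(1)] coframe_at_cotangent J[OF that(2)] coframe_at_cotangent \<xi> differential_cotangent])
  show ?thesis
  proof
    fix h
    show "(exch_form p \<xi> \<alpha> \<beta> + exch_form p \<xi> \<beta> \<alpha>) h = 0 h"
    proof (cases "h \<in> \<C>")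
      case True
      have "exch_form p \<xi> \<alpha> \<beta> h + exch_form p \<xi> \<beta> \<alpha> h =
          (\<Sum>J\<in>?I. \<Sum>K\<in>?I. \<alpha> (frame_at E p J) * (\<beta> (frame_at E p K) * exch_form p \<xi> (?w J) (?w K) h)) +
          (\<Sum>K\<in>?I. \<Sum>J\<in>?I. \<beta> (frame_at E p K) * (\<alpha> (frame_at E p J) * exch_form p \<xi> (?w K) (?w J) h))"
        unfolding ex[OF a b] ex[OF b a] by (simp only: sum_fun_apply scaleR_fun_def real_scaleR_def)
      also have "(\<Sum>K\<in>?I. \<Sum>J\<in>?I. \<beta> (frame_at E p K) * (\<alpha> (frame_at E p J) * exch_form p \<xi> (?w K) (?w J) h)) =
          (\<Sum>J\<in>?I. \<Sum>K\<in>?I. \<beta> (frame_at E p K) * (\<alpha> (frame_at E p J) * exch_form p \<xi> (?w K) (?w J) h))"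
        by (rule sum.swap)
      also have "(\<Sum>J\<in>?I. \<Sum>K\<in>?I. \<alpha> (frame_at E p J) * (\<beta> (frame_at E p K) * exch_form p \<xi> (?w J) (?w K) h)) + ... =
          (\<Sum>J\<in>?I. \<Sum>K\<in>?I. \<alpha> (frame_at E p J) * \<beta> (frame_at E p K) *
            (exch_form p \<xi> (?w J) (?w K) h + exch_form p \<xi> (?w K) (?w J) h))"
        by (simp only: sum.distrib[symmetric]) (simp only: algebra_simps)
      also have "... = 0" using z[OF _ _ True] by (intro sum.neutral ballI) simp
      finally show ?thesis by simp
    next
      case False
      then show ?thesis
        using tangent_outside[OF sharp_tangent[OF exch_form_arg[OF \<xi> a b]]] tangent_outside[OF sharp_tangent[OF exch_form_arg[OF \<xi> b a]]]
        by (simp add: exch_form_def)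
    qed
  qed
qed

subsection \<open>The bracket of forms\<close>

abbreviation (input) "S \<equiv> sharp_field A n \<pi>"
text \<open>The bracket of forms with its last two terms merged by Cartan's formula, as in
  \<open>dorfman_pair\<close>; see \<open>nambu_form_bracket_eq\<close>.\<close>

abbreviation (input) "fb \<alpha> \<beta> \<equiv> LD n (S \<alpha>) \<beta> - ip (S \<beta>) (dd n \<alpha>)"

lemma sharp_field_vector_field: "\<alpha> \<in> forms A n \<Longrightarrow> S \<alpha> \<in> vector_fields A"
  unfolding sharp_field_def by (rule sharp_section[OF open_UNIV])

lemma sharp_field_add: "\<alpha> \<in> forms A n \<Longrightarrow> \<beta> \<in> forms A n \<Longrightarrow> S (\<alpha> + \<beta>) = S \<alpha> + S \<beta>"
  by (rule ext) (simp add: sharp_field_def sharp_add[OF form_alt form_alt])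

lemma sharp_field_scale: "\<alpha> \<in> forms A n \<Longrightarrow> S (\<lambda>p. f p *\<^sub>R \<alpha> p) = (\<lambda>p. f p *\<^sub>R S \<alpha> p)"
  by (rule ext) (simp add: sharp_field_def sharp_scale[OF form_alt])

lemma sharp_field_diff: "\<alpha> \<in> forms A n \<Longrightarrow> \<beta> \<in> forms A n \<Longrightarrow> S (\<alpha> - \<beta>) = S \<alpha> - S \<beta>"
  using sharp_field_add[OF form_diff, of \<alpha> \<beta> \<beta>] by (simp add: algebra_simps)

lemma form_bracket_form:
  assumes "\<alpha> \<in> forms A n" "\<beta> \<in> forms A n"
  shows "fb \<alpha> \<beta> \<in> forms A n"
  by (rule dorfman_form[OF sharp_field_vector_field[OF assms(1)] sharp_field_vector_field[OF assms(2)] assms])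

lemma nambu_form_bracket_eq:
  assumes "\<alpha> \<in> forms A n" "\<beta> \<in> forms A n"
  shows "nambu_form_bracket A n \<pi> \<alpha> \<beta> = fb \<alpha> \<beta>"
  unfolding cartan[OF assms(1) sharp_field_vector_field[OF assms(2)]] by (simp add: nambu_form_bracket_def)

text \<open>At each point the image is the sum of two \<open>exch_form\<close> vectors with \<xi> =
  df, with \<alpha> and \<beta> in both orders.\<close>

lemma sharp_field_d_wedge:
  assumes a: "\<alpha> \<in> forms A n" and b: "\<beta> \<in> forms A n" and f: "f \<in> \<C>"
  shows "S (d_wedge m f (ip (S \<alpha>) \<beta> + ip (S \<beta>) \<alpha>)) = 0"
proof
  fix p
  let ?\<xi> = "differential A f p"
  note d = differential_cotangent[where p = p and f = f]
  note i = interior_product_form[OF b sharp_field_vector_field[OF a]] interior_product_form[OF a sharp_field_vector_field[OF b]]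
  have c: "(ip (S \<alpha>) \<beta> + ip (S \<beta>) \<alpha>) p =
      (\<lambda>vs. \<beta> p (sharp A n \<pi> p (\<alpha> p) # vs)) + (\<lambda>vs. \<alpha> p (sharp A n \<pi> p (\<beta> p) # vs))"
    by (rule ext) (simp add: interior_product_def sharp_field_def)
  note ab = form_alt[OF a, of p] form_alt[OF b, of p]
  have "S (d_wedge m f (ip (S \<alpha>) \<beta> + ip (S \<beta>) \<alpha>)) p = exch_form p ?\<xi> (\<alpha> p) (\<beta> p) + exch_form p ?\<xi> (\<beta> p) (\<alpha> p)"
    unfolding sharp_field_def[of A n \<pi> "d_wedge m f (ip (S \<alpha>) \<beta> + ip (S \<beta>) \<alpha>)"]
      d_wedge_at[OF form_add[OF i] f] c covector_wedge_add exch_form_def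
    by (rule sharp_add[OF exch_form_arg[OF d ab] exch_form_arg[OF d ab(2,1)]])
  then show "S (d_wedge m f (ip (S \<alpha>) \<beta> + ip (S \<beta>) \<alpha>)) p = 0 p"
    using exch_form_antisym[OF d ab] by simp
qed

lemma form_bracket_add:
  assumes a: "\<alpha> \<in> forms A n" and b: "\<beta> \<in> forms A n" and c: "\<gamma> \<in> forms A n"
  shows "fb \<alpha> (\<beta> + \<gamma>) = fb \<alpha> \<beta> + fb \<alpha> \<gamma>" "fb (\<beta> + \<gamma>) \<alpha> = fb \<beta> \<alpha> + fb \<gamma> \<alpha>"
proof -
  note V = sharp_field_vector_field
  show "fb \<alpha> (\<beta> + \<gamma>) = fb \<alpha> \<beta> + fb \<alpha> \<gamma>"
    unfolding lie_derivative_add[OF b c V[OF a]] sharp_field_add[OF b c]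
      interior_product_vadd[OF ext_derivative_form[OF a] V[OF b] V[OF c]] by (simp add: fun_eq_iff)
  show "fb (\<beta> + \<gamma>) \<alpha> = fb \<beta> \<alpha> + fb \<gamma> \<alpha>"
    unfolding sharp_field_add[OF b c] lie_derivative_vadd[OF a V[OF b] V[OF c]] ext_derivative_add[OF b c]
      interior_product_add by (simp add: fun_eq_iff)
qed

lemma form_bracket_scale_right:
  assumes a: "\<alpha> \<in> forms A n" and b: "\<beta> \<in> forms A n" and f: "f \<in> \<C>"
  shows "fb \<alpha> (\<lambda>p. f p *\<^sub>R \<beta> p) = (\<lambda>p. f p *\<^sub>R fb \<alpha> \<beta> p) + (\<lambda>p. S \<alpha> p f *\<^sub>R \<beta> p)"
  unfolding lie_derivative_scale[OF b f sharp_field_vector_field[OF a]] sharp_field_scale[OF b]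
    interior_product_vscale[OF ext_derivative_form[OF a] sharp_field_vector_field[OF b] f]
  by (simp add: fun_eq_iff scaleR_fun_def algebra_simps)

text \<open>One contraction comes from the Lie derivative along f times a field, the other from
  contracting d(f \<alpha>). The last term is what the Lie bracket of vector fields also produces;
  the \<open>d_wedge\<close> term is the obstruction.\<close>

lemma form_bracket_scale_left:
  assumes a: "\<alpha> \<in> forms A n" and b: "\<beta> \<in> forms A n" and f: "f \<in> \<C>"
  shows "fb (\<lambda>p. f p *\<^sub>R \<alpha> p) \<beta> = (\<lambda>p. f p *\<^sub>R fb \<alpha> \<beta> p) + d_wedge m f (ip (S \<alpha>) \<beta> + ip (S \<beta>) \<alpha>)
    - (\<lambda>p. S \<beta> p f *\<^sub>R \<alpha> p)"
proof -
  note V = sharp_field_vector_field[OF a] sharp_field_vector_field[OF b]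
  show ?thesis
    unfolding sharp_field_scale[OF a] lie_derivative_vscale[OF b f V(1)] ext_derivative_scale interior_product_add
      interior_product_scale interior_product_d_wedge[OF a f V(2)]
      d_wedge_add[OF f interior_product_form[OF b V(1)] interior_product_form[OF a V(2)]]
    by (simp add: fun_eq_iff scaleR_fun_def algebra_simps)
qed

section \<open>Vanishing of the deviation\<close>

lemma sharp_field_exact_wedge:
  assumes "set fs \<subseteq> \<C>" "length fs = n" "h \<in> \<C>"
  shows "S (exact_wedge fs) p h = br (fs @ [h]) p"
proof -
  have "S (exact_wedge fs) p = hamiltonian p (differentials fs p)"
    unfolding sharp_field_def exact_wedge_def using assms(2) set_differentials by (intro sharp_wedge) simp_all
  then show ?thesis using assms(3) by (simp add: hamiltonian_def nambu_function_bracket_def)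
qed

text \<open>Fixing \<open>p\<close> and \<open>h\<close> makes it real-valued, as
  \<open>tensorial_form_vanish\<close> requires.\<close>

definition deviation :: "'a \<Rightarrow> ('a \<Rightarrow> real) \<Rightarrow> ('a \<Rightarrow> 'a form) \<Rightarrow> ('a \<Rightarrow> 'a form) \<Rightarrow> real"
  where "deviation p h \<alpha> \<beta> = lie_bracket (S \<alpha>) (S \<beta>) p h - S (fb \<alpha> \<beta>) p h"

lemma deviation_add:
  assumes a: "\<alpha> \<in> forms A n" and b: "\<beta> \<in> forms A n" and c: "\<gamma> \<in> forms A n"
  shows "deviation p h \<alpha> (\<beta> + \<gamma>) = deviation p h \<alpha> \<beta> + deviation p h \<alpha> \<gamma>"
    and "deviation p h (\<beta> + \<gamma>) \<alpha> = deviation p h \<beta> \<alpha> + deviation p h \<gamma> \<alpha>"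
proof -
  note V = sharp_field_vector_field[OF a] sharp_field_vector_field[OF b] sharp_field_vector_field[OF c]
  have fb1: "S (fb \<alpha> (\<beta> + \<gamma>)) = S (fb \<alpha> \<beta>) + S (fb \<alpha> \<gamma>)"
    by (subst form_bracket_add(1)[OF a b c]) (rule sharp_field_add[OF form_bracket_form[OF a b] form_bracket_form[OF a c]])
  have fb2: "S (fb (\<beta> + \<gamma>) \<alpha>) = S (fb \<beta> \<alpha>) + S (fb \<gamma> \<alpha>)"
    by (subst form_bracket_add(2)[OF a b c]) (rule sharp_field_add[OF form_bracket_form[OF b a] form_bracket_form[OF c a]])
  have lb1: "lie_bracket (S \<alpha>) (S (\<beta> + \<gamma>)) = lie_bracket (S \<alpha>) (S \<beta>) + lie_bracket (S \<alpha>) (S \<gamma>)"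
    unfolding sharp_field_add[OF b c] by (rule lie_bracket_add[OF V])
  show "deviation p h \<alpha> (\<beta> + \<gamma>) = deviation p h \<alpha> \<beta> + deviation p h \<alpha> \<gamma>"
    unfolding deviation_def fb1 lb1 by simp
  have lb2: "lie_bracket (S (\<beta> + \<gamma>)) (S \<alpha>) = lie_bracket (S \<beta>) (S \<alpha>) + lie_bracket (S \<gamma>) (S \<alpha>)"
    unfolding sharp_field_add[OF b c] lie_bracket_antisym[of _ "S \<alpha>"] lie_bracket_add[OF V] by (rule minus_add_distrib)
  show "deviation p h (\<beta> + \<gamma>) \<alpha> = deviation p h \<beta> \<alpha> + deviation p h \<gamma> \<alpha>"
    unfolding deviation_def fb2 lb2 by simp
qed

lemma deviation_scale:
  assumes a: "\<alpha> \<in> forms A n" and b: "\<beta> \<in> forms A n" and f: "f \<in> \<C>"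
  shows "deviation p h \<alpha> (\<lambda>q. f q *\<^sub>R \<beta> q) = f p * deviation p h \<alpha> \<beta>"
    and "deviation p h (\<lambda>q. f q *\<^sub>R \<alpha> q) \<beta> = f p * deviation p h \<alpha> \<beta>"
proof -
  note V = sharp_field_vector_field[OF a] sharp_field_vector_field[OF b]
  note F = form_bracket_form[OF a b]
  note af = vector_field_smooth[OF V(1) f] and bf = vector_field_smooth[OF V(2) f]
  note w = d_wedge_form[OF f form_add[OF interior_product_form[OF b V(1)] interior_product_form[OF a V(2)]]]
  have fb1: "S (fb \<alpha> (\<lambda>q. f q *\<^sub>R \<beta> q)) = (\<lambda>q. f q *\<^sub>R S (fb \<alpha> \<beta>) q) + (\<lambda>q. S \<alpha> q f *\<^sub>R S \<beta> q)"
    by (subst form_bracket_scale_right[OF a b f], subst sharp_field_add[OF form_scale[OF f F] form_scale[OF af b]],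
        subst sharp_field_scale[OF F], subst sharp_field_scale[OF b], rule refl)
  have lb1: "lie_bracket (S \<alpha>) (S (\<lambda>q. f q *\<^sub>R \<beta> q)) = (\<lambda>q. f q *\<^sub>R lie_bracket (S \<alpha>) (S \<beta>) q) + (\<lambda>q. S \<alpha> q f *\<^sub>R S \<beta> q)"
    unfolding sharp_field_scale[OF b] by (rule lie_bracket_scale[OF V f])
  \<comment> \<open>The summand 0 is the image of the \<open>d_wedge\<close> term, by
    \<open>sharp_field_d_wedge\<close>.\<close>
  have fb2: "S (fb (\<lambda>q. f q *\<^sub>R \<alpha> q) \<beta>) = (\<lambda>q. f q *\<^sub>R S (fb \<alpha> \<beta>) q) + 0 - (\<lambda>q. S \<beta> q f *\<^sub>R S \<alpha> q)"
    by (subst form_bracket_scale_left[OF a b f],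
        subst sharp_field_diff[OF form_add[OF form_scale[OF f F] w] form_scale[OF bf a]],
        subst sharp_field_add[OF form_scale[OF f F] w], subst sharp_field_scale[OF F], subst sharp_field_scale[OF a],
        subst sharp_field_d_wedge[OF a b f], rule refl)
  have lb2: "lie_bracket (S (\<lambda>q. f q *\<^sub>R \<alpha> q)) (S \<beta>) =
      (\<lambda>q. f q *\<^sub>R lie_bracket (S \<alpha>) (S \<beta>) q) + (\<lambda>q. (- S \<beta> q f) *\<^sub>R S \<alpha> q)"
    unfolding sharp_field_scale[OF a] by (rule lie_bracket_scale_left[OF V f])
  show "deviation p h \<alpha> (\<lambda>q. f q *\<^sub>R \<beta> q) = f p * deviation p h \<alpha> \<beta>"
    unfolding deviation_def fb1 lb1 by (simp add: scaleR_fun_def algebra_simps)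
  show "deviation p h (\<lambda>q. f q *\<^sub>R \<alpha> q) \<beta> = f p * deviation p h \<alpha> \<beta>"
    unfolding deviation_def fb2 lb2 by (simp add: scaleR_fun_def algebra_simps)
qed

lemma sharp_field_sum:
  assumes "\<And>i. i \<in> I \<Longrightarrow> \<omega> i \<in> forms A n"
  shows "S (\<Sum>i\<in>I. \<omega> i) p = (\<Sum>i\<in>I. S (\<omega> i) p)"
proof -
  have "sharp A n \<pi> p (\<Sum>i\<in>I. 1 *\<^sub>R \<omega> i p) = (\<Sum>i\<in>I. 1 *\<^sub>R sharp A n \<pi> p (\<omega> i p))"
  proof (rule linear_on_sum[OF subspace_alt_maps[of n "tangent_space A p"], where T = "sharp A n \<pi> p"])
    show "\<omega> i p \<in> \<Omega> p" if "i \<in> I" for i by (rule form_alt[OF assms[OF that]])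
  qed (rule sharp_add sharp_scale; assumption)+
  then show ?thesis by (simp only: sharp_field_def sum_fun_apply scaleR_one)
qed

text \<open>Wedges of differentials are closed, so their bracket is a Lie derivative. The claim is
  then the fundamental identity for \<open>gs @ [h]\<close>, whose last summand is the second half
  of the commutator.\<close>

lemma deviation_exact_wedge:
  assumes fs: "set fs \<subseteq> \<C>" "length fs = n" and gs: "set gs \<subseteq> \<C>" "length gs = n" and h: "h \<in> \<C>"
  shows "deviation p h (exact_wedge fs) (exact_wedge gs) = 0"
proof -
  let ?\<alpha> = "exact_wedge fs" and ?\<beta> = "exact_wedge gs"
  note a = exact_wedge_form[OF fs] and b = exact_wedge_form[OF gs]
  note Sf = sharp_field_exact_wedge[OF fs] and Sg = sharp_field_exact_wedge[OF gs]
  have C: "br (fs @ [g]) \<in> \<C>" "br (gs @ [g]) \<in> \<C>" if "g \<in> \<C>" for g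
    using fs gs that by (auto intro!: bracket_smooth)
  have gi: "gs ! i \<in> \<C>" if "i < n" for i using gs that nth_mem[of i gs] by auto
  have Sfun: "(\<lambda>q. S ?\<alpha> q g) = br (fs @ [g])" "(\<lambda>q. S ?\<beta> q g) = br (gs @ [g])" if "g \<in> \<C>" for g
    by (rule ext, rule Sf[OF that], rule ext, rule Sg[OF that])
  have lie: "lie_bracket (S ?\<alpha>) (S ?\<beta>) p h = br (fs @ [br (gs @ [h])]) p - br (gs @ [br (fs @ [h])]) p"
    unfolding lie_bracket_def Sfun[OF h] Sf[OF C(2)[OF h]] Sg[OF C(1)[OF h]] ..
  have up: "set (gs[i := br (fs @ [gs ! i])]) \<subseteq> \<C>" "length (gs[i := br (fs @ [gs ! i])]) = n" if "i < n" for i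
    using set_update_subset[OF gs(1) C(1)[OF gi[OF that]]] gs(2) by simp_all
  have "ip (S ?\<beta>) 0 = 0" by (simp add: interior_product_def zero_fun_def)
  then have "fb ?\<alpha> ?\<beta> = LD n (S ?\<alpha>) ?\<beta>" unfolding ext_derivative_exact_wedge[OF fs] by simp
  also have "... = (\<Sum>i<n. exact_wedge (gs[i := (\<lambda>q. S ?\<alpha> q (gs ! i))]))"
    by (rule lie_derivative_exact_wedge[OF gs sharp_field_vector_field[OF a]])
  also have "... = (\<Sum>i<n. exact_wedge (gs[i := br (fs @ [gs ! i])]))"
    using Sfun(1)[OF gi] by (intro sum.cong) auto
  finally have "S (fb ?\<alpha> ?\<beta>) p = (\<Sum>i<n. S (exact_wedge (gs[i := br (fs @ [gs ! i])])) p)"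
    using up exact_wedge_form by (simp only:) (intro sharp_field_sum, simp)
  then have "S (fb ?\<alpha> ?\<beta>) p h = (\<Sum>i<n. S (exact_wedge (gs[i := br (fs @ [gs ! i])])) p h)"
    by (simp only: sum_fun_apply)
  also have "... = (\<Sum>i<n. br (gs[i := br (fs @ [gs ! i])] @ [h]) p)"
    by (intro sum.cong refl sharp_field_exact_wedge[OF up h]) auto
  finally have sharp: "S (fb ?\<alpha> ?\<beta>) p h = (\<Sum>i<n. br (gs[i := br (fs @ [gs ! i])] @ [h]) p)" .
  have "br (fs @ [br (gs @ [h])]) p = (\<Sum>i<Suc n. br ((gs @ [h])[i := br (fs @ [(gs @ [h]) ! i])]) p)"
    using fs gs h by (intro fundamental_identity) auto
  also have "... = (\<Sum>i<n. br (gs[i := br (fs @ [gs ! i])] @ [h]) p) + br (gs @ [br (fs @ [h])]) p"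
  proof -
    have "(gs @ [h])[n := u] = gs @ [u]" "(gs @ [h]) ! n = h" for u
      using gs(2) by (metis list_update_length, metis nth_append_length)
    moreover have "(gs @ [h])[i := br (fs @ [(gs @ [h]) ! i])] = gs[i := br (fs @ [gs ! i])] @ [h]" if "i < n" for i
      using that gs(2) by (simp add: list_update_append nth_append)
    ultimately show ?thesis
      unfolding sum.lessThan_Suc[of _ n] by (intro arg_cong2[of _ _ _ _ "(+)"] sum.cong) simp_all
  qed
  finally show ?thesis unfolding deviation_def lie sharp by simp
qed

theorem sharp_field_bracket:
  assumes a: "\<alpha> \<in> forms A n" and b: "\<beta> \<in> forms A n"
  shows "S (fb \<alpha> \<beta>) = lie_bracket (S \<alpha>) (S \<beta>)"
proof (rule vector_field_eqI[symmetric])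
  fix p h assume h: "h \<in> \<C>"
  obtain U x E where p: "p \<in> U" and f: "chart_frame U x E" using chart_frame_exists by blast
  have J: "set (map x J) \<subseteq> \<C>" "length (map x J) = n" if "J \<in> increasing mdim n" for J
    using that chart_frameD(2)[OF f] by (auto simp: increasing_def)
  \<comment> \<open>The second argument is generalized first, with a coordinate wedge kept in the
    first.\<close>
  have 1: "deviation p h (exact_wedge (map x J)) \<gamma> = 0" if "J \<in> increasing mdim n" "\<gamma> \<in> forms A n" for J \<gamma>
    by (rule tensorial_form_vanish[OF f p, where k = n and G = "deviation p h (exact_wedge (map x J))"])
       (simp_all only: deviation_add deviation_scale exact_wedge_form[OF J[OF that(1)]]
          deviation_exact_wedge[OF J[OF that(1)] J h] that(2))
  have "deviation p h \<alpha> \<beta> = 0"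
    by (rule tensorial_form_vanish[OF f p, where k = n and G = "\<lambda>\<alpha>. deviation p h \<alpha> \<beta>"])
       (simp_all only: deviation_add deviation_scale b 1 a)
  then show "lie_bracket (S \<alpha>) (S \<beta>) p h = S (fb \<alpha> \<beta>) p h" by (simp add: deviation_def)
qed (intro lie_bracket_vector_field sharp_field_vector_field form_bracket_form a b)+

subsection \<open>The graph of \<open>\<pi>\<^sup>\<sharp>\<close>\<close>

lemma graph_section_eq: "graph_section A n \<pi> \<alpha> = (\<lambda>p. (S \<alpha> p, \<alpha> p))"
  by (simp add: graph_section_def)

lemma graph_section_GTB: "\<alpha> \<in> forms A n \<Longrightarrow> graph_section A n \<pi> \<alpha> \<in> global_sections (GTB n)"
  unfolding graph_section_eq by (intro GTB_pair sharp_field_vector_field)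

lemma nambu_form_bracket_form:
  "\<alpha> \<in> forms A n \<Longrightarrow> \<beta> \<in> forms A n \<Longrightarrow> nambu_form_bracket A n \<pi> \<alpha> \<beta> \<in> forms A n"
  by (simp only: nambu_form_bracket_eq form_bracket_form)

lemma dorfman_graph_section:
  assumes "\<alpha> \<in> forms A n" "\<beta> \<in> forms A n"
  shows "dorfman A n (graph_section A n \<pi> \<alpha>) (graph_section A n \<pi> \<beta>) =
    graph_section A n \<pi> (nambu_form_bracket A n \<pi> \<alpha> \<beta>)"
  unfolding graph_section_eq dorfman_pair[OF assms(1) sharp_field_vector_field[OF assms(2)]]
    nambu_form_bracket_eq[OF assms] sharp_field_bracket[OF assms] ..

lemma graph_sections:
  "s \<in> global_sections (restrict_bundle (GTB n) (sharp_graph A n \<pi>)) \<longleftrightarrow> (\<exists>\<alpha>\<in>forms A n. s = graph_section A n \<pi> \<alpha>)"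
proof
  assume s: "s \<in> global_sections (restrict_bundle (GTB n) (sharp_graph A n \<pi>))"
  then have g: "s \<in> global_sections (GTB n)" "\<And>p. s p \<in> sharp_graph A n \<pi> p" by (simp_all add: restrict_bundle_def)
  then have "s = graph_section A n \<pi> (\<lambda>p. snd (s p))"
    by (intro ext prod_eqI) (simp_all add: graph_section_def sharp_field_def sharp_graph_iff)
  moreover have "(\<lambda>p. snd (s p)) \<in> forms A n" using g(1) unfolding GTB_section by simp
  ultimately show "\<exists>\<alpha>\<in>forms A n. s = graph_section A n \<pi> \<alpha>" by blast
next
  assume "\<exists>\<alpha>\<in>forms A n. s = graph_section A n \<pi> \<alpha>"
  then obtain \<alpha> where a: "\<alpha> \<in> forms A n" "s = graph_section A n \<pi> \<alpha>" by blast
  have "s p \<in> sharp_graph A n \<pi> p" for p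
    using form_alt[OF a(1)] by (simp add: a(2) graph_section_def sharp_field_def sharp_graph_iff)
  then show "s \<in> global_sections (restrict_bundle (GTB n) (sharp_graph A n \<pi>))"
    using graph_section_GTB[OF a(1)] a(2) by (simp add: restrict_bundle_def)
qed

lemma sub_leibniz_algebroid_graph:
  "sub_leibniz_algebroid A (GTB n) (dorfman A n) dorfman_anchor (sharp_graph A n \<pi>)"
  unfolding sub_leibniz_algebroid_def
proof (intro conjI ballI leibniz_algebroid_dorfman subbundle_sharp_graph)
  fix a b assume "a \<in> global_sections (restrict_bundle (GTB n) (sharp_graph A n \<pi>))"
    "b \<in> global_sections (restrict_bundle (GTB n) (sharp_graph A n \<pi>))"
  then obtain \<alpha> \<beta> where "\<alpha> \<in> forms A n" "a = graph_section A n \<pi> \<alpha>" "\<beta> \<in> forms A n" "b = graph_section A n \<pi> \<beta>"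
    unfolding graph_sections by blast
  then show "dorfman A n a b \<in> global_sections (restrict_bundle (GTB n) (sharp_graph A n \<pi>))"
    unfolding graph_sections using dorfman_graph_section nambu_form_bracket_form by blast
qed

text \<open>Bilinearity and the Leibniz identity are pulled back along the injective map
  \<open>graph_section\<close>. Compatibility with the anchor is \<open>sharp_field_bracket\<close>,
  and the rule for multiples in the second argument is
  \<open>form_bracket_scale_right\<close>.\<close>

lemma leibniz_algebroid_forms: "leibniz_algebroid A (form_bundle A n) (nambu_form_bracket A n \<pi>) (sharp A n \<pi>)"
proof -
  let ?g = "graph_section A n \<pi>" and ?D = "dorfman A n" and ?b = "nambu_form_bracket A n \<pi>"
  let ?G = "global_sections (GTB n)"
  have inj: "\<alpha> = \<beta>" if "?g \<alpha> = ?g \<beta>" for \<alpha> \<beta>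
    using that by (auto simp: graph_section_def fun_eq_iff)
  have g_add: "?g (\<alpha> + \<beta>) = ?g \<alpha> + ?g \<beta>" if "\<alpha> \<in> forms A n" "\<beta> \<in> forms A n" for \<alpha> \<beta>
    unfolding graph_section_eq sharp_field_add[OF that] fun_pair_add ..
  have g_scale: "?g (\<lambda>p. f p *\<^sub>R \<alpha> p) = (\<lambda>p. f p *\<^sub>R ?g \<alpha> p)" if "\<alpha> \<in> forms A n" for f \<alpha>
    unfolding graph_section_eq sharp_field_scale[OF that] by simp
  have t_fun: "t *\<^sub>R s = (\<lambda>p. t *\<^sub>R s p)" for t :: real and s :: "'a \<Rightarrow> 'v::real_vector"
    by (simp add: scaleR_fun_def)
  note D = dorfman_graph_section and F = nambu_form_bracket_form and G = graph_section_GTB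
  note LA = leibniz_algebroid_dorfman[of m, unfolded leibniz_algebroid_def]
  have bilin: "\<forall>a\<in>?G. \<forall>b\<in>?G. \<forall>c\<in>?G. ?D (a + b) c = ?D a c + ?D b c \<and> ?D a (b + c) = ?D a b + ?D a c"
    using LA by (elim conjE)
  have homog: "\<forall>a\<in>?G. \<forall>b\<in>?G. \<forall>t::real. ?D (t *\<^sub>R a) b = t *\<^sub>R ?D a b \<and> ?D a (t *\<^sub>R b) = t *\<^sub>R ?D a b"
    using LA by (elim conjE)
  have leib: "\<forall>a\<in>?G. \<forall>b\<in>?G. \<forall>c\<in>?G. ?D a (?D b c) = ?D (?D a b) c + ?D b (?D a c)"
    using LA by (elim conjE)
  show ?thesis
    unfolding leibniz_algebroid_def
  proof (intro conjI ballI allI)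
    show "vector_bundle A (form_bundle A n)" by (rule vector_bundle_form)
    show "bundle_morphism (form_bundle A n) (tangent_bundle A) (sharp A n \<pi>)" by (rule sharp_bundle_morphism)
  next
    fix \<alpha> \<beta> assume a: "\<alpha> \<in> forms A n" and b: "\<beta> \<in> forms A n"
    show "?b \<alpha> \<beta> \<in> forms A n" by (rule F[OF a b])
    show "(\<lambda>p. sharp A n \<pi> p (?b \<alpha> \<beta> p)) = lie_bracket (\<lambda>p. sharp A n \<pi> p (\<alpha> p)) (\<lambda>p. sharp A n \<pi> p (\<beta> p))"
      using sharp_field_bracket[OF a b] unfolding nambu_form_bracket_eq[OF a b] unfolding sharp_field_def .
    show "?b \<alpha> (\<lambda>p. f p *\<^sub>R \<beta> p) = (\<lambda>p. f p *\<^sub>R ?b \<alpha> \<beta> p + sharp A n \<pi> p (\<alpha> p) f *\<^sub>R \<beta> p)" if f: "f \<in> \<C>" for f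
      unfolding nambu_form_bracket_eq[OF a b] nambu_form_bracket_eq[OF a form_scale[OF f b]] form_bracket_scale_right[OF a b f]
      by (simp add: fun_eq_iff sharp_field_def)
    fix t :: real
    note c = smooth_funs_const[of t UNIV]
    have "?g (?b (\<lambda>p. t *\<^sub>R \<alpha> p) \<beta>) = ?g (\<lambda>p. t *\<^sub>R ?b \<alpha> \<beta> p)"
      unfolding D[OF form_scale[OF c a] b, symmetric] g_scale[OF a] g_scale[OF F[OF a b]] D[OF a b, symmetric]
      using homog[rule_format, OF G[OF a] G[OF b], of t, THEN conjunct1] unfolding t_fun .
    then show "?b (t *\<^sub>R \<alpha>) \<beta> = t *\<^sub>R ?b \<alpha> \<beta>" unfolding t_fun by (rule inj)
    have "?g (?b \<alpha> (\<lambda>p. t *\<^sub>R \<beta> p)) = ?g (\<lambda>p. t *\<^sub>R ?b \<alpha> \<beta> p)"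
      unfolding D[OF a form_scale[OF c b], symmetric] g_scale[OF b] g_scale[OF F[OF a b]] D[OF a b, symmetric]
      using homog[rule_format, OF G[OF a] G[OF b], of t, THEN conjunct2] unfolding t_fun .
    then show "?b \<alpha> (t *\<^sub>R \<beta>) = t *\<^sub>R ?b \<alpha> \<beta>" unfolding t_fun by (rule inj)
  next
    fix \<alpha> \<beta> \<gamma> assume a: "\<alpha> \<in> forms A n" and b: "\<beta> \<in> forms A n" and c: "\<gamma> \<in> forms A n"
    show "?b (\<alpha> + \<beta>) \<gamma> = ?b \<alpha> \<gamma> + ?b \<beta> \<gamma>"
      using bilin[rule_format, OF G[OF a] G[OF b] G[OF c], THEN conjunct1]
      unfolding g_add[OF a b, symmetric] D[OF form_add[OF a b] c] D[OF a c] D[OF b c] g_add[OF F[OF a c] F[OF b c], symmetric]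
      by (rule inj)
    show "?b \<alpha> (\<beta> + \<gamma>) = ?b \<alpha> \<beta> + ?b \<alpha> \<gamma>"
      using bilin[rule_format, OF G[OF a] G[OF b] G[OF c], THEN conjunct2]
      unfolding g_add[OF b c, symmetric] D[OF a form_add[OF b c]] D[OF a b] D[OF a c] g_add[OF F[OF a b] F[OF a c], symmetric]
      by (rule inj)
    show "?b \<alpha> (?b \<beta> \<gamma>) = ?b (?b \<alpha> \<beta>) \<gamma> + ?b \<beta> (?b \<alpha> \<gamma>)"
      using leib[rule_format, OF G[OF a] G[OF b] G[OF c]]
      unfolding D[OF a b] D[OF b c] D[OF a c] D[OF a F[OF b c]] D[OF F[OF a b] c] D[OF b F[OF a c]]
        g_add[OF F[OF F[OF a b] c] F[OF b F[OF a c]], symmetric]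
      by (rule inj)
  qed
qed

end

theorem corollary3p4:
  fixes A :: "('a::{t2_space, second_countable_topology}, 'e::real_inner) atlas"
    and n :: nat
    and \<pi> :: "'a \<Rightarrow> 'a form list \<Rightarrow> real"
  assumes "smooth_manifold A"
    and "n \<ge> 1"
    and "nambu_poisson A n \<pi>"
  shows "sub_leibniz_algebroid A (generalized_tangent_bundle A n) (dorfman A n) dorfman_anchor
           (sharp_graph A n \<pi>) \<and>
         (\<forall>\<alpha>\<in>forms A n. \<forall>\<beta>\<in>forms A n.
           dorfman A n (graph_section A n \<pi> \<alpha>) (graph_section A n \<pi> \<beta>) =
             graph_section A n \<pi> (nambu_form_bracket A n \<pi> \<alpha> \<beta>)) \<and>
         leibniz_algebroid A (form_bundle A n) (nambu_form_bracket A n \<pi>) (sharp A n \<pi>)"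
proof -
  obtain m where m: "n = Suc m" using assms(2) by (cases n) auto
  interpret nambu_mfd A m \<pi> by unfold_locales (use assms m in auto)
  show ?thesis
    unfolding m using sub_leibniz_algebroid_graph dorfman_graph_section leibniz_algebroid_forms by blast
qed

end
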